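(* (1) (Clamped boundary conditions.) A slender ferromagnetic rod, held straight against gravity, is stable provided $\mathsf A>-\beta_0^{\mathrm{cl}}(\mathsf G)$, where $\beta_0^{\mathrm{cl}}(\mathsf G)$ is the principal eigenvalue of the clamped rod held against gravity in zero field, $$\beta_0^{\mathrm{cl}}(\mathsf G):=\inf\left\{\frac{\int_0^1\big[(u')^2-\mathsf G(1-s)u^2\big]\,ds}{\int_0^1u^2\,ds}\;:\;u\in H^1(0,1)\setminus\{0\},\ u(0)=0\right\},$$ which is controlled by $\mathsf G$ and the largest zero of the Airy function $\mathrm{Ai}$. One has $\beta_0^{\mathrm{cl}}(\mathsf G)>0$ exactly when $\mathsf G<\mathsf G_{\mathrm{crit}}\approx7.8373$, so below the Greenhill threshold $\mathsf G_{\mathrm{crit}}$ no field is needed. If $\beta_0^{\mathrm{cl}}(\mathsf G)$ is close to $0$, then the onset of bifurcation is of supercritical pitchfork type. This branch continuously deforms, eventually to a subcritical bifurcation when $\beta_0^{\mathrm{cl}}(\mathsf G)\le-\frac{\mathsf G}{4}$. (2) (Pinned boundary conditions.) Let $\beta_0^{\mathrm p}(\mathsf G)$ denote the same infimum taken over all of $H^1(0,1)\setminus\{0\}$, without the constraint $u(0)=0$. In the absence of an applied field, the Kirchhoff rod is unstable against gravity for any length, since $\beta_0^{\mathrm p}(\mathsf G)\le-\mathsf G/2<0$. On the other hand, with a uniformly applied magnetic field in the $e_3$ direction, a slender rod is stable provided $\mathsf A>-\beta_0^{\mathrm p}(\mathsf G)$, a threshold controlled by $\mathsf G$ and the largest zero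 of the derivative of the Airy function, $\mathrm{Ai}'$. At the onset of instability, the bifurcation is of subcritical pitchfork type. (3) In either case, a sufficient length for stability is $L<K_d/(\rho g)$, and notably, this is independent of the diameter of the rod.
   Context: A slender, inextensible, unshearable (Kirchhoff) ferromagnetic rod of length $L$ and circular cross-section is supported at its lower end $s=0$ (clamped or pinned) and free at $s=1$ (arclength in units of $L$); $e_3$ is the upward vertical. Its unit tangent is $d_3:[0,1]\to\mathbb S^2$. In a strong uniform applied field along $e_3$ the magnetization is taken to be identically $e_3$, and the nondimensional energy is $$\mathcal E_{\mathrm{unif}}[d_3]=\tfrac12\int_0^1|d_3'|^2\,ds+\tfrac{\mathsf A}{2}\int_0^1\left[1-(e_3\cdot d_3)^2\right]ds+\mathsf G\int_0^1(1-s)\,d_3\cdot e_3\,ds,$$ with $d_3(0)=e_3$ imposed in the clamped case and no condition on $d_3(0)$ imposed in the pinned case. Here $\mathsf G=\rho A_0gL^3/B>0$ and $\mathsf A=K_dA_0L^2/B$, where $\rho$ is the mass density, $g$ the gravitational acceleration, $K_d>0$ the demagnetization constant, $A_0$ the cross-sectional area and $B$ the bending stiffness; absence of an applied field corresponds to setting $\mathsf A=0$ in this energy. The straight rod held against gravity is $d_3=e_3$, an equilibrium for all $\mathsf A\ge0$, $\mathsf G>0$. Its stability refers to positivity of the second variation $$\int_0^1\left[|\eta'|^2+(\mathsf A-\mathsf G(1-s))|\eta|^2\right]ds$$ for all nonzero $\eta\in H^1((0,1);\mathbb R^3)$ with $\eta\cdot e_3=0$ and, in the clamped case, $\eta(0)=0$.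 The onset of instability, for fixed $\mathsf G$, is at $\mathsf A_{\mathrm{crit}}=-\beta_0^{\mathrm{cl}}(\mathsf G)$ (clamped) or $\mathsf A_{\mathrm{crit}}=-\beta_0^{\mathrm p}(\mathsf G)$ (pinned). There a branch of non-straight equilibria bifurcates, with $\mathsf A=\mathsf A(r)=\mathsf A_{\mathrm{crit}}+\mathsf A_2r^2+o(r^2)$ in terms of a small amplitude $r$; the pitchfork is called supercritical if $\mathsf A_2<0$ and subcritical if $\mathsf A_2>0$. $\mathsf G_{\mathrm{crit}}$ is the classical Greenhill threshold for buckling of a clamped vertical rod under its own weight, characterized by $\mathrm{Ai}(-\mathsf G_{\mathrm{crit}}^{1/3})+\frac1{\sqrt3}\mathrm{Bi}(-\mathsf G_{\mathrm{crit}}^{1/3})=0$, with $\mathrm{Ai},\mathrm{Bi}$ the Airy functions. *)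

theory Defs
  imports "HOL-Analysis.Analysis" "HOL-Library.Landau_Symbols"
begin

section \<open>Sobolev space on the unit interval\<close>

text \<open>An element of $H^1(0,1)$ is represented by its continuous representative: a function that on
  \<open>{0..1}\<close> is an indefinite integral of a square-integrable \<open>u'\<close>, its weak derivative. In particular
  boundary values are meaningful. Values outside \<open>{0..1}\<close> are irrelevant throughout this theory.\<close>

definition has_weak_deriv ::
  "(real \<Rightarrow> 'a::euclidean_space) \<Rightarrow> (real \<Rightarrow> 'a) \<Rightarrow> bool" where
  "has_weak_deriv u u' \<longleftrightarrow>
     set_borel_measurable lborel {0..1} u' \<and>
     set_integrable lborel {0..1} (\<lambda>s. (norm (u' s))\<^sup>2) \<and>
     (\<forall>x\<in>{0..1}. u x = u 0 + (LINT s:{0..x}|lborel. u' s))"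

definition H1 :: "(real \<Rightarrow> 'a::euclidean_space) \<Rightarrow> bool" where
  "H1 u \<longleftrightarrow> (\<exists>u'. has_weak_deriv u u')"

text \<open>The weak derivative is unique only almost everywhere; it is used only under integrals.\<close>

definition weak_deriv :: "(real \<Rightarrow> 'a::euclidean_space) \<Rightarrow> real \<Rightarrow> 'a" where
  "weak_deriv u = (SOME u'. has_weak_deriv u u')"

definition nonzero01 :: "(real \<Rightarrow> 'a::zero) \<Rightarrow> bool" where
  "nonzero01 u \<longleftrightarrow> (\<exists>s\<in>{0..1}. u s \<noteq> 0)"


section \<open>The rod\<close>

datatype support = Clamped | Pinned

definition e3 :: "real ^ 3" where
  "e3 = axis 3 1"

definition disc_area :: "real \<Rightarrow> real" where
  "disc_area diam = pi * (diam / 2)\<^sup>2"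

text \<open>Arguments: mass density, cross-sectional area, gravitational acceleration, length,
  bending stiffness.\<close>

definition gravity_par :: "real \<Rightarrow> real \<Rightarrow> real \<Rightarrow> real \<Rightarrow> real \<Rightarrow> real" where
  "gravity_par \<rho> A0 g L B = \<rho> * A0 * g * L ^ 3 / B"

text \<open>Arguments: demagnetization constant, cross-sectional area, length, bending stiffness.\<close>

definition magnetic_par :: "real \<Rightarrow> real \<Rightarrow> real \<Rightarrow> real \<Rightarrow> real" where
  "magnetic_par Kd A0 L B = Kd * A0 * L\<^sup>2 / B"

definition energy :: "real \<Rightarrow> real \<Rightarrow> (real \<Rightarrow> real ^ 3) \<Rightarrow> real" where
  "energy A G d =
     1 / 2 * (LINT s:{0..1}|lborel. (norm (weak_deriv d s))\<^sup>2)
     + A / 2 * (LINT s:{0..1}|lborel. 1 - (e3 \<bullet> d s)\<^sup>2)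
     + G * (LINT s:{0..1}|lborel. (1 - s) * (d s \<bullet> e3))"

definition admissible :: "support \<Rightarrow> (real \<Rightarrow> real ^ 3) \<Rightarrow> bool" where
  "admissible bc d \<longleftrightarrow>
     H1 d \<and> (\<forall>s\<in>{0..1}. norm (d s) = 1) \<and> (bc = Clamped \<longrightarrow> d 0 = e3)"

text \<open>Equilibria are the critical points of the energy among admissible tangent fields. A field \<open>d\<close>
  is varied along the curves $(d + t\eta)/|d + t\eta|$ in the admissible class;
  \<^term>\<open>sgn v\<close> is \<open>v / norm v\<close>.\<close>

definition equilibrium :: "support \<Rightarrow> real \<Rightarrow> real \<Rightarrow> (real \<Rightarrow> real ^ 3) \<Rightarrow> bool" where
  "equilibrium bc A G d \<longleftrightarrow>
     admissible bc d \<and>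
     (\<forall>\<eta>. H1 \<eta> \<and> (bc = Clamped \<longrightarrow> \<eta> 0 = 0) \<longrightarrow>
        ((\<lambda>t. energy A G (\<lambda>s. sgn (d s + t *\<^sub>R \<eta> s))) has_real_derivative 0) (at 0))"

definition straight :: "(real \<Rightarrow> real ^ 3) \<Rightarrow> bool" where
  "straight d \<longleftrightarrow> (\<exists>c. \<forall>s\<in>{0..1}. d s = c)"


section \<open>Stability of the straight rod\<close>

definition second_variation :: "real \<Rightarrow> real \<Rightarrow> (real \<Rightarrow> real ^ 3) \<Rightarrow> real" where
  "second_variation A G \<eta> =
     (LINT s:{0..1}|lborel.
        (norm (weak_deriv \<eta> s))\<^sup>2 + (A - G * (1 - s)) * (norm (\<eta> s))\<^sup>2)"

definition variation :: "support \<Rightarrow> (real \<Rightarrow> real ^ 3) \<Rightarrow> bool" where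
  "variation bc \<eta> \<longleftrightarrow>
     H1 \<eta> \<and> nonzero01 \<eta> \<and> (\<forall>s\<in>{0..1}. \<eta> s \<bullet> e3 = 0) \<and> (bc = Clamped \<longrightarrow> \<eta> 0 = 0)"

definition straight_stable :: "support \<Rightarrow> real \<Rightarrow> real \<Rightarrow> bool" where
  "straight_stable bc A G \<longleftrightarrow> (\<forall>\<eta>. variation bc \<eta> \<longrightarrow> second_variation A G \<eta> > 0)"

text \<open>Instability is the existence of a direction in which the energy strictly decreases to second
  order, which is more than the failure of \<^const>\<open>straight_stable\<close>.\<close>

definition straight_unstable :: "support \<Rightarrow> real \<Rightarrow> real \<Rightarrow> bool" where
  "straight_unstable bc A G \<longleftrightarrow> (\<exists>\<eta>. variation bc \<eta> \<and> second_variation A G \<eta> < 0)"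

definition rayleigh_quotient :: "real \<Rightarrow> (real \<Rightarrow> real) \<Rightarrow> real" where
  "rayleigh_quotient G u =
     (LINT s:{0..1}|lborel. (weak_deriv u s)\<^sup>2 - G * (1 - s) * (u s)\<^sup>2)
     / (LINT s:{0..1}|lborel. (u s)\<^sup>2)"

definition beta0 :: "support \<Rightarrow> real \<Rightarrow> real" where
  "beta0 bc G =
     Inf {rayleigh_quotient G u | u. H1 u \<and> nonzero01 u \<and> (bc = Clamped \<longrightarrow> u 0 = 0)}"

definition A_crit :: "support \<Rightarrow> real \<Rightarrow> real" where
  "A_crit bc G = - beta0 bc G"


section \<open>Pitchfork bifurcation\<close>

text \<open>Rotation by the angle $\pi$ about the vertical axis, the reflection in the symmetry of the
  pitchfork.\<close>

definition half_turn :: "real ^ 3 \<Rightarrow> real ^ 3" where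
  "half_turn v = (2 * (v \<bullet> e3)) *\<^sub>R e3 - v"

text \<open>A branch \<open>r \<mapsto> (a r, D r)\<close>, for \<open>\<bar>r\<bar> < \<epsilon>\<close>, of equilibria that bifurcates at \<^const>\<open>A_crit\<close> from the
  straight rod, with $a(r) = A_{crit} + A_2 r^2 + o(r^2)$. The parameter \<open>r\<close> is an amplitude:
  $D(r) = e_3 + r\varphi + o(r)$ with $\varphi \neq 0$; this makes the sign of $A_2$ independent of the
  parametrization.\<close>

definition pitchfork_branch ::
  "support \<Rightarrow> real \<Rightarrow> real \<Rightarrow> real \<Rightarrow> (real \<Rightarrow> real) \<Rightarrow> (real \<Rightarrow> real \<Rightarrow> real ^ 3) \<Rightarrow> bool" where
  "pitchfork_branch bc G A2 \<epsilon> a D \<longleftrightarrow>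
     \<epsilon> > 0 \<and>
     continuous_on {r. \<bar>r\<bar> < \<epsilon>} a \<and>
     continuous_on {(r, s). \<bar>r\<bar> < \<epsilon> \<and> s \<in> {0..1}} (\<lambda>(r, s). D r s) \<and>
     a 0 = A_crit bc G \<and>
     (\<forall>s\<in>{0..1}. D 0 s = e3) \<and>
     (\<forall>r. \<bar>r\<bar> < \<epsilon> \<longrightarrow> equilibrium bc (a r) G (D r)) \<and>
     (\<forall>r. \<bar>r\<bar> < \<epsilon> \<and> r \<noteq> 0 \<longrightarrow> \<not> straight (D r)) \<and>
     (\<forall>r. \<bar>r\<bar> < \<epsilon> \<longrightarrow> a (- r) = a r \<and> (\<forall>s\<in>{0..1}. D (- r) s = half_turn (D r s))) \<and>
     (\<lambda>r. a r - (A_crit bc G + A2 * r\<^sup>2)) \<in> o[at 0](\<lambda>r. r\<^sup>2) \<and>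
     (\<exists>\<phi>. nonzero01 \<phi> \<and> uniform_limit {0..1} (\<lambda>r s. (D r s - e3) /\<^sub>R r) \<phi> (at 0))"

text \<open>The bifurcation parameter is decreased through \<^const>\<open>A_crit\<close>: the straight rod is stable above
  and unstable below. Hence the sign convention.\<close>

definition supercritical :: "real \<Rightarrow> bool" where
  "supercritical A2 \<longleftrightarrow> A2 < 0"

definition subcritical :: "real \<Rightarrow> bool" where
  "subcritical A2 \<longleftrightarrow> A2 > 0"

text \<open>A family of pitchfork branches, one for each \<open>G > 0\<close>, which depends continuously on \<open>G\<close>.
  Continuity of the radius \<open>\<epsilon>\<close> makes the common domain relatively open, so that the joint continuity
  of the branches is not vacuous.\<close>

definition continuous_pitchfork_family ::
  "support \<Rightarrow> (real \<Rightarrow> real) \<Rightarrow> (real \<Rightarrow> real) \<Rightarrow> (real \<Rightarrow> real \<Rightarrow> real) \<Rightarrow>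
   (real \<Rightarrow> real \<Rightarrow> real \<Rightarrow> real ^ 3) \<Rightarrow> bool" where
  "continuous_pitchfork_family bc A2 \<epsilon> a D \<longleftrightarrow>
     (\<forall>G>0. pitchfork_branch bc G (A2 G) (\<epsilon> G) (a G) (D G)) \<and>
     continuous_on {0<..} A2 \<and>
     continuous_on {0<..} \<epsilon> \<and>
     continuous_on {(G, r). G > 0 \<and> \<bar>r\<bar> < \<epsilon> G} (\<lambda>(G, r). a G r) \<and>
     continuous_on {(G, r, s). G > 0 \<and> \<bar>r\<bar> < \<epsilon> G \<and> s \<in> {0..1}} (\<lambda>(G, r, s). D G r s)"


section \<open>Airy functions\<close>

text \<open>The Maclaurin series of the real Airy functions, with
  $\mathrm{Ai}(0) = 1/(3^{2/3}\Gamma(2/3))$ and $\mathrm{Ai}'(0) = -1/(3^{1/3}\Gamma(1/3))$.\<close>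

definition airy_f :: "real \<Rightarrow> real" where
  "airy_f x = (\<Sum>k. 3 ^ k * pochhammer (1 / 3) k * x ^ (3 * k) / fact (3 * k))"

definition airy_g :: "real \<Rightarrow> real" where
  "airy_g x = (\<Sum>k. 3 ^ k * pochhammer (2 / 3) k * x ^ (3 * k + 1) / fact (3 * k + 1))"

definition Ai :: "real \<Rightarrow> real" where
  "Ai x = airy_f x / (3 powr (2 / 3) * Gamma (2 / 3)) - airy_g x / (3 powr (1 / 3) * Gamma (1 / 3))"

definition Bi :: "real \<Rightarrow> real" where
  "Bi x = sqrt 3 *
     (airy_f x / (3 powr (2 / 3) * Gamma (2 / 3)) + airy_g x / (3 powr (1 / 3) * Gamma (1 / 3)))"

definition Ai_zero :: real where
  "Ai_zero = (GREATEST x. Ai x = 0)"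

definition Ai'_zero :: real where
  "Ai'_zero = (GREATEST x. deriv Ai x = 0)"

text \<open>The equation that characterizes the buckling loads has infinitely many positive
  solutions; the threshold is the least one.\<close>

definition G_crit :: real where
  "G_crit = (LEAST G. G > 0 \<and> Ai (- (G powr (1 / 3))) + 1 / sqrt 3 * Bi (- (G powr (1 / 3))) = 0)"

end

theory Submission
  imports Defs "HOL-Real_Asymp.Real_Asymp"
begin

text \<open>The linearized equation $u'' = (A - G(1-s))u$ is Airy's equation after an affine change of variable,
  so its solution \<open>w\<close> with $w(1) = 1$, $w'(1) = 0$ is explicit. Completing the square with $w'/w$ shows
  that the Rayleigh quotient stays above $-A$ as long as \<open>w\<close> is positive, and \<open>w\<close> cut off at a zero is a
  test function with quotient $-A$; hence at \<open>A_crit\<close> the function \<open>w\<close> is the principal eigenfunction.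
  Its Wronskian with \<open>Ai\<close>, or with \<open>Ai\<close> perturbed by a small multiple of a growing solution, locates
  \<open>beta0\<close> relative to the zeros of \<open>Ai\<close> and of its derivative. That \<open>Ai\<close>, with its
  prescribed initial values, is positive on the half line comes from a Jensen inequality for the two power
  series solutions and the asymptotics of the Gamma function.

  A planar equilibrium with angle $r\psi$ satisfies a Volterra integral equation that perturbs the linear one
  by a term of order $r^2$; the increment $(A - A_{crit})/r^2$ is eliminated by the solvability condition
  against the eigenfunction $\varphi$. The equation is a contraction near $\varphi$, uniformly enough that
  Picard iteration preserves joint continuity in $(G, r, s)$. At $r = 0$ the increment is
  $A_2 = \int (4 A_{crit} - G(1-s)) \varphi^4 / (6 \int \varphi^2)$, from which its sign can be read off.\<close>


section \<open>Absolutely continuous functions on the unit interval\<close>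

text \<open>\<open>beta0\<close> is only an infimum, and no minimizer is constructed by compactness.
  Instead, strict sign conditions on \<open>lin_sol\<close> are open in \<open>A\<close>: positivity
  on the closed interval puts \<open>beta0\<close> strictly above \<open>- A\<close>, a negative
  value puts it strictly below. At \<open>A_crit\<close> neither can happen, and this forces the
  boundary condition at the supported end. The two supports share the free end, so everything starts
  there: \<open>lin_sol\<close> and the Volterra operator are normalized at \<open>s = 1\<close>,
  and the amplitude \<open>r\<close> is the angle at the free end. The condition at
  \<open>s = 0\<close> is recovered last, from the Wronskian with the eigenfunction. Test functions
  and variations are merely in H1, so calculus is done for primitives of integrable functions
  (\<open>indef\<close>), and stationarity of the energy is shown by expansions in \<open>t\<close>
  whose quadratic remainder has an integrable majorant. A continuous family needs a radius
  continuous in \<open>G\<close>; therefore all contraction estimates use one explicit constant that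
  depends continuously on \<open>G\<close>.\<close>

definition indef :: "(real \<Rightarrow> 'a::euclidean_space) \<Rightarrow> (real \<Rightarrow> 'a) \<Rightarrow> bool" where
  "indef u u' \<longleftrightarrow> set_integrable lborel {0..1} u' \<and>
     (\<forall>x\<in>{0..1}. u x = u 0 + (LINT s:{0..x}|lborel. u' s))"

lemma set_integrable_Icc_subset:
  fixes f :: "real \<Rightarrow> 'a::euclidean_space"
  assumes "set_integrable lborel {0..1} f" "0 \<le> a" "b \<le> 1"
  shows "set_integrable lborel {a..b} f"
  by (rule set_integrable_subset[OF assms(1)]) (use assms in auto)

lemma indefI:
  assumes "set_integrable lborel {0..1} u'" "\<And>x. x \<in> {0..1} \<Longrightarrow> u x = u 0 + (LINT s:{0..x}|lborel. u' s)"
  shows "indef u u'"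
  using assms unfolding indef_def by blast

lemma indef_integrable: "indef u u' \<Longrightarrow> set_integrable lborel {0..1} u'"
  unfolding indef_def by blast

lemma indef_eq: "indef u u' \<Longrightarrow> x \<in> {0..1} \<Longrightarrow> u x = u 0 + (LINT s:{0..x}|lborel. u' s)"
  unfolding indef_def by blast

lemma indef_diff:
  assumes "indef u u'" "0 \<le> a" "a \<le> b" "b \<le> 1"
  shows "u b - u a = (LINT s:{a..b}|lborel. u' s)"
proof -
  have i: "set_integrable lborel {0..1} u'" and
    e: "\<And>x. x \<in> {0..1} \<Longrightarrow> u x = u 0 + (LINT s:{0..x}|lborel. u' s)"
    using indef_integrable[OF assms(1)] indef_eq[OF assms(1)] .
  have "(LINT s:{0..x}|lborel. u' s) = integral {0..x} u'" if "x \<le> 1" for x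
    by (rule set_borel_integral_eq_integral(2)) (rule set_integrable_Icc_subset[OF i], use that in auto)
  moreover have "(LINT s:{a..b}|lborel. u' s) = integral {a..b} u'"
    by (rule set_borel_integral_eq_integral(2)) (rule set_integrable_Icc_subset[OF i], use assms in auto)
  moreover have "integral {0..a} u' + integral {a..b} u' = integral {0..b} u'"
    by (rule Henstock_Kurzweil_Integration.integral_combine)
       (use assms in \<open>auto intro!: set_borel_integral_eq_integral(1) set_integrable_Icc_subset[OF i]\<close>)
  ultimately show ?thesis using e[of a] e[of b] assms by (simp add: algebra_simps)
qed

lemma indef_continuous:
  assumes "indef u u'"
  shows "continuous_on {0..1} u"
proof -
  have i: "set_integrable lborel {0..1} u'" and
    e: "\<And>x. x \<in> {0..1} \<Longrightarrow> u x = u 0 + (LINT s:{0..x}|lborel. u' s)"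
    using indef_integrable[OF assms(1)] indef_eq[OF assms(1)] .
  have "(LINT s:{0..x}|lborel. u' s) = integral {0..x} u'" if "x \<le> 1" for x
    by (rule set_borel_integral_eq_integral(2)) (rule set_integrable_Icc_subset[OF i], use that in auto)
  note eI = this
  have e': "u x = u 0 + integral {0..x} u'" if "x \<in> {0..1}" for x
    using e[OF that] eI[of x] that by (metis atLeastAtMost_iff)
  have "continuous_on {0..1} (\<lambda>x. u 0 + integral {0..x} u')"
    by (intro continuous_intros indefinite_integral_continuous_1 set_borel_integral_eq_integral(1) i)
  then show ?thesis by (rule continuous_on_eq) (rule e'[symmetric])
qed

text \<open>The half-lines \<open>{..x}\<close> generate the Borel sets and are closed under
  intersection, so an integral that vanishes on all of them vanishes on every Borel set. This yields
  uniqueness of weak derivatives almost everywhere, so the choice made in \<open>weak_deriv\<close>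
  never affects an integral.\<close>

lemma AE_zero_of_indefinite_integral_zero:
  fixes d :: "real \<Rightarrow> real"
  assumes i: "set_integrable lborel {0..1} d"
    and z: "\<And>x. x \<in> {0..1} \<Longrightarrow> (LINT s:{0..x}|lborel. d s) = 0"
  shows "AE s in lborel. s \<in> {0..1} \<longrightarrow> d s = 0"
proof -
  define D where "D = (\<lambda>x. indicator {0..1} x * d x)"
  have iD: "integrable lborel D" using i by (simp add: set_integrable_def D_def)
  have isub: "set_integrable lborel A D" if "A \<in> sets borel" for A
    unfolding set_integrable_def using iD that by (intro integrable_mult_indicator) auto
  have z': "(LINT s:{..x}|lborel. D s) = 0" for x
  proof -
    have "(LINT s:{..x}|lborel. D s) = (LINT s:{0..min x 1}|lborel. d s)"
      unfolding set_lebesgue_integral_def D_def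
      by (intro Bochner_Integration.integral_cong) (auto simp: indicator_def)
    also have "\<dots> = 0"
      by (cases "x < 0") (use z[of "min x 1"] in \<open>auto simp: set_lebesgue_integral_def\<close>)
    finally show ?thesis .
  qed
  have tot: "(LINT s|lborel. D s) = 0"
    using z[of 1] by (simp add: D_def set_lebesgue_integral_def)
  have all: "(LINT s:A|lborel. D s) = 0" if "A \<in> sets borel" for A
  proof -
    have A: "A \<in> sigma_sets UNIV (range (\<lambda>x::real. {..x}))"
      using that by (simp add: borel_eq_atMost sets_measure_of)
    have sb: "B \<in> sets borel" if "B \<in> sigma_sets UNIV (range (\<lambda>x::real. {..x}))" for B
      using that by (simp add: borel_eq_atMost sets_measure_of)
    have "Int_stable (range (\<lambda>x::real. {..x}))"
    proof (rule Int_stableI_image)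
      fix i j :: real
      show "\<exists>k\<in>UNIV. {..i} \<inter> {..j} = {..k}" by (rule bexI[of _ "min i j"]) auto
    qed
    moreover have "range (\<lambda>x::real. {..x}) \<subseteq> Pow UNIV" by simp
    ultimately show ?thesis using A
    proof (induction rule: sigma_sets_induct_disjoint)
      case (basic A) then show ?case using z' by auto
    next
      case empty then show ?case by (simp add: set_lebesgue_integral_def)
    next
      case (compl A)
      have m: "A \<in> sets borel" "UNIV - A \<in> sets borel"
        using sb[OF compl(1)] borel_comp[of A] by (simp_all add: Compl_eq_Diff_UNIV)
      have "(LINT s:A \<union> (UNIV - A)|lborel. D s) = (LINT s:A|lborel. D s) + (LINT s:(UNIV - A)|lborel. D s)"
        by (rule set_integral_Un) (use m isub in auto)
      moreover have "(LINT s:A \<union> (UNIV - A)|lborel. D s) = 0"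
        using tot by (simp add: set_lebesgue_integral_def)
      ultimately show ?case using compl(2) by simp
    next
      case (union A)
      have "(LINT s:(\<Union>i. A i)|lborel. D s) = (\<Sum>i. LINT s:A i|lborel. D s)"
      proof (rule lebesgue_integral_countable_add)
        show m: "A i \<in> sets lborel" for i using union(2) sb by auto
        show "A i \<inter> A j = {}" if "i \<noteq> j" for i j
          using union(1) that by (auto simp: disjoint_family_on_def)
        show "set_integrable lborel (\<Union>i. A i) D" using m by (intro isub) auto
      qed
      then show ?case using union(3) by simp
    qed
  qed
  have "AE s in lborel. D s = 0"
    by (rule density_unique_real[OF iD]) (use all in \<open>auto simp: set_lebesgue_integral_def\<close>)
  then show ?thesis by eventually_elim (auto simp: D_def indicator_def)
qed


lemma set_integrable_continuous:
  fixes f :: "real \<Rightarrow> 'a::euclidean_space"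
  assumes "continuous_on {a..b} f"
  shows "set_integrable lborel {a..b} f"
  by (rule borel_integrable_atLeastAtMost'[OF assms])

lemma set_integrable_continuous_mult:
  fixes f g :: "real \<Rightarrow> real"
  assumes f: "set_integrable lborel {0..1} f" and g: "continuous_on {0..1} g"
  shows "set_integrable lborel {0..1} (\<lambda>s. g s * f s)"
proof -
  have "bounded (g ` {0..1})" using g by (intro compact_imp_bounded compact_continuous_image) auto
  then obtain B where "\<forall>x\<in>g ` {0..1}. norm x \<le> B" using bounded_iff by blast
  then have B: "\<bar>g s\<bar> \<le> B" if "s \<in> {0..1}" for s using that by auto
  have m: "(\<lambda>s. indicator {0..1} s *\<^sub>R g s) \<in> borel_measurable borel"
    by (rule borel_measurable_continuous_on_indicator) (use g in auto)
  have mf: "(\<lambda>s. indicator {0..1} s *\<^sub>R f s) \<in> borel_measurable borel"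
    using f unfolding set_integrable_def by (auto dest: borel_measurable_integrable)
  have eq: "(\<lambda>s. indicator {0..1} s *\<^sub>R (g s * f s)) =
      (\<lambda>s. (indicator {0..1} s *\<^sub>R g s) * (indicator {0..1} s *\<^sub>R f s))"
    by (auto simp: indicator_def)
  show ?thesis unfolding set_integrable_def
  proof (rule Bochner_Integration.integrable_bound)
    show "integrable lborel (\<lambda>s. B *\<^sub>R (indicator {0..1} s *\<^sub>R f s))"
      using f unfolding set_integrable_def by (intro integrable_scaleR_right) auto
    show "(\<lambda>s. indicator {0..1} s *\<^sub>R (g s * f s)) \<in> borel_measurable lborel"
      unfolding eq using m mf by simp
    show "AE s in lborel. norm (indicator {0..1} s *\<^sub>R (g s * f s)) \<le> norm (B *\<^sub>R (indicator {0..1} s *\<^sub>R f s))"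
    proof (rule AE_I2)
      fix s :: real
      show "norm (indicator {0..1} s *\<^sub>R (g s * f s)) \<le> norm (B *\<^sub>R (indicator {0..1} s *\<^sub>R f s))"
        using B[of s] by (auto simp: indicator_def abs_mult intro!: mult_right_mono)
    qed
  qed
qed

text \<open>The chain rule, although \<open>u\<close> need not be differentiable at any given point.
  On a short interval the increment of \<open>F (u s)\<close> is
  \<open>f (u xi) * (u b - u a)\<close>, so the error of the formula is at most \<open>e\<close>
  times the integral of \<open>\<bar>u' s\<bar>\<close>. Such a bound adds up over adjacent
  intervals, so bisection extends it to all intervals, and \<open>e\<close> is arbitrary.\<close>

lemma indef_comp:
  fixes u u' F f :: "real \<Rightarrow> real"
  assumes u: "indef u u'"
    and I: "\<And>x. x \<in> {0..1} \<Longrightarrow> u x \<in> I" "convex I"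
    and d: "\<And>y. y \<in> I \<Longrightarrow> (F has_field_derivative f y) (at y)"
    and c: "continuous_on I f"
  shows "indef (\<lambda>s. F (u s)) (\<lambda>s. f (u s) * u' s)"
proof -
  have i: "set_integrable lborel {0..1} u'" by (rule indef_integrable[OF u])
  have cu: "continuous_on {0..1} u" by (rule indef_continuous[OF u])
  have cfu: "continuous_on {0..1} (\<lambda>s. f (u s))"
    by (rule continuous_on_compose2[OF c cu]) (use I in auto)
  have ifu: "set_integrable lborel {0..1} (\<lambda>s. f (u s) * u' s)"
    by (rule set_integrable_continuous_mult[OF i cfu])
  have ia: "set_integrable lborel {0..1} (\<lambda>s. \<bar>u' s\<bar>)" using i by (rule set_integrable_abs)
  note sub = set_integrable_Icc_subset
  have comb: "(LINT s:{a..b}|lborel. h s) + (LINT s:{b..c}|lborel. h s) = (LINT s:{a..c}|lborel. h s)"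
    if "set_integrable lborel {0..1} h" "0 \<le> a" "a \<le> b" "b \<le> c" "c \<le> 1" for a b c and h :: "real \<Rightarrow> real"
  proof -
    have "integral {a..b} h + integral {b..c} h = integral {a..c} h"
      by (rule Henstock_Kurzweil_Integration.integral_combine)
        (use that in \<open>auto intro!: set_borel_integral_eq_integral(1) sub[OF that(1)]\<close>)
    moreover have "(LINT s:{x..y}|lborel. h s) = integral {x..y} h" if "0 \<le> x" "y \<le> 1" for x y
      by (rule set_borel_integral_eq_integral(2)) (rule sub[OF \<open>set_integrable lborel {0..1} h\<close> that])
    ultimately show ?thesis using that by auto
  qed
  have main: "\<bar>F (u b) - F (u a) - (LINT s:{a..b}|lborel. f (u s) * u' s)\<bar> \<le> e * (LINT s:{a..b}|lborel. \<bar>u' s\<bar>)"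
    if e: "e > 0" and ab: "0 \<le> a" "a \<le> b" "b \<le> 1" for e a b
  proof -
    define P where "P = (\<lambda>a b. 0 \<le> a \<longrightarrow> a \<le> b \<longrightarrow> b \<le> 1 \<longrightarrow>
      \<bar>F (u b) - F (u a) - (LINT s:{a..b}|lborel. f (u s) * u' s)\<bar> \<le> e * (LINT s:{a..b}|lborel. \<bar>u' s\<bar>))"
    have "P a b" using ab(2)
    proof (induction rule: Bolzano)
      case (trans a b c)
      show ?case unfolding P_def
      proof (intro impI)
        assume *: "0 \<le> a" "a \<le> c" "c \<le> 1"
        then have "\<bar>F (u b) - F (u a) - (LINT s:{a..b}|lborel. f (u s) * u' s)\<bar> \<le> e * (LINT s:{a..b}|lborel. \<bar>u' s\<bar>)"
          "\<bar>F (u c) - F (u b) - (LINT s:{b..c}|lborel. f (u s) * u' s)\<bar> \<le> e * (LINT s:{b..c}|lborel. \<bar>u' s\<bar>)"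
          using trans unfolding P_def by auto
        moreover have "e * (LINT s:{a..c}|lborel. \<bar>u' s\<bar>) = e * (LINT s:{a..b}|lborel. \<bar>u' s\<bar>) + e * (LINT s:{b..c}|lborel. \<bar>u' s\<bar>)"
          using comb[OF ia, of a b c] trans * by (simp add: distrib_left[symmetric])
        ultimately show "\<bar>F (u c) - F (u a) - (LINT s:{a..c}|lborel. f (u s) * u' s)\<bar> \<le> e * (LINT s:{a..c}|lborel. \<bar>u' s\<bar>)"
          using comb[OF ifu, of a b c] trans * by linarith
      qed
    next
      case (local x)
      have x: "x \<in> {0..1}" using local ab by auto
      \<comment> \<open>Half of \<open>e\<close>, because both the running point and the
        intermediate point are compared with \<open>x\<close>.\<close>
      obtain d where d0: "d > 0" and dd: "\<And>s. s \<in> {0..1} \<Longrightarrow> dist s x < d \<Longrightarrow> dist (f (u s)) (f (u x)) < e / 2"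
        using cfu[unfolded continuous_on_iff, rule_format, OF x, of "e/2"] e by auto
      have "P a b" if h: "a \<le> x \<and> x \<le> b \<and> b - a < d" for a b
        unfolding P_def
      proof (intro impI)
        assume *: "0 \<le> a" "a \<le> b" "b \<le> 1"
        \<comment> \<open>Two intermediate points in a row: the mean value theorem for
          \<open>F\<close> gives a value \<open>z\<close> between \<open>u a\<close> and
          \<open>u b\<close>, and continuity of \<open>u\<close> attains it inside the
          interval.\<close>
        obtain xi where xi: "a \<le> xi" "xi \<le> b" "F (u b) - F (u a) = f (u xi) * (u b - u a)"
        proof (cases "u a = u b")
          case True then show ?thesis using that[of a] * by auto
        next
          case False
          define lo hi where "lo = min (u a) (u b)" and "hi = max (u a) (u b)"
          have lh: "lo < hi" using False by (auto simp: lo_def hi_def)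
          have inI: "y \<in> I" if "lo \<le> y" "y \<le> hi" for y
          proof -
            have "closed_segment (u a) (u b) \<subseteq> I" using I * by (intro closed_segment_subset) auto
            moreover have "y \<in> closed_segment (u a) (u b)"
              using that by (auto simp: closed_segment_eq_real_ivl lo_def hi_def)
            ultimately show ?thesis by blast
          qed
          obtain z where z: "lo < z" "z < hi" "F hi - F lo = (hi - lo) * f z"
            using MVT2[OF lh, of F f] d inI by blast
          have eq: "F (u b) - F (u a) = f z * (u b - u a)"
            using z(3) by (cases "u a \<le> u b") (auto simp: lo_def hi_def min_def max_def algebra_simps)
          have cab: "continuous_on {a..b} u" by (rule continuous_on_subset[OF cu]) (use * in auto)
          have "\<exists>xi. a \<le> xi \<and> xi \<le> b \<and> u xi = z"
          proof (cases "u a \<le> u b")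
            case True then show ?thesis using IVT'[of u a z b] z * cab by (auto simp: lo_def hi_def)
          next
            case False then show ?thesis using IVT2'[of u b z a] z * cab by (auto simp: lo_def hi_def)
          qed
          then show ?thesis using that eq by auto
        qed
        have iab: "set_integrable lborel {a..b} u'" "set_integrable lborel {a..b} (\<lambda>s. f (u s) * u' s)"
          "set_integrable lborel {a..b} (\<lambda>s. \<bar>u' s\<bar>)"
          using sub[OF i] sub[OF ifu] sub[OF ia] * by auto
        have "F (u b) - F (u a) - (LINT s:{a..b}|lborel. f (u s) * u' s) =
            (LINT s:{a..b}|lborel. f (u xi) * u' s - f (u s) * u' s)"
          using iab xi(3) indef_diff[OF u *] by simp
        also have "\<bar>\<dots>\<bar> \<le> (LINT s:{a..b}|lborel. \<bar>f (u xi) * u' s - f (u s) * u' s\<bar>)"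
          using set_integral_norm_bound[of lborel "{a..b}" "\<lambda>s. f (u xi) * u' s - f (u s) * u' s"] iab by auto
        also have "\<dots> \<le> (LINT s:{a..b}|lborel. e * \<bar>u' s\<bar>)"
        proof (rule set_integral_mono)
          show "set_integrable lborel {a..b} (\<lambda>s. \<bar>f (u xi) * u' s - f (u s) * u' s\<bar>)"
            using iab by (intro set_integrable_abs set_integral_diff) auto
          show "set_integrable lborel {a..b} (\<lambda>s. e * \<bar>u' s\<bar>)" using iab by auto
          fix s assume s: "s \<in> {a..b}"
          have "dist (f (u s)) (f (u x)) < e/2" "dist (f (u xi)) (f (u x)) < e/2"
            using dd[of s] dd[of xi] s xi h * by (auto simp: dist_real_def)
          then have "\<bar>f (u xi) - f (u s)\<bar> \<le> e" unfolding dist_real_def by linarith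
          then show "\<bar>f (u xi) * u' s - f (u s) * u' s\<bar> \<le> e * \<bar>u' s\<bar>"
            by (auto simp: left_diff_distrib[symmetric] abs_mult intro!: mult_right_mono)
        qed
        finally show "\<bar>F (u b) - F (u a) - (LINT s:{a..b}|lborel. f (u s) * u' s)\<bar> \<le> e * (LINT s:{a..b}|lborel. \<bar>u' s\<bar>)"
          by simp
      qed
      then show ?case using d0 by blast
    qed
    then show ?thesis using ab by (auto simp: P_def)
  qed
  have "F (u x) = F (u 0) + (LINT s:{0..x}|lborel. f (u s) * u' s)" if x: "x \<in> {0..1}" for x
  proof -
    define T where "T = (LINT s:{0..x}|lborel. \<bar>u' s\<bar>)"
    have T: "T \<ge> 0" unfolding T_def set_lebesgue_integral_def by (intro integral_nonneg_AE) auto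
    have "\<bar>F (u x) - F (u 0) - (LINT s:{0..x}|lborel. f (u s) * u' s)\<bar> \<le> 0 + e" if "e > 0" for e
    proof -
      \<comment> \<open>Divided by \<open>T + 1\<close> because \<open>T\<close> may be
        zero.\<close>
      have "\<bar>F (u x) - F (u 0) - (LINT s:{0..x}|lborel. f (u s) * u' s)\<bar> \<le> (e/(T+1)) * T"
        unfolding T_def by (rule main) (use x that T in \<open>auto simp: T_def[symmetric]\<close>)
      also have "\<dots> \<le> e" using T that by (simp add: field_simps)
      finally show ?thesis by simp
    qed
    then have "\<bar>F (u x) - F (u 0) - (LINT s:{0..x}|lborel. f (u s) * u' s)\<bar> \<le> 0" by (rule field_le_epsilon)
    then show ?thesis by simp
  qed
  then show ?thesis using ifu unfolding indef_def by blast
qed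

lemma indef_add:
  assumes u: "indef u u'" and v: "indef v v'"
  shows "indef (\<lambda>s. u s + v s) (\<lambda>s. u' s + v' s)"
proof (rule indefI)
  show "set_integrable lborel {0..1} (\<lambda>s. u' s + v' s)"
    by (intro set_integral_add indef_integrable[OF u] indef_integrable[OF v])
  fix x :: real assume x: "x \<in> {0..1}"
  have "(LINT s:{0..x}|lborel. u' s + v' s) = (LINT s:{0..x}|lborel. u' s) + (LINT s:{0..x}|lborel. v' s)"
    using x set_integrable_Icc_subset[OF indef_integrable[OF u], of 0 x] set_integrable_Icc_subset[OF indef_integrable[OF v], of 0 x]
    by (intro set_integral_add(2)) auto
  then show "u x + v x = u 0 + v 0 + (LINT s:{0..x}|lborel. u' s + v' s)"
    unfolding indef_eq[OF u x] indef_eq[OF v x] by simp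
qed

lemma indef_scaleR:
  assumes "indef u u'"
  shows "indef (\<lambda>s. c *\<^sub>R u s) (\<lambda>s. c *\<^sub>R u' s)"
proof (rule indefI)
  show "set_integrable lborel {0..1} (\<lambda>s. c *\<^sub>R u' s)" using indef_integrable[OF assms] by simp
  show "c *\<^sub>R u x = c *\<^sub>R u 0 + (LINT s:{0..x}|lborel. c *\<^sub>R u' s)" if "x \<in> {0..1}" for x
    unfolding indef_eq[OF assms that] scaleR_add_right by simp
qed

lemma indef_cmult:
  fixes u u' :: "real \<Rightarrow> real"
  assumes "indef u u'"
  shows "indef (\<lambda>s. c * u s) (\<lambda>s. c * u' s)"
  using indef_scaleR[OF assms, of c] by simp

lemma indef_const: "indef (\<lambda>s. c) (\<lambda>s. 0)"
  by (rule indefI) (auto simp: set_integrable_def)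

text \<open>Polarization: the product is half of the square of the sum minus both squares, so the
  chain rule for squares suffices.\<close>

lemma indef_mult:
  fixes u u' v v' :: "real \<Rightarrow> real"
  assumes u: "indef u u'" and v: "indef v v'"
  shows "indef (\<lambda>s. u s * v s) (\<lambda>s. u' s * v s + u s * v' s)"
proof -
  have sq: "indef (\<lambda>s. (w s)\<^sup>2) (\<lambda>s. 2 * w s * w' s)" if "indef w w'" for w w' :: "real \<Rightarrow> real"
    by (rule indef_comp[OF that, of UNIV "\<lambda>y. y\<^sup>2" "\<lambda>y. 2 * y"])
      (auto intro!: derivative_eq_intros continuous_intros)
  have "indef (\<lambda>s. (1/2) * ((u s + v s)\<^sup>2 + ((-1) * (u s)\<^sup>2 + (-1) * (v s)\<^sup>2)))
      (\<lambda>s. (1/2) * (2 * (u s + v s) * (u' s + v' s) + ((-1) * (2 * u s * u' s) + (-1) * (2 * v s * v' s))))"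
    by (intro indef_cmult indef_add sq u v)
  also have "(\<lambda>s. (1/2) * ((u s + v s)\<^sup>2 + ((-1) * (u s)\<^sup>2 + (-1) * (v s)\<^sup>2))) = (\<lambda>s. u s * v s)"
    by (auto simp: power2_eq_square algebra_simps)
  also have "(\<lambda>s. (1/2) * (2 * (u s + v s) * (u' s + v' s) + ((-1) * (2 * u s * u' s) + (-1) * (2 * v s * v' s))))
    = (\<lambda>s. u' s * v s + u s * v' s)"
    by (auto simp: algebra_simps)
  finally show ?thesis .
qed


lemma indef_inner:
  assumes "indef u u'"
  shows "indef (\<lambda>s. u s \<bullet> b) (\<lambda>s. u' s \<bullet> b)"
proof -
  have i: "set_integrable lborel {0..x} u'" if "x \<in> {0..1}" for x
    by (rule set_integrable_Icc_subset[OF indef_integrable[OF assms]]) (use that in auto)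
  have ib: "set_integrable lborel {0..x} (\<lambda>s. u' s \<bullet> b)"
      "(LINT s:{0..x}|lborel. u' s \<bullet> b) = (LINT s:{0..x}|lborel. u' s) \<bullet> b" if "x \<in> {0..1}" for x
  proof -
    have eq: "indicator {0..x} s *\<^sub>R (u' s \<bullet> b) = (indicator {0..x} s *\<^sub>R u' s) \<bullet> b" for s by simp
    show "set_integrable lborel {0..x} (\<lambda>s. u' s \<bullet> b)" unfolding set_integrable_def eq
      using i[OF that] by (intro integrable_inner_left) (auto simp: set_integrable_def)
    show "(LINT s:{0..x}|lborel. u' s \<bullet> b) = (LINT s:{0..x}|lborel. u' s) \<bullet> b"
      unfolding set_lebesgue_integral_def eq
      using i[OF that] by (intro integral_inner_left) (auto simp: set_integrable_def)
  qed
  show ?thesis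
  proof (rule indefI)
    show "set_integrable lborel {0..1} (\<lambda>s. u' s \<bullet> b)" using ib(1)[of 1] by simp
    show "u x \<bullet> b = u 0 \<bullet> b + (LINT s:{0..x}|lborel. u' s \<bullet> b)" if "x \<in> {0..1}" for x
      unfolding indef_eq[OF assms that] ib(2)[OF that] by (rule inner_add_left)
  qed
qed

lemma indef_euclideanI:
  fixes u u' :: "real \<Rightarrow> 'a::euclidean_space"
  assumes "\<And>b. b \<in> Basis \<Longrightarrow> indef (\<lambda>s. u s \<bullet> b) (\<lambda>s. u' s \<bullet> b)"
  shows "indef u u'"
proof -
  have i: "set_integrable lborel {0..1} u'"
  proof -
    have ib: "integrable lborel (\<lambda>s. indicator {0..1} s *\<^sub>R (u' s \<bullet> b))" if "b \<in> Basis" for b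
      using indef_integrable[OF assms[OF that]] by (simp add: set_integrable_def)
    have "integrable lborel (\<lambda>s. \<Sum>b\<in>Basis. (indicator {0..1} s *\<^sub>R (u' s \<bullet> b)) *\<^sub>R b)"
      by (intro Bochner_Integration.integrable_sum integrable_scaleR_left ib)
    also have "(\<lambda>s. \<Sum>b\<in>Basis. (indicator {0..1} s *\<^sub>R (u' s \<bullet> b)) *\<^sub>R b) = (\<lambda>s. indicator {0..1} s *\<^sub>R u' s)"
    proof
      fix s
      have "(\<Sum>b\<in>Basis. (indicator {0..1} s *\<^sub>R (u' s \<bullet> b)) *\<^sub>R b) = (\<Sum>b\<in>Basis. ((indicator {0..1} s *\<^sub>R u' s) \<bullet> b) *\<^sub>R b)"
        by simp
      also have "\<dots> = indicator {0..1} s *\<^sub>R u' s" by (rule euclidean_representation)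
      finally show "(\<Sum>b\<in>Basis. (indicator {0..1} s *\<^sub>R (u' s \<bullet> b)) *\<^sub>R b) = indicator {0..1} s *\<^sub>R u' s" .
    qed
    finally show ?thesis by (simp add: set_integrable_def)
  qed
  have "u x = u 0 + (LINT s:{0..x}|lborel. u' s)" if x: "x \<in> {0..1}" for x
  proof (rule euclidean_eqI)
    fix b :: 'a assume b: "b \<in> Basis"
    have ix: "set_integrable lborel {0..x} u'" by (rule set_integrable_Icc_subset[OF i]) (use x in auto)
    have eq: "indicator {0..x} s *\<^sub>R (u' s \<bullet> b) = (indicator {0..x} s *\<^sub>R u' s) \<bullet> b" for s by simp
    have "(LINT s:{0..x}|lborel. u' s \<bullet> b) = (LINT s:{0..x}|lborel. u' s) \<bullet> b"
      unfolding set_lebesgue_integral_def eq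
      using ix by (intro integral_inner_left) (auto simp: set_integrable_def)
    then show "u x \<bullet> b = (u 0 + (LINT s:{0..x}|lborel. u' s)) \<bullet> b"
      unfolding inner_add_left by (metis indef_eq[OF assms[OF b] x])
  qed
  then show ?thesis using i unfolding indef_def by blast
qed

lemma indef_unique_AE:
  fixes u u' v' :: "real \<Rightarrow> 'a::euclidean_space"
  assumes u: "indef u u'" and v: "indef u v'"
  shows "AE s in lborel. s \<in> {0..1} \<longrightarrow> u' s = v' s"
proof -
  have "AE s in lborel. s \<in> {0..1} \<longrightarrow> (u' s - v' s) \<bullet> b = 0" for b
  proof (rule AE_zero_of_indefinite_integral_zero)
    have d: "indef (\<lambda>s. u s \<bullet> b + (-1) * (u s \<bullet> b)) (\<lambda>s. u' s \<bullet> b + (-1) * (v' s \<bullet> b))"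
      by (intro indef_add indef_cmult indef_inner u v)
    then show "set_integrable lborel {0..1} (\<lambda>s. (u' s - v' s) \<bullet> b)"
      using indef_integrable[OF d] by (simp add: inner_diff_left)
    show "(LINT s:{0..x}|lborel. (u' s - v' s) \<bullet> b) = 0" if "x \<in> {0..1}" for x
      using indef_eq[OF d that] by (simp add: inner_diff_left)
  qed
  then have "AE s in lborel. \<forall>b\<in>Basis. s \<in> {0..1} \<longrightarrow> (u' s - v' s) \<bullet> b = 0"
    by (intro AE_finite_allI) auto
  then show ?thesis
    by eventually_elim (auto simp: euclidean_eq_iff[where 'a='a] inner_diff_left)
qed

lemma has_weak_deriv_indef:
  assumes "has_weak_deriv u u'"
  shows "indef u u'"
proof -
  have m: "set_borel_measurable lborel {0..1} u'" and s: "set_integrable lborel {0..1} (\<lambda>s. (norm (u' s))\<^sup>2)"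
    and e: "\<And>x. x \<in> {0..1} \<Longrightarrow> u x = u 0 + (LINT s:{0..x}|lborel. u' s)"
    using assms unfolding has_weak_deriv_def by blast+
  have "set_integrable lborel {0..1} u'" unfolding set_integrable_def
  proof (rule Bochner_Integration.integrable_bound)
    show "integrable lborel (\<lambda>x. indicator {0..1} x *\<^sub>R (1 + (norm (u' x))\<^sup>2))"
      using set_integral_add(1)[OF set_integrable_continuous s, of "\<lambda>x. 1"] by (simp add: set_integrable_def)
    show "(\<lambda>x. indicat_real {0..1} x *\<^sub>R u' x) \<in> borel_measurable lborel"
      using m by (simp add: set_borel_measurable_def)
    \<comment> \<open>On an interval of finite length, square integrability implies integrability by
      this pointwise inequality.\<close>
    have "norm (u' x) \<le> 1 + (norm (u' x))\<^sup>2" for x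
    proof -
      have "0 \<le> (norm (u' x) - 1/2)\<^sup>2" by simp
      then show ?thesis by (simp add: power2_eq_square algebra_simps)
    qed
    then show "AE x in lborel. norm (indicat_real {0..1} x *\<^sub>R u' x) \<le> norm (indicator {0..1} x *\<^sub>R (1 + (norm (u' x))\<^sup>2))"
      by (intro AE_I2) (auto simp: indicator_def)
  qed
  then show ?thesis using e unfolding indef_def by blast
qed

lemma has_weak_derivI:
  assumes "indef u u'" "set_integrable lborel {0..1} (\<lambda>s. (norm (u' s))\<^sup>2)"
  shows "has_weak_deriv u u'"
proof -
  have "set_borel_measurable lborel {0..1} u'"
    using assms(1) unfolding indef_def set_integrable_def set_borel_measurable_def
    by (blast dest: borel_measurable_integrable)
  then show ?thesis using assms unfolding has_weak_deriv_def indef_def by blast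
qed

lemma H1_weak_deriv: "H1 u \<Longrightarrow> has_weak_deriv u (weak_deriv u)"
  unfolding H1_def weak_deriv_def by (rule someI_ex[of "has_weak_deriv u"])

lemma has_weak_deriv_H1: "has_weak_deriv u u' \<Longrightarrow> H1 u"
  unfolding H1_def by blast

lemma weak_deriv_AE:
  assumes "has_weak_deriv u u'"
  shows "AE s in lborel. s \<in> {0..1} \<longrightarrow> weak_deriv u s = u' s"
  by (intro indef_unique_AE[where u=u] has_weak_deriv_indef assms
      H1_weak_deriv has_weak_deriv_H1[OF assms])

lemma set_integral_eq_AE:
  assumes "AE s in lborel. s \<in> A \<longrightarrow> f s = g s" "set_integrable lborel A f" "set_integrable lborel A g"
  shows "(LINT s:A|lborel. f s) = (LINT s:A|lborel. g s)"
  unfolding set_lebesgue_integral_def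
proof (rule integral_cong_AE)
  show "(\<lambda>s. indicator A s *\<^sub>R f s) \<in> borel_measurable lborel"
    "(\<lambda>s. indicator A s *\<^sub>R g s) \<in> borel_measurable lborel"
    using assms unfolding set_integrable_def by (blast dest: borel_measurable_integrable)+
  show "AE s in lborel. indicator A s *\<^sub>R f s = indicator A s *\<^sub>R g s"
    using assms(1) by eventually_elim (auto simp: indicator_def)
qed

lemma integral_norm_weak_deriv:
  assumes "has_weak_deriv u u'"
  shows "(LINT s:{0..1}|lborel. (norm (weak_deriv u s))\<^sup>2) = (LINT s:{0..1}|lborel. (norm (u' s))\<^sup>2)"
    and "set_integrable lborel {0..1} (\<lambda>s. (norm (weak_deriv u s))\<^sup>2)"
proof -
  have h: "has_weak_deriv u (weak_deriv u)" by (intro H1_weak_deriv has_weak_deriv_H1[OF assms])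
  show i: "set_integrable lborel {0..1} (\<lambda>s. (norm (weak_deriv u s))\<^sup>2)"
    using h unfolding has_weak_deriv_def by blast
  show "(LINT s:{0..1}|lborel. (norm (weak_deriv u s))\<^sup>2) = (LINT s:{0..1}|lborel. (norm (u' s))\<^sup>2)"
  proof (rule set_integral_eq_AE[OF _ i])
    show "AE x\<in>{0..1} in lborel. (norm (weak_deriv u x))\<^sup>2 = (norm (u' x))\<^sup>2"
      using weak_deriv_AE[OF assms] by eventually_elim auto
    show "set_integrable lborel {0..1} (\<lambda>s. (norm (u' s))\<^sup>2)"
      using assms unfolding has_weak_deriv_def by blast
  qed
qed

lemma second_variation_eq:
  assumes "has_weak_deriv u u'"
  shows "second_variation A G u =
    (LINT s:{0..1}|lborel. (norm (u' s))\<^sup>2) + (LINT s:{0..1}|lborel. (A - G * (1 - s)) * (norm (u s))\<^sup>2)"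
    and "set_integrable lborel {0..1} (\<lambda>s. (A - G * (1 - s)) * (norm (u s))\<^sup>2)"
proof -
  show i: "set_integrable lborel {0..1} (\<lambda>s. (A - G * (1 - s)) * (norm (u s))\<^sup>2)"
    by (intro set_integrable_continuous continuous_intros indef_continuous[OF has_weak_deriv_indef[OF assms]])
  then show "second_variation A G u =
    (LINT s:{0..1}|lborel. (norm (u' s))\<^sup>2) + (LINT s:{0..1}|lborel. (A - G * (1 - s)) * (norm (u s))\<^sup>2)"
    unfolding second_variation_def integral_norm_weak_deriv(1)[OF assms, symmetric]
    by (intro set_integral_add integral_norm_weak_deriv(2)[OF assms])
qed

text \<open>The finite set \<open>S\<close> admits corners; it serves the solution that is cut off
  at one of its zeros.\<close>

lemma has_weak_deriv_piecewise:
  fixes u :: "real \<Rightarrow> 'a::euclidean_space"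
  assumes S: "finite S" and c: "continuous_on {0..1} u"
    and d: "\<And>x. x \<in> {0<..<1} - S \<Longrightarrow> (u has_vector_derivative u' x) (at x)"
    and m: "u' \<in> borel_measurable borel" and B: "\<And>x. x \<in> {0..1} \<Longrightarrow> norm (u' x) \<le> B"
  shows "has_weak_deriv u u'"
proof (rule has_weak_derivI)
  have bd: "set_integrable lborel {0..1} f" if "f \<in> borel_measurable borel" "\<And>x. x \<in> {0..1} \<Longrightarrow> norm (f x) \<le> C"
    for f :: "real \<Rightarrow> 'b::euclidean_space" and C
    unfolding set_integrable_def
  proof (rule Bochner_Integration.integrable_bound)
    show "integrable lborel (\<lambda>x::real. indicator {0..1} x *\<^sub>R C)"
      using set_integrable_continuous[OF continuous_on_const, of 0 1 C] unfolding set_integrable_def .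
    show "(\<lambda>x. indicat_real {0..1} x *\<^sub>R f x) \<in> borel_measurable lborel"
      using that(1) by simp
    show "AE x in lborel. norm (indicat_real {0..1} x *\<^sub>R f x) \<le> norm (indicator {0..1} x *\<^sub>R C)"
      using that(2) by (intro AE_I2) (force simp: indicator_def)
  qed
  have i: "set_integrable lborel {0..1} u'" by (rule bd[OF m B])
  show "indef u u'" unfolding indef_def
  proof (intro conjI ballI i)
    fix x :: real assume x: "x \<in> {0..1}"
    have "(u' has_integral (u x - u 0)) {0..x}"
      by (rule fundamental_theorem_of_calculus_interior_strong[OF S])
        (use x d in \<open>auto intro: continuous_on_subset[OF c]\<close>)
    moreover have "(LINT s:{0..x}|lborel. u' s) = integral {0..x} u'"
      by (rule set_borel_integral_eq_integral(2), rule set_integrable_Icc_subset[OF i]) (use x in auto)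
    ultimately show "u x = u 0 + (LINT s:{0..x}|lborel. u' s)" by (simp add: integral_unique)
  qed
  show "set_integrable lborel {0..1} (\<lambda>s. (norm (u' s))\<^sup>2)"
    by (rule bd[of _ "B\<^sup>2"]) (use m B in \<open>auto intro!: power_mono\<close>)
qed

lemma has_weak_deriv_C1:
  fixes u :: "real \<Rightarrow> 'a::euclidean_space"
  assumes d: "\<And>x. x \<in> {0..1} \<Longrightarrow> (u has_vector_derivative u' x) (at x within {0..1})"
    and c: "continuous_on {0..1} u'"
  shows "has_weak_deriv u u'"
proof (rule has_weak_derivI)
  have i: "set_integrable lborel {0..1} u'" by (rule set_integrable_continuous[OF c])
  show "indef u u'" unfolding indef_def
  proof (intro conjI ballI i)
    fix x :: real assume x: "x \<in> {0..1}"
    have "(u' has_integral (u x - u 0)) {0..x}"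
      by (rule fundamental_theorem_of_calculus)
        (use x in \<open>auto intro: has_vector_derivative_within_subset[OF d]\<close>)
    moreover have "(LINT s:{0..x}|lborel. u' s) = integral {0..x} u'"
      by (rule set_borel_integral_eq_integral(2), rule set_integrable_Icc_subset[OF i]) (use x in auto)
    ultimately show "u x = u 0 + (LINT s:{0..x}|lborel. u' s)" by (simp add: integral_unique)
  qed
  show "set_integrable lborel {0..1} (\<lambda>s. (norm (u' s))\<^sup>2)"
    by (intro set_integrable_continuous continuous_intros c)
qed

lemma integral_Icc_pos:
  fixes f :: "real \<Rightarrow> real"
  assumes c: "continuous_on {0..1} f" and nn: "\<And>s. s \<in> {0..1} \<Longrightarrow> f s \<ge> 0" and x: "x \<in> {0..1}" "f x \<noteq> 0"
  shows "(LINT s:{0..1}|lborel. f s) > 0"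
proof -
  have eq: "(LINT s:{0..1}|lborel. f s) = integral {0..1} f"
    by (rule set_borel_integral_eq_integral(2)) (rule set_integrable_continuous[OF c])
  have i: "f integrable_on {0..1}" by (rule integrable_continuous_real[OF c])
  have "integral {0..1} f \<ge> 0" using i nn by (intro integral_nonneg) auto
  moreover have "integral {0..1} f \<noteq> 0"
  proof
    assume "integral {0..1} f = 0"
    then have "(f has_integral 0) (cbox 0 1)" using i by (metis box_real(2) integrable_integral)
    then have "f x = 0"
      using has_integral_0_cbox_imp_0[of 0 1 f x] c nn x by auto
    then show False using x by simp
  qed
  ultimately show ?thesis unfolding eq by simp
qed

section \<open>Airy functions\<close>

text \<open>Coefficients in the variable \<open>z = x ^ 3\<close>, not in \<open>x\<close>. In this
  variable \<open>airy_f x\<close> and \<open>airy_g x / x\<close> are plain power series with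
  positive coefficients, which makes termwise comparison possible.\<close>

definition airy_a :: "nat \<Rightarrow> real" where
  "airy_a k = 3 ^ k * pochhammer (1 / 3) k / fact (3 * k)"

definition airy_b :: "nat \<Rightarrow> real" where
  "airy_b k = 3 ^ k * pochhammer (2 / 3) k / fact (3 * k + 1)"

lemma airy_a_0 [simp]: "airy_a 0 = 1" and airy_b_0 [simp]: "airy_b 0 = 1"
  by (simp_all add: airy_a_def airy_b_def)

lemma airy_a_pos: "airy_a k > 0" and airy_b_pos: "airy_b k > 0"
  unfolding airy_a_def airy_b_def by (auto intro!: divide_pos_pos mult_pos_pos pochhammer_pos)

lemma airy_a_Suc: "airy_a (Suc k) * ((3 * real k + 2) * (3 * real k + 3)) = airy_a k"
proof -
  have "3 * Suc k = Suc (Suc (Suc (3 * k)))" by simp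
  then have f: "fact (3 * Suc k) = (3 * real k + 3) * ((3 * real k + 2) * ((3 * real k + 1) * fact (3 * k)))"
    by (simp only: fact_Suc) (simp add: algebra_simps)
  have "airy_a (Suc k) = 3 ^ k * pochhammer (1/3) k * (3 * real k + 1) /
      ((3 * real k + 3) * ((3 * real k + 2) * ((3 * real k + 1) * fact (3 * k))))"
    unfolding airy_a_def f by (simp add: pochhammer_Suc algebra_simps)
  also have "\<dots> = airy_a k / ((3 * real k + 3) * (3 * real k + 2))"
    unfolding airy_a_def by (simp add: divide_simps)
  finally show ?thesis by (simp add: divide_simps) (simp add: mult_ac)
qed

lemma airy_b_Suc: "airy_b (Suc k) * ((3 * real k + 3) * (3 * real k + 4)) = airy_b k"
proof -
  have "3 * Suc k + 1 = Suc (Suc (Suc (3 * k + 1)))" by simp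
  then have f: "fact (3 * Suc k + 1) = (3 * real k + 4) * ((3 * real k + 3) * ((3 * real k + 2) * fact (3 * k + 1)))"
    by (simp only: fact_Suc) (simp add: algebra_simps)
  have "airy_b (Suc k) = 3 ^ k * pochhammer (2/3) k * (3 * real k + 2) /
      ((3 * real k + 4) * ((3 * real k + 3) * ((3 * real k + 2) * fact (3 * k + 1))))"
    unfolding airy_b_def f by (simp add: pochhammer_Suc algebra_simps)
  also have "\<dots> = airy_b k / ((3 * real k + 4) * (3 * real k + 3))"
    unfolding airy_b_def by (simp add: divide_simps)
  finally show ?thesis by (simp add: divide_simps) (simp add: mult_ac)
qed

lemma airy_a_le: "airy_a k \<le> 1 / fact k"
proof (induction k)
  case (Suc k)
  have "airy_a (Suc k) = airy_a k / ((3 * real k + 2) * (3 * real k + 3))"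
    by (simp add: airy_a_Suc[of k, symmetric])
  also have "\<dots> \<le> airy_a k / (real k + 1)"
  proof (rule divide_left_mono)
    show "real k + 1 \<le> (3 * real k + 2) * (3 * real k + 3)" by (simp add: algebra_simps)
    show "0 < (3 * real k + 2) * (3 * real k + 3) * (real k + 1)" by (intro mult_pos_pos) auto
  qed (use airy_a_pos[of k] in auto)
  also have "\<dots> \<le> (1 / fact k) / (real k + 1)" by (intro divide_right_mono Suc) auto
  also have "\<dots> = 1 / fact (Suc k)" by (simp add: field_simps)
  finally show ?case .
qed simp

lemma airy_b_le: "airy_b k \<le> 1 / fact k"
proof (induction k)
  case (Suc k)
  have "airy_b (Suc k) = airy_b k / ((3 * real k + 3) * (3 * real k + 4))"
    by (simp add: airy_b_Suc[of k, symmetric])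
  also have "\<dots> \<le> airy_b k / (real k + 1)"
  proof (rule divide_left_mono)
    show "real k + 1 \<le> (3 * real k + 3) * (3 * real k + 4)" by (simp add: algebra_simps)
    show "0 < (3 * real k + 3) * (3 * real k + 4) * (real k + 1)" by (intro mult_pos_pos) auto
  qed (use airy_b_pos[of k] in auto)
  also have "\<dots> \<le> (1 / fact k) / (real k + 1)" by (intro divide_right_mono Suc) auto
  also have "\<dots> = 1 / fact (Suc k)" by (simp add: field_simps)
  finally show ?case .
qed simp

lemma summable_le_inverse_fact:
  fixes c :: "nat \<Rightarrow> real"
  assumes "\<And>k. 0 \<le> c k" "\<And>k. c k \<le> 1 / fact k"
  shows "summable (\<lambda>k. c k * z ^ k)"
proof (rule summable_comparison_test')
  show "summable (\<lambda>k. inverse (fact k) * \<bar>z\<bar> ^ k)" by (rule summable_exp)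
  show "norm (c k * z ^ k) \<le> inverse (fact k) * \<bar>z\<bar> ^ k" if "k \<ge> 0" for k
    using assms[of k] by (auto simp: abs_mult power_abs divide_inverse intro!: mult_right_mono)
qed

lemma summable_airy_a: "summable (\<lambda>k. airy_a k * z ^ k)"
  by (rule summable_le_inverse_fact) (use airy_a_pos airy_a_le in \<open>auto intro: less_imp_le\<close>)

lemma summable_airy_b: "summable (\<lambda>k. airy_b k * z ^ k)"
  by (rule summable_le_inverse_fact) (use airy_b_pos airy_b_le in \<open>auto intro: less_imp_le\<close>)

definition pser :: "(nat \<Rightarrow> real) \<Rightarrow> real \<Rightarrow> real" where
  "pser c z = (\<Sum>k. c k * z ^ k)"

lemma pser_has_derivative:
  assumes "\<And>z. summable (\<lambda>k. c k * z ^ k)"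
  shows "(pser c has_field_derivative pser (diffs c) z) (at z)"
  unfolding pser_def[abs_def] by (rule termdiffs_strong_converges_everywhere[OF assms])

lemma pser_0: "pser c 0 = c 0"
  by (simp add: pser_def)

lemma summable_diffs_a: "summable (\<lambda>k. diffs airy_a k * z ^ k)"
  by (rule termdiff_converges_all[OF summable_airy_a])

lemma summable_diffs_b: "summable (\<lambda>k. diffs airy_b k * z ^ k)"
  by (rule termdiff_converges_all[OF summable_airy_b])

lemma airy_f_pser: "airy_f x = pser airy_a (x ^ 3)"
  by (simp add: airy_f_def pser_def airy_a_def power_mult)

lemma airy_g_pser: "airy_g x = x * pser airy_b (x ^ 3)"
proof -
  have eq: "x ^ (3 * k + 1) = x * (x ^ 3) ^ k" for k by (simp add: power_mult)
  have "airy_g x = (\<Sum>k. x * (airy_b k * (x ^ 3) ^ k))"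
    unfolding airy_g_def airy_b_def eq by (simp only: times_divide_eq_left times_divide_eq_right mult_ac)
  also have "\<dots> = x * pser airy_b (x ^ 3)"
    unfolding pser_def by (rule suminf_mult[OF summable_airy_b])
  finally show ?thesis .
qed

definition airy_f' :: "real \<Rightarrow> real" where
  "airy_f' x = 3 * x\<^sup>2 * pser (diffs airy_a) (x ^ 3)"

definition airy_g' :: "real \<Rightarrow> real" where
  "airy_g' x = pser airy_b (x ^ 3) + 3 * x ^ 3 * pser (diffs airy_b) (x ^ 3)"

lemma pser_shift:
  assumes "summable (\<lambda>k. c k * z ^ k)"
  shows "z * pser c z = (\<Sum>k. (case k of 0 \<Rightarrow> 0 | Suc n \<Rightarrow> c n) * z ^ k)"
proof -
  let ?d = "\<lambda>k. (case k of 0 \<Rightarrow> 0 | Suc n \<Rightarrow> c n) * z ^ k"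
  have s: "summable (\<lambda>k. ?d (Suc k))" using summable_mult[OF assms, of z] by (simp add: mult_ac)
  have "summable ?d" using s by (subst summable_Suc_iff[symmetric])
  then have "suminf ?d = ?d 0 + (\<Sum>k. ?d (Suc k))"
    using suminf_split_head[of ?d] by simp
  also have "\<dots> = (\<Sum>k. z * (c k * z ^ k))" by (simp add: mult_ac)
  also have "\<dots> = z * pser c z" unfolding pser_def by (rule suminf_mult[OF assms])
  finally show ?thesis by simp
qed

text \<open>For \<open>f x = P (x ^ 3)\<close> one has
  \<open>f'' = 9 * x ^ 4 * P'' + 6 * x * P'\<close>; dividing Airy's equation
  \<open>f'' = x * f\<close> by \<open>x\<close> gives this equation in
  \<open>z = x ^ 3\<close>.\<close>

lemma pser_ode_a: "9 * z * pser (diffs (diffs airy_a)) z + 6 * pser (diffs airy_a) z = pser airy_a z"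
proof -
  have sd: "summable (\<lambda>k. diffs (diffs airy_a) k * z ^ k)"
    by (rule termdiff_converges_all[OF summable_diffs_a])
  let ?d = "\<lambda>k. (case k of 0 \<Rightarrow> 0 | Suc n \<Rightarrow> diffs (diffs airy_a) n) * z ^ k"
  have s: "summable ?d"
    using summable_mult[OF sd, of z] by (subst summable_Suc_iff[symmetric]) (simp add: mult_ac)
  have "9 * (z * pser (diffs (diffs airy_a)) z) + 6 * pser (diffs airy_a) z
      = (\<Sum>k. 9 * ?d k + 6 * (diffs airy_a k * z ^ k))"
    unfolding pser_shift[OF sd] unfolding pser_def
    by (simp add: suminf_add[symmetric] suminf_mult s summable_diffs_a summable_mult)
  also have "(\<lambda>k. 9 * ?d k + 6 * (diffs airy_a k * z ^ k)) = (\<lambda>k. airy_a k * z ^ k)"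
  proof
    fix k
    show "9 * ?d k + 6 * (diffs airy_a k * z ^ k) = airy_a k * z ^ k"
      using airy_a_Suc[of k, symmetric]
      by (cases k) (auto simp: diffs_def algebra_simps)
  qed
  finally show ?thesis by (simp add: pser_def mult_ac)
qed

text \<open>The same reduction for \<open>g x = x * P (x ^ 3)\<close>, where Airy's equation is
  divided by the square of \<open>x\<close>.\<close>

lemma pser_ode_b: "9 * z * pser (diffs (diffs airy_b)) z + 12 * pser (diffs airy_b) z = pser airy_b z"
proof -
  have sd: "summable (\<lambda>k. diffs (diffs airy_b) k * z ^ k)"
    by (rule termdiff_converges_all[OF summable_diffs_b])
  let ?d = "\<lambda>k. (case k of 0 \<Rightarrow> 0 | Suc n \<Rightarrow> diffs (diffs airy_b) n) * z ^ k"
  have s: "summable ?d"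
    using summable_mult[OF sd, of z] by (subst summable_Suc_iff[symmetric]) (simp add: mult_ac)
  have "9 * (z * pser (diffs (diffs airy_b)) z) + 12 * pser (diffs airy_b) z
      = (\<Sum>k. 9 * ?d k + 12 * (diffs airy_b k * z ^ k))"
    unfolding pser_shift[OF sd] unfolding pser_def
    by (simp add: suminf_add[symmetric] suminf_mult s summable_diffs_b summable_mult)
  also have "(\<lambda>k. 9 * ?d k + 12 * (diffs airy_b k * z ^ k)) = (\<lambda>k. airy_b k * z ^ k)"
  proof
    fix k
    show "9 * ?d k + 12 * (diffs airy_b k * z ^ k) = airy_b k * z ^ k"
      using airy_b_Suc[of k, symmetric]
      by (cases k) (auto simp: diffs_def algebra_simps)
  qed
  finally show ?thesis by (simp add: pser_def mult_ac)
qed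

lemma airy_f_deriv: "(airy_f has_field_derivative airy_f' x) (at x)"
proof -
  have "((\<lambda>x. pser airy_a (x ^ 3)) has_field_derivative pser (diffs airy_a) (x ^ 3) * (3 * x\<^sup>2)) (at x)"
    by (rule DERIV_chain'[OF _ pser_has_derivative[OF summable_airy_a]])
       (auto intro!: derivative_eq_intros)
  then show ?thesis by (simp add: airy_f_pser[abs_def] airy_f'_def mult_ac)
qed

lemma airy_f'_deriv: "(airy_f' has_field_derivative x * airy_f x) (at x)"
proof -
  have "((\<lambda>x. pser (diffs airy_a) (x ^ 3)) has_field_derivative pser (diffs (diffs airy_a)) (x ^ 3) * (3 * x\<^sup>2)) (at x)"
    by (rule DERIV_chain'[OF _ pser_has_derivative[OF summable_diffs_a]])
       (auto intro!: derivative_eq_intros)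
  then have "((\<lambda>x. 3 * x\<^sup>2 * pser (diffs airy_a) (x ^ 3)) has_field_derivative
      6 * x * pser (diffs airy_a) (x ^ 3) + 3 * x\<^sup>2 * (pser (diffs (diffs airy_a)) (x ^ 3) * (3 * x\<^sup>2))) (at x)"
    by (auto intro!: derivative_eq_intros)
  also have "6 * x * pser (diffs airy_a) (x ^ 3) + 3 * x\<^sup>2 * (pser (diffs (diffs airy_a)) (x ^ 3) * (3 * x\<^sup>2)) =
      x * (9 * x ^ 3 * pser (diffs (diffs airy_a)) (x ^ 3) + 6 * pser (diffs airy_a) (x ^ 3))"
    by (simp add: algebra_simps power2_eq_square power3_eq_cube)
  also have "\<dots> = x * airy_f x" unfolding pser_ode_a airy_f_pser ..
  finally show ?thesis by (simp add: airy_f'_def[abs_def])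
qed

lemma airy_g_deriv: "(airy_g has_field_derivative airy_g' x) (at x)"
proof -
  have "((\<lambda>x. pser airy_b (x ^ 3)) has_field_derivative pser (diffs airy_b) (x ^ 3) * (3 * x\<^sup>2)) (at x)"
    by (rule DERIV_chain'[OF _ pser_has_derivative[OF summable_airy_b]])
       (auto intro!: derivative_eq_intros)
  then have "((\<lambda>x. x * pser airy_b (x ^ 3)) has_field_derivative
      pser airy_b (x ^ 3) + x * (pser (diffs airy_b) (x ^ 3) * (3 * x\<^sup>2))) (at x)"
    by (auto intro!: derivative_eq_intros)
  then show ?thesis
    by (simp add: airy_g_pser[abs_def] airy_g'_def mult_ac power2_eq_square power3_eq_cube)
qed

lemma airy_g'_deriv: "(airy_g' has_field_derivative x * airy_g x) (at x)"
proof -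
  have 1: "((\<lambda>x. pser airy_b (x ^ 3)) has_field_derivative pser (diffs airy_b) (x ^ 3) * (3 * x\<^sup>2)) (at x)"
    by (rule DERIV_chain'[OF _ pser_has_derivative[OF summable_airy_b]])
       (auto intro!: derivative_eq_intros)
  have "((\<lambda>x. pser (diffs airy_b) (x ^ 3)) has_field_derivative pser (diffs (diffs airy_b)) (x ^ 3) * (3 * x\<^sup>2)) (at x)"
    by (rule DERIV_chain'[OF _ pser_has_derivative[OF summable_diffs_b]])
       (auto intro!: derivative_eq_intros)
  with 1 have "((\<lambda>x. pser airy_b (x ^ 3) + 3 * x ^ 3 * pser (diffs airy_b) (x ^ 3)) has_field_derivative
      pser (diffs airy_b) (x ^ 3) * (3 * x\<^sup>2) + (9 * x\<^sup>2 * pser (diffs airy_b) (x ^ 3)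
        + 3 * x ^ 3 * (pser (diffs (diffs airy_b)) (x ^ 3) * (3 * x\<^sup>2)))) (at x)"
    by (auto intro!: derivative_eq_intros)
  also have "pser (diffs airy_b) (x ^ 3) * (3 * x\<^sup>2) + (9 * x\<^sup>2 * pser (diffs airy_b) (x ^ 3)
        + 3 * x ^ 3 * (pser (diffs (diffs airy_b)) (x ^ 3) * (3 * x\<^sup>2)))
      = x * (x * (9 * x ^ 3 * pser (diffs (diffs airy_b)) (x ^ 3) + 12 * pser (diffs airy_b) (x ^ 3)))"
    by (simp add: algebra_simps power2_eq_square power3_eq_cube)
  also have "\<dots> = x * airy_g x" unfolding pser_ode_b airy_g_pser ..
  finally show ?thesis by (simp add: airy_g'_def[abs_def])
qed

lemma airy_at_0 [simp]: "airy_f 0 = 1" "airy_f' 0 = 0" "airy_g 0 = 0" "airy_g' 0 = 1"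
  by (simp_all add: airy_f_pser airy_f'_def airy_g_pser airy_g'_def pser_0)

lemma airy_wronskian: "airy_f x * airy_g' x - airy_f' x * airy_g x = 1"
proof -
  have "((\<lambda>x. airy_f x * airy_g' x - airy_f' x * airy_g x) has_field_derivative 0) (at x)" for x
    by (auto intro!: derivative_eq_intros airy_f_deriv airy_f'_deriv airy_g_deriv airy_g'_deriv)
  then have "(\<lambda>x. airy_f x * airy_g' x - airy_f' x * airy_g x) x = (\<lambda>x. airy_f x * airy_g' x - airy_f' x * airy_g x) 0"
    by (intro DERIV_isconst_all) auto
  then show ?thesis by simp
qed

lemma airy_continuous:
  "continuous_on S airy_f" "continuous_on S airy_f'" "continuous_on S airy_g" "continuous_on S airy_g'"
  using airy_f_deriv airy_f'_deriv airy_g_deriv airy_g'_deriv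
  by (auto intro!: continuous_at_imp_continuous_on DERIV_isCont)

lemma pser_ge:
  assumes "\<And>k. c k \<ge> 0" "summable (\<lambda>k. c k * z ^ k)" "z \<ge> 0"
  shows "pser c z \<ge> c 0"
proof -
  have "(\<Sum>k\<in>{0}. c k * z ^ k) \<le> suminf (\<lambda>k. c k * z ^ k)"
    by (rule sum_le_suminf[OF assms(2)]) (use assms in auto)
  then show ?thesis by (simp add: pser_def)
qed

lemma diffs_pos: "(\<And>k. c k > 0) \<Longrightarrow> diffs c k > (0::real)"
  unfolding diffs_def by simp

lemma airy_pos:
  assumes "x \<ge> 0"
  shows "airy_f x \<ge> 1" "airy_f' x \<ge> 0" "airy_g x \<ge> x" "airy_g' x \<ge> 1" "x > 0 \<Longrightarrow> airy_f' x > 0"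
proof -
  have a: "pser airy_a (x^3) \<ge> airy_a 0"
    by (rule pser_ge) (use assms airy_a_pos summable_airy_a in \<open>auto intro: less_imp_le\<close>)
  have b: "pser airy_b (x^3) \<ge> airy_b 0"
    by (rule pser_ge) (use assms airy_b_pos summable_airy_b in \<open>auto intro: less_imp_le\<close>)
  have da: "pser (diffs airy_a) (x^3) \<ge> diffs airy_a 0"
    by (rule pser_ge) (use assms airy_a_pos summable_diffs_a diffs_pos in \<open>auto intro: less_imp_le\<close>)
  have db: "pser (diffs airy_b) (x^3) \<ge> diffs airy_b 0"
    by (rule pser_ge) (use assms airy_b_pos summable_diffs_b diffs_pos in \<open>auto intro: less_imp_le\<close>)
  have p: "diffs airy_a 0 > 0" "diffs airy_b 0 > 0" by (auto intro!: diffs_pos airy_a_pos airy_b_pos)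
  show "airy_f x \<ge> 1" using a by (simp add: airy_f_pser)
  show "airy_f' x \<ge> 0" using da p by (simp add: airy_f'_def)
  show "airy_g x \<ge> x" using b assms mult_left_mono[of 1 "pser airy_b (x^3)" x] by (simp add: airy_g_pser)
  show "airy_g' x \<ge> 1" using b db p assms by (simp add: airy_g'_def add_increasing2)
  show "airy_f' x > 0" if "x > 0" using da p that by (simp add: airy_f'_def)
qed

section \<open>Signs of Ai and of its derivative on the half-line\<close>

text \<open>The right-hand side is the tangent at \<open>t\<close> of the concave function
  \<open>s powr p\<close>, obtained from the weighted inequality of arithmetic and geometric means.
  It linearizes the power before an average is taken.\<close>

lemma powr_tangent:
  fixes s t p :: real
  assumes "s > 0" "t > 0" "0 \<le> p" "p \<le> 1"
  shows "s powr p \<le> t powr (p - 1) * (p * s + (1 - p) * t)"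
proof -
  have "s powr p * t powr (1 - p) \<le> p * s + (1 - p) * t"
    by (rule Youngs_inequality_0) (use assms in auto)
  then have "t powr (p - 1) * (s powr p * t powr (1 - p)) \<le> t powr (p - 1) * (p * s + (1 - p) * t)"
    by (intro mult_left_mono) auto
  moreover have "t powr (p - 1) * (s powr p * t powr (1 - p)) = s powr p"
    using assms by (simp add: powr_add[symmetric] mult.left_commute)
  ultimately show ?thesis by simp
qed

text \<open>Jensen's inequality for the concave function \<open>(t + C) powr p\<close> and the distribution on the
  naturals with weights \<open>d k * z ^ k\<close>, under which \<open>t\<close> has expectation \<open>z\<close>.\<close>

lemma series_Jensen:
  fixes d t h :: "nat \<Rightarrow> real"
  assumes d: "\<And>k. d k \<ge> 0" and t: "\<And>k. t k \<ge> 0" and t0: "t 0 = 0" and td: "\<And>k. t (Suc k) * d (Suc k) = d k"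
    and h: "\<And>k. h k \<le> K * (t k + C) powr p" and K: "K \<ge> 0" and C: "C > 0" and p: "0 \<le> p" "p \<le> 1" and z: "z \<ge> 0"
    and sd: "summable (\<lambda>k. d k * z ^ k)" and sh: "summable (\<lambda>k. h k * d k * z ^ k)"
  shows "(\<Sum>k. h k * d k * z ^ k) \<le> K * (z + C) powr p * pser d z"
proof -
  have eq: "(t (Suc k) * d (Suc k)) * z ^ Suc k = z * (d k * z ^ k)" for k unfolding td by simp
  have st: "summable (\<lambda>k. (t k * d k) * z ^ k)"
    by (subst summable_Suc_iff[symmetric]) (simp only: eq summable_mult[OF sd])
  have "(\<Sum>k. (t k * d k) * z ^ k) = (\<Sum>k. (t (Suc k) * d (Suc k)) * z ^ Suc k)"
    using suminf_split_head[OF st] t0 by simp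
  also have "\<dots> = z * pser d z" unfolding eq pser_def by (rule suminf_mult[OF sd])
  finally have Et: "(\<Sum>k. (t k * d k) * z ^ k) = z * pser d z" .
  let ?m = "K * (z + C) powr (p - 1)"
  \<comment> \<open>The tangent is taken at \<open>z + C\<close>, the expectation of
    \<open>t k + C\<close>, so that averaging the linear bound returns the power itself.\<close>
  have b: "h k * d k * z ^ k \<le> ?m * (p * ((t k * d k) * z ^ k) + (p * C + (1 - p) * (z + C)) * (d k * z ^ k))" for k
  proof -
    have "h k \<le> K * (t k + C) powr p" by (rule h)
    also have "\<dots> \<le> K * ((z + C) powr (p - 1) * (p * (t k + C) + (1 - p) * (z + C)))"
      using t[of k] C z p by (intro mult_left_mono powr_tangent K) auto
    finally have "h k * (d k * z ^ k) \<le> K * ((z + C) powr (p - 1) * (p * (t k + C) + (1 - p) * (z + C))) * (d k * z ^ k)"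
      using d z by (intro mult_right_mono) auto
    then show ?thesis by (simp add: algebra_simps)
  qed
  have s2: "summable (\<lambda>k. p * ((t k * d k) * z ^ k) + (p * C + (1 - p) * (z + C)) * (d k * z ^ k))"
    by (intro summable_add summable_mult st sd)
  have "(\<Sum>k. h k * d k * z ^ k) \<le> (\<Sum>k. ?m * (p * ((t k * d k) * z ^ k) + (p * C + (1 - p) * (z + C)) * (d k * z ^ k)))"
    by (rule suminf_le[OF b sh summable_mult[OF s2]])
  also have "\<dots> = ?m * (p * (z * pser d z) + (p * C + (1 - p) * (z + C)) * pser d z)"
    using suminf_add[OF summable_mult[OF st, of p] summable_mult[OF sd, of "p * C + (1 - p) * (z + C)"]] Et
    unfolding suminf_mult[OF s2] by (simp add: suminf_mult st sd pser_def)
  also have "\<dots> = K * ((z + C) powr (p - 1) * (z + C)) * pser d z" by (simp add: algebra_simps)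
  also have "(z + C) powr (p - 1) * (z + C) = (z + C) powr p"
    using C z by (simp add: powr_diff)
  finally show ?thesis .
qed

text \<open>The limit controls \<open>q\<close> only for large indices. The shift by
  \<open>C\<close> absorbs the finitely many others while keeping the leading constant
  \<open>K\<close>, and it disappears in the limit of large argument.\<close>

lemma eventually_le_imp_le_shift:
  fixes q T :: "nat \<Rightarrow> real"
  assumes lim: "(\<lambda>k. q k / T k powr p) \<longlonglongrightarrow> L" and L: "0 < L" "L < K" and p: "p > 0"
    and T: "\<And>k. T k \<ge> 0" "\<And>k. k > 0 \<Longrightarrow> T k > 0"
  obtains C where "C > 0" "\<And>k. q k \<le> K * (T k + C) powr p"
proof -
  have "eventually (\<lambda>k. q k / T k powr p < K) sequentially" using lim L by (intro order_tendstoD(2)) auto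
  then obtain N where N: "\<And>k. k \<ge> N \<Longrightarrow> q k / T k powr p < K" by (auto simp: eventually_sequentially)
  define Q where "Q = Max (insert 1 (q ` {..N}))"
  have Q: "Q \<ge> 1" "\<And>k. k \<le> N \<Longrightarrow> q k \<le> Q" unfolding Q_def by (rule Max_ge; simp)+
  \<comment> \<open>The solution of \<open>K * C powr p = Q\<close>, where \<open>Q\<close> bounds
    the first values.\<close>
  define C where "C = (Q / K) powr (1 / p)"
  have C: "C > 0" using Q L by (simp add: C_def)
  have Kp: "K * C powr p = Q" using Q L p by (simp add: C_def powr_powr)
  show ?thesis
  proof (rule that[OF C])
    fix k
    have mono: "T k powr p \<le> (T k + C) powr p" "C powr p \<le> (T k + C) powr p"
      using T(1)[of k] C p by (auto intro!: powr_mono2)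
    show "q k \<le> K * (T k + C) powr p"
    proof (cases "k \<le> N")
      case True
      then have "q k \<le> K * C powr p" using Q Kp by simp
      also have "\<dots> \<le> K * (T k + C) powr p" using mono L by (intro mult_left_mono) auto
      finally show ?thesis .
    next
      case False
      then have "q k / T k powr p < K" "T k > 0" using N[of k] T(2)[of k] by auto
      then have "q k < K * T k powr p" by (simp add: divide_less_eq)
      also have "\<dots> \<le> K * (T k + C) powr p" using mono L by (intro mult_left_mono) auto
      finally show ?thesis by simp
    qed
  qed
qed

text \<open>This number is the negative of the slope of \<open>Ai\<close> at zero divided by
  \<open>Ai 0\<close>. Positivity of \<open>Ai\<close> and negativity of its derivative on the
  half-line mean that it lies between all quotients \<open>airy_f' x / airy_g' x\<close> and all
  quotients \<open>airy_f x / airy_g x\<close>.\<close>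

definition airy_ratio :: real where
  "airy_ratio = 3 powr (1/3) * Gamma (2/3) / Gamma (1/3)"

lemma airy_ratio_pos: "airy_ratio > 0"
  unfolding airy_ratio_def by (intro divide_pos_pos mult_pos_pos Gamma_real_pos) auto

text \<open>The quotient of the coefficients is \<open>3 * k + 1\<close> times a quotient of
  Pochhammer symbols. The product formula for Gamma determines its growth, and this is how the Gamma
  values in the definition of \<open>Ai\<close> enter.\<close>

lemma airy_coeff_ratio_limit:
  "(\<lambda>k. (airy_a k / airy_b k) / real k powr (2/3)) \<longlonglongrightarrow> 3 * Gamma (2/3) / Gamma (1/3)"
proof -
  have G: "(\<lambda>k. Gamma_series (2/3) k / Gamma_series (1/3::real) k) \<longlonglongrightarrow> Gamma (2/3) / Gamma (1/3)"
  proof (intro tendsto_divide Gamma_series_LIMSEQ)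
    have "Gamma (1/3::real) > 0" by (intro Gamma_real_pos) simp
    then show "Gamma (1/3::real) \<noteq> 0" by linarith
  qed
  have "(\<lambda>k. (3 * (real k + 2/3) / real k) * (Gamma_series (2/3) k / Gamma_series (1/3::real) k)) \<longlonglongrightarrow> 3 * (Gamma (2/3) / Gamma (1/3))"
    by (rule tendsto_mult[OF _ G]) real_asymp
  moreover have "eventually (\<lambda>k. (3 * (real k + 2/3) / real k) * (Gamma_series (2/3) k / Gamma_series (1/3::real) k) =
     (airy_a k / airy_b k) / real k powr (2/3)) sequentially"
    using eventually_gt_at_top[of 0]
  proof eventually_elim
    case (elim k)
    have p13: "pochhammer (1/3::real) k > 0" "pochhammer (2/3::real) k > 0" by (auto intro!: pochhammer_pos)
    have e: "exp (2/3 * ln (real k)) = real k powr (2/3)" "exp (1/3 * ln (real k)) = real k powr (1/3)"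
      using elim by (auto simp: powr_def)
    have kk: "real k powr (2/3) * real k powr (1/3) = real k"
      using elim by (simp add: powr_add[symmetric])
    have r: "airy_a k / airy_b k = (3 * real k + 1) * pochhammer (1/3) k / pochhammer (2/3) k"
      using p13 unfolding airy_a_def airy_b_def by (simp add: divide_simps)
    have gs: "Gamma_series (2/3) k / Gamma_series (1/3::real) k =
      (real k powr (2/3) / (pochhammer (2/3) k * (real k + 2/3))) / (real k powr (1/3) / (pochhammer (1/3) k * (real k + 1/3)))"
      unfolding Gamma_series_def using e by (simp add: pochhammer_Suc add.commute)
    define X Y where "X = real k powr (2/3)" and "Y = real k powr (1/3)"
    have XY: "X > 0" "Y > 0" "X * Y = real k" "X = Y * Y" using elim kk by (auto simp: X_def Y_def powr_add[symmetric])
    have "(3 * (real k + 2/3) / real k) * (Gamma_series (2/3) k / Gamma_series (1/3::real) k) =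
       (3 * (real k + 2/3) / (X * Y)) * ((X / (pochhammer (2/3) k * (real k + 2/3))) / (Y / (pochhammer (1/3) k * (real k + 1/3))))"
      unfolding gs X_def Y_def kk ..
    also have "\<dots> = (3 * (real k + 1/3)) * pochhammer (1/3) k / pochhammer (2/3) k / (Y * Y)"
      using XY(1,2) p13 by (simp add: divide_simps) (simp add: algebra_simps)
    also have "\<dots> = (airy_a k / airy_b k) / X" unfolding r XY(4) by simp
    finally show ?case unfolding X_def .
  qed
  ultimately show ?thesis by (auto intro: Lim_transform_eventually)
qed

text \<open>The series of \<open>airy_f\<close> is that of \<open>airy_g\<close> with weights
  \<open>airy_a k / airy_b k\<close>. These grow like \<open>k powr (2/3)\<close>, hence like the
  power \<open>1/3\<close> of \<open>t k = 3 * k * (3 * k + 1)\<close>, the quotient of consecutive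
  \<open>airy_b\<close>. The factor in the bound tends to \<open>K\<close> for large
  \<open>x\<close>, so asymptotically \<open>airy_f / airy_g\<close> is at most any
  \<open>K > airy_ratio\<close>.\<close>

lemma airy_f_over_g_bound:
  assumes K: "K > airy_ratio"
  shows "\<exists>C>0. \<forall>x>0. airy_f x \<le> K * (x ^ 3 + C) powr (1/3) / x * airy_g x"
proof -
  have lim: "(\<lambda>k. (airy_a k / airy_b k) / (3 * real k * (3 * real k + 1)) powr (1/3)) \<longlonglongrightarrow> airy_ratio"
  proof -
    have "(\<lambda>k. real k powr (2/3) / (3 * real k * (3 * real k + 1)) powr (1/3)) \<longlonglongrightarrow> inverse (9 powr (1/3))"
      by real_asymp
    from tendsto_mult[OF airy_coeff_ratio_limit this]
    have 1: "(\<lambda>k. airy_a k / airy_b k / real k powr (2/3) * (real k powr (2/3) / (3 * real k * (3 * real k + 1)) powr (1/3)))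
       \<longlonglongrightarrow> 3 * Gamma (2/3) / Gamma (1/3) * inverse (9 powr (1/3))" .
    have i: "inverse (9 powr (1/3)) = (9::real) powr (-1/3)" using powr_minus[of "9::real" "1/3"] by simp
    have "(3::real) * 9 powr (-1/3) = 3 powr (1/3)"
    proof -
      have "(9::real) powr (-1/3) = 3 powr (-2/3)"
        using powr_powr[of "3::real" 2 "-1/3"] by simp
      then show ?thesis using powr_add[of "3::real" 1 "-2/3"] by simp
    qed
    then have 2: "3 * Gamma (2/3) / Gamma (1/3) * 9 powr (-1/3) = airy_ratio"
      unfolding airy_ratio_def by (simp add: field_simps)
    show ?thesis
      by (rule Lim_transform_eventually[OF 1[unfolded i 2]])
         (use eventually_gt_at_top[of 0] in eventually_elim, simp)
  qed
  obtain C where C: "C > 0" "\<And>k. airy_a k / airy_b k \<le> K * (3 * real k * (3 * real k + 1) + C) powr (1/3)"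
    by (rule eventually_le_imp_le_shift[OF lim airy_ratio_pos K]) auto
  show ?thesis
  proof (intro exI[of _ C] conjI allI impI C)
    fix x :: real assume x: "x > 0"
    have ha: "airy_a k / airy_b k * airy_b k * z ^ k = airy_a k * z ^ k" for k z
      using airy_b_pos[of k] by simp
    have "(\<Sum>k. airy_a k / airy_b k * airy_b k * (x ^ 3) ^ k) \<le> K * (x ^ 3 + C) powr (1/3) * pser airy_b (x ^ 3)"
    proof (rule series_Jensen[where t="\<lambda>k. 3 * real k * (3 * real k + 1)"])
      show "3 * real (Suc k) * (3 * real (Suc k) + 1) * airy_b (Suc k) = airy_b k" for k
        using airy_b_Suc[of k] by (simp add: algebra_simps)
      show "summable (\<lambda>k. airy_a k / airy_b k * airy_b k * (x ^ 3) ^ k)" unfolding ha by (rule summable_airy_a)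
    qed (use C K airy_ratio_pos x airy_b_pos summable_airy_a summable_airy_b in \<open>auto simp: ha less_imp_le\<close>)
    then have "airy_f x \<le> K * (x ^ 3 + C) powr (1/3) * pser airy_b (x ^ 3)"
      unfolding ha airy_f_pser pser_def .
    also have "\<dots> = K * (x ^ 3 + C) powr (1/3) / x * airy_g x"
      using x by (simp add: airy_g_pser)
    finally show "airy_f x \<le> K * (x ^ 3 + C) powr (1/3) / x * airy_g x" .
  qed
qed

text \<open>The reverse comparison, for the derivatives: the weights are now the quotients of the
  coefficients of \<open>airy_g'\<close> by those of \<open>airy_f'\<close>, which grow like
  \<open>k powr (4/3)\<close>; this explains the exponent \<open>2/3\<close>.\<close>

lemma airy_g'_over_f'_bound:
  assumes K: "K > 1 / airy_ratio"
  shows "\<exists>C>0. \<forall>x>0. airy_g' x \<le> K * (x ^ 3 + C) powr (2/3) / x\<^sup>2 * airy_f' x"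
proof -
  let ?h = "\<lambda>k. (3 * real k + 1) * airy_b k / (3 * diffs airy_a k)"
  have dp: "diffs airy_a k > 0" for k by (intro diffs_pos airy_a_pos)
  have da: "diffs airy_a k * (3 * (3 * real k + 2)) = airy_a k" for k
    unfolding airy_a_Suc[of k, symmetric] diffs_def by (simp add: algebra_simps)
  have hk: "?h k = (3 * real k + 1) * (3 * real k + 2) / (airy_a k / airy_b k)" for k
    using dp[of k] airy_b_pos[of k] unfolding da[of k, symmetric] by (simp add: divide_simps)
  have lim: "(\<lambda>k. ?h k / (3 * real k * (3 * real k + 2)) powr (2/3)) \<longlonglongrightarrow> 1 / airy_ratio"
  proof -
    have g: "Gamma (1/3::real) > 0" "Gamma (2/3::real) > 0" by (intro Gamma_real_pos; simp)+
    have "(\<lambda>k. (3 * real k + 1) * (3 * real k + 2) / real k powr (2/3) / (3 * real k * (3 * real k + 2)) powr (2/3)) \<longlonglongrightarrow> 9 * inverse (9 powr (2/3))"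
      by real_asymp
    from tendsto_divide[OF this airy_coeff_ratio_limit]
    have 1: "(\<lambda>k. (3 * real k + 1) * (3 * real k + 2) / real k powr (2/3) / (3 * real k * (3 * real k + 2)) powr (2/3)
        / (airy_a k / airy_b k / real k powr (2/3))) \<longlonglongrightarrow> 9 * inverse (9 powr (2/3)) / (3 * Gamma (2/3) / Gamma (1/3))"
      using g by simp
    have e: "(3::real) = 9 powr (2/3) * 3 powr (-1/3)"
    proof -
      have "(9::real) powr (2/3) = 3 powr (4/3)"
        using powr_powr[of "3::real" 2 "2/3"] by simp
      then show ?thesis using powr_add[of "3::real" "4/3" "-1/3"] by simp
    qed
    have e2: "3 powr (-1/3) * 3 powr (1/3) = (1::real)" by (simp add: powr_add[symmetric])
    have 2: "9 * inverse (9 powr (2/3)) / (3 * Gamma (2/3) / Gamma (1/3)) = 1 / airy_ratio"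
    proof -
      have "9 * inverse (9 powr (2/3)) = 3 * (3 powr (-1/3) :: real)"
        using e by (simp add: field_simps)
      also have "\<dots> = 3 / 3 powr (1/3)" using e2 by (simp add: field_simps)
      finally have e3: "9 * inverse (9 powr (2/3)) = 3 / (3 powr (1/3) :: real)" .
      show ?thesis using g unfolding e3 airy_ratio_def by (simp add: divide_simps)
    qed
    show ?thesis
    proof (rule Lim_transform_eventually[OF 1[unfolded 2]])
      show "\<forall>\<^sub>F k in sequentially. (3 * real k + 1) * (3 * real k + 2) / real k powr (2/3) / (3 * real k * (3 * real k + 2)) powr (2/3)
        / (airy_a k / airy_b k / real k powr (2/3)) = ?h k / (3 * real k * (3 * real k + 2)) powr (2/3)"
        using eventually_gt_at_top[of 0]
      proof eventually_elim
        case (elim k)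
        have "real k powr (2/3) \<noteq> 0" using elim by simp
        then show ?case unfolding hk by (simp add: mult_ac)
      qed
    qed
  qed
  obtain C where C: "C > 0" "\<And>k. ?h k \<le> K * (3 * real k * (3 * real k + 2) + C) powr (2/3)"
    by (rule eventually_le_imp_le_shift[OF lim _ K]) (use airy_ratio_pos in auto)
  show ?thesis
  proof (intro exI[of _ C] conjI allI impI C)
    fix x :: real assume x: "x > 0"
    have ha: "?h k * (3 * diffs airy_a k) * z ^ k = (airy_b k * z ^ k) + 3 * (real k * airy_b k * z ^ k)" for k z
    proof -
      have "?h k * (3 * diffs airy_a k) = (3 * real k + 1) * airy_b k" using dp[of k] by simp
      then show ?thesis by (simp add: algebra_simps)
    qed
    let ?z = "x ^ 3"
    let ?d = "\<lambda>k. 3 * diffs airy_a k"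
    have kb: "(\<lambda>k. real k * airy_b k * ?z ^ k) sums (?z * pser (diffs airy_b) ?z)"
    proof -
      have "(\<lambda>k. real (Suc k) * airy_b (Suc k) * ?z ^ Suc k) sums (?z * pser (diffs airy_b) ?z)"
        using sums_mult[OF summable_sums[OF summable_diffs_b[of ?z]], of ?z] unfolding pser_def
        by (simp add: diffs_def mult_ac)
      then show ?thesis by (subst (asm) sums_Suc_iff) simp
    qed
    have sh: "(\<lambda>k. ?h k * ?d k * ?z ^ k) sums (airy_g' x)"
    proof -
      have "(\<lambda>k. airy_b k * ?z ^ k + 3 * (real k * airy_b k * ?z ^ k)) sums (pser airy_b ?z + 3 * (?z * pser (diffs airy_b) ?z))"
        unfolding pser_def[of airy_b] by (intro sums_add sums_mult kb summable_sums summable_airy_b)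
      then show ?thesis unfolding ha airy_g'_def by (simp add: mult_ac)
    qed
    have sd: "(\<lambda>k. ?d k * ?z ^ k) sums (3 * pser (diffs airy_a) ?z)"
      using sums_mult[OF summable_sums[OF summable_diffs_a[of ?z]], of 3] unfolding pser_def by (simp add: mult_ac)
    have "(\<Sum>k. ?h k * ?d k * ?z ^ k) \<le> K * (?z + C) powr (2/3) * pser ?d ?z"
    proof (rule series_Jensen[where t="\<lambda>k. 3 * real k * (3 * real k + 2)"])
      show "3 * real (Suc k) * (3 * real (Suc k) + 2) * (3 * diffs airy_a (Suc k)) = 3 * diffs airy_a k" for k
        unfolding diffs_def airy_a_Suc[of "Suc k", symmetric] by (simp add: algebra_simps)
      show "0 \<le> K" using K airy_ratio_pos by (meson divide_pos_pos less_trans order_less_imp_le zero_less_one)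
    qed (use C x dp sh sd in \<open>auto simp: sums_iff less_imp_le\<close>)
    then have "airy_g' x \<le> K * (?z + C) powr (2/3) * (3 * pser (diffs airy_a) ?z)"
      using sh sd by (simp add: sums_iff pser_def)
    also have "\<dots> = K * (x ^ 3 + C) powr (2/3) / x\<^sup>2 * airy_f' x"
      using x by (simp add: airy_f'_def)
    finally show "airy_g' x \<le> K * (x ^ 3 + C) powr (2/3) / x\<^sup>2 * airy_f' x" .
  qed
qed

text \<open>The Wronskian determines both signs: \<open>airy_f / airy_g\<close> falls and
  \<open>airy_f' / airy_g'\<close> rises on the half-line. A violated comparison with
  \<open>airy_ratio\<close> at one point therefore persists, and only the behaviour at infinity has
  to be examined.\<close>

lemma airy_quotient_deriv:
  assumes "x > 0"
  shows "((\<lambda>x. airy_f x / airy_g x) has_field_derivative (- 1 / (airy_g x)\<^sup>2)) (at x)"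
    and "((\<lambda>x. airy_f' x / airy_g' x) has_field_derivative (x / (airy_g' x)\<^sup>2)) (at x)"
proof -
  have p: "airy_g x > 0" "airy_g' x > 0" using airy_pos[of x] assms by auto
  have w: "airy_f x * airy_g' x = airy_f' x * airy_g x + 1" using airy_wronskian[of x] by simp
  have "((\<lambda>x. airy_f x / airy_g x) has_field_derivative ((airy_f' x * airy_g x - airy_f x * airy_g' x) / (airy_g x * airy_g x))) (at x)"
    by (rule DERIV_divide[OF airy_f_deriv airy_g_deriv]) (use p in auto)
  then show "((\<lambda>x. airy_f x / airy_g x) has_field_derivative (- 1 / (airy_g x)\<^sup>2)) (at x)"
    unfolding w by (simp add: power2_eq_square)
  have "((\<lambda>x. airy_f' x / airy_g' x) has_field_derivative ((x * airy_f x * airy_g' x - airy_f' x * (x * airy_g x)) / (airy_g' x * airy_g' x))) (at x)"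
    by (rule DERIV_divide[OF airy_f'_deriv airy_g'_deriv]) (use p in auto)
  moreover have "x * airy_f x * airy_g' x - airy_f' x * (x * airy_g x) = x"
    using w by (simp add: mult.assoc) (simp add: algebra_simps)
  ultimately show "((\<lambda>x. airy_f' x / airy_g' x) has_field_derivative (x / (airy_g' x)\<^sup>2)) (at x)"
    by (simp add: power2_eq_square)
qed

lemma airy_quotient_strict_mono:
  assumes "0 < x" "x < y"
  shows "airy_f y / airy_g y < airy_f x / airy_g x" "airy_f' x / airy_g' x < airy_f' y / airy_g' y"
proof -
  have p: "airy_g u > 0" "airy_g' u > 0" if "u > 0" for u using airy_pos[of u] that by auto
  show "airy_f y / airy_g y < airy_f x / airy_g x"
  proof (rule DERIV_neg_imp_decreasing[OF assms(2)])
    fix u assume "x \<le> u" "u \<le> y"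
    then show "\<exists>d. ((\<lambda>x. airy_f x / airy_g x) has_field_derivative d) (at u) \<and> d < 0"
      using airy_quotient_deriv(1)[of u] p[of u] assms by (intro exI[of _ "- 1 / (airy_g u)\<^sup>2"]) auto
  qed
  show "airy_f' x / airy_g' x < airy_f' y / airy_g' y"
  proof (rule DERIV_pos_imp_increasing[OF assms(2)])
    fix u assume "x \<le> u" "u \<le> y"
    then show "\<exists>d. ((\<lambda>x. airy_f' x / airy_g' x) has_field_derivative d) (at u) \<and> d > 0"
      using airy_quotient_deriv(2)[of u] p[of u] assms by (intro exI[of _ "u / (airy_g' u)\<^sup>2"]) auto
  qed
qed

lemma airy_quotient_less:
  assumes "0 < x"
  shows "airy_f' x / airy_g' x < airy_f x / airy_g x"
  using airy_wronskian[of x] airy_pos[of x] assms by (simp add: divide_simps mult.commute)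

text \<open>If \<open>airy_f / airy_g\<close> fell to \<open>airy_ratio\<close>, it would later stay
  below some \<open>q < airy_ratio\<close>. Far out, the bound on \<open>airy_g' / airy_f'\<close>
  pushes \<open>airy_f' / airy_g'\<close> above \<open>q\<close>, although this quotient is smaller
  than \<open>airy_f / airy_g\<close>.\<close>

lemma airy_ratio_less_f_over_g:
  assumes x: "x > 0"
  shows "airy_ratio < airy_f x / airy_g x"
proof (rule ccontr)
  assume "\<not> airy_ratio < airy_f x / airy_g x"
  \<comment> \<open>Moving on to \<open>x + 1\<close> turns the weak inequality into a strict one,
    which leaves room for \<open>K\<close> midway between the two reciprocals.\<close>
  moreover define q where "q = airy_f (x + 1) / airy_g (x + 1)"
  ultimately have q: "q < airy_ratio" using airy_quotient_strict_mono(1)[of x "x+1"] x by auto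
  have qp: "q > 0" using airy_pos[of "x+1"] x unfolding q_def by (intro divide_pos_pos) auto
  define K where "K = (1 / q + 1 / airy_ratio) / 2"
  have 1: "1 / airy_ratio < 1 / q" using q qp by (simp add: divide_simps)
  then have K: "K > 1 / airy_ratio" "K < 1 / q" unfolding K_def by auto
  obtain C where C: "C > 0" "\<And>y. y > 0 \<Longrightarrow> airy_g' y \<le> K * (y ^ 3 + C) powr (2/3) / y\<^sup>2 * airy_f' y"
    using airy_g'_over_f'_bound[OF K(1)] by blast
  have "((\<lambda>y. K * (y ^ 3 + C) powr (2/3) / y\<^sup>2) \<longlongrightarrow> K) at_top" using C(1) by real_asymp
  then have "eventually (\<lambda>y. K * (y ^ 3 + C) powr (2/3) / y\<^sup>2 < 1 / q) at_top"
    using K by (intro order_tendstoD(2)) auto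
  then have "eventually (\<lambda>y. K * (y ^ 3 + C) powr (2/3) / y\<^sup>2 < 1 / q \<and> y > x + 1) at_top"
    using eventually_gt_at_top by (rule eventually_conj)
  then obtain y where y: "K * (y ^ 3 + C) powr (2/3) / y\<^sup>2 < 1 / q" "y > x + 1"
    by (metis (no_types, lifting) eventually_at_top_linorder order_refl)
  have f: "airy_f' y > 0" "airy_g' y > 0" using airy_pos[of y] y x by auto
  have "airy_g' y \<le> K * (y ^ 3 + C) powr (2/3) / y\<^sup>2 * airy_f' y" using C(2)[of y] y x by auto
  also have "\<dots> < 1 / q * airy_f' y" using y f by (intro mult_strict_right_mono) auto
  finally have "q < airy_f' y / airy_g' y" using qp f by (simp add: divide_simps mult.commute)
  also have "\<dots> < airy_f y / airy_g y" using airy_quotient_less[of y] y x by auto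
  also have "\<dots> < q" unfolding q_def using airy_quotient_strict_mono(1)[of "x+1" y] y x by auto
  finally show False .
qed

text \<open>The mirror image: the upper bound for \<open>airy_f / airy_g\<close> is contradicted by
  \<open>airy_f' / airy_g'\<close> rising past \<open>airy_ratio\<close>.\<close>

lemma airy_ratio_greater_f'_over_g':
  assumes x: "x > 0"
  shows "airy_f' x / airy_g' x < airy_ratio"
proof (rule ccontr)
  assume "\<not> airy_f' x / airy_g' x < airy_ratio"
  moreover define q where "q = airy_f' (x + 1) / airy_g' (x + 1)"
  ultimately have q: "q > airy_ratio" using airy_quotient_strict_mono(2)[of x "x+1"] x by auto
  define K where "K = (q + airy_ratio) / 2"
  have K: "K > airy_ratio" "K < q" unfolding K_def using q by auto
  obtain C where C: "C > 0" "\<And>y. y > 0 \<Longrightarrow> airy_f y \<le> K * (y ^ 3 + C) powr (1/3) / y * airy_g y"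
    using airy_f_over_g_bound[OF K(1)] by blast
  have "((\<lambda>y. K * (y ^ 3 + C) powr (1/3) / y) \<longlongrightarrow> K) at_top" using C(1) by real_asymp
  then have "eventually (\<lambda>y. K * (y ^ 3 + C) powr (1/3) / y < q) at_top"
    using K by (intro order_tendstoD(2)) auto
  then have "eventually (\<lambda>y. K * (y ^ 3 + C) powr (1/3) / y < q \<and> y > x + 1) at_top"
    using eventually_gt_at_top by (rule eventually_conj)
  then obtain y where y: "K * (y ^ 3 + C) powr (1/3) / y < q" "y > x + 1"
    by (metis (no_types, lifting) eventually_at_top_linorder order_refl)
  have f: "airy_g y > 0" using airy_pos[of y] y x by auto
  have "airy_f y \<le> K * (y ^ 3 + C) powr (1/3) / y * airy_g y" using C(2)[of y] y x by auto
  also have "\<dots> < q * airy_g y" using y f by (intro mult_strict_right_mono) auto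
  finally have "airy_f y / airy_g y < q" using f by (simp add: divide_simps)
  moreover have "q < airy_f' y / airy_g' y" unfolding q_def using airy_quotient_strict_mono(2)[of "x+1" y] y x by auto
  moreover have "airy_f' y / airy_g' y < airy_f y / airy_g y" using airy_quotient_less[of y] y x by auto
  ultimately show False by simp
qed


definition airy_c :: real where
  "airy_c = 1 / (3 powr (2 / 3) * Gamma (2 / 3))"

lemma airy_c_pos: "airy_c > 0"
  unfolding airy_c_def by (intro divide_pos_pos mult_pos_pos Gamma_real_pos) auto

lemma airy_ratio_eq: "airy_c * airy_ratio = 1 / (3 powr (1 / 3) * Gamma (1 / 3))"
proof -
  have g: "Gamma (1/3::real) > 0" "Gamma (2/3::real) > 0" by (intro Gamma_real_pos; simp)+
  have "Gamma (1/3::real) \<noteq> 0" "Gamma (2/3::real) \<noteq> 0" using g by linarith+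
  moreover have "3 powr (2/3) = 3 powr (1/3) * (3::real) powr (1/3)" by (simp add: powr_add[symmetric])
  ultimately show ?thesis unfolding airy_c_def airy_ratio_def by (simp add: field_simps)
qed

lemma Ai_eq: "Ai x = airy_c * (airy_f x - airy_ratio * airy_g x)"
proof -
  have "Ai x = airy_c * airy_f x - (airy_c * airy_ratio) * airy_g x"
    unfolding Ai_def airy_ratio_eq unfolding airy_c_def by simp
  then show ?thesis by (simp add: algebra_simps)
qed

text \<open>Greenhill's combination cancels \<open>airy_g\<close>. The threshold is therefore the
  least positive zero of a single power series, \<open>pser airy_a (- G)\<close>.\<close>

lemma Ai_Bi_eq: "Ai x + 1 / sqrt 3 * Bi x = 2 * airy_c * airy_f x"
  unfolding Ai_def Bi_def airy_c_def by (simp add: field_simps)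

definition Ai' :: "real \<Rightarrow> real" where
  "Ai' x = airy_c * (airy_f' x - airy_ratio * airy_g' x)"

lemma Ai_deriv: "(Ai has_field_derivative Ai' x) (at x)"
  unfolding Ai_eq[abs_def] Ai'_def
  by (auto intro!: derivative_eq_intros airy_f_deriv airy_g_deriv)

lemma Ai'_deriv: "(Ai' has_field_derivative x * Ai x) (at x)"
  unfolding Ai_eq[abs_def] Ai'_def[abs_def]
  by (auto intro!: derivative_eq_intros airy_f'_deriv airy_g'_deriv simp: algebra_simps)

lemma Ai_continuous: "continuous_on S Ai" "continuous_on S Ai'"
  using Ai_deriv Ai'_deriv by (auto intro!: continuous_at_imp_continuous_on DERIV_isCont)

lemma Ai_pos:
  assumes "x \<ge> 0"
  shows "Ai x > 0"
proof (cases "x = 0")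
  case True then show ?thesis using airy_c_pos by (simp add: Ai_eq)
next
  case False
  then have x: "x > 0" using assms by simp
  then have "airy_g x > 0" using airy_pos[of x] by auto
  then have "airy_ratio * airy_g x < airy_f x"
    using airy_ratio_less_f_over_g[OF x] by (simp add: divide_simps)
  then show ?thesis using airy_c_pos by (simp add: Ai_eq)
qed

lemma Ai'_neg:
  assumes "x \<ge> 0"
  shows "Ai' x < 0"
proof (cases "x = 0")
  case True then show ?thesis using airy_c_pos airy_ratio_pos by (simp add: Ai'_def mult_pos_pos)
next
  case False
  then have x: "x > 0" using assms by simp
  then have "airy_g' x > 0" using airy_pos[of x] by auto
  then have "airy_f' x < airy_ratio * airy_g' x"
    using airy_ratio_greater_f'_over_g'[OF x] by (simp add: divide_simps)
  then show ?thesis using airy_c_pos by (simp add: Ai'_def mult_pos_neg)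
qed

text \<open>Sturm comparison with \<open>sin\<close> on an interval where the Airy equation has frequency at least one.\<close>

lemma Ai_nonpos_somewhere: "\<exists>x<0. Ai x \<le> 0"
proof (rule ccontr)
  assume "\<not> (\<exists>x<0. Ai x \<le> 0)"
  then have pos: "Ai x > 0" for x using Ai_pos[of x] by (cases "x < 0") (auto simp: not_le)
  let ?l = "-1 - pi"
  let ?W = "\<lambda>x. Ai' x * sin (x - ?l) - Ai x * cos (x - ?l)"
  have d: "(?W has_field_derivative (x + 1) * Ai x * sin (x - ?l)) (at x)" for x
    by (auto intro!: derivative_eq_intros Ai_deriv Ai'_deriv simp: algebra_simps)
  \<comment> \<open>The shifted sine vanishes at both ends of the interval, where \<open>?W\<close>
    equals \<open>Ai (-1)\<close> and \<open>- Ai ?l\<close>. With \<open>Ai\<close> positive, the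
    monotonicity of \<open>?W\<close> contradicts these signs.\<close>
  have "?W (-1) \<le> ?W ?l"
  proof (rule DERIV_nonpos_imp_nonincreasing[where f="?W"])
    show "?l \<le> -1" by simp
    fix x assume x: "?l \<le> x" "x \<le> -1"
    have "sin (x - ?l) \<ge> 0" using x by (intro sin_ge_zero) auto
    then have "(x + 1) * Ai x * sin (x - ?l) \<le> 0"
      using x pos[of x] by (intro mult_nonpos_nonneg) auto
    then show "\<exists>y. (?W has_field_derivative y) (at x) \<and> y \<le> 0" using d by blast
  qed
  then show False using pos[of "-1"] pos[of ?l] by simp
qed

section \<open>The largest zeros of Ai and of its derivative\<close>

text \<open>\<open>GREATEST\<close> is meaningful only once a maximum is known to exist. Positivity
  on the half-line and the nonpositive value at \<open>x0\<close> place it in the compact interval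
  \<open>{x0..0}\<close>. Applied to \<open>Ai\<close> and to the negative of its
  derivative.\<close>

lemma greatest_zero:
  fixes h :: "real \<Rightarrow> real"
  assumes c: "\<And>S. continuous_on S h" and pos: "\<And>x. x \<ge> 0 \<Longrightarrow> h x > 0" and x0: "x0 < 0" "h x0 \<le> 0"
  defines "z \<equiv> (GREATEST x. h x = 0)"
  shows "h z = 0" "x0 \<le> z" "z < 0" "\<And>x. x > z \<Longrightarrow> h x > 0"
proof -
  let ?Z = "{x. h x = 0} \<inter> {x0..0}"
  have cl: "closed {x. h x = 0}" using continuous_closed_preimage_constant[OF c[of UNIV] closed_UNIV, of 0] by (simp add: vimage_def)
  have comp: "compact ?Z" using cl by (intro closed_Int_compact) auto
  have "\<exists>x\<ge>x0. x \<le> 0 \<and> h x = 0" using IVT'[of h x0 0 0] c pos[of 0] x0 by auto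
  then have ne: "?Z \<noteq> {}" by auto
  obtain y where y: "y \<in> ?Z" "\<And>x. x \<in> ?Z \<Longrightarrow> x \<le> y" using compact_attains_sup[OF comp ne] by auto
  have max: "x \<le> y" if "h x = 0" for x
    using that y(2)[of x] y(1) pos[of x] by (cases "x < x0"; cases "x \<ge> 0") auto
  have zy: "z = y" unfolding z_def by (rule Greatest_equality) (use y max in auto)
  show hz: "h z = 0" "x0 \<le> z" using y zy by auto
  show z0: "z < 0" using hz pos[of z] by (cases "z < 0") auto
  show "h x > 0" if "x > z" for x
  proof (rule ccontr)
    assume "\<not> h x > 0"
    moreover have "x < 0" using calculation pos[of x] by (cases "x < 0") auto
    ultimately have "\<exists>w\<ge>x. w \<le> 0 \<and> h w = 0" using IVT'[of h x 0 0] c pos[of 0] by auto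
    then show False using max zy that by force
  qed
qed

lemma Ai_zero:
  shows "Ai Ai_zero = 0" "Ai_zero < 0" "\<And>x. x > Ai_zero \<Longrightarrow> Ai x > 0"
proof -
  obtain x0 where "x0 < 0" "Ai x0 \<le> 0" using Ai_nonpos_somewhere by blast
  then show "Ai Ai_zero = 0" "Ai_zero < 0" "\<And>x. x > Ai_zero \<Longrightarrow> Ai x > 0"
    using greatest_zero[of Ai x0] Ai_continuous(1) Ai_pos unfolding Ai_zero_def by blast+
qed

lemma deriv_Ai: "deriv Ai = Ai'"
  by (rule ext) (rule DERIV_imp_deriv[OF Ai_deriv])

lemma Ai'_zero:
  shows "Ai' Ai'_zero = 0" "Ai'_zero < 0" "Ai_zero < Ai'_zero" "\<And>x. x > Ai'_zero \<Longrightarrow> Ai' x < 0"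
proof -
  \<comment> \<open>Between its largest zero and the origin \<open>Ai\<close> rises, so its slope is
    positive at some \<open>x0\<close>; the largest zero of the slope lies to the right of that
    point.\<close>
  obtain x0 where x0: "Ai_zero < x0" "x0 < 0" "Ai 0 - Ai Ai_zero = (0 - Ai_zero) * Ai' x0"
    using MVT2[OF Ai_zero(2), of Ai Ai'] Ai_deriv by blast
  then have "(0 - Ai_zero) * Ai' x0 > 0" using Ai_zero(1) Ai_pos[of 0] by linarith
  then have "Ai' x0 > 0" by (rule zero_less_mult_pos) (use Ai_zero(2) in simp)
  then have x1: "- Ai' x0 \<le> 0" by simp
  have eq: "Ai'_zero = (GREATEST x. - Ai' x = 0)" unfolding Ai'_zero_def deriv_Ai by simp
  have c: "continuous_on S (\<lambda>x. - Ai' x)" for S by (intro continuous_intros Ai_continuous)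
  have n: "- Ai' x > 0" if "x \<ge> 0" for x using Ai'_neg[OF that] by simp
  have g: "- Ai' Ai'_zero = 0" "x0 \<le> Ai'_zero" "Ai'_zero < 0" "\<And>x. x > Ai'_zero \<Longrightarrow> - Ai' x > 0"
    using greatest_zero[of "\<lambda>x. - Ai' x" x0] c n x0(2) x1 unfolding eq by blast+
  show "Ai' Ai'_zero = 0" "Ai'_zero < 0" "Ai_zero < Ai'_zero" using g(1-3) x0 by auto
  show "Ai' x < 0" if "x > Ai'_zero" for x using g(4)[OF that] by simp
qed

section \<open>Numerical enclosure of the Greenhill threshold\<close>

lemma airy_a_numeric:
  "airy_a 1 = 1/6" "airy_a 2 = 1/180" "airy_a 3 = 1/12960" "airy_a 4 = 1/1710720" "airy_a 5 = 1/359251200"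
  "airy_a 6 = 1/109930867200" "airy_a 7 = 1/46170964224000" "airy_a 8 = 1/25486372251648000"
proof -
  have s: "airy_a (Suc k) = airy_a k / ((3 * real k + 2) * (3 * real k + 3))" for k
    by (simp add: airy_a_Suc[of k, symmetric])
  show 1: "airy_a 1 = 1/6" using s[of 0] by simp
  show 2: "airy_a 2 = 1/180" using s[of 1] 1 by (simp add: numeral_2_eq_2)
  show 3: "airy_a 3 = 1/12960" using s[of 2] 2 by (simp add: numeral_3_eq_3 numeral_2_eq_2)
  have 4: "airy_a (Suc 3) = 1/1710720" using s[of 3] 3 by simp
  then have 5: "airy_a (Suc 4) = 1/359251200" using s[of 4] by simp
  then have 6: "airy_a (Suc 5) = 1/109930867200" using s[of 5] by simp
  then have 7: "airy_a (Suc 6) = 1/46170964224000" using s[of 6] by simp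
  then have 8: "airy_a (Suc 7) = 1/25486372251648000" using s[of 7] by simp
  show "airy_a 4 = 1/1710720" "airy_a 5 = 1/359251200"
  "airy_a 6 = 1/109930867200" "airy_a 7 = 1/46170964224000" "airy_a 8 = 1/25486372251648000"
    using 4 5 6 7 8 by simp_all
qed

text \<open>Leibniz' criterion. The terms decrease from index 2 on, because there a term exceeds its
  successor by a factor of at least \<open>72 / z\<close>. Two initial terms are split off, an even
  number, so that the signs of the tail start with plus.\<close>

lemma airy_f_alternating_bounds:
  assumes z: "0 \<le> z" "z \<le> 8"
  shows "(\<Sum>k<8. airy_a k * (- z) ^ k) \<le> pser airy_a (- z)" "pser airy_a (- z) \<le> (\<Sum>k<9. airy_a k * (- z) ^ k)"
proof -
  let ?t = "\<lambda>k. airy_a (k + 2) * z ^ (k + 2)"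
  have t: "(\<lambda>k. airy_a k * z ^ k) \<longlonglongrightarrow> 0" by (rule summable_LIMSEQ_zero[OF summable_airy_a])
  have t0: "?t \<longlonglongrightarrow> 0" using LIMSEQ_ignore_initial_segment[OF t, of 2] .
  have tp: "?t k \<ge> 0" for k using airy_a_pos[of "k+2"] z by simp
  have mono: "?t (Suc k) \<le> ?t k" for k
  proof -
    have "airy_a (Suc k + 2) * z ^ (Suc k + 2) = (airy_a (Suc (k + 2)) * z) * z ^ (k + 2)" by simp
    also have "\<dots> \<le> (airy_a (Suc (k + 2)) * ((3 * real (k + 2) + 2) * (3 * real (k + 2) + 3))) * z ^ (k + 2)"
    proof (intro mult_right_mono mult_left_mono)
      have "8 * 9 \<le> (3 * real (k + 2) + 2) * (3 * real (k + 2) + 3)" by (intro mult_mono) auto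
      then show "z \<le> (3 * real (k + 2) + 2) * (3 * real (k + 2) + 3)" using z by linarith
    qed (use z airy_a_pos[of "Suc (k + 2)"] in auto)
    also have "\<dots> = airy_a (k + 2) * z ^ (k + 2)" by (simp only: airy_a_Suc)
    finally show ?thesis .
  qed
  have e: "(\<lambda>k. airy_a (k + 2) * (- z) ^ (k + 2)) = (\<lambda>k. (-1) ^ k * ?t k)"
    by (rule ext) (subst power_minus, simp add: power_add)
  have split: "pser airy_a (- z) = (\<Sum>k. airy_a (k + 2) * (- z) ^ (k + 2)) + (\<Sum>k<2. airy_a k * (- z) ^ k)"
    unfolding pser_def by (rule suminf_split_initial_segment[OF summable_airy_a])
  have fin: "(\<Sum>k<m+2. airy_a k * (- z) ^ k) = (\<Sum>k<m. (-1) ^ k * ?t k) + (\<Sum>k<2. airy_a k * (- z) ^ k)" for m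
  proof -
    have "(\<Sum>k<2+m. airy_a k * (- z) ^ k) = (\<Sum>k<2. airy_a k * (- z) ^ k) + (\<Sum>k<m. airy_a (2 + k) * (- z) ^ (2 + k))"
    proof (induction m)
      case (Suc m) then show ?case by (simp only: add_Suc_right sum.lessThan_Suc add.assoc)
    qed simp
    then show ?thesis using fun_cong[OF e] by (simp only: add.commute)
  qed
  show "(\<Sum>k<8. airy_a k * (- z) ^ k) \<le> pser airy_a (- z)"
    using summable_Leibniz'(2)[OF t0 tp mono, of 3] fin[of 6] unfolding split e by simp
  show "pser airy_a (- z) \<le> (\<Sum>k<9. airy_a k * (- z) ^ k)"
    using summable_Leibniz'(4)[OF t0 tp mono, of 3] fin[of 7] unfolding split e by simp
qed

lemma sum_lessThan_8: "(\<Sum>k<8. f k) = f 0 + f 1 + f 2 + f 3 + f 4 + f 5 + f 6 + f 7"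
  for f :: "nat \<Rightarrow> real"
  by (simp add: eval_nat_numeral)

lemma sum_lessThan_9: "(\<Sum>k<9. f k) = f 0 + f 1 + f 2 + f 3 + f 4 + f 5 + f 6 + f 7 + f 8"
  for f :: "nat \<Rightarrow> real"
  by (simp add: eval_nat_numeral)

text \<open>The truncated series is decreasing on the interval, so its sign at the right end
  decides. Together with the value used in the next lemma this end delimits the numbers that round
  to 7.8373.\<close>

lemma pser_airy_a_pos:
  assumes "0 \<le> z" "z \<le> 7.83725"
  shows "pser airy_a (- z) > 0"
proof -
  let ?p = "\<lambda>z::real. 1 - z/6 + z^2/180 - z^3/12960 + z^4/1710720 - z^5/359251200 + z^6/109930867200 - z^7/46170964224000"
  have sum: "(\<Sum>k<8. airy_a k * (- z) ^ k) = ?p z"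
    unfolding sum_lessThan_8 sum_lessThan_9 airy_a_numeric airy_a_0 by simp
  have "?p 7.83725 \<le> ?p z"
  proof (rule DERIV_nonpos_imp_nonincreasing[OF assms(2), where f="?p"])
    fix x :: real assume x': "z \<le> x" "x \<le> 7.83725"
    then have x: "0 \<le> x" "x \<le> 8" using assms by simp_all
    let ?d = "-1/6 + x/90 - x^2/4320 + x^3/427680 - x^4/71850240 + x^5/18321811200 - x^6/6595852032000"
    have "(?p has_field_derivative ?d) (at x)"
      by (auto intro!: derivative_eq_intros simp: eval_nat_numeral)
    moreover have "?d \<le> 0"
    proof -
      \<comment> \<open>Each odd power, which enters with a positive sign, is absorbed by the even
        power below it.\<close>
      have 1: "x^2 * x \<le> x^2 * 8" "x^4 * x \<le> x^4 * 8" using x by (intro mult_left_mono; simp)+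
      have "x^3 = x^2 * x" "x^5 = x^4 * x" by (simp_all add: eval_nat_numeral)
      moreover have "x^6 \<ge> 0" "x^2 \<ge> 0" "x^4 \<ge> 0" by simp_all
      ultimately show ?thesis using 1 x by linarith
    qed
    ultimately show "\<exists>y. (?p has_field_derivative y) (at x) \<and> y \<le> 0" by blast
  qed
  moreover have "?p 7.83725 > 0" by (simp add: power_divide)
  moreover have "(\<Sum>k<8. airy_a k * (- z) ^ k) \<le> pser airy_a (- z)"
    by (rule airy_f_alternating_bounds) (use assms in auto)
  ultimately show ?thesis unfolding sum by linarith
qed

lemma pser_airy_a_neg: "pser airy_a (- 7.83735) < 0"
proof -
  let ?p = "\<lambda>z::real. 1 - z/6 + z^2/180 - z^3/12960 + z^4/1710720 - z^5/359251200 + z^6/109930867200 - z^7/46170964224000 + z^8/25486372251648000"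
  have "(\<Sum>k<9. airy_a k * (- z) ^ k) = ?p z" for z
    unfolding sum_lessThan_8 sum_lessThan_9 airy_a_numeric airy_a_0 by simp
  moreover have "?p 7.83735 < 0" by (simp add: power_divide)
  ultimately show ?thesis using airy_f_alternating_bounds(2)[of "7.83735"] by simp
qed

lemma airy_f_powr:
  assumes "G \<ge> 0"
  shows "airy_f (- (G powr (1 / 3))) = pser airy_a (- G)"
proof -
  have "(G powr (1/3)) ^ 3 = G"
  proof (cases "G = 0")
    case False then show ?thesis using assms by (simp add: powr_realpow[symmetric] powr_powr)
  qed simp
  then show ?thesis by (simp add: airy_f_pser)
qed

text \<open>\<open>LEAST\<close> again needs existence: the zeros in \<open>{0..7.83735}\<close>
  form a nonempty compact set, and every other positive zero lies above it.\<close>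

lemma G_crit:
  shows "G_crit > 7.83725" "G_crit < 7.83735" "pser airy_a (- G_crit) = 0"
    and "\<And>z. 0 \<le> z \<Longrightarrow> z < G_crit \<Longrightarrow> pser airy_a (- z) > 0"
    and "Ai (- (G_crit powr (1/3))) + 1 / sqrt 3 * Bi (- (G_crit powr (1/3))) = 0"
proof -
  let ?P = "\<lambda>z. pser airy_a (- z)"
  have "continuous_on UNIV (pser airy_a)"
    using pser_has_derivative[OF summable_airy_a] by (auto intro!: continuous_at_imp_continuous_on DERIV_isCont)
  then have c: "continuous_on S ?P" for S
    by (rule continuous_on_compose2[where f=uminus]) (auto intro!: continuous_intros)
  let ?Z = "{z. ?P z = 0} \<inter> {0..7.83735}"
  have cl: "closed {x. ?P x = 0}" using continuous_closed_preimage_constant[OF c[of UNIV] closed_UNIV, of 0] by (simp add: vimage_def)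
  have comp: "compact ?Z" using cl by (intro closed_Int_compact) auto
  have "\<exists>z\<ge>0. z \<le> 7.83735 \<and> ?P z = 0" using IVT2'[of ?P "7.83735" 0 0] c pser_airy_a_pos[of 0] pser_airy_a_neg by auto
  then have ne: "?Z \<noteq> {}" by auto
  obtain y where y: "y \<in> ?Z" "\<And>x. x \<in> ?Z \<Longrightarrow> y \<le> x" using compact_attains_inf[OF comp ne] by auto
  have yb: "y > 7.83725" using y(1) pser_airy_a_pos[of y] by (cases "y \<le> 7.83725") auto
  have y2: "y < 7.83735" using y(1) pser_airy_a_neg by (cases "y = 7.83735") auto
  have cond: "(G > 0 \<and> Ai (- (G powr (1 / 3))) + 1 / sqrt 3 * Bi (- (G powr (1 / 3))) = 0) \<longleftrightarrow> (G > 0 \<and> ?P G = 0)" for G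
    using airy_c_pos airy_f_powr[of G] unfolding Ai_Bi_eq by auto
  have eq: "G_crit = y" unfolding G_crit_def cond
  proof (rule Least_equality)
    show "y > 0 \<and> ?P y = 0" using y yb by auto
    fix z assume z: "0 < z \<and> ?P z = 0"
    show "y \<le> z" using z y(2)[of z] y2 by (cases "z \<le> 7.83735") auto
  qed
  show "G_crit > 7.83725" "G_crit < 7.83735" "?P G_crit = 0" unfolding eq using yb y2 y by auto
  then show "Ai (- (G_crit powr (1/3))) + 1 / sqrt 3 * Bi (- (G_crit powr (1/3))) = 0"
    using cond[of G_crit] by auto
  show "?P z > 0" if z: "0 \<le> z" "z < G_crit" for z
  proof (rule ccontr)
    assume "\<not> ?P z > 0"
    then have "\<exists>w\<ge>0. w \<le> z \<and> ?P w = 0" using IVT2'[of ?P z 0 0] c pser_airy_a_pos[of 0] z by auto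
    then show False using y(2) z y2 unfolding eq by force
  qed
qed

section \<open>The principal eigenvalue\<close>

definition test_function :: "support \<Rightarrow> (real \<Rightarrow> real) \<Rightarrow> bool" where
  "test_function bc u \<longleftrightarrow> H1 u \<and> nonzero01 u \<and> (bc = Clamped \<longrightarrow> u 0 = 0)"

text \<open>The parameter \<open>A\<close> is part of the form so that a lower bound
  \<open>- A\<close> for \<open>beta0\<close> becomes nonnegativity of \<open>rod_form A G\<close>
  on test functions. Keeping two integrals separates the term that is only integrable from the
  continuous one.\<close>

definition rod_form :: "real \<Rightarrow> real \<Rightarrow> (real \<Rightarrow> real) \<Rightarrow> real" where
  "rod_form A G u = (LINT s:{0..1}|lborel. (weak_deriv u s)\<^sup>2) + (LINT s:{0..1}|lborel. (A - G * (1 - s)) * (u s)\<^sup>2)"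

definition mass :: "(real \<Rightarrow> real) \<Rightarrow> real" where
  "mass u = (LINT s:{0..1}|lborel. (u s)\<^sup>2)"

lemma H1_continuous: "H1 u \<Longrightarrow> continuous_on {0..1} u"
  by (rule indef_continuous[OF has_weak_deriv_indef[OF H1_weak_deriv]])

lemma set_integral_continuous_add:
  fixes f g :: "real \<Rightarrow> real"
  assumes "continuous_on {0..1} f" "continuous_on {0..1} g"
  shows "(LINT s:{0..1}|lborel. f s + g s) = (LINT s:{0..1}|lborel. f s) + (LINT s:{0..1}|lborel. g s)"
  by (intro set_integral_add(2) set_integrable_continuous assms)

lemma set_integral_continuous_mono:
  fixes f g :: "real \<Rightarrow> real"
  assumes "continuous_on {0..1} f" "continuous_on {0..1} g" "\<And>s. s \<in> {0..1} \<Longrightarrow> f s \<le> g s"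
  shows "(LINT s:{0..1}|lborel. f s) \<le> (LINT s:{0..1}|lborel. g s)"
  by (intro set_integral_mono set_integrable_continuous assms)

lemma set_integral_nonneg01:
  fixes f :: "real \<Rightarrow> real"
  assumes "\<And>s. s \<in> {0..1} \<Longrightarrow> f s \<ge> 0"
  shows "(LINT s:{0..1}|lborel. f s) \<ge> 0"
  unfolding set_lebesgue_integral_def
  by (intro integral_nonneg_AE AE_I2) (use assms in \<open>auto simp: indicator_def\<close>)

lemma mass_nonneg: "mass u \<ge> 0"
  unfolding mass_def by (rule set_integral_nonneg01) auto

lemma mass_pos:
  assumes "continuous_on {0..1} u" "nonzero01 u"
  shows "mass u > 0"
proof -
  obtain s where "s \<in> {0..1}" "u s \<noteq> 0" using assms(2) by (auto simp: nonzero01_def)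
  then show ?thesis unfolding mass_def
    by (intro integral_Icc_pos[of _ s] continuous_intros assms(1)) auto
qed

lemma rod_form_shift:
  assumes "continuous_on {0..1} u"
  shows "rod_form A G u = rod_form B G u + (A - B) * mass u"
proof -
  have "(LINT s:{0..1}|lborel. (A - G * (1 - s)) * (u s)\<^sup>2) =
      (LINT s:{0..1}|lborel. (B - G * (1 - s)) * (u s)\<^sup>2 + (A - B) * (u s)\<^sup>2)"
    by (simp add: algebra_simps)
  also have "\<dots> = (LINT s:{0..1}|lborel. (B - G * (1 - s)) * (u s)\<^sup>2) + (LINT s:{0..1}|lborel. (A - B) * (u s)\<^sup>2)"
    by (intro set_integral_continuous_add continuous_intros assms)
  finally show ?thesis unfolding rod_form_def mass_def by simp
qed

lemma rod_form_mono_G: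
  assumes u: "continuous_on {0..1} u" and "G \<le> H"
  shows "rod_form A H u \<le> rod_form A G u" "rod_form A G u \<le> rod_form A H u + (H - G) * mass u"
proof -
  show "rod_form A H u \<le> rod_form A G u" unfolding rod_form_def
    by (intro add_left_mono set_integral_continuous_mono continuous_intros u)
       (use assms in \<open>auto intro!: mult_right_mono\<close>)
  have "(LINT s:{0..1}|lborel. (A - G * (1 - s)) * (u s)\<^sup>2) \<le> (LINT s:{0..1}|lborel. ((A + (H - G)) - H * (1 - s)) * (u s)\<^sup>2)"
  proof (intro set_integral_continuous_mono continuous_intros u mult_right_mono)
    fix s :: real assume s: "s \<in> {0..1}"
    have "(H - G) * (1 - s) \<le> (H - G) * 1" using assms s by (intro mult_left_mono) auto
    then show "A - G * (1 - s) \<le> (A + (H - G)) - H * (1 - s)" by (simp add: algebra_simps)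
  qed auto
  then show "rod_form A G u \<le> rod_form A H u + (H - G) * mass u"
    using rod_form_shift[OF u, of "A + (H - G)" H A] by (simp add: rod_form_def)
qed

lemma rod_form_ge:
  assumes u: "continuous_on {0..1} u" and "G \<ge> 0"
  shows "rod_form A G u \<ge> (A - G) * mass u"
proof -
  have "rod_form A 0 u \<le> rod_form A G u + (G - 0) * mass u" by (rule rod_form_mono_G) (use assms in auto)
  moreover have "rod_form A 0 u = rod_form 0 0 u + A * mass u" using rod_form_shift[OF u, of A 0 0] by simp
  moreover have "rod_form 0 0 u \<ge> 0" unfolding rod_form_def by (simp add: set_integral_nonneg01)
  ultimately show ?thesis by (simp add: algebra_simps)
qed

lemma rayleigh_quotient_form:
  assumes "H1 u"
  shows "rayleigh_quotient G u = rod_form 0 G u / mass u"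
proof -
  note h = H1_weak_deriv[OF assms]
  have i: "set_integrable lborel {0..1} (\<lambda>s. (weak_deriv u s)\<^sup>2)"
    using integral_norm_weak_deriv(2)[OF h] by simp
  have "set_integrable lborel {0..1} (\<lambda>s. (0 - G * (1 - s)) * (u s)\<^sup>2)"
    by (intro set_integrable_continuous continuous_intros H1_continuous assms)
  from set_integral_add(2)[OF i this] show ?thesis
    unfolding rayleigh_quotient_def rod_form_def mass_def by (simp add: algebra_simps)
qed

lemma beta0_set: "beta0 bc G = Inf {rod_form 0 G u / mass u | u. test_function bc u}"
proof -
  have "{rayleigh_quotient G u | u. H1 u \<and> nonzero01 u \<and> (bc = Clamped \<longrightarrow> u 0 = 0)} = {rod_form 0 G u / mass u | u. test_function bc u}"
    unfolding test_function_def using rayleigh_quotient_form by (metis (no_types, lifting))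
  then show ?thesis unfolding beta0_def by simp
qed

lemma test_function_continuous: "test_function bc u \<Longrightarrow> continuous_on {0..1} u"
  unfolding test_function_def by (blast intro: H1_continuous)

lemma test_function_mass: "test_function bc u \<Longrightarrow> mass u > 0"
  by (rule mass_pos[OF test_function_continuous]) (auto simp: test_function_def)

lemma test_function_exists: "test_function bc (\<lambda>s. s)"
proof -
  have "has_weak_deriv (\<lambda>s::real. s) (\<lambda>s. 1)"
    by (rule has_weak_deriv_C1) (auto intro!: derivative_eq_intros simp: has_real_derivative_iff_has_vector_derivative[symmetric])
  then show ?thesis unfolding test_function_def nonzero01_def
    by (auto intro: has_weak_deriv_H1 intro!: bexI[of _ 1])
qed

lemma beta0_le_quotient:
  assumes "G \<ge> 0" "test_function bc u"
  shows "beta0 bc G * mass u \<le> rod_form 0 G u"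
proof -
  have "beta0 bc G \<le> rod_form 0 G u / mass u" unfolding beta0_set
  proof (rule cInf_lower)
    show "bdd_below {rod_form 0 G u / mass u | u. test_function bc u}"
    proof (rule bdd_belowI)
      fix x assume "x \<in> {rod_form 0 G u / mass u | u. test_function bc u}"
      then obtain v where v: "x = rod_form 0 G v / mass v" "test_function bc v" by auto
      show "- G \<le> x" unfolding v(1)
        using rod_form_ge[OF test_function_continuous[OF v(2)] assms(1), of 0] test_function_mass[OF v(2)]
        by (simp add: divide_simps)
    qed
  qed (use assms in auto)
  then show ?thesis using test_function_mass[OF assms(2)] by (simp add: divide_simps)
qed

lemma rod_form_test: "test_function bc u \<Longrightarrow> rod_form A G u = rod_form 0 G u + A * mass u"
  using rod_form_shift[OF test_function_continuous, of bc u A G 0] by simp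

lemma beta0_le:
  assumes "G \<ge> 0" "test_function bc u" "rod_form A G u \<le> 0"
  shows "beta0 bc G \<le> - A"
proof -
  have "beta0 bc G * mass u \<le> (- A) * mass u"
    using beta0_le_quotient[OF assms(1,2)] rod_form_test[OF assms(2), of A G] assms(3) by simp
  then show ?thesis using test_function_mass[OF assms(2)] by (simp only: mult_le_cancel_right_pos)
qed

lemma beta0_ge:
  assumes "\<And>u. test_function bc u \<Longrightarrow> rod_form A G u \<ge> 0"
  shows "beta0 bc G \<ge> - A"
  unfolding beta0_set
proof (rule cInf_greatest)
  show "{rod_form 0 G u / mass u |u. test_function bc u} \<noteq> {}" using test_function_exists by blast
  fix x assume "x \<in> {rod_form 0 G u / mass u | u. test_function bc u}"
  then obtain v where v: "x = rod_form 0 G v / mass v" "test_function bc v" by auto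
  have "(- A) * mass v \<le> rod_form 0 G v" using assms[OF v(2)] rod_form_test[OF v(2), of A G] by simp
  then show "- A \<le> x" unfolding v(1) using test_function_mass[OF v(2)] by (simp add: divide_simps)
qed

text \<open>Here \<open>u\<close> may vanish identically, as a component of a nonzero variation
  can.\<close>

lemma rod_form_beta0:
  assumes G: "G \<ge> 0" and u: "H1 u" "bc = Clamped \<longrightarrow> u 0 = 0"
  shows "rod_form A G u \<ge> (A + beta0 bc G) * mass u"
proof (cases "nonzero01 u")
  case True
  then have t: "test_function bc u" using u by (simp add: test_function_def)
  show ?thesis using beta0_le_quotient[OF G t] rod_form_test[OF t, of A G] by (simp add: algebra_simps)
next
  case False
  then have z: "u s = 0" if "s \<in> {0..1}" for s using that by (auto simp: nonzero01_def)
  have "mass u = (LINT s:{0..1::real}|lborel. 0)" unfolding mass_def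
    by (rule set_lebesgue_integral_cong) (use z in auto)
  then have m: "mass u = 0" by simp
  have "(LINT s:{0..1}|lborel. (A - G * (1 - s)) * (u s)\<^sup>2) = (LINT s:{0..1::real}|lborel. 0)"
    by (rule set_lebesgue_integral_cong) (use z in auto)
  then show ?thesis unfolding rod_form_def m by (simp add: set_integral_nonneg01)
qed

lemma beta0_ge_minus_G: "G \<ge> 0 \<Longrightarrow> beta0 bc G \<ge> - G"
  by (rule beta0_ge) (use rod_form_ge[of _ G G] test_function_continuous in fastforce)

text \<open>Since \<open>1 - s\<close> lies between 0 and 1, replacing \<open>G\<close> by
  \<open>H\<close> lowers the form by at most \<open>(H - G) * mass u\<close>. Continuity of
  \<open>A_crit\<close>, and through it of the whole family of branches, rests on this.\<close>

lemma beta0_Lipschitz: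
  assumes "0 \<le> G" "G \<le> H"
  shows "beta0 bc H \<le> beta0 bc G" "beta0 bc G \<le> beta0 bc H + (H - G)"
proof -
  have "beta0 bc G \<ge> - (- beta0 bc H)"
  proof (rule beta0_ge)
    fix u assume t: "test_function bc u"
    have "rod_form (- beta0 bc H) H u \<ge> 0"
      using beta0_le_quotient[OF _ t, of H] rod_form_test[OF t, of "- beta0 bc H" H] assms by simp
    then show "rod_form (- beta0 bc H) G u \<ge> 0"
      using rod_form_mono_G(1)[OF test_function_continuous[OF t] assms(2)] by (meson order_trans)
  qed
  then show "beta0 bc H \<le> beta0 bc G" by simp
  have "beta0 bc H \<ge> - (- beta0 bc G + (H - G))"
  proof (rule beta0_ge)
    fix u assume t: "test_function bc u"
    have "rod_form (- beta0 bc G) G u \<ge> 0"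
      using beta0_le_quotient[OF assms(1) t] rod_form_test[OF t, of "- beta0 bc G" G] by simp
    then show "rod_form (- beta0 bc G + (H - G)) H u \<ge> 0"
      using rod_form_mono_G(2)[OF test_function_continuous[OF t] assms(2), of "- beta0 bc G"]
        rod_form_shift[OF test_function_continuous[OF t], of "- beta0 bc G + (H - G)" H "- beta0 bc G"] by simp
  qed
  then show "beta0 bc G \<le> beta0 bc H + (H - G)" by simp
qed


lemma beta0_continuous: "continuous_on {0<..} (beta0 bc)"
proof -
  have l: "\<bar>beta0 bc G - beta0 bc H\<bar> \<le> \<bar>G - H\<bar>" if "0 < G" "0 < H" for G H
    using beta0_Lipschitz[of G H bc] beta0_Lipschitz[of H G bc] that by (cases "G \<le> H") auto
  show ?thesis unfolding continuous_on_iff dist_real_def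
    using l by (metis greaterThan_iff order_le_less_trans)
qed

text \<open>A pinned rod can tilt rigidly: the constant test function has no elastic energy, and the
  mean of \<open>G * (1 - s)\<close> is \<open>G / 2\<close>.\<close>

lemma beta0_Pinned_le: "G > 0 \<Longrightarrow> beta0 Pinned G \<le> - G / 2"
proof -
  assume G: "G > 0"
  have h: "has_weak_deriv (\<lambda>s::real. 1::real) (\<lambda>s. 0)"
    by (rule has_weak_deriv_C1) (auto intro!: derivative_eq_intros)
  then have t: "test_function Pinned (\<lambda>s. 1)" unfolding test_function_def nonzero01_def
    by (auto intro: has_weak_deriv_H1 intro!: bexI[of _ 1])
  have d: "(LINT s:{0..1}|lborel. (weak_deriv (\<lambda>s. 1::real) s)\<^sup>2) = 0"
    using integral_norm_weak_deriv(1)[OF h] by simp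
  have "((\<lambda>s. G/2 - G * (1 - s)) has_integral (\<lambda>s. G / 2 * s - G * (s - s\<^sup>2/2)) 1 - (\<lambda>s. G / 2 * s - G * (s - s\<^sup>2/2)) 0) {0..1}"
    by (rule fundamental_theorem_of_calculus)
      (auto intro!: derivative_eq_intros simp: has_real_derivative_iff_has_vector_derivative[symmetric])
  then have "((\<lambda>s. G/2 - G * (1 - s)) has_integral 0) {0..1}" by simp
  then have "(LINT s:{0..1}|lborel. (G/2 - G * (1 - s)) * 1\<^sup>2) = 0"
    by (subst set_borel_integral_eq_integral(2))
       (auto intro!: set_integrable_continuous continuous_intros simp: integral_unique)
  then have "rod_form (G/2) G (\<lambda>s. 1) = 0" unfolding rod_form_def d by simp
  then show ?thesis using beta0_le[OF _ t, of G "G/2"] G by simp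
qed

section \<open>Stability of the straight rod\<close>

text \<open>The quadratic form decouples into Cartesian components, so stability is decided by the
  scalar form.\<close>

lemma second_variation_components:
  assumes "H1 \<eta>"
  shows "second_variation A G \<eta> = (\<Sum>b\<in>Basis. rod_form A G (\<lambda>s. \<eta> s \<bullet> b))"
    and "\<And>b. b \<in> Basis \<Longrightarrow> H1 (\<lambda>s. \<eta> s \<bullet> b)"
proof -
  let ?d = "weak_deriv \<eta>"
  note h = H1_weak_deriv[OF assms]
  have ni: "(norm v)\<^sup>2 = (\<Sum>b\<in>Basis. (v \<bullet> b)\<^sup>2)" for v :: "real^3"
    unfolding power2_norm_eq_inner euclidean_inner[of v v] by (simp add: power2_eq_square)
  have hb: "has_weak_deriv (\<lambda>s. \<eta> s \<bullet> b) (\<lambda>s. ?d s \<bullet> b)" if "b \<in> Basis" for b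
  proof (rule has_weak_derivI)
    show ib: "indef (\<lambda>s. \<eta> s \<bullet> b) (\<lambda>s. ?d s \<bullet> b)" by (rule indef_inner[OF has_weak_deriv_indef[OF h]])
    have m: "(\<lambda>s. indicator {0..1} s *\<^sub>R (?d s \<bullet> b)) \<in> borel_measurable lborel"
      using indef_integrable[OF ib] unfolding set_integrable_def by (blast dest: borel_measurable_integrable)
    show "set_integrable lborel {0..1} (\<lambda>s. (norm (?d s \<bullet> b))\<^sup>2)"
      unfolding set_integrable_def
    proof (rule Bochner_Integration.integrable_bound)
      show "integrable lborel (\<lambda>s. indicator {0..1} s *\<^sub>R (norm (?d s))\<^sup>2)"
        using integral_norm_weak_deriv(2)[OF h] unfolding set_integrable_def .
      have "(\<lambda>s. indicator {0..1} s *\<^sub>R (norm (?d s \<bullet> b))\<^sup>2) = (\<lambda>s. (indicator {0..1} s *\<^sub>R (?d s \<bullet> b))\<^sup>2)"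
        by (auto simp: indicator_def)
      then show "(\<lambda>s. indicator {0..1} s *\<^sub>R (norm (?d s \<bullet> b))\<^sup>2) \<in> borel_measurable lborel"
        using m by simp
      show "AE s in lborel. norm (indicator {0..1} s *\<^sub>R (norm (?d s \<bullet> b))\<^sup>2) \<le> norm (indicator {0..1} s *\<^sub>R (norm (?d s))\<^sup>2)"
      proof (rule AE_I2)
        fix s
        have "\<bar>?d s \<bullet> b\<bar> \<le> norm (?d s)" using that by (rule Basis_le_norm)
        then have "(?d s \<bullet> b)\<^sup>2 \<le> (norm (?d s))\<^sup>2" by (metis abs_ge_zero power2_abs power_mono)
        then show "norm (indicator {0..1} s *\<^sub>R (norm (?d s \<bullet> b))\<^sup>2) \<le> norm (indicator {0..1} s *\<^sub>R (norm (?d s))\<^sup>2)"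
          by (auto simp: indicator_def)
      qed
    qed
  qed
  then show "\<And>b. b \<in> Basis \<Longrightarrow> H1 (\<lambda>s. \<eta> s \<bullet> b)" by (blast intro: has_weak_deriv_H1)
  have ib: "set_integrable lborel {0..1} (\<lambda>s. (?d s \<bullet> b)\<^sup>2)"
    "(LINT s:{0..1}|lborel. (weak_deriv (\<lambda>s. \<eta> s \<bullet> b) s)\<^sup>2) = (LINT s:{0..1}|lborel. (?d s \<bullet> b)\<^sup>2)" if "b \<in> Basis" for b
    using hb[OF that] integral_norm_weak_deriv(1)[OF hb[OF that]] unfolding has_weak_deriv_def by auto
  have sumI: "(LINT s:{0..1}|lborel. (\<Sum>b\<in>Basis. F b s)) = (\<Sum>b\<in>Basis. LINT s:{0..1}|lborel. F b s)"
    if "\<And>b. b \<in> Basis \<Longrightarrow> set_integrable lborel {0..1} (F b)" for F :: "real^3 \<Rightarrow> real \<Rightarrow> real"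
  proof -
    have "(LINT s|lborel. (\<Sum>b\<in>Basis. indicator {0..1} s *\<^sub>R F b s)) = (\<Sum>b\<in>Basis. (LINT s|lborel. indicator {0..1} s *\<^sub>R F b s))"
      by (rule Bochner_Integration.integral_sum) (use that in \<open>auto simp: set_integrable_def\<close>)
    then show ?thesis unfolding set_lebesgue_integral_def by (simp add: sum_distrib_left)
  qed
  have "(LINT s:{0..1}|lborel. (norm (?d s))\<^sup>2) = (\<Sum>b\<in>Basis. LINT s:{0..1}|lborel. (?d s \<bullet> b)\<^sup>2)"
    unfolding ni by (rule sumI) (rule ib)
  moreover have "(LINT s:{0..1}|lborel. (A - G * (1 - s)) * (norm (\<eta> s))\<^sup>2) =
      (\<Sum>b\<in>Basis. LINT s:{0..1}|lborel. (A - G * (1 - s)) * (\<eta> s \<bullet> b)\<^sup>2)"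
    unfolding ni sum_distrib_left
    by (rule sumI) (intro set_integrable_continuous continuous_intros H1_continuous assms)
  ultimately show "second_variation A G \<eta> = (\<Sum>b\<in>Basis. rod_form A G (\<lambda>s. \<eta> s \<bullet> b))"
    unfolding second_variation_eq(1)[OF h] rod_form_def by (simp add: sum.distrib ib(2))
qed

lemma straight_stable_above:
  assumes G: "G \<ge> 0" and A: "A > - beta0 bc G"
  shows "straight_stable bc A G"
  unfolding straight_stable_def
proof (intro allI impI)
  fix \<eta> assume v: "variation bc \<eta>"
  then have H: "H1 \<eta>" and bc: "bc = Clamped \<longrightarrow> \<eta> 0 = 0" by (auto simp: variation_def)
  obtain s where s: "s \<in> {0..1}" "\<eta> s \<noteq> 0" using v by (auto simp: variation_def nonzero01_def)
  then obtain b where b: "b \<in> Basis" "\<eta> s \<bullet> b \<noteq> 0" by (metis euclidean_eqI inner_zero_left)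
  have ge: "rod_form A G (\<lambda>s. \<eta> s \<bullet> c) \<ge> (A + beta0 bc G) * mass (\<lambda>s. \<eta> s \<bullet> c)" if "c \<in> Basis" for c
    by (rule rod_form_beta0[OF G]) (use second_variation_components(2)[OF H that] bc in auto)
  have "0 < rod_form A G (\<lambda>s. \<eta> s \<bullet> b)"
  proof -
    have "mass (\<lambda>s. \<eta> s \<bullet> b) > 0"
      using b s by (intro mass_pos H1_continuous second_variation_components(2) H) (auto simp: nonzero01_def)
    then have "(A + beta0 bc G) * mass (\<lambda>s. \<eta> s \<bullet> b) > 0" using A by simp
    then show ?thesis using ge[OF b(1)] by linarith
  qed
  moreover have "0 \<le> rod_form A G (\<lambda>s. \<eta> s \<bullet> c)" if "c \<in> Basis" for c
  proof -
    have "(A + beta0 bc G) * mass (\<lambda>s. \<eta> s \<bullet> c) \<ge> 0" using A mass_nonneg by simp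
    then show ?thesis using ge[OF that] by linarith
  qed
  ultimately show "second_variation A G \<eta> > 0"
    unfolding second_variation_components(1)[OF H] using b(1) by (intro sum_pos2) auto
qed

lemma straight_unstable_below:
  assumes A: "A < - beta0 bc G"
  shows "straight_unstable bc A G"
proof -
  have "\<exists>u. test_function bc u \<and> rod_form A G u < 0"
  proof (rule ccontr)
    assume "\<nexists>u. test_function bc u \<and> rod_form A G u < 0"
    then have "beta0 bc G \<ge> - A" by (intro beta0_ge) (auto simp: not_less)
    then show False using A by simp
  qed
  then obtain u where u: "test_function bc u" "rod_form A G u < 0" by blast
  define e where "e = (axis 1 1 :: real^3)"
  have e: "norm e = 1" "e \<bullet> e3 = 0" by (simp_all add: e_def e3_def inner_axis_axis)
  have h: "has_weak_deriv u (weak_deriv u)" using u by (intro H1_weak_deriv) (auto simp: test_function_def)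
  have hw: "has_weak_deriv (\<lambda>s. u s *\<^sub>R e) (\<lambda>s. weak_deriv u s *\<^sub>R e)"
  proof (rule has_weak_derivI)
    show "set_integrable lborel {0..1} (\<lambda>s. (norm (weak_deriv u s *\<^sub>R e))\<^sup>2)"
      using integral_norm_weak_deriv(2)[OF h] e by simp
    have "indef (\<lambda>s. (e \<bullet> b) * u s) (\<lambda>s. (e \<bullet> b) * weak_deriv u s)" for b
      by (rule indef_cmult[OF has_weak_deriv_indef[OF h]])
    then show "indef (\<lambda>s. u s *\<^sub>R e) (\<lambda>s. weak_deriv u s *\<^sub>R e)"
      by - (rule indef_euclideanI, simp add: mult.commute)
  qed
  have "second_variation A G (\<lambda>s. u s *\<^sub>R e) = rod_form A G u"
    unfolding second_variation_eq(1)[OF hw] rod_form_def using e by simp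
  moreover have "variation bc (\<lambda>s. u s *\<^sub>R e)"
    using u e has_weak_deriv_H1[OF hw] by (auto simp: variation_def test_function_def nonzero01_def)
  ultimately show ?thesis using u unfolding straight_unstable_def by metis
qed

section \<open>The linearized equation\<close>

text \<open>With \<open>x = airy_arg A G s\<close> one has \<open>dx / ds = G powr (1/3)\<close>,
  and the square of this slope times \<open>x\<close> is \<open>A - G * (1 - s)\<close>. The
  linearized equation thus becomes Airy's equation in \<open>x\<close>.\<close>

definition airy_arg :: "real \<Rightarrow> real \<Rightarrow> real \<Rightarrow> real" where
  "airy_arg A G s = (A - G * (1 - s)) / G powr (2 / 3)"

text \<open>The coefficients are the derivatives of the two Airy solutions at the free end; by the
  Wronskian identity the value there is 1 and the slope 0.\<close>

definition lin_sol :: "real \<Rightarrow> real \<Rightarrow> real \<Rightarrow> real" where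
  "lin_sol A G s = airy_g' (airy_arg A G 1) * airy_f (airy_arg A G s) - airy_f' (airy_arg A G 1) * airy_g (airy_arg A G s)"

definition lin_sol' :: "real \<Rightarrow> real \<Rightarrow> real \<Rightarrow> real" where
  "lin_sol' A G s = G powr (1 / 3) *
     (airy_g' (airy_arg A G 1) * airy_f' (airy_arg A G s) - airy_f' (airy_arg A G 1) * airy_g' (airy_arg A G s))"

lemma powr_third:
  fixes G :: real
  assumes "G > 0"
  shows "G powr (1/3) * G powr (2/3) = G" "G powr (1/3) * G powr (1/3) = G powr (2/3)" "(G powr (1/3)) ^ 3 = G" "G powr (1/3) > 0"
  using assms by (auto simp: powr_add[symmetric] powr_realpow[symmetric] powr_powr)

lemma airy_arg_mult: "G > 0 \<Longrightarrow> G powr (2/3) * airy_arg A G s = A - G * (1 - s)"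
  by (simp add: airy_arg_def)

lemma airy_arg_eq: "G > 0 \<Longrightarrow> airy_arg A G s = airy_arg A G 1 - G powr (1/3) * (1 - s)"
  using powr_third[of G] by (simp add: airy_arg_def field_simps)

lemma airy_arg_deriv [derivative_intros]:
  assumes "G > 0"
  shows "(airy_arg A G has_field_derivative G powr (1/3)) (at s)"
proof -
  have "(airy_arg A G has_field_derivative G / G powr (2/3)) (at s)"
    unfolding airy_arg_def[abs_def] using assms by (auto intro!: derivative_eq_intros)
  moreover have "G / G powr (2/3) = G powr (1/3)" using powr_third[OF assms] assms by (simp add: field_simps)
  ultimately show ?thesis by simp
qed

lemma airy_compose_deriv:
  assumes "G > 0"
  shows "((\<lambda>s. airy_f (airy_arg A G s)) has_field_derivative G powr (1/3) * airy_f' (airy_arg A G s)) (at s)"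
    "((\<lambda>s. airy_g (airy_arg A G s)) has_field_derivative G powr (1/3) * airy_g' (airy_arg A G s)) (at s)"
    "((\<lambda>s. airy_f' (airy_arg A G s)) has_field_derivative G powr (1/3) * (airy_arg A G s * airy_f (airy_arg A G s))) (at s)"
    "((\<lambda>s. airy_g' (airy_arg A G s)) has_field_derivative G powr (1/3) * (airy_arg A G s * airy_g (airy_arg A G s))) (at s)"
    "((\<lambda>s. Ai (airy_arg A G s)) has_field_derivative G powr (1/3) * Ai' (airy_arg A G s)) (at s)"
    "((\<lambda>s. Ai' (airy_arg A G s)) has_field_derivative G powr (1/3) * (airy_arg A G s * Ai (airy_arg A G s))) (at s)"
  using DERIV_chain2[OF airy_f_deriv airy_arg_deriv[OF assms]] DERIV_chain2[OF airy_g_deriv airy_arg_deriv[OF assms]]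
    DERIV_chain2[OF airy_f'_deriv airy_arg_deriv[OF assms]] DERIV_chain2[OF airy_g'_deriv airy_arg_deriv[OF assms]]
    DERIV_chain2[OF Ai_deriv airy_arg_deriv[OF assms]] DERIV_chain2[OF Ai'_deriv airy_arg_deriv[OF assms]]
  by (simp_all add: mult.commute)

lemma lin_sol_deriv:
  assumes G: "G > 0"
  shows "(lin_sol A G has_field_derivative lin_sol' A G s) (at s)"
    "(lin_sol' A G has_field_derivative (A - G * (1 - s)) * lin_sol A G s) (at s)"
proof -
  show "(lin_sol A G has_field_derivative lin_sol' A G s) (at s)"
    unfolding lin_sol_def[abs_def] lin_sol'_def
    by (auto intro!: derivative_eq_intros airy_compose_deriv[OF G] simp: algebra_simps)
  have "(lin_sol' A G has_field_derivative G powr (1/3) * G powr (1/3) * airy_arg A G s * lin_sol A G s) (at s)"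
    unfolding lin_sol'_def[abs_def] lin_sol_def
    by (auto intro!: derivative_eq_intros airy_compose_deriv[OF G] simp: algebra_simps)
  then show "(lin_sol' A G has_field_derivative (A - G * (1 - s)) * lin_sol A G s) (at s)"
    unfolding powr_third(2)[OF G] airy_arg_mult[OF G] .
qed

lemma lin_sol_1 [simp]: "lin_sol A G 1 = 1" "lin_sol' A G 1 = 0"
  using airy_wronskian[of "airy_arg A G 1"] by (simp_all add: lin_sol_def lin_sol'_def algebra_simps)

text \<open>At a double zero the Wronskian identity, applied at \<open>s\<close>, makes both
  coefficients of \<open>lin_sol\<close> vanish, which contradicts the same identity at the free
  end.\<close>

lemma lin_sol_nondegenerate:
  assumes "G > 0" "lin_sol A G s = 0"
  shows "lin_sol' A G s \<noteq> 0"
proof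
  assume z: "lin_sol' A G s = 0"
  let ?a = "airy_g' (airy_arg A G 1)" and ?b = "airy_f' (airy_arg A G 1)"
  let ?f = "airy_f (airy_arg A G s)" and ?g = "airy_g (airy_arg A G s)"
  let ?f' = "airy_f' (airy_arg A G s)" and ?g' = "airy_g' (airy_arg A G s)"
  have 1: "?a * ?f = ?b * ?g" "?a * ?f' = ?b * ?g'"
    using assms z powr_third(4)[OF assms(1)] by (auto simp: lin_sol_def lin_sol'_def)
  have w: "?f * ?g' - ?f' * ?g = 1" by (rule airy_wronskian)
  have "?a = ?a * (?f * ?g' - ?f' * ?g)" unfolding w by simp
  also have "\<dots> = (?a * ?f) * ?g' - (?a * ?f') * ?g" by (simp add: algebra_simps)
  also have "\<dots> = 0" unfolding 1 by (simp add: algebra_simps)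
  finally have a: "?a = 0" .
  have "?b = ?b * (?f * ?g' - ?f' * ?g)" unfolding w by simp
  also have "\<dots> = ?f * (?b * ?g') - ?f' * (?b * ?g)" by (simp add: algebra_simps)
  also have "\<dots> = 0" unfolding 1[symmetric] by (simp add: algebra_simps)
  finally have "?b = 0" .
  with a show False using airy_wronskian[of "airy_arg A G 1"] by simp
qed

lemma airy_arg_continuous [continuous_intros]:
  assumes "continuous_on S a" "continuous_on S g" "continuous_on S h" "\<And>x. x \<in> S \<Longrightarrow> g x > 0"
  shows "continuous_on S (\<lambda>x. airy_arg (a x) (g x) (h x))"
  unfolding airy_arg_def using assms(4)
  by (intro continuous_intros assms) (force dest: assms(4))+

lemma airy_continuous_compose [continuous_intros]:
  assumes "continuous_on S h"
  shows "continuous_on S (\<lambda>x. airy_f (h x))" "continuous_on S (\<lambda>x. airy_g (h x))"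
    "continuous_on S (\<lambda>x. airy_f' (h x))" "continuous_on S (\<lambda>x. airy_g' (h x))"
    "continuous_on S (\<lambda>x. Ai (h x))" "continuous_on S (\<lambda>x. Ai' (h x))"
  by (rule continuous_on_compose2[OF airy_continuous(1)[of UNIV] assms] continuous_on_compose2[OF airy_continuous(2)[of UNIV] assms]
      continuous_on_compose2[OF airy_continuous(3)[of UNIV] assms] continuous_on_compose2[OF airy_continuous(4)[of UNIV] assms]
      continuous_on_compose2[OF Ai_continuous(1)[of UNIV] assms] continuous_on_compose2[OF Ai_continuous(2)[of UNIV] assms]; simp)+

lemma lin_sol_continuous [continuous_intros]:
  assumes "continuous_on S a" "continuous_on S g" "continuous_on S h" "\<And>x. x \<in> S \<Longrightarrow> g x > 0"
  shows "continuous_on S (\<lambda>x. lin_sol (a x) (g x) (h x))" "continuous_on S (\<lambda>x. lin_sol' (a x) (g x) (h x))"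
  unfolding lin_sol_def lin_sol'_def
  by (intro continuous_intros assms | force dest: assms(4))+

text \<open>Jacobi's identity: completing the square with \<open>w' / w\<close> for a positive solution \<open>w\<close>.\<close>

lemma rod_form_nonneg_if_positive_solution:
  assumes G: "G > 0" and w: "\<And>s. s \<in> {0..1} \<Longrightarrow> lin_sol A G s > 0"
    and u: "H1 u" and bc: "u 0 = 0 \<or> lin_sol' A G 0 \<le> 0"
  shows "rod_form A G u \<ge> 0"
proof -
  let ?w = "lin_sol A G" and ?w' = "lin_sol' A G" and ?u' = "weak_deriv u"
  define q where "q = (\<lambda>s. A - G * (1 - s))"
  define p where "p = (\<lambda>s. ?w' s / ?w s)"
  note hu = H1_weak_deriv[OF u]
  note iu = has_weak_deriv_indef[OF hu]
  have cu: "continuous_on {0..1} u" by (rule H1_continuous[OF u])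
  have cp: "continuous_on {0..1} p" unfolding p_def
    by (intro continuous_intros) (use G w in force)+
  have dp: "(p has_field_derivative (q s - (p s)\<^sup>2)) (at s)" if "s \<in> {0..1}" for s
  proof -
    have "(p has_field_derivative (((A - G * (1 - s)) * ?w s * ?w s - ?w' s * ?w' s) / (?w s * ?w s))) (at s)"
      unfolding p_def by (rule DERIV_divide[OF lin_sol_deriv(2)[OF G] lin_sol_deriv(1)[OF G]]) (use w[OF that] in auto)
    moreover have "((A - G * (1 - s)) * ?w s * ?w s - ?w' s * ?w' s) / (?w s * ?w s) = q s - (p s)\<^sup>2"
      using w[OF that] unfolding p_def q_def by (simp add: divide_simps power2_eq_square)
    ultimately show ?thesis by simp
  qed
  have cq: "continuous_on {0..1} (\<lambda>s. q s - (p s)\<^sup>2)" unfolding q_def by (intro continuous_intros cp)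
  have ip: "indef p (\<lambda>s. q s - (p s)\<^sup>2)"
    by (rule has_weak_deriv_indef[OF has_weak_deriv_C1[OF _ cq]])
       (use dp in \<open>auto simp: has_real_derivative_iff_has_vector_derivative[symmetric] intro: has_field_derivative_at_within\<close>)
  have ipu: "indef (\<lambda>s. p s * (u s * u s)) (\<lambda>s. (q s - (p s)\<^sup>2) * (u s * u s) + p s * (?u' s * u s + u s * ?u' s))"
    by (intro indef_mult ip iu)
  let ?J = "\<lambda>s. (q s - (p s)\<^sup>2) * (u s * u s) + p s * (?u' s * u s + u s * ?u' s)"
  have b: "(LINT s:{0..1}|lborel. ?J s) = p 1 * (u 1 * u 1) - p 0 * (u 0 * u 0)"
    using indef_diff[OF ipu, of 0 1] by simp
  have i1: "set_integrable lborel {0..1} (\<lambda>s. (?u' s)\<^sup>2)" using integral_norm_weak_deriv(2)[OF hu] by simp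
  have i2: "set_integrable lborel {0..1} (\<lambda>s. q s * (u s)\<^sup>2)" unfolding q_def
    by (intro set_integrable_continuous continuous_intros cu)
  have i3: "set_integrable lborel {0..1} ?J" by (rule indef_integrable[OF ipu])
  have i12: "set_integrable lborel {0..1} (\<lambda>s. (?u' s)\<^sup>2 + q s * (u s)\<^sup>2)" by (rule set_integral_add(1)[OF i1 i2])
  have "0 \<le> (LINT s:{0..1}|lborel. (?u' s - p s * u s)\<^sup>2)" by (rule set_integral_nonneg01) simp
  also have "(\<lambda>s. (?u' s - p s * u s)\<^sup>2) = (\<lambda>s. (?u' s)\<^sup>2 + q s * (u s)\<^sup>2 - ?J s)"
    by (rule ext) (simp add: power2_eq_square algebra_simps)
  also have "(LINT s:{0..1}|lborel. (?u' s)\<^sup>2 + q s * (u s)\<^sup>2 - ?J s) =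
      (LINT s:{0..1}|lborel. (?u' s)\<^sup>2 + q s * (u s)\<^sup>2) - (LINT s:{0..1}|lborel. ?J s)"
    by (rule set_integral_diff(2)[OF i12 i3])
  also have "(LINT s:{0..1}|lborel. (?u' s)\<^sup>2 + q s * (u s)\<^sup>2) = rod_form A G u"
    unfolding rod_form_def q_def by (rule set_integral_add(2)[OF i1 i2[unfolded q_def]])
  finally have "rod_form A G u \<ge> p 1 * (u 1 * u 1) - p 0 * (u 0 * u 0)" unfolding b by simp
  moreover have "p 1 = 0" by (simp add: p_def)
  moreover have "p 0 * (u 0 * u 0) \<le> 0"
    using bc
  proof
    assume "lin_sol' A G 0 \<le> 0"
    then have "p 0 \<le> 0" using w[of 0] by (simp add: p_def divide_nonpos_pos)
    then show ?thesis by (simp add: mult_nonpos_nonneg)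
  qed simp
  ultimately show ?thesis by simp
qed

text \<open>On the part that is kept, the integrand is the derivative of
  \<open>lin_sol * lin_sol'\<close>, and the slope at the free end is zero, so only the boundary
  term at \<open>s0\<close> remains. The case \<open>s0 = 0\<close> keeps the entire solution, as a
  test function for the pinned rod.\<close>

lemma truncated_solution:
  assumes G: "G > 0" and s0: "0 \<le> s0" "s0 < 1" and z: "s0 = 0 \<or> lin_sol A G s0 = 0"
  defines "u \<equiv> (\<lambda>s. if s < s0 then 0 else lin_sol A G s)"
  shows "H1 u" "nonzero01 u" "rod_form A G u = - lin_sol A G s0 * lin_sol' A G s0"
proof -
  let ?w = "lin_sol A G" and ?w' = "lin_sol' A G"
  let ?u' = "\<lambda>s. if s < s0 then 0 else ?w' s"
  have cw: "continuous_on S ?w" "continuous_on S ?w'" for S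
    by (intro continuous_intros G)+
  have dev: "eventually (\<lambda>y. y < s0) (nhds x)" if "x < s0" for x using eventually_nhds_in_open[of "{..<s0}" x] that by auto
  have dev2: "eventually (\<lambda>y. s0 < y) (nhds x)" if "s0 < x" for x using eventually_nhds_in_open[of "{s0<..}" x] that by auto
  have pd: "((\<lambda>s. if s < s0 then 0 else F s) has_field_derivative (if x < s0 then 0 else D)) (at x)"
    if "x \<noteq> s0" "(F has_field_derivative D) (at x)" for F D x
  proof (cases "x < s0")
    case True
    have "((\<lambda>s. 0) has_field_derivative 0) (at x)" by simp
    then have "((\<lambda>s. if s < s0 then 0 else F s) has_field_derivative 0) (at x)"
      by (subst DERIV_cong_ev[OF refl _ refl, of _ "\<lambda>s. 0"]) (use dev[OF True] in \<open>auto elim: eventually_mono\<close>)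
    then show ?thesis using True by simp
  next
    case False
    then have x: "s0 < x" using that by simp
    have "((\<lambda>s. if s < s0 then 0 else F s) has_field_derivative D) (at x)"
      by (subst DERIV_cong_ev[OF refl _ refl, of _ F]) (use dev2[OF x] that(2) in \<open>auto elim: eventually_mono\<close>)
    then show ?thesis using False by simp
  qed
  have pc: "continuous_on {0..1} (\<lambda>s. if s < s0 then 0 else F s)"
    if F: "continuous_on {0..1} F" "s0 = 0 \<or> F s0 = 0" for F :: "real \<Rightarrow> real"
  proof (cases "s0 = 0")
    case True
    then show ?thesis using F(1) by (auto intro: continuous_on_eq[OF F(1)])
  next
    case False
    then have F0: "F s0 = 0" using F by simp
    have "continuous_on ({0..s0} \<union> {s0..1}) (\<lambda>s. if s \<le> s0 then 0 else F s)"
      by (rule continuous_on_If) (use s0 F0 F in \<open>auto intro: continuous_on_subset\<close>)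
    then show ?thesis using s0 F0 by (auto elim!: continuous_on_eq simp: ivl_disj_un)
  qed
  have cu: "continuous_on {0..1} u" unfolding u_def by (rule pc) (use cw z in auto)
  have "bounded (?w' ` {0..1})" by (intro compact_imp_bounded compact_continuous_image cw) auto
  then obtain B where "\<forall>x\<in>?w' ` {0..1}. norm x \<le> B" using bounded_iff by blast
  then have B: "\<bar>?w' s\<bar> \<le> B" if "s \<in> {0..1}" for s using that by auto
  have h: "has_weak_deriv u ?u'"
  proof (rule has_weak_deriv_piecewise[of "{s0}"])
    show "(u has_vector_derivative ?u' x) (at x)" if "x \<in> {0<..<1} - {s0}" for x
      using pd[OF _ lin_sol_deriv(1)[OF G], of x] that unfolding u_def
      by (simp add: has_real_derivative_iff_has_vector_derivative)
    show "norm (?u' x) \<le> max 0 B" if "x \<in> {0..1}" for x using B[OF that] by auto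
    have "?w' \<in> borel_measurable borel" by (intro borel_measurable_continuous_onI cw)
    then show "?u' \<in> borel_measurable borel" by measurable
  qed (use cu in auto)
  then show "H1 u" by (rule has_weak_deriv_H1)
  show "nonzero01 u" unfolding nonzero01_def u_def using s0 by (intro bexI[of _ 1]) auto
  \<comment> \<open>The antiderivative is normalized to vanish at \<open>s0\<close>, so that its
    cut-off remains continuous.\<close>
  define F where "F = (\<lambda>s. ?w s * ?w' s - ?w s0 * ?w' s0)"
  let ?q = "\<lambda>s. A - G * (1 - s)"
  have "((\<lambda>s. if s < s0 then 0 else (?w' s)\<^sup>2 + ?q s * (?w s)\<^sup>2) has_integral
      (if 1 < s0 then 0 else F 1) - (if 0 < s0 then 0 else F 0)) {0..1}"
  proof (rule fundamental_theorem_of_calculus_interior_strong[of "{s0}"])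
    show "continuous_on {0..1} (\<lambda>s. if s < s0 then 0 else F s)"
      by (rule pc) (auto simp: F_def intro!: continuous_intros cw)
    fix x assume x: "x \<in> {0<..<1} - {s0}"
    have "(F has_field_derivative (?w' x)\<^sup>2 + ?q x * (?w x)\<^sup>2) (at x)"
      unfolding F_def
      by (auto intro!: derivative_eq_intros lin_sol_deriv G simp: power2_eq_square)
    from pd[OF _ this] x
    show "((\<lambda>s. if s < s0 then 0 else F s) has_vector_derivative (if x < s0 then 0 else (?w' x)\<^sup>2 + ?q x * (?w x)\<^sup>2)) (at x)"
      by (simp add: has_real_derivative_iff_has_vector_derivative)
  qed auto
  moreover have "(if 1 < s0 then 0 else F 1) - (if 0 < s0 then 0 else F 0) = - ?w s0 * ?w' s0"
    using s0 z by (auto simp: F_def)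
  moreover have "(\<lambda>s. if s < s0 then 0 else (?w' s)\<^sup>2 + ?q s * (?w s)\<^sup>2) = (\<lambda>s. (?u' s)\<^sup>2 + ?q s * (u s)\<^sup>2)"
    by (auto simp: u_def)
  ultimately have I: "((\<lambda>s. (?u' s)\<^sup>2 + ?q s * (u s)\<^sup>2) has_integral (- ?w s0 * ?w' s0)) {0..1}" by simp
  have i1: "set_integrable lborel {0..1} (\<lambda>s. (?u' s)\<^sup>2)" using h unfolding has_weak_deriv_def by simp
  have i2: "set_integrable lborel {0..1} (\<lambda>s. ?q s * (u s)\<^sup>2)"
    by (intro set_integrable_continuous continuous_intros cu)
  have "rod_form A G u = (LINT s:{0..1}|lborel. (?u' s)\<^sup>2 + ?q s * (u s)\<^sup>2)"
    unfolding rod_form_def set_integral_add(2)[OF i1 i2] using integral_norm_weak_deriv(1)[OF h] by simp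
  also have "\<dots> = - ?w s0 * ?w' s0"
    using set_borel_integral_eq_integral(2)[OF set_integral_add(1)[OF i1 i2]] I by (simp add: integral_unique)
  finally show "rod_form A G u = - ?w s0 * ?w' s0" .
qed

text \<open>Compactness in \<open>s\<close> makes the dependence on \<open>A\<close> uniform, so a
  strict sign on the whole rod survives a small change of \<open>A\<close>.\<close>

lemma lin_sol_near:
  assumes G: "G > 0" and e: "e > 0"
  obtains d where "d > 0" "\<And>B s. \<bar>B - A\<bar> < d \<Longrightarrow> s \<in> {0..1} \<Longrightarrow> \<bar>lin_sol B G s - lin_sol A G s\<bar> < e"
    "\<And>B s. \<bar>B - A\<bar> < d \<Longrightarrow> s \<in> {0..1} \<Longrightarrow> \<bar>lin_sol' B G s - lin_sol' A G s\<bar> < e"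
proof -
  let ?K = "{A - 1..A + 1} \<times> {0..1::real}"
  have K: "compact ?K" by (intro compact_Times) auto
  have c: "continuous_on ?K (\<lambda>x. lin_sol (fst x) G (snd x))" "continuous_on ?K (\<lambda>x. lin_sol' (fst x) G (snd x))"
    by (intro continuous_intros G)+
  obtain d1 where d1: "d1 > 0" "\<And>x y. x \<in> ?K \<Longrightarrow> y \<in> ?K \<Longrightarrow> dist y x < d1 \<Longrightarrow>
      dist (lin_sol (fst y) G (snd y)) (lin_sol (fst x) G (snd x)) < e"
    using compact_uniformly_continuous[OF c(1) K] e unfolding uniformly_continuous_on_def by metis
  obtain d2 where d2: "d2 > 0" "\<And>x y. x \<in> ?K \<Longrightarrow> y \<in> ?K \<Longrightarrow> dist y x < d2 \<Longrightarrow>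
      dist (lin_sol' (fst y) G (snd y)) (lin_sol' (fst x) G (snd x)) < e"
    using compact_uniformly_continuous[OF c(2) K] e unfolding uniformly_continuous_on_def by metis
  show ?thesis
  proof (rule that[of "min 1 (min d1 d2)"])
    fix B s :: real assume B: "\<bar>B - A\<bar> < min 1 (min d1 d2)" and s: "s \<in> {0..1}"
    have k: "(A, s) \<in> ?K" "(B, s) \<in> ?K" "dist (B, s) (A, s) = \<bar>B - A\<bar>"
      using B s by (auto simp: dist_Pair_Pair dist_real_def)
    show "\<bar>lin_sol B G s - lin_sol A G s\<bar> < e" "\<bar>lin_sol' B G s - lin_sol' A G s\<bar> < e"
      using d1(2)[OF k(1,2)] d2(2)[OF k(1,2)] k(3) B by (auto simp: dist_real_def)
  qed (use d1 d2 in auto)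
qed

lemma beta0_le_if_zero:
  assumes G: "G > 0" and s: "0 \<le> s" "s < 1" "lin_sol A G s = 0"
  shows "beta0 bc G \<le> - A"
proof -
  let ?u = "\<lambda>x. if x < s then 0 else lin_sol A G x"
  have "test_function bc ?u"
    using truncated_solution(1,2)[OF G s(1,2), of A] s by (cases "s = 0") (auto simp: test_function_def)
  moreover have "rod_form A G ?u \<le> 0" using truncated_solution(3)[OF G s(1,2), of A] s by simp
  ultimately show ?thesis using G by (intro beta0_le) auto
qed

text \<open>The negative value persists for a slightly larger \<open>B\<close>, for which
  \<open>lin_sol\<close> still reaches 1 at the free end and so has a zero in between. The strict
  inequality is the gain from \<open>A\<close> to \<open>B\<close>.\<close>

lemma beta0_less_if_negative:
  assumes G: "G > 0" and s: "s \<in> {0..1}" "lin_sol A G s < 0"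
  shows "beta0 bc G < - A"
proof -
  define e where "e = - lin_sol A G s"
  have e: "e > 0" using s by (simp add: e_def)
  obtain d where d: "d > 0" "\<And>B s. \<bar>B - A\<bar> < d \<Longrightarrow> s \<in> {0..1} \<Longrightarrow> \<bar>lin_sol B G s - lin_sol A G s\<bar> < e"
    using lin_sol_near[OF G e, of A] by metis
  define B where "B = A + d / 2"
  have B: "B > A" "\<bar>B - A\<bar> < d" using d(1) by (auto simp: B_def)
  then have neg: "lin_sol B G s < 0" using d(2)[of B s] s(1) unfolding e_def by linarith
  have "continuous_on {s..1} (lin_sol B G)" by (intro continuous_intros G)
  then obtain x where x: "s \<le> x" "x \<le> 1" "lin_sol B G x = 0"
    using IVT'[of "lin_sol B G" s 0 1] neg s(1) by auto
  have "x \<noteq> 1" using x by auto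
  then have "beta0 bc G \<le> - B" using x s(1) by (intro beta0_le_if_zero[OF G, of x]) auto
  then show ?thesis using B by simp
qed

text \<open>Positivity survives for a slightly smaller \<open>B\<close>, where Jacobi's identity
  still bounds the form from below; the difference between \<open>A\<close> and \<open>B\<close>
  makes the bound strict.\<close>

lemma beta0_greater_if_positive:
  assumes G: "G > 0" and p: "\<And>s. s \<in> {0..1} \<Longrightarrow> lin_sol A G s > 0" and bc: "bc = Clamped \<or> lin_sol' A G 0 < 0"
  shows "beta0 bc G > - A"
proof -
  have c: "continuous_on {0..1} (lin_sol A G)" by (intro continuous_intros G)
  obtain s0 where s0: "s0 \<in> {0..1}" "\<And>s. s \<in> {0..1} \<Longrightarrow> lin_sol A G s0 \<le> lin_sol A G s"
    using continuous_attains_inf[OF _ _ c] by auto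
  \<comment> \<open>When the slope at zero is negative, the perturbation has to preserve its sign as
    well: for the pinned rod the boundary term of Jacobi's identity depends on it.\<close>
  define e where "e = (if lin_sol' A G 0 < 0 then min (lin_sol A G s0) (- lin_sol' A G 0) else lin_sol A G s0)"
  have e: "e > 0" "e \<le> lin_sol A G s0" "lin_sol' A G 0 < 0 \<Longrightarrow> e \<le> - lin_sol' A G 0"
    using p[OF s0(1)] by (auto simp: e_def)
  obtain d where d: "d > 0" "\<And>B s. \<bar>B - A\<bar> < d \<Longrightarrow> s \<in> {0..1} \<Longrightarrow> \<bar>lin_sol B G s - lin_sol A G s\<bar> < e"
     "\<And>B s. \<bar>B - A\<bar> < d \<Longrightarrow> s \<in> {0..1} \<Longrightarrow> \<bar>lin_sol' B G s - lin_sol' A G s\<bar> < e"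
    using lin_sol_near[OF G e(1), of A] by metis
  define B where "B = A - d / 2"
  have B: "B < A" "\<bar>B - A\<bar> < d" using d(1) by (auto simp: B_def)
  have "beta0 bc G \<ge> - B"
  proof (rule beta0_ge)
    fix u assume t: "test_function bc u"
    show "rod_form B G u \<ge> 0"
    proof (rule rod_form_nonneg_if_positive_solution[OF G])
      show "lin_sol B G s > 0" if "s \<in> {0..1}" for s
        using d(2)[OF B(2) that] s0(2)[OF that] e(2) by linarith
      show "H1 u" using t by (simp add: test_function_def)
      show "u 0 = 0 \<or> lin_sol' B G 0 \<le> 0"
      proof (cases "bc = Clamped")
        case True then show ?thesis using t by (simp add: test_function_def)
      next
        case False
        then have "lin_sol' A G 0 < 0" using bc by simp
        then have "lin_sol' B G 0 \<le> 0" using d(3)[OF B(2), of 0] e(3) by auto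
        then show ?thesis by simp
      qed
    qed
  qed
  then show ?thesis using B by simp
qed

text \<open>The form of the untruncated solution is minus its value times its slope at the pinned
  end. A positive slope, preserved for a slightly larger \<open>B\<close>, makes it nonpositive
  unless the value is negative, a case already covered.\<close>

lemma beta0_Pinned_less:
  assumes G: "G > 0" and p: "lin_sol' A G 0 > 0"
  shows "beta0 Pinned G < - A"
proof -
  obtain d where d: "d > 0" "\<And>B s. \<bar>B - A\<bar> < d \<Longrightarrow> s \<in> {0..1} \<Longrightarrow> \<bar>lin_sol' B G s - lin_sol' A G s\<bar> < lin_sol' A G 0"
    using lin_sol_near[OF G p, of A] by metis
  define B where "B = A + d / 2"
  have B: "B > A" "\<bar>B - A\<bar> < d" using d(1) by (auto simp: B_def)
  then have w': "lin_sol' B G 0 > 0" using d(2)[of B 0] by auto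
  have "beta0 Pinned G \<le> - B"
  proof (cases "lin_sol B G 0 < 0")
    case True then show ?thesis using beta0_less_if_negative[OF G, of 0 B Pinned] by auto
  next
    case False
    let ?u = "\<lambda>x. if x < 0 then 0 else lin_sol B G x"
    have "test_function Pinned ?u"
      using truncated_solution(1,2)[OF G, of 0 B] by (auto simp: test_function_def)
    moreover have "rod_form B G ?u \<le> 0" using truncated_solution(3)[OF G, of 0 B] w' False by simp
    ultimately show ?thesis using G by (intro beta0_le) auto
  qed
  then show ?thesis using B by simp
qed

definition buckling_mode :: "support \<Rightarrow> real \<Rightarrow> real \<Rightarrow> real" where
  "buckling_mode bc G = lin_sol (A_crit bc G) G"

definition buckling_mode' :: "support \<Rightarrow> real \<Rightarrow> real \<Rightarrow> real" where
  "buckling_mode' bc G = lin_sol' (A_crit bc G) G"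

lemma buckling_mode_deriv:
  assumes "G > 0"
  shows "(buckling_mode bc G has_field_derivative buckling_mode' bc G s) (at s)"
    "(buckling_mode' bc G has_field_derivative (A_crit bc G - G * (1 - s)) * buckling_mode bc G s) (at s)"
  unfolding buckling_mode_def buckling_mode'_def by (rule lin_sol_deriv[OF assms])+

lemma buckling_mode_1 [simp]: "buckling_mode bc G 1 = 1" "buckling_mode' bc G 1 = 0"
  by (simp_all add: buckling_mode_def buckling_mode'_def)

text \<open>A negative value would put \<open>beta0\<close> strictly below \<open>- A_crit\<close>,
  which is \<open>beta0\<close> itself. An interior zero of a nonnegative solution would be a double
  zero.\<close>

lemma buckling_mode_pos:
  assumes G: "G > 0" and s: "0 < s" "s \<le> 1"
  shows "buckling_mode bc G s > 0"
    and "buckling_mode bc G 0 \<ge> 0"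
proof -
  let ?A = "A_crit bc G"
  have nn: "lin_sol ?A G s \<ge> 0" if "s \<in> {0..1}" for s
    using beta0_less_if_negative[OF G that, of ?A bc] by (cases "lin_sol ?A G s < 0") (auto simp: A_crit_def)
  show "buckling_mode bc G 0 \<ge> 0" unfolding buckling_mode_def by (rule nn) simp
  have "lin_sol ?A G s \<noteq> 0"
  proof
    assume z: "lin_sol ?A G s = 0"
    then have s1: "s < 1" using s by (cases "s = 1") auto
    have "lin_sol' ?A G s = 0"
    proof (rule DERIV_local_min[OF lin_sol_deriv(1)[OF G]])
      show "0 < min s (1 - s)" using s s1 by simp
      show "\<forall>y. \<bar>s - y\<bar> < min s (1 - s) \<longrightarrow> lin_sol ?A G s \<le> lin_sol ?A G y"
      proof (intro allI impI)
        fix y assume "\<bar>s - y\<bar> < min s (1 - s)"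
        then have "y \<in> {0..1}" by auto
        then show "lin_sol ?A G s \<le> lin_sol ?A G y" unfolding z by (rule nn)
      qed
    qed
    then show False using lin_sol_nondegenerate[OF G z] by simp
  qed
  then show "buckling_mode bc G s > 0" using nn[of s] s unfolding buckling_mode_def by auto
qed

text \<open>If the mode were positive at the clamped end too, it would be positive on the closed
  interval, and \<open>beta0\<close> would exceed itself. The slope at the resulting zero cannot
  vanish and cannot lead to negative values.\<close>

lemma buckling_mode_Clamped:
  assumes G: "G > 0"
  shows "buckling_mode Clamped G 0 = 0" "buckling_mode' Clamped G 0 > 0"
proof -
  let ?A = "A_crit Clamped G"
  show z: "buckling_mode Clamped G 0 = 0"
  proof (rule ccontr)
    assume "buckling_mode Clamped G 0 \<noteq> 0"
    then have "buckling_mode Clamped G 0 > 0" using buckling_mode_pos(2)[OF G, of 1 Clamped] by simp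
    then have "lin_sol ?A G s > 0" if "s \<in> {0..1}" for s
      using buckling_mode_pos(1)[OF G, of s Clamped] that unfolding buckling_mode_def by (cases "s = 0") auto
    then have "beta0 Clamped G > - ?A" by (intro beta0_greater_if_positive[OF G]) auto
    then show False by (simp add: A_crit_def)
  qed
  have "buckling_mode' Clamped G 0 \<noteq> 0"
    using lin_sol_nondegenerate[OF G, of ?A 0] z by (simp add: buckling_mode_def buckling_mode'_def)
  moreover have "\<not> buckling_mode' Clamped G 0 < 0"
  proof
    assume "buckling_mode' Clamped G 0 < 0"
    then obtain d where d: "d > 0" "\<forall>h>0. h < d \<longrightarrow> buckling_mode Clamped G (0 + h) < buckling_mode Clamped G 0"
      using DERIV_neg_dec_right[OF buckling_mode_deriv(1)[OF G]] by blast
    then have "buckling_mode Clamped G (min (d/2) 1) < 0" using z by auto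
    then show False using buckling_mode_pos(1)[OF G, of "min (d/2) 1" Clamped] d(1) by auto
  qed
  ultimately show "buckling_mode' Clamped G 0 > 0" by simp
qed

text \<open>A positive slope at the pinned end would push \<open>beta0\<close> down. A negative
  slope would push it up if the value there is positive, and would create negative values if it is
  zero; only slope zero with a positive value remains.\<close>

lemma buckling_mode_Pinned:
  assumes G: "G > 0"
  shows "buckling_mode Pinned G 0 > 0" "buckling_mode' Pinned G 0 = 0"
proof -
  let ?A = "A_crit Pinned G"
  have np: "\<not> buckling_mode' Pinned G 0 > 0"
    using beta0_Pinned_less[OF G, of ?A] by (auto simp: A_crit_def buckling_mode'_def)
  show p: "buckling_mode Pinned G 0 > 0"
  proof (rule ccontr)
    assume "\<not> buckling_mode Pinned G 0 > 0"
    then have z: "buckling_mode Pinned G 0 = 0" using buckling_mode_pos(2)[OF G, of 1 Pinned] by simp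
    then have "buckling_mode' Pinned G 0 \<noteq> 0"
      using lin_sol_nondegenerate[OF G, of ?A 0] by (simp add: buckling_mode_def buckling_mode'_def)
    then have "buckling_mode' Pinned G 0 < 0" using np by simp
    then obtain d where d: "d > 0" "\<forall>h>0. h < d \<longrightarrow> buckling_mode Pinned G (0 + h) < buckling_mode Pinned G 0"
      using DERIV_neg_dec_right[OF buckling_mode_deriv(1)[OF G]] by blast
    then have "buckling_mode Pinned G (min (d/2) 1) < 0" using z by auto
    then show False using buckling_mode_pos(1)[OF G, of "min (d/2) 1" Pinned] d(1) by auto
  qed
  show "buckling_mode' Pinned G 0 = 0"
  proof (rule ccontr)
    assume "buckling_mode' Pinned G 0 \<noteq> 0"
    then have n: "lin_sol' ?A G 0 < 0" using np by (simp add: buckling_mode'_def)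
    have "lin_sol ?A G s > 0" if "s \<in> {0..1}" for s
      using buckling_mode_pos(1)[OF G, of s Pinned] that p unfolding buckling_mode_def by (cases "s = 0") auto
    then have "beta0 Pinned G > - ?A" using n by (intro beta0_greater_if_positive[OF G]) auto
    then show False by (simp add: A_crit_def)
  qed
qed

lemma A_crit_bounds:
  assumes "G > 0"
  shows "A_crit bc G \<le> G"
  using beta0_ge_minus_G[of G bc] assms by (simp add: A_crit_def)

lemma airy_arg_1: "G > 0 \<Longrightarrow> airy_arg (A_crit bc G) G 1 = - beta0 bc G / G powr (2/3)"
  and airy_arg_0: "G > 0 \<Longrightarrow> airy_arg (A_crit bc G) G 0 = - (beta0 bc G + G) / G powr (2/3)"
  by (simp_all add: airy_arg_def A_crit_def)

text \<open>At the free end \<open>lin_sol\<close> has value 1 and slope 0, so the constant is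
  determined by \<open>v'\<close> alone. Comparing signs there and at another point of the rod
  locates zeros of \<open>v\<close> or \<open>v'\<close> relative to
  \<open>airy_arg\<close>.\<close>

lemma wronskian_constant:
  assumes G: "G > 0" and v: "\<And>x. (v has_field_derivative v' x) (at x)" "\<And>x. (v' has_field_derivative x * v x) (at x)"
  shows "G powr (1/3) * v' (airy_arg A G s) * lin_sol A G s - v (airy_arg A G s) * lin_sol' A G s
    = G powr (1/3) * v' (airy_arg A G 1)"
proof -
  let ?W = "\<lambda>s. G powr (1/3) * v' (airy_arg A G s) * lin_sol A G s - v (airy_arg A G s) * lin_sol' A G s"
  have "(?W has_field_derivative 0) (at s)" for s
  proof -
    have d: "((\<lambda>s. v (airy_arg A G s)) has_field_derivative v' (airy_arg A G s) * G powr (1/3)) (at s)"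
      "((\<lambda>s. v' (airy_arg A G s)) has_field_derivative airy_arg A G s * v (airy_arg A G s) * G powr (1/3)) (at s)"
      by (rule DERIV_chain2[OF v(1) airy_arg_deriv[OF G]], rule DERIV_chain2[OF v(2) airy_arg_deriv[OF G]])
    have "(?W has_field_derivative (G powr (1/3) * G powr (1/3)) * airy_arg A G s * (v (airy_arg A G s) * lin_sol A G s)
        - v (airy_arg A G s) * ((A - G * (1 - s)) * lin_sol A G s)) (at s)"
      by (auto intro!: derivative_eq_intros d lin_sol_deriv[OF G] simp: algebra_simps)
    then show ?thesis unfolding powr_third(2)[OF G] airy_arg_mult[OF G] by (simp add: algebra_simps)
  qed
  then have "?W s = ?W 1" using DERIV_isconst_all[of ?W s 1] by blast
  then show ?thesis by simp
qed

lemma Ai'_at_Ai_zero: "Ai' Ai_zero \<ge> 0"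
proof -
  have "Ai' Ai'_zero \<le> Ai' Ai_zero"
  proof (rule DERIV_nonpos_imp_nonincreasing[where f=Ai'])
    show "Ai_zero \<le> Ai'_zero" using Ai'_zero by simp
    fix x assume x: "Ai_zero \<le> x" "x \<le> Ai'_zero"
    have "Ai x \<ge> 0" using Ai_zero(1) Ai_zero(3)[of x] x by (cases "x = Ai_zero") auto
    then have "x * Ai x \<le> 0" using x Ai'_zero by (intro mult_nonpos_nonneg) auto
    then show "\<exists>y. (Ai' has_real_derivative y) (at x) \<and> y \<le> 0" using Ai'_deriv by blast
  qed
  then show ?thesis using Ai'_zero by simp
qed

lemma airy_arg_surj:
  assumes G: "G > 0" and "airy_arg A G 0 < z" "z < airy_arg A G 1"
  obtains s where "0 < s" "s < 1" "airy_arg A G s = z"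
proof -
  have "continuous_on {0..1} (airy_arg A G)" by (intro continuous_intros G)
  then obtain s where "0 \<le> s" "s \<le> 1" "airy_arg A G s = z"
    using IVT'[of "airy_arg A G" 0 z 1] assms by auto
  then show ?thesis using that[of s] assms by (cases "s = 0"; cases "s = 1") auto
qed

text \<open>Otherwise \<open>airy_arg\<close> takes the value \<open>Ai_zero\<close> at an interior
  point, since \<open>beta0 \<le> 0\<close> makes it nonnegative at the free end. The Wronskian of
  \<open>Ai\<close> and the positive mode is nonnegative at that point, but negative at the free end
  because \<open>Ai'\<close> is negative on the half-line.\<close>

lemma Ai_zero_le_airy_arg:
  assumes G: "G > 0" and b: "beta0 Clamped G \<le> 0"
  shows "Ai_zero \<le> airy_arg (A_crit Clamped G) G 0"
proof (rule ccontr)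
  let ?A = "A_crit Clamped G"
  assume "\<not> Ai_zero \<le> airy_arg ?A G 0"
  moreover have x1: "airy_arg ?A G 1 \<ge> 0" using b G unfolding airy_arg_1[OF G] by (simp add: divide_nonpos_pos)
  moreover have "Ai_zero < airy_arg ?A G 1" using Ai_zero(2) x1 by simp
  ultimately obtain s where s: "0 < s" "s < 1" "airy_arg ?A G s = Ai_zero"
    using airy_arg_surj[OF G, of ?A Ai_zero] by auto
  have W: "G powr (1/3) * Ai' Ai_zero * lin_sol ?A G s = G powr (1/3) * Ai' (airy_arg ?A G 1)"
    using wronskian_constant[OF G Ai_deriv Ai'_deriv, of ?A s] Ai_zero(1) s(3) by simp
  have "lin_sol ?A G s > 0" using buckling_mode_pos(1)[OF G, of s Clamped] s by (simp add: buckling_mode_def)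
  then have "G powr (1/3) * Ai' Ai_zero * lin_sol ?A G s \<ge> 0" using Ai'_at_Ai_zero by simp
  moreover have "G powr (1/3) * Ai' (airy_arg ?A G 1) < 0"
    using Ai'_neg[OF x1] powr_third(4)[OF G] by (simp add: mult_pos_neg)
  ultimately show False using W by simp
qed

text \<open>As for the clamped rod, with the roles of value and slope exchanged. The slope of the
  mode is needed at the point where \<open>airy_arg\<close> equals \<open>Ai'_zero\<close>; it is
  nonpositive there because the mode starts with slope zero and is concave while
  \<open>airy_arg\<close> is negative.\<close>

lemma Ai'_zero_le_airy_arg:
  assumes G: "G > 0"
  shows "Ai'_zero \<le> airy_arg (A_crit Pinned G) G 0"
proof (rule ccontr)
  let ?A = "A_crit Pinned G"
  assume n: "\<not> Ai'_zero \<le> airy_arg ?A G 0"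
  moreover have x1: "airy_arg ?A G 1 \<ge> 0" using beta0_Pinned_le[OF G] G unfolding airy_arg_1[OF G] by (simp add: divide_nonpos_pos)
  moreover have "Ai'_zero < airy_arg ?A G 1" using Ai'_zero(2) x1 by simp
  ultimately obtain s where s: "0 < s" "s < 1" "airy_arg ?A G s = Ai'_zero"
    using airy_arg_surj[OF G, of ?A Ai'_zero] by auto
  have W: "- Ai Ai'_zero * lin_sol' ?A G s = G powr (1/3) * Ai' (airy_arg ?A G 1)"
    using wronskian_constant[OF G Ai_deriv Ai'_deriv, of ?A s] Ai'_zero(1) s(3) by simp
  have "lin_sol' ?A G s \<le> lin_sol' ?A G 0"
  proof (rule DERIV_nonpos_imp_nonincreasing[where f="lin_sol' ?A G"])
    show "0 \<le> s" using s by simp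
    fix x assume x: "0 \<le> x" "x \<le> s"
    have "lin_sol ?A G x \<ge> 0"
      using buckling_mode_pos[OF G, of x Pinned] buckling_mode_Pinned(1)[OF G] x s by (cases "x = 0") (auto simp: buckling_mode_def)
    moreover have "G powr (1/3) * (1 - s) \<le> G powr (1/3) * (1 - x)" using x by (intro mult_left_mono) auto
    then have "airy_arg ?A G x \<le> Ai'_zero"
      using s(3) airy_arg_eq[OF G, of ?A x] airy_arg_eq[OF G, of ?A s] by linarith
    then have "G powr (2/3) * airy_arg ?A G x \<le> 0" using Ai'_zero(2) by (intro mult_nonneg_nonpos) auto
    ultimately have "(?A - G * (1 - x)) * lin_sol ?A G x \<le> 0" unfolding airy_arg_mult[OF G] by (intro mult_nonpos_nonneg)
    then show "\<exists>y. (lin_sol' ?A G has_real_derivative y) (at x) \<and> y \<le> 0" using lin_sol_deriv(2)[OF G] by blast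
  qed
  then have "lin_sol' ?A G s \<le> 0" using buckling_mode_Pinned(2)[OF G] by (simp add: buckling_mode'_def)
  then have "- Ai Ai'_zero * lin_sol' ?A G s \<ge> 0"
    using Ai_zero(3)[OF Ai'_zero(3)] by (simp add: mult_nonneg_nonpos)
  moreover have "G powr (1/3) * Ai' (airy_arg ?A G 1) < 0"
    using Ai'_neg[OF x1] powr_third(4)[OF G] by (simp add: mult_pos_neg)
  ultimately show False using W by simp
qed

lemma le_airy_arg_0_iff:
  assumes "G > 0"
  shows "z \<le> airy_arg (A_crit bc G) G 0 \<longleftrightarrow> beta0 bc G \<le> - G - z * G powr (2/3)"
  unfolding airy_arg_0[OF assms] using assms by (simp add: field_simps)

text \<open>For \<open>A = 0\<close> the solution is
  \<open>pser airy_a (- (G * (1 - s) ^ 3))\<close>, whose argument runs through all of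
  \<open>{- G..0}\<close>. It is positive on the whole rod exactly if the first zero, at
  \<open>- G_crit\<close>, is not reached.\<close>

lemma beta0_Clamped_pos_iff:
  assumes G: "G > 0"
  shows "beta0 Clamped G > 0 \<longleftrightarrow> G < G_crit"
proof -
  have w: "lin_sol 0 G s = pser airy_a (- (G * (1 - s) ^ 3))" for s
  proof -
    have 1: "airy_arg 0 G 1 = 0" by (simp add: airy_arg_def)
    then have "lin_sol 0 G s = airy_f (- (G powr (1/3) * (1 - s)))"
      using airy_arg_eq[OF G, of 0 s] by (simp add: lin_sol_def)
    also have "\<dots> = pser airy_a (- (G * (1 - s) ^ 3))"
      unfolding airy_f_pser using powr_third(3)[OF G] by (simp add: power_mult_distrib)
    finally show ?thesis .
  qed
  show ?thesis
  proof
    assume "G < G_crit"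
    have "lin_sol 0 G s > 0" if s: "s \<in> {0..1}" for s unfolding w
    proof (rule G_crit(4))
      have "(1 - s) ^ 3 \<le> 1" using s by (intro power_le_one) auto
      then have "G * (1 - s) ^ 3 \<le> G" using G by (simp add: mult_left_le)
      then show "G * (1 - s) ^ 3 < G_crit" using \<open>G < G_crit\<close> by simp
    qed (use G s in auto)
    then show "beta0 Clamped G > 0" using beta0_greater_if_positive[OF G, of 0 Clamped] by simp
  next
    assume b: "beta0 Clamped G > 0"
    show "G < G_crit"
    proof (rule ccontr)
      assume "\<not> G < G_crit"
      then have q: "0 < G_crit / G" "G_crit / G \<le> 1" using G G_crit(1) by auto
      \<comment> \<open>The point of the rod at which the argument of the series is
        \<open>- G_crit\<close>.\<close>
      define s where "s = 1 - (G_crit / G) powr (1/3)"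
      have "(G_crit / G) powr (1/3) \<le> 1 powr (1/3)" by (rule powr_mono2) (use q in auto)
      then have s: "0 \<le> s" "s < 1" unfolding s_def using q by auto
      have "(1 - s) ^ 3 = G_crit / G" unfolding s_def using powr_third(3)[OF q(1)] by simp
      then have "lin_sol 0 G s = 0" unfolding w using G G_crit(3) by simp
      then show False using beta0_le_if_zero[OF G s, of 0 Clamped] b by simp
    qed
  qed
qed


section \<open>Asymptotics of the principal eigenvalue for large gravity\<close>

lemma perturbation_positive:
  fixes h g :: "real \<Rightarrow> real"
  assumes h: "continuous_on {a..b} h" "\<And>x. x \<in> {a..b} \<Longrightarrow> h x > 0" and g: "continuous_on {a..b} g" and ab: "a \<le> b"
  obtains k where "k > 0" "\<And>c x. 0 < c \<Longrightarrow> c \<le> k \<Longrightarrow> x \<in> {a..b} \<Longrightarrow> h x + c * g x > 0"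
proof -
  have ne: "{a..b} \<noteq> {}" using ab by simp
  obtain x0 where x0: "x0 \<in> {a..b}" "\<And>x. x \<in> {a..b} \<Longrightarrow> h x0 \<le> h x"
    using continuous_attains_inf[OF compact_Icc ne h(1)] by auto
  have "bounded (g ` {a..b})" by (intro compact_imp_bounded compact_continuous_image g) auto
  then obtain M where "\<forall>y\<in>g ` {a..b}. norm y \<le> M" using bounded_iff by blast
  then have M: "\<bar>g x\<bar> \<le> M" if "x \<in> {a..b}" for x using that by auto
  have M0: "M \<ge> 0" using M[OF x0(1)] by simp
  show ?thesis
  proof (rule that[of "h x0 / (2 * (M + 1))"])
    show "h x0 / (2 * (M + 1)) > 0" using h(2)[OF x0(1)] M0 by simp
    fix c x assume c: "0 < c" "c \<le> h x0 / (2 * (M + 1))" and x: "x \<in> {a..b}"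
    have "\<bar>c * g x\<bar> \<le> c * (M + 1)" using M[OF x] c by (auto simp: abs_mult intro!: mult_left_mono)
    also have "\<dots> \<le> h x0 / (2 * (M + 1)) * (M + 1)" using c M0 by (intro mult_right_mono) auto
    also have "\<dots> = h x0 / 2" using M0 by (simp add: field_simps)
    also have "\<dots> < h x" using x0(2)[OF x] h(2)[OF x0(1)] by simp
    finally show "h x + c * g x > 0" by linarith
  qed
qed

text \<open>On the half-line \<open>Ai'\<close> is at least its value at zero, while
  \<open>airy_f'\<close> grows at least like half the square of \<open>x\<close>. A small multiple
  of \<open>airy_f\<close> therefore reverses the sign of the slope far out, and with it the sign of
  the Wronskian at the free end. The constant is where \<open>k * x / 2\<close> dominates
  \<open>\<bar>Ai' 0\<bar>\<close>.\<close>

lemma growing_supersolution: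
  assumes k: "k > 0"
  obtains Y where "Y \<ge> 0" "\<And>x. x \<ge> Y \<Longrightarrow> Ai' x + k * airy_f' x \<ge> 0"
proof (rule that[of "1 + 2 * \<bar>Ai' 0\<bar> / k"])
  show "0 \<le> 1 + 2 * \<bar>Ai' 0\<bar> / k" using k by simp
  fix x assume x: "x \<ge> 1 + 2 * \<bar>Ai' 0\<bar> / k"
  have x1: "x \<ge> 1" using x k by (meson divide_nonneg_pos le_add_same_cancel1 mult_nonneg_nonneg abs_ge_zero order_trans zero_le_numeral)
  have "Ai' 0 \<le> Ai' x"
  proof (rule DERIV_nonneg_imp_nondecreasing[where f=Ai'])
    show "0 \<le> x" using x1 by simp
    fix t :: real assume "0 \<le> t" "t \<le> x"
    then show "\<exists>y. (Ai' has_real_derivative y) (at t) \<and> 0 \<le> y"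
      using Ai'_deriv[of t] Ai_pos[of t] by (intro exI[of _ "t * Ai t"]) auto
  qed
  moreover have "x\<^sup>2 / 2 \<le> airy_f' x"
  proof -
    have "pser (diffs airy_a) (x ^ 3) \<ge> diffs airy_a 0"
      by (rule pser_ge) (use x1 airy_a_pos summable_diffs_a diffs_pos in \<open>auto intro: less_imp_le\<close>)
    then have "pser (diffs airy_a) (x ^ 3) \<ge> 1/6" using airy_a_numeric(1) by (simp add: diffs_def)
    then have "3 * x\<^sup>2 * (1/6) \<le> airy_f' x" unfolding airy_f'_def by (intro mult_left_mono) auto
    then show ?thesis by simp
  qed
  then have "k * (x\<^sup>2 / 2) \<le> k * airy_f' x" using k by simp
  moreover have "\<bar>Ai' 0\<bar> \<le> k * (x\<^sup>2 / 2)"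
  proof -
    have "2 * \<bar>Ai' 0\<bar> / k \<le> x" using x by simp
    then have "2 * \<bar>Ai' 0\<bar> \<le> k * x" using k by (simp add: divide_simps mult.commute)
    also have "\<dots> \<le> k * x\<^sup>2" using x1 k by (simp add: power2_eq_square mult_left_mono)
    finally show ?thesis by simp
  qed
  ultimately show "Ai' x + k * airy_f' x \<ge> 0" by linarith
qed

lemma Ai_plus_f_deriv:
  "((\<lambda>x. Ai x + k * airy_f x) has_field_derivative Ai' x + k * airy_f' x) (at x)"
  "((\<lambda>x. Ai' x + k * airy_f' x) has_field_derivative x * (Ai x + k * airy_f x)) (at x)"
  by (auto intro!: derivative_eq_intros Ai_deriv Ai'_deriv airy_f_deriv airy_f'_deriv simp: algebra_simps)

lemma airy_arg_0_nonpos: "G > 0 \<Longrightarrow> airy_arg (A_crit bc G) G 0 \<le> 0"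
  using A_crit_bounds[of G bc] by (simp add: airy_arg_def divide_nonpos_pos)

lemma eventually_airy_arg_1_ge: "eventually (\<lambda>G::real. G > 0 \<and> z + G powr (1/3) \<ge> Y) at_top"
proof -
  have "filterlim (\<lambda>G::real. z + G powr (1/3)) at_top at_top" by real_asymp
  then show ?thesis unfolding filterlim_at_top
    using eventually_gt_at_top[of 0] by (auto intro: eventually_conj)
qed

text \<open>Suppose that \<open>airy_arg\<close> exceeds \<open>z\<close> at the clamped end. Then
  \<open>?v\<close> is positive there, and the Wronskian with the mode, which vanishes there with
  positive slope, is negative. At the free end it is nonnegative as soon as
  \<open>G powr (1/3)\<close> carries \<open>airy_arg\<close> beyond \<open>Y\<close>.\<close>

lemma eventually_airy_arg_le_Clamped:
  assumes d: "d > 0"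
  shows "eventually (\<lambda>G. airy_arg (A_crit Clamped G) G 0 \<le> Ai_zero + d) at_top"
proof -
  \<comment> \<open>Capped at zero: \<open>k\<close> is chosen by compactness on
    \<open>{z..0}\<close> only, and to the right of it \<open>Ai\<close> and \<open>airy_f\<close>
    are both positive.\<close>
  define z where "z = min (Ai_zero + d) 0"
  have z: "z \<le> 0" "Ai_zero < z" "z \<le> Ai_zero + d" using d Ai_zero(2) by (auto simp: z_def)
  obtain k where k: "k > 0" "\<And>c x. 0 < c \<Longrightarrow> c \<le> k \<Longrightarrow> x \<in> {z..0} \<Longrightarrow> Ai x + c * airy_f x > 0"
    by (rule perturbation_positive[of z 0 Ai airy_f]) (use z Ai_zero(3) Ai_continuous airy_continuous in auto)
  let ?v = "\<lambda>x. Ai x + k * airy_f x" and ?v' = "\<lambda>x. Ai' x + k * airy_f' x"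
  have vpos: "?v x > 0" if "x \<ge> z" for x
  proof (cases "x \<le> 0")
    case True then show ?thesis using k(2)[of k x] k(1) that by auto
  next
    case False
    then have "Ai x > 0" "airy_f x > 0" using Ai_pos[of x] airy_pos(1)[of x] by auto
    then show ?thesis using k(1) by (simp add: add_pos_pos)
  qed
  obtain Y where Y: "Y \<ge> 0" "\<And>x. x \<ge> Y \<Longrightarrow> ?v' x \<ge> 0" using growing_supersolution[OF k(1)] by blast
  show ?thesis using eventually_airy_arg_1_ge[of Y z]
  proof eventually_elim
    case (elim G)
    then have G: "G > 0" and GY: "z + G powr (1/3) \<ge> Y" by auto
    let ?A = "A_crit Clamped G"
    have "airy_arg ?A G 0 \<le> z"
    proof (rule ccontr)
      assume n: "\<not> airy_arg ?A G 0 \<le> z"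
      then have "airy_arg ?A G 1 \<ge> Y" using airy_arg_eq[OF G, of ?A 0] GY by simp
      then have "G powr (1/3) * ?v' (airy_arg ?A G 1) \<ge> 0" using Y(2) by simp
      moreover have "- (?v (airy_arg ?A G 0) * lin_sol' ?A G 0) = G powr (1/3) * ?v' (airy_arg ?A G 1)"
        using wronskian_constant[OF G Ai_plus_f_deriv(1)[where k=k] Ai_plus_f_deriv(2)[where k=k], of ?A 0] buckling_mode_Clamped(1)[OF G]
        by (simp add: buckling_mode_def)
      moreover have "?v (airy_arg ?A G 0) * lin_sol' ?A G 0 > 0"
        using vpos[of "airy_arg ?A G 0"] n buckling_mode_Clamped(2)[OF G] by (simp add: buckling_mode'_def)
      ultimately show False by linarith
    qed
    then show ?case using z by simp
  qed
qed

text \<open>The slope of the mode vanishes at the pinned end, so here the sign of \<open>?v'\<close>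
  decides. Knowing it on \<open>{z..0}\<close> is enough because \<open>airy_arg\<close> is never
  positive at the supported end.\<close>

lemma eventually_airy_arg_le_Pinned:
  assumes d: "d > 0"
  shows "eventually (\<lambda>G. airy_arg (A_crit Pinned G) G 0 \<le> Ai'_zero + d) at_top"
proof -
  define z where "z = min (Ai'_zero + d) 0"
  have z: "z \<le> 0" "Ai'_zero < z" "z \<le> Ai'_zero + d" using d Ai'_zero(2) by (auto simp: z_def)
  obtain k where k: "k > 0" "\<And>c x. 0 < c \<Longrightarrow> c \<le> k \<Longrightarrow> x \<in> {z..0} \<Longrightarrow> - Ai' x + c * (- airy_f' x) > 0"
    by (rule perturbation_positive[of z 0 "\<lambda>x. - Ai' x" "\<lambda>x. - airy_f' x"])
       (use z Ai'_zero(4) in \<open>auto intro!: continuous_intros Ai_continuous airy_continuous\<close>)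
  let ?v = "\<lambda>x. Ai x + k * airy_f x" and ?v' = "\<lambda>x. Ai' x + k * airy_f' x"
  obtain Y where Y: "Y \<ge> 0" "\<And>x. x \<ge> Y \<Longrightarrow> ?v' x \<ge> 0" using growing_supersolution[OF k(1)] by blast
  show ?thesis using eventually_airy_arg_1_ge[of Y z]
  proof eventually_elim
    case (elim G)
    then have G: "G > 0" and GY: "z + G powr (1/3) \<ge> Y" by auto
    let ?A = "A_crit Pinned G"
    have "airy_arg ?A G 0 \<le> z"
    proof (rule ccontr)
      assume n: "\<not> airy_arg ?A G 0 \<le> z"
      then have "airy_arg ?A G 1 \<ge> Y" using airy_arg_eq[OF G, of ?A 0] GY by simp
      then have "G powr (1/3) * ?v' (airy_arg ?A G 1) \<ge> 0" using Y(2) by simp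
      moreover have "G powr (1/3) * ?v' (airy_arg ?A G 0) * lin_sol ?A G 0 = G powr (1/3) * ?v' (airy_arg ?A G 1)"
        using wronskian_constant[OF G Ai_plus_f_deriv(1)[where k=k] Ai_plus_f_deriv(2)[where k=k], of ?A 0] buckling_mode_Pinned(2)[OF G]
        by (simp add: buckling_mode'_def)
      moreover have "G powr (1/3) * ?v' (airy_arg ?A G 0) * lin_sol ?A G 0 < 0"
      proof (rule mult_neg_pos[OF mult_pos_neg])
        show "?v' (airy_arg ?A G 0) < 0"
          using k(2)[of k "airy_arg ?A G 0"] k(1) n airy_arg_0_nonpos[OF G] by auto
        show "0 < lin_sol ?A G 0" using buckling_mode_Pinned(1)[OF G] by (simp add: buckling_mode_def)
      qed (use G in auto)
      ultimately show False by linarith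
    qed
    then show ?case using z by simp
  qed
qed

lemma beta0_asymptotics:
  assumes u: "\<And>d. d > 0 \<Longrightarrow> eventually (\<lambda>G. airy_arg (A_crit bc G) G 0 \<le> z + d) at_top"
    and l: "eventually (\<lambda>G. z \<le> airy_arg (A_crit bc G) G 0) at_top"
  shows "((\<lambda>G. (beta0 bc G + G) / G powr (2 / 3)) \<longlongrightarrow> - z) at_top"
proof -
  have "((\<lambda>G. airy_arg (A_crit bc G) G 0) \<longlongrightarrow> z) at_top"
  proof (rule order_tendstoI)
    fix a assume "a < z" then show "eventually (\<lambda>G. a < airy_arg (A_crit bc G) G 0) at_top"
      using l by (auto elim: eventually_mono)
  next
    fix a assume "z < a"
    then show "eventually (\<lambda>G. airy_arg (A_crit bc G) G 0 < a) at_top"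
      using u[of "(a - z) / 2"] by (auto elim: eventually_mono simp: field_simps)
  qed
  then have "((\<lambda>G. - airy_arg (A_crit bc G) G 0) \<longlongrightarrow> - z) at_top" by (rule tendsto_minus)
  then show ?thesis
    by (rule Lim_transform_eventually)
       (use eventually_gt_at_top[of 0] in \<open>eventually_elim, simp add: airy_arg_0 field_simps\<close>)
qed

lemma beta0_Clamped_upper:
  assumes "G \<ge> G_crit"
  shows "beta0 Clamped G \<le> - G - Ai_zero * G powr (2 / 3)"
proof -
  have G: "G > 0" using assms G_crit(1) by simp
  have "beta0 Clamped G \<le> 0" using beta0_Clamped_pos_iff[OF G] assms by (meson not_le)
  then show ?thesis using Ai_zero_le_airy_arg[OF G] le_airy_arg_0_iff[OF G] by blast
qed

lemma beta0_Pinned_upper: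
  assumes "G > 0"
  shows "beta0 Pinned G \<le> - G - Ai'_zero * G powr (2 / 3)"
  using Ai'_zero_le_airy_arg[OF assms] le_airy_arg_0_iff[OF assms] by blast

lemma beta0_Clamped_limit: "((\<lambda>G. (beta0 Clamped G + G) / G powr (2 / 3)) \<longlongrightarrow> - Ai_zero) at_top"
proof (rule beta0_asymptotics[OF eventually_airy_arg_le_Clamped])
  show "eventually (\<lambda>G. Ai_zero \<le> airy_arg (A_crit Clamped G) G 0) at_top"
    using eventually_ge_at_top[of G_crit]
  proof eventually_elim
    case (elim G)
    then have "G > 0" using G_crit(1) by simp
    then show ?case using beta0_Clamped_upper[OF elim] le_airy_arg_0_iff by blast
  qed
qed

lemma beta0_Pinned_limit: "((\<lambda>G. (beta0 Pinned G + G) / G powr (2 / 3)) \<longlongrightarrow> - Ai'_zero) at_top"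
proof (rule beta0_asymptotics[OF eventually_airy_arg_le_Pinned])
  show "eventually (\<lambda>G. Ai'_zero \<le> airy_arg (A_crit Pinned G) G 0) at_top"
    using eventually_gt_at_top[of 0] by eventually_elim (rule Ai'_zero_le_airy_arg)
qed

lemma eventually_beta0_Clamped_le: "\<forall>\<^sub>F G in at_top. beta0 Clamped G \<le> - G / 4"
proof -
  have "((\<lambda>G::real. Ai_zero * G powr (2/3) / G) \<longlongrightarrow> Ai_zero * 0) at_top"
  proof -
    have "((\<lambda>G::real. G powr (2/3) / G) \<longlongrightarrow> 0) at_top" by real_asymp
    from tendsto_mult_left[OF this, of Ai_zero] show ?thesis by simp
  qed
  then have "eventually (\<lambda>G. Ai_zero * G powr (2/3) / G > - 3/4) at_top" by (intro order_tendstoD(1)) auto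
  then show ?thesis using eventually_ge_at_top[of G_crit]
  proof eventually_elim
    case (elim G)
    then have "G > 0" using G_crit(1) by simp
    then have "Ai_zero * G powr (2/3) > - 3/4 * G" using elim by (simp add: field_simps)
    then show ?case using beta0_Clamped_upper[OF elim(2)] by simp
  qed
qed

lemma beta0_Clamped_G_crit: "beta0 Clamped G_crit = 0"
proof (rule antisym)
  have G: "G_crit > 0" using G_crit(1) by simp
  show "beta0 Clamped G_crit \<le> 0" using beta0_Clamped_pos_iff[OF G] by simp
  show "0 \<le> beta0 Clamped G_crit"
  proof (rule field_le_epsilon)
    fix e :: real assume e: "e > 0"
    define H where "H = max (G_crit / 2) (G_crit - e)"
    have H: "0 < H" "H < G_crit" "G_crit - H \<le> e" using G e by (auto simp: H_def)
    have "beta0 Clamped H > 0" using beta0_Clamped_pos_iff[OF H(1)] H(2) by simp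
    then show "0 \<le> beta0 Clamped G_crit + e" using beta0_Lipschitz(2)[of H G_crit Clamped] H by simp
  qed
qed

text \<open>If \<open>beta0\<close> were zero, the mode would be \<open>lin_sol 0 G\<close>, which
  above the threshold has an interior zero although a mode is positive there.\<close>

lemma beta0_Clamped_negative:
  assumes "G > G_crit"
  shows "beta0 Clamped G < 0"
proof -
  have G: "G > 0" using assms G_crit(1) by simp
  have le: "beta0 Clamped G \<le> 0" using beta0_Clamped_pos_iff[OF G] assms by (meson not_le order_less_imp_le)
  have "beta0 Clamped G \<noteq> 0"
  proof
    assume "beta0 Clamped G = 0"
    then have m: "buckling_mode Clamped G = lin_sol 0 G" by (simp add: buckling_mode_def A_crit_def)
    define s where "s = 1 - (G_crit / G) powr (1/3)"
    have q: "0 < G_crit / G" "G_crit / G < 1" using G assms G_crit(1) by auto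
    have "(G_crit / G) powr (1/3) < 1 powr (1/3)" by (rule powr_less_mono2) (use q in auto)
    then have s: "0 < s" "s < 1" unfolding s_def using q by auto
    have 1: "airy_arg 0 G 1 = 0" by (simp add: airy_arg_def)
    have c: "(1 - s) ^ 3 = G_crit / G" unfolding s_def using powr_third(3)[OF q(1)] by simp
    have "lin_sol 0 G s = airy_f (- (G powr (1/3) * (1 - s)))"
      using airy_arg_eq[OF G, of 0 s] 1 by (simp add: lin_sol_def)
    also have "\<dots> = pser airy_a (- (G * (1 - s) ^ 3))"
      unfolding airy_f_pser using powr_third(3)[OF G] by (simp add: power_mult_distrib)
    also have "\<dots> = 0" unfolding c using G G_crit(3) by simp
    finally show False using buckling_mode_pos(1)[OF G, of s Clamped] s unfolding m by simp
  qed
  then show ?thesis using le by simp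
qed

section \<open>The bifurcating branch\<close>

definition sinc3 :: "real \<Rightarrow> real" where
  "sinc3 x = (if x = 0 then 1 / 6 else (x - sin x) / x ^ 3)"

lemma sinc3_continuous: "continuous_on S sinc3"
proof -
  have "isCont sinc3 x" for x
  proof (cases "x = 0")
    case True
    have "((\<lambda>x::real. (x - sin x) / x ^ 3) \<longlongrightarrow> 1 / 6) (at 0)" by real_asymp
    then have "(sinc3 \<longlongrightarrow> 1 / 6) (at 0)"
      by (rule Lim_transform_eventually) (auto simp: sinc3_def eventually_at_filter)
    then show ?thesis unfolding True isCont_def by (simp add: sinc3_def)
  next
    case False
    have "continuous_on (- {0}) (\<lambda>x::real. (x - sin x) / x ^ 3)" by (intro continuous_intros) auto
    then have "continuous_on (- {0}) sinc3" by (rule continuous_on_eq) (auto simp: sinc3_def)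
    then show ?thesis using False by (subst (asm) continuous_on_eq_continuous_at) auto
  qed
  then show ?thesis by (simp add: continuous_at_imp_continuous_on)
qed

text \<open>The cubic part of \<open>sin\<close>, rescaled so that it stays regular at amplitude \<open>r = 0\<close>.\<close>

definition cub :: "real \<Rightarrow> real \<Rightarrow> real" where
  "cub r y = y ^ 3 * sinc3 (r * y)"

lemma cub_eq: "r ^ 3 * cub r y = r * y - sin (r * y)"
  unfolding cub_def sinc3_def by (auto simp: power_mult_distrib)

lemma cub_0 [simp]: "cub 0 y = y ^ 3 / 6"
  by (simp add: cub_def sinc3_def)

lemma cub_zero [simp]: "cub r 0 = 0"
  by (simp add: cub_def)

lemma cub_minus: "cub (- r) y = cub r y"
  unfolding cub_def sinc3_def by (simp add: divide_simps)

lemma cub_continuous [continuous_intros]: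
  assumes "continuous_on S a" "continuous_on S b"
  shows "continuous_on S (\<lambda>x. cub (a x) (b x))"
  unfolding cub_def
  by (intro continuous_intros assms continuous_on_compose2[OF sinc3_continuous[of UNIV]]) auto

lemma one_minus_cos_le: "1 - cos x \<le> x\<^sup>2 / 2" for x :: real
proof -
  have "1 - cos x = 2 * (sin (x/2))\<^sup>2" using cos_double_sin[of "x/2"] by simp
  moreover have "(sin (x/2))\<^sup>2 \<le> (x/2)\<^sup>2"
    using abs_sin_x_le_abs_x[of "x/2"] by (simp add: abs_le_square_iff[symmetric])
  ultimately show ?thesis by (simp add: power_divide)
qed

text \<open>The constant is independent of \<open>r\<close>: the derivative in \<open>y\<close> is
  \<open>(1 - cos (r * y))\<close> divided by the square of \<open>r\<close>, hence at most half the
  square of \<open>y\<close>, which is also its value at \<open>r = 0\<close>.\<close>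

lemma cub_Lipschitz:
  assumes "\<bar>y\<bar> \<le> Y" "\<bar>z\<bar> \<le> Y"
  shows "\<bar>cub r y - cub r z\<bar> \<le> Y\<^sup>2 / 2 * \<bar>y - z\<bar>"
proof -
  have "\<exists>d. (cub r has_field_derivative d) (at x) \<and> \<bar>d\<bar> \<le> x\<^sup>2 / 2" for x
  proof (cases "r = 0")
    case True
    have "(cub r has_field_derivative x\<^sup>2 / 2) (at x)"
      unfolding True cub_0[abs_def] by (auto intro!: derivative_eq_intros)
    then show ?thesis by (intro exI[of _ "x\<^sup>2 / 2"]) auto
  next
    case False
    have e: "cub r = (\<lambda>y. (r * y - sin (r * y)) / r ^ 3)"
      using cub_eq[of r] False by (auto simp: field_simps)
    have "(cub r has_field_derivative (r - cos (r * x) * r) / r ^ 3) (at x)"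
      unfolding e by (rule DERIV_cdivide) (auto intro!: derivative_eq_intros)
    moreover have "(r - cos (r * x) * r) / r ^ 3 = (1 - cos (r * x)) / r\<^sup>2"
      using False by (simp add: divide_simps power2_eq_square power3_eq_cube) (simp add: algebra_simps)
    moreover have "\<bar>(1 - cos (r * x)) / r\<^sup>2\<bar> \<le> x\<^sup>2 / 2"
    proof -
      have "(1 - cos (r * x)) / r\<^sup>2 \<ge> 0" by simp
      moreover have "(1 - cos (r * x)) / r\<^sup>2 \<le> x\<^sup>2 / 2"
        using one_minus_cos_le[of "r * x"] False by (simp add: field_simps power_mult_distrib)
      ultimately show ?thesis by simp
    qed
    ultimately show ?thesis by metis
  qed
  then obtain d where d: "\<And>x. (cub r has_field_derivative d x) (at x)" "\<And>x. \<bar>d x\<bar> \<le> x\<^sup>2 / 2" by metis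
  have "norm (cub r y - cub r z) \<le> Y\<^sup>2 / 2 * norm (y - z)"
  proof (rule field_differentiable_bound[of "{-Y..Y}" "cub r" d])
    fix x assume "x \<in> {-Y..Y}"
    then have "\<bar>x\<bar> \<le> \<bar>Y\<bar>" by auto
    then have "x\<^sup>2 \<le> Y\<^sup>2" by (simp add: abs_le_square_iff)
    then show "norm (d x) \<le> Y\<^sup>2 / 2" using d(2)[of x] by simp
    show "(cub r has_field_derivative d x) (at x within {- Y..Y})" using d(1) by (rule has_field_derivative_at_within)
  qed (use assms in auto)
  then show ?thesis by simp
qed

section \<open>The fixed-point equation for the profile\<close>

text \<open>As a function of \<open>s\<close>, the solution of the linearized equation at
  \<open>A_crit\<close> that vanishes at \<open>s = t\<close> with slope -1. The sign fits
  integration over \<open>t\<close> from \<open>s\<close> up to the free end.\<close>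

definition airy_kernel :: "support \<Rightarrow> real \<Rightarrow> real \<Rightarrow> real \<Rightarrow> real" where
  "airy_kernel bc G s t =
     (airy_f (airy_arg (A_crit bc G) G s) * airy_g (airy_arg (A_crit bc G) G t)
      - airy_g (airy_arg (A_crit bc G) G s) * airy_f (airy_arg (A_crit bc G) G t)) / G powr (1/3)"

text \<open>This is \<open>sin (r * y) * cos (r * y) / r\<close>, extended to \<open>r = 0\<close>.
  Writing the product as half of a sine of the double angle produces \<open>cub (2 * r)\<close> and
  the factor 4, and hence the 4 in the formula for the branching coefficient.\<close>

definition sincos_part :: "real \<Rightarrow> real \<Rightarrow> real" where
  "sincos_part r y = y - 4 * r\<^sup>2 * cub (2 * r) y"

lemma sincos_part_eq: "r * sincos_part r y = sin (r * y) * cos (r * y)"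
proof -
  have "(2 * r) ^ 3 * cub (2 * r) y = 2 * r * y - sin (2 * (r * y))" using cub_eq[of "2 * r" y] by (simp add: mult.assoc)
  then have "8 * (r ^ 3 * cub (2 * r) y) = 2 * r * y - 2 * (sin (r * y) * cos (r * y))"
    by (simp add: sin_double power_mult_distrib mult.assoc)
  then show ?thesis unfolding sincos_part_def by (simp add: algebra_simps power2_eq_square power3_eq_cube)
qed

definition kappa_num :: "support \<Rightarrow> real \<Rightarrow> real \<Rightarrow> (real \<Rightarrow> real) \<Rightarrow> real" where
  "kappa_num bc G r \<psi> = integral {0..1}
     (\<lambda>s. (4 * A_crit bc G * cub (2 * r) (\<psi> s) - G * (1 - s) * cub r (\<psi> s)) * buckling_mode bc G s)"

definition kappa_den :: "support \<Rightarrow> real \<Rightarrow> real \<Rightarrow> (real \<Rightarrow> real) \<Rightarrow> real" where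
  "kappa_den bc G r \<psi> = integral {0..1} (\<lambda>s. sincos_part r (\<psi> s) * buckling_mode bc G s)"

text \<open>Solvability condition: this value of \<open>(A - A_crit) / r\<^sup>2\<close> makes \<open>branch_rhs\<close> orthogonal to the
  buckling mode.\<close>

definition kappa :: "support \<Rightarrow> real \<Rightarrow> real \<Rightarrow> (real \<Rightarrow> real) \<Rightarrow> real" where
  "kappa bc G r \<psi> = kappa_num bc G r \<psi> / kappa_den bc G r \<psi>"

text \<open>The profile is the angle divided by \<open>r\<close>. With
  \<open>A = A_crit + r^2 * kappa\<close> in its equation, the linear part at \<open>A_crit\<close>
  splits off, and this is the remainder divided by the square of \<open>r\<close>.\<close>

definition branch_rhs :: "support \<Rightarrow> real \<Rightarrow> real \<Rightarrow> (real \<Rightarrow> real) \<Rightarrow> real \<Rightarrow> real" where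
  "branch_rhs bc G r \<psi> s = kappa bc G r \<psi> * sincos_part r (\<psi> s)
     - (4 * A_crit bc G * cub (2 * r) (\<psi> s) - G * (1 - s) * cub r (\<psi> s))"

definition branch_step :: "support \<Rightarrow> real \<Rightarrow> real \<Rightarrow> (real \<Rightarrow> real) \<Rightarrow> real \<Rightarrow> real" where
  "branch_step bc G r \<psi> s = buckling_mode bc G s
     + r\<^sup>2 * integral {s..1} (\<lambda>t. airy_kernel bc G s t * branch_rhs bc G r \<psi> t)"

text \<open>A single constant for all quantities, so that products of bounds collapse to powers of
  \<open>C\<close>. The last clause bounds the squared norm of the mode from below by
  \<open>1 / C\<close>, which keeps the denominator of \<open>kappa\<close> away from zero.\<close>

definition mode_bound :: "support \<Rightarrow> real \<Rightarrow> real \<Rightarrow> bool" where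
  "mode_bound bc G C \<longleftrightarrow> C \<ge> 1 \<and> (\<forall>s\<in>{0..1}. \<bar>buckling_mode bc G s\<bar> \<le> C) \<and>
     (\<forall>s\<in>{0..1}. \<forall>t\<in>{0..1}. \<bar>airy_kernel bc G s t\<bar> \<le> C) \<and> \<bar>A_crit bc G\<bar> \<le> C \<and> G \<le> C \<and>
     1 \<le> C * integral {0..1} (\<lambda>s. (buckling_mode bc G s)\<^sup>2)"

lemma integral_abs_le:
  fixes h :: "real \<Rightarrow> real"
  assumes "0 \<le> a" "a \<le> b" "b \<le> 1" "continuous_on {a..b} h" "\<And>s. s \<in> {a..b} \<Longrightarrow> \<bar>h s\<bar> \<le> B"
  shows "\<bar>integral {a..b} h\<bar> \<le> B"
proof -
  have "norm (integral {a..b} h) \<le> B * (b - a)"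
    by (rule integral_bound) (use assms in auto)
  moreover have hb: "\<bar>h a\<bar> \<le> B" by (rule assms(5)) (use assms in auto)
  have "0 \<le> B" using hb abs_ge_zero[of "h a"] by linarith
  then have "B * (b - a) \<le> B" using assms by (intro mult_left_le) auto
  ultimately show ?thesis by simp
qed

lemma buckling_mode_continuous_s: "G > 0 \<Longrightarrow> continuous_on S (buckling_mode bc G)"
  unfolding buckling_mode_def by (intro continuous_intros)

text \<open>The smallness of \<open>r\<close> gives \<open>r^2 * C ^ 10 \<le> 1 / 10000\<close>. The
  tenth power is the largest that the estimates produce, and the largest numerical factor in front
  of it is 2890, which leaves a contraction by less than one half.\<close>

locale branch_point =
  fixes bc :: support and G r C :: real
  assumes G: "G > 0" and C: "mode_bound bc G C" and r: "\<bar>r\<bar> < 1 / (100 * C ^ 5)"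
begin

abbreviation "\<phi> \<equiv> buckling_mode bc G"

text \<open>Within this radius \<open>kappa_den\<close> changes by at most
  \<open>1 / (2 * C)\<close>, half of the lower bound for the squared norm of the mode.\<close>

definition near :: "(real \<Rightarrow> real) \<Rightarrow> bool" where
  "near \<psi> \<longleftrightarrow> continuous_on {0..1} \<psi> \<and> (\<forall>s\<in>{0..1}. \<bar>\<psi> s - \<phi> s\<bar> \<le> 1 / (4 * C\<^sup>2))"

lemma C1: "C \<ge> 1" and phi_le: "s \<in> {0..1} \<Longrightarrow> \<bar>\<phi> s\<bar> \<le> C"
  and ker_le: "s \<in> {0..1} \<Longrightarrow> t \<in> {0..1} \<Longrightarrow> \<bar>airy_kernel bc G s t\<bar> \<le> C"
  and A_le: "\<bar>A_crit bc G\<bar> \<le> C" and G_le: "G \<le> C"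
  and m_ge: "1 \<le> C * integral {0..1} (\<lambda>s. (\<phi> s)\<^sup>2)"
  using C unfolding mode_bound_def by auto

lemma r_C: "j \<le> 10 \<Longrightarrow> r\<^sup>2 * C ^ j \<le> 1 / 10000"
proof -
  assume j: "j \<le> 10"
  have "\<bar>r\<bar> * C ^ 5 \<le> 1 / 100" using r C1 by (simp add: field_simps)
  then have "(\<bar>r\<bar> * C ^ 5)\<^sup>2 \<le> (1 / 100)\<^sup>2" using C1 by (intro power_mono) auto
  then have "r\<^sup>2 * C ^ 10 \<le> 1 / 10000" by (simp add: power_mult_distrib power_divide)
  moreover have "r\<^sup>2 * C ^ j \<le> r\<^sup>2 * C ^ 10" using C1 j by (intro mult_left_mono power_increasing) auto
  ultimately show ?thesis by simp
qed

lemma C_pow: "i \<le> j \<Longrightarrow> C ^ i \<le> C ^ j"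
  using C1 by (rule power_increasing[rotated])

lemma phi_cont: "continuous_on S \<phi>"
  by (rule buckling_mode_continuous_s[OF G])

lemma near_le: "near \<psi> \<Longrightarrow> s \<in> {0..1} \<Longrightarrow> \<bar>\<psi> s\<bar> \<le> 2 * C"
proof -
  assume *: "near \<psi>" "s \<in> {0..1}"
  have "1 * 1 \<le> 4 * C\<^sup>2" using C1 by (intro mult_mono) auto
  then have "1 / (4 * C\<^sup>2) \<le> 1" by (simp add: divide_simps)
  moreover have "\<bar>\<psi> s - \<phi> s\<bar> \<le> 1 / (4 * C\<^sup>2)" using * unfolding near_def by blast
  ultimately show ?thesis using phi_le[OF *(2)] C1 by linarith
qed

lemma near_cont: "near \<psi> \<Longrightarrow> continuous_on {0..1} \<psi>"
  by (simp add: near_def)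

lemma cub_le:
  assumes "\<bar>y\<bar> \<le> 2 * C" shows "\<bar>cub q y\<bar> \<le> 4 * C ^ 3"
proof -
  have "\<bar>cub q y - cub q 0\<bar> \<le> (2 * C)\<^sup>2 / 2 * \<bar>y - 0\<bar>" by (rule cub_Lipschitz) (use assms C1 in auto)
  also have "\<dots> \<le> (2 * C)\<^sup>2 / 2 * (2 * C)" using assms by (intro mult_left_mono) auto
  finally show ?thesis by (simp add: power2_eq_square power3_eq_cube)
qed

lemma cub_diff:
  assumes "\<bar>y\<bar> \<le> 2 * C" "\<bar>z\<bar> \<le> 2 * C" "\<bar>y - z\<bar> \<le> D" shows "\<bar>cub q y - cub q z\<bar> \<le> 2 * C\<^sup>2 * D"
proof -
  have "\<bar>cub q y - cub q z\<bar> \<le> (2 * C)\<^sup>2 / 2 * \<bar>y - z\<bar>" by (rule cub_Lipschitz) (use assms in auto)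
  also have "\<dots> \<le> (2 * C)\<^sup>2 / 2 * D" using assms by (intro mult_left_mono) auto
  finally show ?thesis by (simp add: power2_eq_square)
qed

lemma sincos_diff:
  assumes "\<bar>y\<bar> \<le> 2 * C" "\<bar>z\<bar> \<le> 2 * C" "\<bar>y - z\<bar> \<le> D" shows "\<bar>sincos_part r y - sincos_part r z\<bar> \<le> 2 * D"
proof -
  have D: "D \<ge> 0" using assms(3) by simp
  have "\<bar>sincos_part r y - sincos_part r z\<bar> = \<bar>(y - z) - 4 * r\<^sup>2 * (cub (2 * r) y - cub (2 * r) z)\<bar>"
    by (simp add: sincos_part_def algebra_simps)
  also have "\<dots> \<le> \<bar>y - z\<bar> + 4 * r\<^sup>2 * \<bar>cub (2 * r) y - cub (2 * r) z\<bar>"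
    by (rule order_trans[OF abs_triangle_ineq4]) (simp add: abs_mult)
  also have "\<dots> \<le> D + 4 * r\<^sup>2 * (2 * C\<^sup>2 * D)" using assms by (intro add_mono mult_left_mono cub_diff) auto
  also have "\<dots> = D + 8 * (r\<^sup>2 * C ^ 2) * D" by simp
  also have "\<dots> \<le> D + 8 * (1 / 10000) * D" using r_C[of 2] D by (intro add_left_mono mult_right_mono mult_left_mono) auto
  also have "\<dots> \<le> 2 * D" using D by simp
  finally show ?thesis .
qed

lemma sincos_le:
  assumes "\<bar>y\<bar> \<le> 2 * C" shows "\<bar>sincos_part r y\<bar> \<le> 4 * C"
  using sincos_diff[OF assms, of 0 "2 * C"] assms C1 by (simp add: sincos_part_def)

definition cubics :: "(real \<Rightarrow> real) \<Rightarrow> real \<Rightarrow> real" where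
  "cubics \<psi> s = 4 * A_crit bc G * cub (2 * r) (\<psi> s) - G * (1 - s) * cub r (\<psi> s)"

lemma cubics_cont: "near \<psi> \<Longrightarrow> continuous_on {0..1} (cubics \<psi>)"
  unfolding cubics_def by (intro continuous_intros near_cont)

lemma sincos_cont: "near \<psi> \<Longrightarrow> continuous_on {0..1} (\<lambda>s. sincos_part r (\<psi> s))"
  unfolding sincos_part_def by (intro continuous_intros near_cont)

lemma coeff_combination:
  assumes "\<bar>x\<bar> \<le> B" "\<bar>y\<bar> \<le> B" "s \<in> {0..1}"
  shows "\<bar>4 * A_crit bc G * x - G * (1 - s) * y\<bar> \<le> 5 * C * B"
proof -
  have "\<bar>4 * A_crit bc G * x - G * (1 - s) * y\<bar> \<le> \<bar>4 * A_crit bc G * x\<bar> + \<bar>G * (1 - s) * y\<bar>" by (rule abs_triangle_ineq4)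
  also have "\<dots> = 4 * (\<bar>A_crit bc G\<bar> * \<bar>x\<bar>) + G * (1 - s) * \<bar>y\<bar>" using G assms by (simp add: abs_mult)
  also have "\<dots> \<le> 4 * (C * B) + C * 1 * B"
    using assms A_le G_le G C1 by (intro add_mono mult_left_mono mult_mono) auto
  finally show ?thesis by (simp add: mult_ac)
qed

lemma cubics_le: "near \<psi> \<Longrightarrow> s \<in> {0..1} \<Longrightarrow> \<bar>cubics \<psi> s\<bar> \<le> 20 * C ^ 4"
proof -
  assume n: "near \<psi>" and s: "s \<in> {0..1}"
  have "\<bar>cubics \<psi> s\<bar> \<le> 5 * C * (4 * C ^ 3)" unfolding cubics_def
    by (rule coeff_combination[OF cub_le cub_le s]) (rule near_le[OF n s])+
  then show ?thesis by (simp add: eval_nat_numeral)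
qed

lemma cubics_diff:
  assumes "near \<psi>" "near \<omega>" "s \<in> {0..1}" "\<bar>\<psi> s - \<omega> s\<bar> \<le> D"
  shows "\<bar>cubics \<psi> s - cubics \<omega> s\<bar> \<le> 10 * C ^ 3 * D"
proof -
  have "cubics \<psi> s - cubics \<omega> s = 4 * A_crit bc G * (cub (2 * r) (\<psi> s) - cub (2 * r) (\<omega> s)) - G * (1 - s) * (cub r (\<psi> s) - cub r (\<omega> s))"
    by (simp add: cubics_def algebra_simps)
  also have "\<bar>\<dots>\<bar> \<le> 5 * C * (2 * C\<^sup>2 * D)"
    by (intro coeff_combination cub_diff near_le assms)
  finally show ?thesis by (simp add: power2_eq_square power3_eq_cube)
qed

lemma num_eq: "kappa_num bc G r \<psi> = integral {0..1} (\<lambda>s. cubics \<psi> s * \<phi> s)"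
  by (simp add: kappa_num_def cubics_def)

lemma mult_phi_le: "\<bar>x\<bar> \<le> B \<Longrightarrow> s \<in> {0..1} \<Longrightarrow> \<bar>x * \<phi> s\<bar> \<le> B * C"
  using phi_le[of s] by (auto simp: abs_mult intro!: mult_mono)

lemma num_le: "near \<psi> \<Longrightarrow> \<bar>kappa_num bc G r \<psi>\<bar> \<le> 20 * C ^ 5"
proof -
  assume n: "near \<psi>"
  have "\<bar>kappa_num bc G r \<psi>\<bar> \<le> (20 * C ^ 4) * C" unfolding num_eq
    by (rule integral_abs_le) (auto intro!: mult_phi_le cubics_le n continuous_intros cubics_cont phi_cont)
  then show ?thesis by (simp add: eval_nat_numeral mult_ac)
qed

lemma num_diff:
  assumes n: "near \<psi>" "near \<omega>" and D: "\<And>s. s \<in> {0..1} \<Longrightarrow> \<bar>\<psi> s - \<omega> s\<bar> \<le> D"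
  shows "\<bar>kappa_num bc G r \<psi> - kappa_num bc G r \<omega>\<bar> \<le> 10 * C ^ 4 * D"
proof -
  have "kappa_num bc G r \<psi> - kappa_num bc G r \<omega> = integral {0..1} (\<lambda>s. (cubics \<psi> s - cubics \<omega> s) * \<phi> s)"
    unfolding num_eq left_diff_distrib
    by (rule Henstock_Kurzweil_Integration.integral_diff[symmetric])
       (intro integrable_continuous_real continuous_intros cubics_cont n phi_cont)+
  also have "\<bar>\<dots>\<bar> \<le> (10 * C ^ 3 * D) * C"
    by (rule integral_abs_le) (auto intro!: mult_phi_le cubics_diff D n continuous_intros cubics_cont phi_cont)
  finally show ?thesis by (simp add: eval_nat_numeral mult_ac)
qed

lemma den_diff:
  assumes n: "near \<psi>" "near \<omega>" and D: "\<And>s. s \<in> {0..1} \<Longrightarrow> \<bar>\<psi> s - \<omega> s\<bar> \<le> D"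
  shows "\<bar>kappa_den bc G r \<psi> - kappa_den bc G r \<omega>\<bar> \<le> 2 * C * D"
proof -
  have "kappa_den bc G r \<psi> - kappa_den bc G r \<omega> = integral {0..1} (\<lambda>s. (sincos_part r (\<psi> s) - sincos_part r (\<omega> s)) * \<phi> s)"
    unfolding kappa_den_def left_diff_distrib
    by (rule Henstock_Kurzweil_Integration.integral_diff[symmetric])
       (intro integrable_continuous_real continuous_intros sincos_cont n phi_cont)+
  also have "\<bar>\<dots>\<bar> \<le> (2 * D) * C"
    by (rule integral_abs_le) (auto intro!: mult_phi_le sincos_diff[OF near_le[OF n(1)] near_le[OF n(2)] D] n continuous_intros sincos_cont phi_cont)
  finally show ?thesis by (simp add: mult_ac)
qed

lemma near_phi: "near \<phi>"
  using C1 by (auto simp: near_def intro!: phi_cont)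

text \<open>The squared norm of the mode contributes at least \<open>1 / C\<close>. The nonlinearity
  costs at most a tenth of this and the distance to the mode at most half, so more than a quarter
  remains.\<close>

lemma den_ge:
  assumes n: "near \<psi>"
  shows "kappa_den bc G r \<psi> \<ge> 1 / (4 * C)"
proof -
  let ?m = "integral {0..1} (\<lambda>s. (\<phi> s)\<^sup>2)"
  have "kappa_den bc G r \<phi> - ?m = integral {0..1} (\<lambda>s. (sincos_part r (\<phi> s) - \<phi> s) * \<phi> s)"
    unfolding kappa_den_def left_diff_distrib power2_eq_square
    by (rule Henstock_Kurzweil_Integration.integral_diff[symmetric])
       (intro integrable_continuous_real continuous_intros sincos_cont near_phi phi_cont)+
  also have "\<bar>\<dots>\<bar> \<le> (1 / (10 * C\<^sup>2)) * C"
  proof (rule integral_abs_le)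
    fix s :: real assume s: "s \<in> {0..1}"
    have "\<bar>sincos_part r (\<phi> s) - \<phi> s\<bar> = 4 * r\<^sup>2 * \<bar>cub (2 * r) (\<phi> s)\<bar>" by (simp add: sincos_part_def abs_mult)
    also have "\<dots> \<le> 4 * r\<^sup>2 * (4 * C ^ 3)" by (intro mult_left_mono cub_le near_le near_phi s) auto
    also have "\<dots> \<le> 1 / (10 * C\<^sup>2)"
    proof -
      have "4 * r\<^sup>2 * (4 * C ^ 3) * (10 * C\<^sup>2) = 160 * (r\<^sup>2 * C ^ 5)" by (simp add: eval_nat_numeral)
      also have "\<dots> \<le> 1" using r_C[of 5] by simp
      finally show ?thesis using C1 by (subst pos_le_divide_eq) auto
    qed
    finally show "\<bar>(sincos_part r (\<phi> s) - \<phi> s) * \<phi> s\<bar> \<le> (1 / (10 * C\<^sup>2)) * C" by (rule mult_phi_le[OF _ s])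
  qed (auto intro!: continuous_intros sincos_cont near_phi phi_cont)
  finally have 1: "\<bar>kappa_den bc G r \<phi> - ?m\<bar> \<le> 1 / (10 * C)" using C1 by (simp add: power2_eq_square)
  have "\<bar>kappa_den bc G r \<psi> - kappa_den bc G r \<phi>\<bar> \<le> 2 * C * (1 / (4 * C\<^sup>2))"
    by (rule den_diff[OF n near_phi]) (use n in \<open>auto simp: near_def\<close>)
  then have 2: "\<bar>kappa_den bc G r \<psi> - kappa_den bc G r \<phi>\<bar> \<le> 1 / (2 * C)" using C1 by (simp add: power2_eq_square)
  define i where "i = 1 / C"
  have i: "1 / (10 * C) = i / 10" "1 / (2 * C) = i / 2" "1 / (4 * C) = i / 4" "i > 0" using C1 by (auto simp: i_def)
  have "?m \<ge> i" unfolding i_def using m_ge C1 by (simp add: field_simps)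
  then show ?thesis using 1 2 i(4) unfolding i(1-3) abs_le_iff by linarith
qed

lemma kappa_le: "near \<psi> \<Longrightarrow> \<bar>kappa bc G r \<psi>\<bar> \<le> 80 * C ^ 6"
proof -
  assume n: "near \<psi>"
  have d: "kappa_den bc G r \<psi> \<ge> 1 / (4 * C)" "1 / (4 * C) > 0" using den_ge[OF n] C1 by auto
  then have "kappa_den bc G r \<psi> > 0" by linarith
  then have "\<bar>kappa bc G r \<psi>\<bar> = \<bar>kappa_num bc G r \<psi>\<bar> / kappa_den bc G r \<psi>" by (simp add: kappa_def abs_divide)
  also have "\<dots> \<le> (20 * C ^ 5) / (1 / (4 * C))"
    using d num_le[OF n] C1 by (intro frac_le) auto
  finally show ?thesis by (simp add: eval_nat_numeral mult_ac)
qed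

lemma kappa_diff:
  assumes n: "near \<psi>" "near \<omega>" and D: "\<And>s. s \<in> {0..1} \<Longrightarrow> \<bar>\<psi> s - \<omega> s\<bar> \<le> D"
  shows "\<bar>kappa bc G r \<psi> - kappa bc G r \<omega>\<bar> \<le> 680 * C ^ 8 * D"
proof -
  have D0: "D \<ge> 0" using D[of 0] by simp
  define d1 d2 n1 n2 where "d1 = kappa_den bc G r \<psi>" and "d2 = kappa_den bc G r \<omega>"
    and "n1 = kappa_num bc G r \<psi>" and "n2 = kappa_num bc G r \<omega>"
  have d: "d1 \<ge> 1 / (4 * C)" "d2 \<ge> 1 / (4 * C)" "1 / (4 * C) > 0"
    using den_ge n C1 by (auto simp: d1_def d2_def)
  then have dp: "d1 > 0" "d2 > 0" by linarith+
  \<comment> \<open>The difference of quotients is written with the bounded factor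
    \<open>kappa\<close> of the second profile, so the only divisor left is the first
    denominator.\<close>
  have "kappa bc G r \<psi> - kappa bc G r \<omega> = (n1 - n2) / d1 + kappa bc G r \<omega> * ((d2 - d1) / d1)"
    using dp unfolding kappa_def d1_def[symmetric] d2_def[symmetric] n1_def[symmetric] n2_def[symmetric]
    by (simp add: field_simps)
  also have "\<bar>\<dots>\<bar> \<le> \<bar>n1 - n2\<bar> / d1 + \<bar>kappa bc G r \<omega>\<bar> * (\<bar>d2 - d1\<bar> / d1)"
    using dp by (intro order_trans[OF abs_triangle_ineq]) (simp add: abs_mult)
  also have "\<dots> \<le> (10 * C ^ 4 * D) / (1 / (4 * C)) + (80 * C ^ 6) * ((2 * C * D) / (1 / (4 * C)))"
  proof (intro add_mono mult_mono frac_le)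
    show "\<bar>n1 - n2\<bar> \<le> 10 * C ^ 4 * D" unfolding n1_def n2_def by (rule num_diff[OF n D])
    show "\<bar>d2 - d1\<bar> \<le> 2 * C * D" unfolding d1_def d2_def using den_diff[OF n D] by (simp add: abs_minus_commute)
  qed (use d dp C1 D0 kappa_le[OF n(2)] in auto)
  also have "\<dots> = 40 * C ^ 5 * D + 640 * C ^ 8 * D" by (simp add: eval_nat_numeral mult_ac)
  also have "\<dots> \<le> 40 * C ^ 8 * D + 640 * C ^ 8 * D" using D0 C_pow[of 5 8] by (intro add_mono mult_right_mono mult_left_mono) auto
  finally show ?thesis by (simp add: mult_ac)
qed

lemma rhs_eq: "branch_rhs bc G r \<psi> s = kappa bc G r \<psi> * sincos_part r (\<psi> s) - cubics \<psi> s"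
  by (simp add: branch_rhs_def cubics_def)

lemma rhs_cont: "near \<psi> \<Longrightarrow> continuous_on {0..1} (branch_rhs bc G r \<psi>)"
  unfolding rhs_eq[abs_def] by (intro continuous_intros sincos_cont cubics_cont)

lemma rhs_le:
  assumes n: "near \<psi>" and s: "s \<in> {0..1}"
  shows "\<bar>branch_rhs bc G r \<psi> s\<bar> \<le> 340 * C ^ 7"
proof -
  have "\<bar>branch_rhs bc G r \<psi> s\<bar> \<le> \<bar>kappa bc G r \<psi>\<bar> * \<bar>sincos_part r (\<psi> s)\<bar> + \<bar>cubics \<psi> s\<bar>"
    unfolding rhs_eq by (rule order_trans[OF abs_triangle_ineq4]) (simp add: abs_mult)
  also have "\<dots> \<le> (80 * C ^ 6) * (4 * C) + 20 * C ^ 4"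
    using C1 by (intro add_mono mult_mono kappa_le sincos_le near_le cubics_le n s) auto
  also have "\<dots> \<le> (80 * C ^ 6) * (4 * C) + 20 * C ^ 7" using C_pow[of 4 7] by simp
  finally show ?thesis by (simp add: eval_nat_numeral mult_ac)
qed

lemma rhs_diff:
  assumes n: "near \<psi>" "near \<omega>" and D: "\<And>s. s \<in> {0..1} \<Longrightarrow> \<bar>\<psi> s - \<omega> s\<bar> \<le> D" and s: "s \<in> {0..1}"
  shows "\<bar>branch_rhs bc G r \<psi> s - branch_rhs bc G r \<omega> s\<bar> \<le> 2890 * C ^ 9 * D"
proof -
  have D0: "D \<ge> 0" using D[of 0] by simp
  let ?k = "kappa bc G r \<psi>" and ?l = "kappa bc G r \<omega>"
  let ?a = "sincos_part r (\<psi> s)" and ?b = "sincos_part r (\<omega> s)"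
  have "branch_rhs bc G r \<psi> s - branch_rhs bc G r \<omega> s = ((?k - ?l) * ?a + ?l * (?a - ?b)) - (cubics \<psi> s - cubics \<omega> s)"
    unfolding rhs_eq by (simp add: algebra_simps)
  also have "\<bar>\<dots>\<bar> \<le> (\<bar>?k - ?l\<bar> * \<bar>?a\<bar> + \<bar>?l\<bar> * \<bar>?a - ?b\<bar>) + \<bar>cubics \<psi> s - cubics \<omega> s\<bar>"
    by (intro order_trans[OF abs_triangle_ineq4] add_right_mono order_trans[OF abs_triangle_ineq]) (simp add: abs_mult)
  also have "\<dots> \<le> ((680 * C ^ 8 * D) * (4 * C) + (80 * C ^ 6) * (2 * D)) + 10 * C ^ 3 * D"
    using C1 D0 by (intro add_mono mult_mono kappa_diff kappa_le sincos_le sincos_diff near_le cubics_diff n D s) auto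
  also have "\<dots> = 2720 * C ^ 9 * D + 160 * (C ^ 6 * D) + 10 * (C ^ 3 * D)" by (simp add: eval_nat_numeral mult_ac)
  also have "\<dots> \<le> 2720 * C ^ 9 * D + 160 * (C ^ 9 * D) + 10 * (C ^ 9 * D)"
    using D0 C_pow[of 6 9] C_pow[of 3 9] by (intro add_mono mult_left_mono mult_right_mono) auto
  finally show ?thesis by (simp add: mult_ac)
qed

end

lemma airy_kernel_continuous:
  assumes "G > 0" shows "continuous_on S (\<lambda>t. airy_kernel bc G s t)"
  unfolding airy_kernel_def using assms by (intro continuous_intros) auto

text \<open>Variation of constants, integrated from the free end.\<close>

lemma volterra_solution:
  fixes h :: "real \<Rightarrow> real" and bc :: support
  assumes G: "G > 0" and h: "continuous_on {0..1} h"
  defines "u \<equiv> (\<lambda>s. integral {s..1} (\<lambda>t. airy_kernel bc G s t * h t))"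
  obtains u1 where "\<And>s. s \<in> {0..1} \<Longrightarrow> (u has_real_derivative u1 s) (at s within {0..1})"
    "\<And>s. s \<in> {0..1} \<Longrightarrow> (u1 has_real_derivative (A_crit bc G - G * (1 - s)) * u s + h s) (at s within {0..1})"
    "u 1 = 0" "u1 1 = 0"
proof -
  let ?S = "G powr (1/3)" and ?x = "airy_arg (A_crit bc G) G"
  define p q p' q' where "p = (\<lambda>s. airy_f (?x s))" and "q = (\<lambda>s. airy_g (?x s))"
    and "p' = (\<lambda>s. ?S * airy_f' (?x s))" and "q' = (\<lambda>s. ?S * airy_g' (?x s))"
  have Sp: "?S > 0" using G by simp
  define Q where "Q = (\<lambda>s. A_crit bc G - G * (1 - s))"
  have d: "(p has_real_derivative p' s) (at s within T)" "(q has_real_derivative q' s) (at s within T)"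
    "(p' has_real_derivative Q s * p s) (at s within T)" "(q' has_real_derivative Q s * q s) (at s within T)" for s T
  proof -
    show "(p has_real_derivative p' s) (at s within T)" "(q has_real_derivative q' s) (at s within T)"
      unfolding p_def q_def p'_def q'_def by (rule has_field_derivative_at_within, rule airy_compose_deriv[OF G])+
    have e: "?S * (?S * (?x s * y)) = Q s * y" for y
      using airy_arg_mult[OF G, of "A_crit bc G" s] powr_third(2)[OF G] by (simp add: Q_def mult.assoc[symmetric])
    show "(p' has_real_derivative Q s * p s) (at s within T)"
      unfolding p_def p'_def e[symmetric]
      by (rule has_field_derivative_at_within, rule DERIV_cmult, rule airy_compose_deriv[OF G])
    show "(q' has_real_derivative Q s * q s) (at s within T)"
      unfolding q_def q'_def e[symmetric]
      by (rule has_field_derivative_at_within, rule DERIV_cmult, rule airy_compose_deriv[OF G])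
  qed
  have w: "p s * q' s - p' s * q s = ?S" for s
  proof -
    have "p s * q' s - p' s * q s = ?S * (airy_f (?x s) * airy_g' (?x s) - airy_f' (?x s) * airy_g (?x s))"
      unfolding p_def q_def p'_def q'_def by (simp only: right_diff_distrib mult_ac)
    then show ?thesis unfolding airy_wronskian by simp
  qed
  have c: "continuous_on {0..1} p" "continuous_on {0..1} q"
    unfolding p_def q_def by (intro continuous_intros G)+
  have ch: "continuous_on {0..1} (\<lambda>t. p t * h t)" "continuous_on {0..1} (\<lambda>t. q t * h t)"
    by (intro continuous_intros c h)+
  define Ip Iq where "Ip = (\<lambda>s. integral {s..1} (\<lambda>t. p t * h t))" and "Iq = (\<lambda>s. integral {s..1} (\<lambda>t. q t * h t))"
  have tail: "((\<lambda>s. integral {s..1} g) has_real_derivative - g s) (at s within {0..1})"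
    if "continuous_on {0..1} g" "s \<in> {0..1}" for g :: "real \<Rightarrow> real" and s
  proof -
    have eq: "integral {0..1} g - integral {0..x} g = integral {x..1} g" if "x \<in> {0..1}" for x
      using Henstock_Kurzweil_Integration.integral_combine[of 0 x 1 g] that integrable_continuous_real[OF \<open>continuous_on {0..1} g\<close>] by auto
    have "((\<lambda>s. integral {0..1} g - integral {0..s} g) has_real_derivative 0 - g s) (at s within {0..1})"
      by (intro derivative_intros integral_has_real_derivative that)
    then have "((\<lambda>s. integral {0..1} g - integral {0..s} g) has_real_derivative - g s) (at s within {0..1})" by simp
    then show ?thesis
      by (rule has_field_derivative_transform_within[where d=1]) (use eq that in auto)
  qed
  note dI = tail[OF ch(1), folded Ip_def] tail[OF ch(2), folded Iq_def]
  have u: "u s = (p s * Iq s - q s * Ip s) / ?S" if s: "s \<in> {0..1}" for s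
  proof -
    have i: "(\<lambda>t. c * (q t * h t)) integrable_on {s..1}" "(\<lambda>t. c * (p t * h t)) integrable_on {s..1}" for c
      by (rule integrable_continuous_real, rule continuous_on_mult_left, rule continuous_on_subset[OF ch(2)], use s in auto)
         (rule integrable_continuous_real, rule continuous_on_mult_left, rule continuous_on_subset[OF ch(1)], use s in auto)
    have "airy_kernel bc G s t * h t = (p s / ?S) * (q t * h t) - (q s / ?S) * (p t * h t)" for t
      unfolding airy_kernel_def p_def q_def by (simp add: diff_divide_distrib algebra_simps)
    then have "u s = integral {s..1} (\<lambda>t. (p s / ?S) * (q t * h t) - (q s / ?S) * (p t * h t))"
      unfolding u_def by simp
    also have "\<dots> = (p s / ?S) * Iq s - (q s / ?S) * Ip s"
      unfolding Ip_def Iq_def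
      by (subst Henstock_Kurzweil_Integration.integral_diff[OF i]) simp
    finally show ?thesis by (simp add: diff_divide_distrib)
  qed
  define u1 where "u1 = (\<lambda>s. (p' s * Iq s - q' s * Ip s) / ?S)"
  show ?thesis
  proof (rule that[of u1])
    fix s :: real assume s: "s \<in> {0..1}"
    have "((\<lambda>s. (p s * Iq s - q s * Ip s) / ?S) has_real_derivative
       ((p' s * Iq s + (- (q s * h s)) * p s) - (q' s * Ip s + (- (p s * h s)) * q s)) / ?S) (at s within {0..1})"
      by (intro DERIV_cdivide DERIV_diff DERIV_mult d dI s)
    then have "((\<lambda>s. (p s * Iq s - q s * Ip s) / ?S) has_real_derivative u1 s) (at s within {0..1})"
      by (simp add: u1_def mult_ac)
    then show "(u has_real_derivative u1 s) (at s within {0..1})"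
      by (rule has_field_derivative_transform_within[where d=1]) (use u s in auto)
    have "(u1 has_real_derivative
       ((Q s * p s * Iq s + (- (q s * h s)) * p' s) - (Q s * q s * Ip s + (- (p s * h s)) * q' s)) / ?S) (at s within {0..1})"
      unfolding u1_def by (intro DERIV_cdivide DERIV_diff DERIV_mult d dI s)
    moreover have "((Q s * p s * Iq s + (- (q s * h s)) * p' s) - (Q s * q s * Ip s + (- (p s * h s)) * q' s)) / ?S
        = (Q s * (p s * Iq s - q s * Ip s) + h s * (p s * q' s - p' s * q s)) / ?S"
      by (simp add: algebra_simps)
    moreover have "\<dots> = Q s * u s + h s" unfolding w u[OF s] using Sp by (simp add: add_divide_distrib)
    ultimately show "(u1 has_real_derivative (A_crit bc G - G * (1 - s)) * u s + h s) (at s within {0..1})"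
      unfolding Q_def by simp
  next
    show "u 1 = 0" by (simp add: u_def)
    show "u1 1 = 0" by (simp add: u1_def Ip_def Iq_def)
  qed
qed

context branch_point
begin

lemma tail_integrable_cont: "near \<psi> \<Longrightarrow> s \<in> {0..1} \<Longrightarrow> continuous_on {s..1} (\<lambda>t. airy_kernel bc G s t * branch_rhs bc G r \<psi> t)"
  by (intro continuous_intros airy_kernel_continuous G continuous_on_subset[OF rhs_cont]) auto

lemma mult_ker_le: "\<bar>x\<bar> \<le> B \<Longrightarrow> s \<in> {0..1} \<Longrightarrow> t \<in> {0..1} \<Longrightarrow> \<bar>airy_kernel bc G s t * x\<bar> \<le> C * B"
  using ker_le[of s t] C1 by (auto simp: abs_mult intro!: mult_mono)

lemma step_near_bound:
  assumes n: "near \<psi>" and s: "s \<in> {0..1}"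
  shows "\<bar>branch_step bc G r \<psi> s - buckling_mode bc G s\<bar> \<le> 1 / (4 * C\<^sup>2)"
proof -
  have "\<bar>integral {s..1} (\<lambda>t. airy_kernel bc G s t * branch_rhs bc G r \<psi> t)\<bar> \<le> C * (340 * C ^ 7)"
    using s by (intro integral_abs_le tail_integrable_cont n mult_ker_le rhs_le) auto
  then have "\<bar>branch_step bc G r \<psi> s - buckling_mode bc G s\<bar> \<le> r\<^sup>2 * (C * (340 * C ^ 7))"
    by (auto simp: branch_step_def abs_mult intro!: mult_left_mono)
  also have "\<dots> \<le> 1 / (4 * C\<^sup>2)"
  proof -
    have "r\<^sup>2 * (C * (340 * C ^ 7)) * (4 * C\<^sup>2) = 1360 * (r\<^sup>2 * C ^ 10)" by (simp add: eval_nat_numeral)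
    also have "\<dots> \<le> 1" using r_C[of 10] by simp
    finally show ?thesis using C1 by (subst pos_le_divide_eq) auto
  qed
  finally show ?thesis .
qed

lemma step_solution:
  assumes n: "near \<psi>"
  obtains v1 where "\<And>s. s \<in> {0..1} \<Longrightarrow> (branch_step bc G r \<psi> has_real_derivative v1 s) (at s within {0..1})"
    "\<And>s. s \<in> {0..1} \<Longrightarrow> (v1 has_real_derivative
        (A_crit bc G - G * (1 - s)) * branch_step bc G r \<psi> s + r\<^sup>2 * branch_rhs bc G r \<psi> s) (at s within {0..1})"
    "branch_step bc G r \<psi> 1 = 1" "v1 1 = 0"
proof -
  obtain u1 where u1: "\<And>s. s \<in> {0..1} \<Longrightarrow> ((\<lambda>s. integral {s..1} (\<lambda>t. airy_kernel bc G s t * branch_rhs bc G r \<psi> t)) has_real_derivative u1 s) (at s within {0..1})"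
    "\<And>s. s \<in> {0..1} \<Longrightarrow> (u1 has_real_derivative (A_crit bc G - G * (1 - s)) * integral {s..1} (\<lambda>t. airy_kernel bc G s t * branch_rhs bc G r \<psi> t) + branch_rhs bc G r \<psi> s) (at s within {0..1})"
    "integral {1..1} (\<lambda>t. airy_kernel bc G 1 t * branch_rhs bc G r \<psi> t) = 0" "u1 1 = 0"
  proof (rule volterra_solution[OF G rhs_cont[OF n], of bc], goal_cases)
    case (1 u1) from 1(2-) show ?thesis by (rule that)
  qed
  show ?thesis
  proof (rule that[of "\<lambda>s. buckling_mode' bc G s + r\<^sup>2 * u1 s"])
    fix s :: real assume s: "s \<in> {0..1}"
    show "(branch_step bc G r \<psi> has_real_derivative buckling_mode' bc G s + r\<^sup>2 * u1 s) (at s within {0..1})"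
      unfolding branch_step_def[abs_def]
      by (intro DERIV_add DERIV_cmult u1 s has_field_derivative_at_within[OF buckling_mode_deriv(1)] G)
    have "((\<lambda>s. buckling_mode' bc G s + r\<^sup>2 * u1 s) has_real_derivative
      (A_crit bc G - G * (1 - s)) * buckling_mode bc G s + r\<^sup>2 * ((A_crit bc G - G * (1 - s)) * integral {s..1} (\<lambda>t. airy_kernel bc G s t * branch_rhs bc G r \<psi> t) + branch_rhs bc G r \<psi> s)) (at s within {0..1})"
      by (intro DERIV_add DERIV_cmult u1 s has_field_derivative_at_within[OF buckling_mode_deriv(2)] G)
    then show "((\<lambda>s. buckling_mode' bc G s + r\<^sup>2 * u1 s) has_real_derivative
        (A_crit bc G - G * (1 - s)) * branch_step bc G r \<psi> s + r\<^sup>2 * branch_rhs bc G r \<psi> s) (at s within {0..1})"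
      by (simp add: branch_step_def algebra_simps)
  qed (use u1 in \<open>auto simp: branch_step_def\<close>)
qed

lemma step_near: "near \<psi> \<Longrightarrow> near (branch_step bc G r \<psi>)"
proof -
  assume n: "near \<psi>"
  obtain v1 where "\<And>s. s \<in> {0..1} \<Longrightarrow> (branch_step bc G r \<psi> has_real_derivative v1 s) (at s within {0..1})"
  proof (rule step_solution[OF n], goal_cases)
    case (1 v1) show ?thesis by (rule that) (rule 1(2))
  qed
  then have "continuous_on {0..1} (branch_step bc G r \<psi>)" by (rule DERIV_continuous_on)
  then show ?thesis using step_near_bound[OF n] by (simp add: near_def)
qed

text \<open>The Lipschitz factor is \<open>2890 * r^2 * C ^ 10\<close>, at most 0.289 by the choice
  of the radius.\<close>

lemma step_diff:
  assumes n: "near \<psi>" "near \<omega>" and D: "\<And>s. s \<in> {0..1} \<Longrightarrow> \<bar>\<psi> s - \<omega> s\<bar> \<le> D" and s: "s \<in> {0..1}"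
  shows "\<bar>branch_step bc G r \<psi> s - branch_step bc G r \<omega> s\<bar> \<le> D / 2"
proof -
  have D0: "D \<ge> 0" using D[of 0] by simp
  have i: "(\<lambda>t. airy_kernel bc G s t * branch_rhs bc G r \<psi>' t) integrable_on {s..1}" if "near \<psi>'" for \<psi>'
    by (rule integrable_continuous_real[OF tail_integrable_cont[OF that s]])
  have eq: "branch_step bc G r \<psi> s - branch_step bc G r \<omega> s =
     r\<^sup>2 * integral {s..1} (\<lambda>t. airy_kernel bc G s t * (branch_rhs bc G r \<psi> t - branch_rhs bc G r \<omega> t))"
    unfolding branch_step_def right_diff_distrib
    using Henstock_Kurzweil_Integration.integral_diff[OF i[OF n(1)] i[OF n(2)]] by (simp add: right_diff_distrib)
  have "\<bar>branch_step bc G r \<psi> s - branch_step bc G r \<omega> s\<bar>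
      = r\<^sup>2 * \<bar>integral {s..1} (\<lambda>t. airy_kernel bc G s t * (branch_rhs bc G r \<psi> t - branch_rhs bc G r \<omega> t))\<bar>"
    unfolding eq abs_mult by simp
  also have "\<dots> \<le> r\<^sup>2 * (C * (2890 * C ^ 9 * D))"
  proof (rule mult_left_mono)
    show "\<bar>integral {s..1} (\<lambda>t. airy_kernel bc G s t * (branch_rhs bc G r \<psi> t - branch_rhs bc G r \<omega> t))\<bar>
        \<le> C * (2890 * C ^ 9 * D)"
    proof (rule integral_abs_le)
      show "continuous_on {s..1} (\<lambda>t. airy_kernel bc G s t * (branch_rhs bc G r \<psi> t - branch_rhs bc G r \<omega> t))"
        by (rule continuous_on_mult[OF airy_kernel_continuous[OF G]
              continuous_on_diff[OF continuous_on_subset[OF rhs_cont[OF n(1)]] continuous_on_subset[OF rhs_cont[OF n(2)]]]])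
           (use s in auto)
      fix t assume "t \<in> {s..1}"
      then have t: "t \<in> {0..1}" using s by auto
      show "\<bar>airy_kernel bc G s t * (branch_rhs bc G r \<psi> t - branch_rhs bc G r \<omega> t)\<bar> \<le> C * (2890 * C ^ 9 * D)"
        by (rule mult_ker_le[OF rhs_diff[OF n D t] s t])
    next
      show "0 \<le> s" "s \<le> 1" "(1::real) \<le> 1" using s by auto
    qed
  qed simp
  also have "\<dots> = 2890 * (r\<^sup>2 * C ^ 10) * D" by (simp add: eval_nat_numeral)
  also have "\<dots> \<le> 2890 * (1 / 10000) * D" using r_C[of 10] D0 by (intro mult_right_mono mult_left_mono) auto
  finally show ?thesis using D0 by simp
qed

end

definition branch_iter :: "support \<Rightarrow> real \<Rightarrow> real \<Rightarrow> nat \<Rightarrow> real \<Rightarrow> real" where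
  "branch_iter bc G r n = (branch_step bc G r ^^ n) (buckling_mode bc G)"

lemma branch_iter_simps [simp]:
  "branch_iter bc G r 0 = buckling_mode bc G"
  "branch_iter bc G r (Suc n) = branch_step bc G r (branch_iter bc G r n)"
  by (simp_all add: branch_iter_def)

text \<open>The limit of the Picard iterates, written as a telescoping series so that uniform
  convergence follows from a majorant of the increments.\<close>

definition branch_profile :: "support \<Rightarrow> real \<Rightarrow> real \<Rightarrow> real \<Rightarrow> real" where
  "branch_profile bc G r s = buckling_mode bc G s + (\<Sum>n. branch_iter bc G r (Suc n) s - branch_iter bc G r n s)"

definition branch_parameter :: "support \<Rightarrow> real \<Rightarrow> real \<Rightarrow> real" where
  "branch_parameter bc G r = A_crit bc G + r\<^sup>2 * kappa bc G r (branch_profile bc G r)"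

context branch_point
begin

lemma iter_near: "near (branch_iter bc G r n)"
  by (induction n) (simp_all add: near_phi step_near)

lemma iter_diff: "s \<in> {0..1} \<Longrightarrow> \<bar>branch_iter bc G r (Suc n) s - branch_iter bc G r n s\<bar> \<le> (1 / 2) ^ n"
proof (induction n arbitrary: s)
  case 0
  have "1 * 1 \<le> 4 * C\<^sup>2" using C1 by (intro mult_mono) auto
  then have "1 / (4 * C\<^sup>2) \<le> 1" by (simp add: divide_simps)
  then show ?case using step_near_bound[OF near_phi 0] by simp
next
  case (Suc n)
  have "\<bar>branch_step bc G r (branch_iter bc G r (Suc n)) s - branch_step bc G r (branch_iter bc G r n) s\<bar> \<le> (1 / 2) ^ n / 2"
    by (rule step_diff[OF iter_near iter_near Suc.IH Suc.prems])
  then show ?case by simp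
qed

end

text \<open>The increments are bounded by \<open>(1/2) ^ n\<close>, whatever the constant
  \<open>C\<close> of each parameter point is. Convergence is therefore uniform even where
  \<open>C\<close> is unbounded, and joint continuity in all parameters passes to the limit.\<close>

lemma branch_iter_uniform_limit:
  assumes "\<And>G r s. ((G, r), s) \<in> X \<Longrightarrow> s \<in> {0..1} \<and> (\<exists>C. branch_point bc G r C)"
  shows "uniform_limit X (\<lambda>n x. branch_iter bc (fst (fst x)) (snd (fst x)) n (snd x))
    (\<lambda>x. branch_profile bc (fst (fst x)) (snd (fst x)) (snd x)) sequentially"
proof -
  let ?f = "\<lambda>n x. branch_iter bc (fst (fst x)) (snd (fst x)) (Suc n) (snd x) - branch_iter bc (fst (fst x)) (snd (fst x)) n (snd x)"
  have "uniform_limit X (\<lambda>n x. \<Sum>i<n. ?f i x) (\<lambda>x. \<Sum>i. ?f i x) sequentially"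
  proof (rule Weierstrass_m_test)
    fix n x assume "x \<in> X"
    then obtain G r s where x: "x = ((G, r), s)" "((G, r), s) \<in> X" by (metis prod.collapse)
    then obtain C where "branch_point bc G r C" "s \<in> {0..1}" using assms by blast
    then show "norm (?f n x) \<le> (1 / 2) ^ n" using branch_point.iter_diff[of bc G r C s n] by (simp add: x)
  qed (simp add: summable_geometric)
  then have "uniform_limit X (\<lambda>n x. buckling_mode bc (fst (fst x)) (snd x) + (\<Sum>i<n. ?f i x))
     (\<lambda>x. buckling_mode bc (fst (fst x)) (snd x) + (\<Sum>i. ?f i x)) sequentially"
    by (intro uniform_limit_intros)
  moreover have "buckling_mode bc (fst (fst x)) (snd x) + (\<Sum>i<n. ?f i x) = branch_iter bc (fst (fst x)) (snd (fst x)) n (snd x)" for n x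
  proof -
    have "(\<Sum>i<n. ?f i x) = branch_iter bc (fst (fst x)) (snd (fst x)) n (snd x) - branch_iter bc (fst (fst x)) (snd (fst x)) 0 (snd x)"
      by (rule sum_lessThan_telescope)
    then show ?thesis by simp
  qed
  ultimately show ?thesis unfolding branch_profile_def by simp
qed

context branch_point
begin

lemma profile_uniform: "uniform_limit {0..1} (branch_iter bc G r) (branch_profile bc G r) sequentially"
proof -
  have "uniform_limit ({(G, r)} \<times> {0..1}) (\<lambda>n x. branch_iter bc (fst (fst x)) (snd (fst x)) n (snd x))
    (\<lambda>x. branch_profile bc (fst (fst x)) (snd (fst x)) (snd x)) sequentially"
    by (rule branch_iter_uniform_limit) (use branch_point_axioms in auto)
  then show ?thesis unfolding uniform_limit_iff by auto
qed

lemma profile_limit: "s \<in> {0..1} \<Longrightarrow> (\<lambda>n. branch_iter bc G r n s) \<longlonglongrightarrow> branch_profile bc G r s"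
  by (rule tendsto_uniform_limitI[OF profile_uniform])

lemma profile_near: "near (branch_profile bc G r)"
proof -
  have "continuous_on {0..1} (branch_profile bc G r)"
    by (rule uniform_limit_theorem[OF _ profile_uniform]) (use iter_near near_cont in auto)
  moreover have "\<bar>branch_profile bc G r s - buckling_mode bc G s\<bar> \<le> 1 / (4 * C\<^sup>2)" if s: "s \<in> {0..1}" for s
  proof (rule LIMSEQ_le_const2)
    show "(\<lambda>n. \<bar>branch_iter bc G r n s - buckling_mode bc G s\<bar>) \<longlonglongrightarrow> \<bar>branch_profile bc G r s - buckling_mode bc G s\<bar>"
      by (intro tendsto_intros profile_limit s)
    show "\<exists>N. \<forall>n\<ge>N. \<bar>branch_iter bc G r n s - buckling_mode bc G s\<bar> \<le> 1 / (4 * C\<^sup>2)"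
      using iter_near s unfolding near_def by blast
  qed
  ultimately show ?thesis by (simp add: near_def)
qed

lemma profile_fixed_point:
  assumes s: "s \<in> {0..1}"
  shows "branch_profile bc G r s = branch_step bc G r (branch_profile bc G r) s"
proof -
  have "(\<lambda>n. branch_step bc G r (branch_iter bc G r n) s) \<longlonglongrightarrow> branch_step bc G r (branch_profile bc G r) s"
  proof (rule metric_LIMSEQ_I)
    fix e :: real assume e: "e > 0"
    then have "eventually (\<lambda>n. \<forall>s\<in>{0..1}. dist (branch_iter bc G r n s) (branch_profile bc G r s) < e) sequentially"
      using profile_uniform unfolding uniform_limit_iff by blast
    then obtain N where N: "\<And>n s. n \<ge> N \<Longrightarrow> s \<in> {0..1} \<Longrightarrow> dist (branch_iter bc G r n s) (branch_profile bc G r s) < e"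
      unfolding eventually_sequentially by blast
    show "\<exists>N. \<forall>n\<ge>N. dist (branch_step bc G r (branch_iter bc G r n) s) (branch_step bc G r (branch_profile bc G r) s) < e"
    proof (intro exI allI impI)
      fix n assume n: "n \<ge> N"
      have "\<bar>branch_step bc G r (branch_iter bc G r n) s - branch_step bc G r (branch_profile bc G r) s\<bar> \<le> e / 2"
        by (rule step_diff[OF iter_near profile_near _ s]) (use N[OF n] in \<open>force simp: dist_real_def\<close>)
      then show "dist (branch_step bc G r (branch_iter bc G r n) s) (branch_step bc G r (branch_profile bc G r) s) < e"
        using e by (simp add: dist_real_def)
    qed
  qed
  moreover have "(\<lambda>n. branch_step bc G r (branch_iter bc G r n) s) \<longlonglongrightarrow> branch_profile bc G r s"
    using LIMSEQ_Suc[OF profile_limit[OF s]] by simp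
  ultimately show ?thesis using LIMSEQ_unique by blast
qed

lemma rhs_orthogonal:
  assumes "near \<psi>"
  shows "integral {0..1} (\<lambda>s. branch_rhs bc G r \<psi> s * buckling_mode bc G s) = 0"
proof -
  have "kappa_den bc G r \<psi> > 0" using den_ge[OF assms] C1 by (smt (verit) divide_pos_pos)
  then have k: "kappa bc G r \<psi> * kappa_den bc G r \<psi> = kappa_num bc G r \<psi>" by (simp add: kappa_def)
  have "integral {0..1} (\<lambda>s. branch_rhs bc G r \<psi> s * buckling_mode bc G s) =
    integral {0..1} (\<lambda>s. kappa bc G r \<psi> * (sincos_part r (\<psi> s) * buckling_mode bc G s) - cubics \<psi> s * buckling_mode bc G s)"
    unfolding rhs_eq by (simp add: algebra_simps)
  also have "\<dots> = kappa bc G r \<psi> * kappa_den bc G r \<psi> - kappa_num bc G r \<psi>"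
    unfolding num_eq kappa_den_def
    by (subst Henstock_Kurzweil_Integration.integral_diff)
      (auto intro!: integrable_continuous_real continuous_intros sincos_cont cubics_cont phi_cont assms)
  finally show ?thesis using k by simp
qed

text \<open>The Volterra equation prescribes data at the free end only. The Wronskian of profile and
  mode vanishes there, and its change along the rod is the integral of \<open>branch_rhs\<close>
  against the mode, which \<open>kappa\<close> makes zero. Hence it vanishes at \<open>s = 0\<close>
  as well, where exactly one of value and slope of the mode is zero, and the profile inherits that
  condition.\<close>

lemma profile_solution:
  obtains v1 where "\<And>s. s \<in> {0..1} \<Longrightarrow> (branch_profile bc G r has_real_derivative v1 s) (at s within {0..1})"
    "\<And>s. s \<in> {0..1} \<Longrightarrow> (v1 has_real_derivative
        branch_parameter bc G r * sincos_part r (branch_profile bc G r s)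
        - G * (1 - s) * (branch_profile bc G r s - r\<^sup>2 * cub r (branch_profile bc G r s))) (at s within {0..1})"
    "branch_profile bc G r 1 = 1" "v1 1 = 0"
    "bc = Clamped \<Longrightarrow> branch_profile bc G r 0 = 0" "bc = Pinned \<Longrightarrow> v1 0 = 0"
proof -
  let ?psi = "branch_profile bc G r"
  note n = profile_near
  obtain v1 where v1: "\<And>s. s \<in> {0..1} \<Longrightarrow> (branch_step bc G r ?psi has_real_derivative v1 s) (at s within {0..1})"
    "\<And>s. s \<in> {0..1} \<Longrightarrow> (v1 has_real_derivative
        (A_crit bc G - G * (1 - s)) * branch_step bc G r ?psi s + r\<^sup>2 * branch_rhs bc G r ?psi s) (at s within {0..1})"
    "branch_step bc G r ?psi 1 = 1" "v1 1 = 0"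
  proof (rule step_solution[OF n], goal_cases)
    case (1 v1) from 1(2-) show ?thesis by (rule that)
  qed
  have d1: "(?psi has_real_derivative v1 s) (at s within {0..1})" if "s \<in> {0..1}" for s
    by (rule has_field_derivative_transform_within[OF v1(1)[OF that], where d=1])
       (use that profile_fixed_point in auto)
  have d2: "(v1 has_real_derivative (A_crit bc G - G * (1 - s)) * ?psi s + r\<^sup>2 * branch_rhs bc G r ?psi s) (at s within {0..1})"
    if "s \<in> {0..1}" for s using v1(2)[OF that] profile_fixed_point[OF that] by simp
  let ?W = "\<lambda>s. v1 s * buckling_mode bc G s - ?psi s * buckling_mode' bc G s"
  have "((\<lambda>s. r\<^sup>2 * (branch_rhs bc G r ?psi s * buckling_mode bc G s)) has_integral (?W 1 - ?W 0)) {0..1}"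
  proof (rule fundamental_theorem_of_calculus)
    fix s :: real assume s: "s \<in> {0..1}"
    have "(?W has_real_derivative
       (((A_crit bc G - G * (1 - s)) * ?psi s + r\<^sup>2 * branch_rhs bc G r ?psi s) * buckling_mode bc G s + buckling_mode' bc G s * v1 s)
       - (v1 s * buckling_mode' bc G s + ((A_crit bc G - G * (1 - s)) * buckling_mode bc G s) * ?psi s)) (at s within {0..1})"
      by (intro DERIV_diff DERIV_mult d1 d2 s has_field_derivative_at_within[OF buckling_mode_deriv(1)]
          has_field_derivative_at_within[OF buckling_mode_deriv(2)] G)
    then show "(?W has_vector_derivative r\<^sup>2 * (branch_rhs bc G r ?psi s * buckling_mode bc G s)) (at s within {0..1})"
      by (simp add: has_real_derivative_iff_has_vector_derivative algebra_simps)
  qed simp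
  moreover have "integral {0..1} (\<lambda>s. r\<^sup>2 * (branch_rhs bc G r ?psi s * buckling_mode bc G s)) = 0"
    using rhs_orthogonal[OF n] by simp
  ultimately have "?W 1 - ?W 0 = 0" by (metis integral_unique)
  then have W0: "v1 0 * buckling_mode bc G 0 = ?psi 0 * buckling_mode' bc G 0"
    using v1(4) by simp
  show ?thesis
  proof (rule that[of v1])
    show "bc = Clamped \<Longrightarrow> ?psi 0 = 0"
      using W0 buckling_mode_Clamped[OF G] by auto
    show "bc = Pinned \<Longrightarrow> v1 0 = 0"
      using W0 buckling_mode_Pinned[OF G] by auto
    show "?psi 1 = 1" using v1(3) profile_fixed_point[of 1] by simp
    fix s :: real assume s: "s \<in> {0..1}"
    have "(A_crit bc G - G * (1 - s)) * ?psi s + r\<^sup>2 * branch_rhs bc G r ?psi s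
      = branch_parameter bc G r * sincos_part r (?psi s) - G * (1 - s) * (?psi s - r\<^sup>2 * cub r (?psi s))"
      unfolding branch_parameter_def branch_rhs_def sincos_part_def by (simp add: algebra_simps)
    then show "(v1 has_real_derivative branch_parameter bc G r * sincos_part r (?psi s)
        - G * (1 - s) * (?psi s - r\<^sup>2 * cub r (?psi s))) (at s within {0..1})" using d2[OF s] by simp
  qed (use d1 v1 in auto)
qed

end

section \<open>Joint continuity in gravity, amplitude and arclength\<close>

lemma A_crit_continuous: "continuous_on {0<..} (A_crit bc)"
  unfolding A_crit_def[abs_def] by (intro continuous_intros beta0_continuous)

lemma A_crit_continuous_compose:
  assumes "continuous_on S g" "\<And>x. x \<in> S \<Longrightarrow> g x > 0"
  shows "continuous_on S (\<lambda>x. A_crit bc (g x))"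
  by (rule continuous_on_compose2[OF A_crit_continuous assms(1)]) (use assms(2) in auto)

lemma buckling_mode_continuous:
  assumes "continuous_on S g" "continuous_on S h" "\<And>x. x \<in> S \<Longrightarrow> g x > 0"
  shows "continuous_on S (\<lambda>x. buckling_mode bc (g x) (h x))"
  unfolding buckling_mode_def
  by (rule lin_sol_continuous(1)[OF A_crit_continuous_compose[OF assms(1,3)] assms])

lemma powr_continuous_pos:
  fixes g :: "'a::topological_space \<Rightarrow> real"
  assumes "continuous_on S g" "\<And>x. x \<in> S \<Longrightarrow> g x > 0"
  shows "continuous_on S (\<lambda>x. g x powr a)"
  by (intro continuous_on_powr assms(1) continuous_on_const) (use assms(2) in force)

lemma airy_kernel_continuous_compose:
  assumes "continuous_on S g" "continuous_on S h" "continuous_on S k" "\<And>x. x \<in> S \<Longrightarrow> g x > 0"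
  shows "continuous_on S (\<lambda>x. airy_kernel bc (g x) (h x) (k x))"
  unfolding airy_kernel_def
  by (intro continuous_on_divide continuous_on_diff continuous_on_mult airy_continuous_compose
      airy_arg_continuous[OF A_crit_continuous_compose[OF assms(1,4)] assms(1,2,4)]
      airy_arg_continuous[OF A_crit_continuous_compose[OF assms(1,4)] assms(1,3,4)] powr_continuous_pos[OF assms(1,4)])
     (use assms(4) in \<open>auto dest: assms(4)\<close>)

lemma abs_pser_le:
  assumes "\<And>k. c k \<ge> 0" "\<And>z. summable (\<lambda>k. c k * z ^ k)" "\<bar>z\<bar> \<le> w"
  shows "\<bar>pser c z\<bar> \<le> pser c w"
proof -
  have le: "\<bar>c k * z ^ k\<bar> \<le> c k * w ^ k" for k
    using assms(1)[of k] assms(3) by (auto simp: abs_mult power_abs intro!: mult_left_mono power_mono)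
  have s: "summable (\<lambda>k. \<bar>c k * z ^ k\<bar>)"
    by (rule summable_comparison_test'[OF assms(2)[of w]]) (use le in auto)
  have "\<bar>pser c z\<bar> \<le> (\<Sum>k. \<bar>c k * z ^ k\<bar>)" unfolding pser_def by (rule summable_rabs[OF s])
  also have "\<dots> \<le> pser c w" unfolding pser_def by (rule suminf_le[OF le s assms(2)])
  finally show ?thesis .
qed

lemma airy_abs_le:
  assumes "\<bar>x\<bar> \<le> X"
  shows "\<bar>airy_f x\<bar> \<le> airy_f X" "\<bar>airy_g x\<bar> \<le> airy_g X" "\<bar>airy_f' x\<bar> \<le> airy_f' X" "\<bar>airy_g' x\<bar> \<le> airy_g' X"
proof -
  have z: "\<bar>x ^ 3\<bar> \<le> X ^ 3" "\<bar>x\<^sup>2\<bar> \<le> X\<^sup>2" unfolding power_abs using assms by (intro power_mono; simp)+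
  have X0: "X \<ge> 0" using assms by simp
  have p: "\<bar>pser airy_a (x ^ 3)\<bar> \<le> pser airy_a (X ^ 3)" "\<bar>pser airy_b (x ^ 3)\<bar> \<le> pser airy_b (X ^ 3)"
    "\<bar>pser (diffs airy_a) (x ^ 3)\<bar> \<le> pser (diffs airy_a) (X ^ 3)" "\<bar>pser (diffs airy_b) (x ^ 3)\<bar> \<le> pser (diffs airy_b) (X ^ 3)"
    by (rule abs_pser_le[OF _ _ z(1)]; use airy_a_pos airy_b_pos diffs_pos summable_airy_a summable_airy_b summable_diffs_a summable_diffs_b in \<open>auto intro: less_imp_le\<close>)+
  show "\<bar>airy_f x\<bar> \<le> airy_f X" using p by (simp add: airy_f_pser)
  show "\<bar>airy_g x\<bar> \<le> airy_g X" using p assms by (auto simp: airy_g_pser abs_mult intro!: mult_mono)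
  show "\<bar>airy_f' x\<bar> \<le> airy_f' X" using p z X0 by (auto simp: airy_f'_def abs_mult intro!: mult_mono)
  have "\<bar>airy_g' x\<bar> \<le> \<bar>pser airy_b (x ^ 3)\<bar> + 3 * \<bar>x ^ 3\<bar> * \<bar>pser (diffs airy_b) (x ^ 3)\<bar>"
    unfolding airy_g'_def by (rule order_trans[OF abs_triangle_ineq]) (simp add: abs_mult)
  also have "\<dots> \<le> airy_g' X" unfolding airy_g'_def using p z X0 by (intro add_mono mult_mono) auto
  finally show "\<bar>airy_g' x\<bar> \<le> airy_g' X" .
qed

text \<open>\<open>X\<close> bounds \<open>\<bar>airy_arg\<bar>\<close> along the rod, and since all
  coefficients are positive the series at \<open>X\<close> dominate the series at all such
  arguments. An explicit formula makes continuity in \<open>G\<close> immediate.\<close>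

definition airy_bound :: "support \<Rightarrow> real \<Rightarrow> real" where
  "airy_bound bc G = (let X = (\<bar>A_crit bc G\<bar> + G) / G powr (2/3) in airy_f X + airy_g X + airy_f' X + airy_g' X)"

text \<open>A sum of nonnegative terms, so that each clause of \<open>mode_bound\<close> is covered
  by one of them and continuity in \<open>G\<close> is inherited from each.\<close>

definition mode_const :: "support \<Rightarrow> real \<Rightarrow> real" where
  "mode_const bc G = 1 + 2 * (airy_bound bc G)\<^sup>2 + 2 * (airy_bound bc G)\<^sup>2 / G powr (1/3) + \<bar>A_crit bc G\<bar> + G
     + 1 / integral {0..1} (\<lambda>s. (buckling_mode bc G s)\<^sup>2)"

lemma buckling_mass_pos:
  assumes "G > 0"
  shows "integral {0..1} (\<lambda>s. (buckling_mode bc G s)\<^sup>2) > 0"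
proof -
  have c: "continuous_on {0..1} (\<lambda>s. (buckling_mode bc G s)\<^sup>2)" by (intro continuous_intros buckling_mode_continuous_s assms)
  show ?thesis
    using integral_Icc_pos[OF c, of 1] set_borel_integral_eq_integral(2)[OF set_integrable_continuous[OF c]] by simp
qed

lemma mode_const_bound:
  assumes G: "G > 0"
  shows "mode_bound bc G (mode_const bc G)"
proof -
  let ?A = "A_crit bc G"
  define X where "X = (\<bar>?A\<bar> + G) / G powr (2/3)"
  define E where "E = airy_bound bc G"
  define m where "m = integral {0..1} (\<lambda>s. (buckling_mode bc G s)\<^sup>2)"
  have m: "m > 0" unfolding m_def by (rule buckling_mass_pos[OF G])
  have X0: "X \<ge> 0" using G by (simp add: X_def)
  have E: "E = airy_f X + airy_g X + airy_f' X + airy_g' X" unfolding E_def airy_bound_def X_def Let_def ..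
  have nn: "airy_f X \<ge> 0" "airy_g X \<ge> 0" "airy_f' X \<ge> 0" "airy_g' X \<ge> 0" using airy_pos[OF X0] X0 by linarith+
  then have E0: "E \<ge> 0" unfolding E by simp
  have arg: "\<bar>airy_arg ?A G s\<bar> \<le> X" if "s \<in> {0..1}" for s
  proof -
    have "G * (1 - s) \<le> G" "G * (1 - s) \<ge> 0" using that G by (auto simp: mult_left_le)
    then have "\<bar>?A - G * (1 - s)\<bar> \<le> \<bar>?A\<bar> + G" by linarith
    then show ?thesis unfolding airy_arg_def X_def by (simp add: abs_divide divide_right_mono)
  qed
  have b: "\<bar>airy_f (airy_arg ?A G s)\<bar> \<le> E" "\<bar>airy_g (airy_arg ?A G s)\<bar> \<le> E"
      "\<bar>airy_f' (airy_arg ?A G s)\<bar> \<le> E" "\<bar>airy_g' (airy_arg ?A G s)\<bar> \<le> E" if "s \<in> {0..1}" for s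
    using airy_abs_le[OF arg[OF that]] nn unfolding E by linarith+
  have prod: "\<bar>x * y - z * w\<bar> \<le> 2 * E\<^sup>2" if "\<bar>x\<bar> \<le> E" "\<bar>y\<bar> \<le> E" "\<bar>z\<bar> \<le> E" "\<bar>w\<bar> \<le> E" for x y z w
  proof -
    have "\<bar>x\<bar> * \<bar>y\<bar> \<le> E * E" "\<bar>z\<bar> * \<bar>w\<bar> \<le> E * E" using that E0 by (intro mult_mono; simp)+
    then have "\<bar>x * y\<bar> \<le> E * E" "\<bar>z * w\<bar> \<le> E * E" by (simp_all add: abs_mult)
    then show ?thesis unfolding power2_eq_square by linarith
  qed
  have phi: "\<bar>buckling_mode bc G s\<bar> \<le> 2 * E\<^sup>2" if "s \<in> {0..1}" for s
    unfolding buckling_mode_def lin_sol_def by (rule prod) (use b that b[of 1] in auto)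
  have ker: "\<bar>airy_kernel bc G s t\<bar> \<le> 2 * E\<^sup>2 / G powr (1/3)" if "s \<in> {0..1}" "t \<in> {0..1}" for s t
    unfolding airy_kernel_def abs_divide using G
    by (simp, intro divide_right_mono prod b that) auto
  have C: "mode_const bc G = 1 + 2 * E\<^sup>2 + 2 * E\<^sup>2 / G powr (1/3) + \<bar>?A\<bar> + G + 1 / m"
    unfolding mode_const_def E_def m_def ..
  have q: "2 * E\<^sup>2 / G powr (1/3) \<ge> 0" "2 * E\<^sup>2 \<ge> 0" "1 / m \<ge> 0" using m by auto
  show ?thesis unfolding mode_bound_def C m_def[symmetric]
  proof (intro conjI ballI)
    fix s t :: real assume s: "s \<in> {0..1}" and t: "t \<in> {0..1}"
    show "\<bar>airy_kernel bc G s t\<bar> \<le> 1 + 2 * E\<^sup>2 + 2 * E\<^sup>2 / G powr (1 / 3) + \<bar>?A\<bar> + G + 1 / m"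
      using ker[OF s t] q G by linarith
  next
    fix s :: real assume s: "s \<in> {0..1}"
    show "\<bar>buckling_mode bc G s\<bar> \<le> 1 + 2 * E\<^sup>2 + 2 * E\<^sup>2 / G powr (1 / 3) + \<bar>?A\<bar> + G + 1 / m"
      using phi[OF s] q G by linarith
  next
    have "1 = 1 / m * m" using m by simp
    also have "\<dots> \<le> (1 + 2 * E\<^sup>2 + 2 * E\<^sup>2 / G powr (1 / 3) + \<bar>?A\<bar> + G + 1 / m) * m"
      using m q G by (intro mult_right_mono) linarith+
    finally show "1 \<le> (1 + 2 * E\<^sup>2 + 2 * E\<^sup>2 / G powr (1 / 3) + \<bar>?A\<bar> + G + 1 / m) * m" .
  qed (use q G in linarith)+
qed

lemma continuous_integral_param:
  fixes F :: "'a::topological_space \<Rightarrow> real \<Rightarrow> real"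
  assumes "continuous_on (U \<times> {0..1}) (\<lambda>x. F (fst x) (snd x))"
  shows "continuous_on U (\<lambda>x. integral {0..1} (F x))"
  using integral_continuous_on_param[of U 0 1 F] assms by (simp add: case_prod_unfold)

lemma mode_const_continuous: "continuous_on {0<..} (mode_const bc)"
proof -
  have A: "continuous_on {0<..} (A_crit bc)" by (rule A_crit_continuous)
  have p: "continuous_on {0<..} (\<lambda>G::real. G powr a)" for a by (rule powr_continuous_pos) auto
  have E: "continuous_on {0<..} (airy_bound bc)"
    unfolding airy_bound_def Let_def
    by (intro continuous_on_add airy_continuous_compose continuous_on_divide continuous_on_rabs A p continuous_on_id) auto
  have "continuous_on {0<..} (\<lambda>G. integral {0..1} (\<lambda>s. (buckling_mode bc G s)\<^sup>2))"
    by (rule continuous_integral_param) (intro continuous_on_power buckling_mode_continuous continuous_intros; auto)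
  then have m: "continuous_on {0<..} (\<lambda>G. 1 / integral {0..1} (\<lambda>s. (buckling_mode bc G s)\<^sup>2))"
  proof (rule continuous_on_divide[OF continuous_on_const])
    show "\<forall>G\<in>{0<..}. integral {0..1} (\<lambda>s. (buckling_mode bc G s)\<^sup>2) \<noteq> 0"
      using buckling_mass_pos by (metis greaterThan_iff less_irrefl)
  qed
  show ?thesis unfolding mode_const_def[abs_def]
    by (intro continuous_on_add continuous_on_const continuous_on_mult continuous_on_divide continuous_on_power
        continuous_on_rabs continuous_on_id A E p m) auto
qed

definition branch_radius :: "support \<Rightarrow> real \<Rightarrow> real" where
  "branch_radius bc G = 1 / (100 * mode_const bc G ^ 5)"

lemma mode_const_ge_1: "G > 0 \<Longrightarrow> mode_const bc G \<ge> 1"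
  using mode_const_bound[of G bc] by (simp add: mode_bound_def)

lemma branch_radius_pos: "G > 0 \<Longrightarrow> branch_radius bc G > 0"
  using mode_const_ge_1[of G bc] by (simp add: branch_radius_def)

lemma branch_radius_le: "G > 0 \<Longrightarrow> branch_radius bc G \<le> 1 / 100"
proof -
  assume "G > 0"
  then have "1 ^ 5 \<le> mode_const bc G ^ 5" using mode_const_ge_1[of G bc] by (intro power_mono) auto
  then show ?thesis unfolding branch_radius_def by (intro frac_le) auto
qed

lemma branch_radius_continuous: "continuous_on {0<..} (branch_radius bc)"
  unfolding branch_radius_def[abs_def]
  by (intro continuous_intros mode_const_continuous) (use mode_const_ge_1[of _ bc] in force)

definition branch_domain :: "support \<Rightarrow> (real \<times> real) set" where
  "branch_domain bc = {(G, r). G > 0 \<and> \<bar>r\<bar> < branch_radius bc G}"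

lemma branch_domain_point:
  assumes "w \<in> branch_domain bc"
  shows "branch_point bc (fst w) (snd w) (mode_const bc (fst w))"
  using assms mode_const_bound unfolding branch_domain_def branch_point_def branch_radius_def by auto

lemma branch_domain_G: "w \<in> branch_domain bc \<Longrightarrow> fst w > 0"
  unfolding branch_domain_def by auto

text \<open>The lower limit of the Volterra integral moves with \<open>s\<close>. The substitution
  fixes the domain of integration, so continuity of parameter integrals applies.\<close>

lemma integral_tail_rescaled:
  fixes F :: "real \<Rightarrow> real"
  assumes F: "continuous_on {0..1} F" and s: "s \<in> {0..1}"
  shows "integral {s..1} F = (1 - s) * integral {0..1} (\<lambda>x. F (s + (1 - s) * x))"
proof -
  have ran: "s + (1 - s) * x \<in> {0..1}" if "x \<in> {0..1}" for x
  proof -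
    have "(1 - s) * x \<le> (1 - s) * 1" by (rule mult_left_mono) (use s that in auto)
    moreover have "(1 - s) * x \<ge> 0" using s that by simp
    ultimately have "(1 - s) * x \<le> 1 - s" "(1 - s) * x \<ge> 0" by auto
    then show ?thesis using s by simp
  qed
  let ?H = "\<lambda>x. integral {0..x} F"
  have "((\<lambda>x. (1 - s) * F (s + (1 - s) * x)) has_integral (?H (s + (1 - s) * 1) - ?H (s + (1 - s) * 0))) {0..1}"
  proof (rule fundamental_theorem_of_calculus)
    fix x :: real assume x: "x \<in> {0..1}"
    have "((\<lambda>x. s + (1 - s) * x) has_real_derivative (1 - s)) (at x within {0..1})"
      by (auto intro!: derivative_eq_intros)
    moreover have "(?H has_real_derivative F (s + (1 - s) * x)) (at (s + (1 - s) * x) within (\<lambda>x. s + (1 - s) * x) ` {0..1})"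
      by (rule DERIV_subset[OF integral_has_real_derivative[OF F ran[OF x]]]) (use ran in auto)
    ultimately have "((?H \<circ> (\<lambda>x. s + (1 - s) * x)) has_real_derivative F (s + (1 - s) * x) * (1 - s)) (at x within {0..1})"
      by (intro DERIV_image_chain)
    then show "((\<lambda>x. ?H (s + (1 - s) * x)) has_vector_derivative (1 - s) * F (s + (1 - s) * x)) (at x within {0..1})"
      by (simp add: has_real_derivative_iff_has_vector_derivative o_def mult.commute)
  qed simp
  from integral_unique[OF this]
  have "(1 - s) * integral {0..1} (\<lambda>x. F (s + (1 - s) * x)) = integral {0..1} F - integral {0..s} F"
    by simp
  moreover have "integral {0..s} F + integral {s..1} F = integral {0..1} F"
    by (rule Henstock_Kurzweil_Integration.integral_combine) (use s integrable_continuous_real[OF F] in auto)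
  ultimately show ?thesis by simp
qed

context
  fixes bc :: support and Psi :: "real \<times> real \<Rightarrow> real \<Rightarrow> real"
  assumes Psi: "continuous_on (branch_domain bc \<times> {0..1}) (\<lambda>x. Psi (fst x) (snd x))"
    and den: "\<And>w. w \<in> branch_domain bc \<Longrightarrow> kappa_den bc (fst w) (snd w) (Psi w) \<noteq> 0"
begin

lemma joint_intros:
  "continuous_on (branch_domain bc \<times> {0..1}) (\<lambda>x. A_crit bc (fst (fst x)))"
  "continuous_on (branch_domain bc \<times> {0..1}) (\<lambda>x. buckling_mode bc (fst (fst x)) (snd x))"
  by (intro A_crit_continuous_compose buckling_mode_continuous continuous_intros; use branch_domain_G in force)+

lemma kappa_continuous: "continuous_on (branch_domain bc) (\<lambda>w. kappa bc (fst w) (snd w) (Psi w))"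
  unfolding kappa_def
proof (rule continuous_on_divide)
  show "continuous_on (branch_domain bc) (\<lambda>w. kappa_num bc (fst w) (snd w) (Psi w))"
    unfolding kappa_num_def by (rule continuous_integral_param) (intro continuous_intros Psi joint_intros)
  show "continuous_on (branch_domain bc) (\<lambda>w. kappa_den bc (fst w) (snd w) (Psi w))"
    unfolding kappa_den_def sincos_part_def by (rule continuous_integral_param) (intro continuous_intros Psi joint_intros)
qed (use den in blast)

lemma branch_rhs_continuous:
  "continuous_on (branch_domain bc \<times> {0..1}) (\<lambda>x. branch_rhs bc (fst (fst x)) (snd (fst x)) (Psi (fst x)) (snd x))"
proof -
  have "continuous_on (branch_domain bc \<times> {0..1}) (\<lambda>x. kappa bc (fst (fst x)) (snd (fst x)) (Psi (fst x)))"
    by (rule continuous_on_compose2[OF kappa_continuous]) (auto intro!: continuous_intros)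
  then show ?thesis unfolding branch_rhs_def sincos_part_def by (intro continuous_intros Psi joint_intros)
qed

text \<open>\<open>Psi\<close> stands for an arbitrary jointly continuous family with nonzero
  denominators; this makes the lemma the induction step for the Picard iterates.\<close>

lemma branch_step_continuous:
  "continuous_on (branch_domain bc \<times> {0..1}) (\<lambda>x. branch_step bc (fst (fst x)) (snd (fst x)) (Psi (fst x)) (snd x))"
proof -
  let ?X = "branch_domain bc \<times> {0..1::real}"
  let ?R = "\<lambda>w. branch_rhs bc (fst w) (snd w) (Psi w)"
  let ?t = "\<lambda>y::((real \<times> real) \<times> real) \<times> real. snd (fst y) + (1 - snd (fst y)) * snd y"
  have ran: "s + (1 - s) * x \<in> {0..1}" if "s \<in> {0..1}" "x \<in> {0..1}" for s x :: real
  proof -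
    have "(1 - s) * x \<le> (1 - s) * 1" by (rule mult_left_mono) (use that in auto)
    moreover have "(1 - s) * x \<ge> 0" using that by simp
    ultimately have "(1 - s) * x \<le> 1 - s" "(1 - s) * x \<ge> 0" by auto
    then show ?thesis using that by simp
  qed
  have "continuous_on (?X \<times> {0..1}) (\<lambda>y. ?R (fst (fst y)) (?t y))"
    by (rule continuous_on_compose2[OF branch_rhs_continuous, where f="\<lambda>y. (fst (fst y), ?t y)", simplified])
       (use ran in \<open>auto intro!: continuous_intros\<close>)
  moreover have "continuous_on (?X \<times> {0..1}) (\<lambda>y. airy_kernel bc (fst (fst (fst y))) (snd (fst y)) (?t y))"
    by (rule airy_kernel_continuous_compose) (use branch_domain_G in \<open>auto intro!: continuous_intros\<close>)
  ultimately have "continuous_on (?X \<times> {0..1}) (\<lambda>y. airy_kernel bc (fst (fst (fst y))) (snd (fst y)) (?t y) * ?R (fst (fst y)) (?t y))"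
    by (rule continuous_on_mult[rotated])
  then have i: "continuous_on ?X (\<lambda>x. integral {0..1} (\<lambda>\<tau>. airy_kernel bc (fst (fst x)) (snd x) (snd x + (1 - snd x) * \<tau>)
       * ?R (fst x) (snd x + (1 - snd x) * \<tau>)))"
    by (intro continuous_integral_param)
  have eq: "branch_step bc (fst (fst x)) (snd (fst x)) (Psi (fst x)) (snd x) =
     buckling_mode bc (fst (fst x)) (snd x) + (snd (fst x))\<^sup>2 * ((1 - snd x) *
      integral {0..1} (\<lambda>\<tau>. airy_kernel bc (fst (fst x)) (snd x) (snd x + (1 - snd x) * \<tau>)
       * ?R (fst x) (snd x + (1 - snd x) * \<tau>)))" if x: "x \<in> ?X" for x
  proof -
    have G: "fst (fst x) > 0" using x branch_domain_G by auto
    have "continuous_on {0..1} (\<lambda>t. ?R (fst x) t)"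
      by (rule continuous_on_compose2[OF branch_rhs_continuous, where f="\<lambda>t. (fst x, t)", simplified])
         (use x in \<open>auto intro!: continuous_intros\<close>)
    then have "continuous_on {0..1} (\<lambda>t. airy_kernel bc (fst (fst x)) (snd x) t * ?R (fst x) t)"
      by (intro continuous_on_mult airy_kernel_continuous G)
    then show ?thesis unfolding branch_step_def using integral_tail_rescaled x by auto
  qed
  have "continuous_on ?X (\<lambda>x. buckling_mode bc (fst (fst x)) (snd x) + (snd (fst x))\<^sup>2 * ((1 - snd x) *
      integral {0..1} (\<lambda>\<tau>. airy_kernel bc (fst (fst x)) (snd x) (snd x + (1 - snd x) * \<tau>)
       * ?R (fst x) (snd x + (1 - snd x) * \<tau>))))"
    by (intro continuous_on_add continuous_on_mult joint_intros i continuous_intros)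
  then show ?thesis by (rule continuous_on_eq) (use eq in simp)
qed

end

lemma branch_iter_continuous:
  "continuous_on (branch_domain bc \<times> {0..1}) (\<lambda>x. branch_iter bc (fst (fst x)) (snd (fst x)) n (snd x))"
proof (induction n)
  case 0 show ?case by (simp, rule buckling_mode_continuous) (use branch_domain_G in \<open>auto intro!: continuous_intros\<close>)
next
  case (Suc n)
  have "kappa_den bc (fst w) (snd w) (branch_iter bc (fst w) (snd w) n) \<noteq> 0" if "w \<in> branch_domain bc" for w
  proof -
    interpret branch_point bc "fst w" "snd w" "mode_const bc (fst w)" by (rule branch_domain_point[OF that])
    show ?thesis using den_ge[OF iter_near] C1 by (smt (verit) divide_pos_pos)
  qed
  then show ?case
    using branch_step_continuous[of bc "\<lambda>w. branch_iter bc (fst w) (snd w) n"] Suc by simp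
qed

lemma branch_profile_continuous:
  "continuous_on (branch_domain bc \<times> {0..1}) (\<lambda>x. branch_profile bc (fst (fst x)) (snd (fst x)) (snd x))"
proof (rule uniform_limit_theorem)
  show "uniform_limit (branch_domain bc \<times> {0..1}) (\<lambda>n x. branch_iter bc (fst (fst x)) (snd (fst x)) n (snd x))
    (\<lambda>x. branch_profile bc (fst (fst x)) (snd (fst x)) (snd x)) sequentially"
    by (rule branch_iter_uniform_limit) (use branch_domain_point in force)
qed (auto intro!: always_eventually branch_iter_continuous)

lemma branch_kappa_continuous:
  "continuous_on (branch_domain bc) (\<lambda>w. kappa bc (fst w) (snd w) (branch_profile bc (fst w) (snd w)))"
proof (rule kappa_continuous[OF branch_profile_continuous])
  fix w assume "w \<in> branch_domain bc"
  then interpret branch_point bc "fst w" "snd w" "mode_const bc (fst w)" by (rule branch_domain_point)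
  show "kappa_den bc (fst w) (snd w) (branch_profile bc (fst w) (snd w)) \<noteq> 0"
    using den_ge[OF profile_near] C1 by (smt (verit) divide_pos_pos)
qed

lemma branch_parameter_continuous:
  "continuous_on (branch_domain bc) (\<lambda>w. branch_parameter bc (fst w) (snd w))"
  unfolding branch_parameter_def
  by (intro continuous_on_add continuous_on_mult branch_kappa_continuous A_crit_continuous_compose continuous_intros)
     (use branch_domain_G in auto)

lemma branch_profile_even: "branch_profile bc G (- r) = branch_profile bc G r"
proof -
  have c: "cub (2 * - r) = cub (2 * r)" "cub (- r) = cub r" using cub_minus[of "2 * r"] cub_minus[of r] by auto
  have s: "branch_step bc G (- r) = branch_step bc G r"
    unfolding branch_step_def[abs_def] branch_rhs_def[abs_def] kappa_def kappa_num_def kappa_den_def sincos_part_def c by simp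
  show ?thesis unfolding branch_profile_def[abs_def] branch_iter_def s ..
qed

lemma branch_parameter_even: "branch_parameter bc G (- r) = branch_parameter bc G r"
proof -
  have c: "cub (2 * - r) = cub (2 * r)" "cub (- r) = cub r" using cub_minus[of "2 * r"] cub_minus[of r] by auto
  show ?thesis
    unfolding branch_parameter_def branch_profile_even kappa_def kappa_num_def kappa_den_def sincos_part_def c by simp
qed

lemma branch_profile_0: "branch_profile bc G 0 = buckling_mode bc G"
proof -
  have "branch_iter bc G 0 n = buckling_mode bc G" for n
  proof (cases n)
    case (Suc m) then show ?thesis by (simp add: branch_step_def[abs_def])
  qed simp
  then show ?thesis unfolding branch_profile_def[abs_def] by (simp del: branch_iter_simps)
qed

section \<open>The second-order coefficient of the branch\<close>

definition branch_A2 :: "support \<Rightarrow> real \<Rightarrow> real" where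
  "branch_A2 bc G = kappa bc G 0 (buckling_mode bc G)"

lemma branch_A2_continuous: "continuous_on {0<..} (branch_A2 bc)"
proof -
  have "continuous_on {0<..} (\<lambda>G. kappa bc (fst (G, 0::real)) (snd (G, 0::real)) (branch_profile bc (fst (G, 0::real)) (snd (G, 0::real))))"
    by (rule continuous_on_compose2[OF branch_kappa_continuous, where f="\<lambda>G. (G, 0)"])
       (use branch_radius_pos in \<open>auto intro!: continuous_intros simp: branch_domain_def\<close>)
  then show ?thesis by (simp add: branch_A2_def[abs_def] branch_profile_0)
qed

lemma branch_parameter_expansion:
  assumes G: "G > 0"
  shows "(\<lambda>r. branch_parameter bc G r - (A_crit bc G + branch_A2 bc G * r\<^sup>2)) \<in> o[at 0](\<lambda>r. r\<^sup>2)"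
proof (rule smalloI_tendsto)
  let ?k = "\<lambda>r. kappa bc G r (branch_profile bc G r)"
  let ?S = "{- branch_radius bc G<..<branch_radius bc G}"
  have "continuous_on ?S (\<lambda>r. kappa bc (fst (G, r)) (snd (G, r)) (branch_profile bc (fst (G, r)) (snd (G, r))))"
    by (rule continuous_on_compose2[OF branch_kappa_continuous, where f="\<lambda>r. (G, r)"])
       (use G in \<open>auto intro!: continuous_intros simp: branch_domain_def\<close>)
  then have "continuous_on ?S ?k" by simp
  then have "isCont ?k 0" using branch_radius_pos[OF G, of bc] by (subst (asm) continuous_on_eq_continuous_at) auto
  then have "((\<lambda>r. ?k r - ?k 0) \<longlongrightarrow> ?k 0 - ?k 0) (at 0)" unfolding isCont_def by (intro tendsto_diff tendsto_const)
  then have l: "((\<lambda>r. ?k r - branch_A2 bc G) \<longlongrightarrow> 0) (at 0)" by (simp add: branch_A2_def branch_profile_0)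
  show "((\<lambda>r. (branch_parameter bc G r - (A_crit bc G + branch_A2 bc G * r\<^sup>2)) / r\<^sup>2) \<longlongrightarrow> 0) (at 0)"
  proof (rule Lim_transform_eventually[OF l])
    show "\<forall>\<^sub>F r in at 0. ?k r - branch_A2 bc G = (branch_parameter bc G r - (A_crit bc G + branch_A2 bc G * r\<^sup>2)) / r\<^sup>2"
      unfolding eventually_at_filter by (intro always_eventually) (auto simp: branch_parameter_def field_simps)
  qed
  show "\<forall>\<^sub>F r::real in at 0. r\<^sup>2 \<noteq> 0" unfolding eventually_at_filter by (intro always_eventually) auto
qed

lemma branch_A2_eq:
  assumes "G > 0"
  shows "branch_A2 bc G = integral {0..1} (\<lambda>s. (4 * A_crit bc G - G * (1 - s)) * buckling_mode bc G s ^ 4)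
      / (6 * integral {0..1} (\<lambda>s. (buckling_mode bc G s)\<^sup>2))"
proof -
  have "kappa_num bc G 0 (buckling_mode bc G) = integral {0..1} (\<lambda>s. (1/6) * ((4 * A_crit bc G - G * (1 - s)) * buckling_mode bc G s ^ 4))"
    unfolding kappa_num_def by (simp add: eval_nat_numeral algebra_simps diff_divide_distrib)
  then have kn: "kappa_num bc G 0 (buckling_mode bc G) = integral {0..1} (\<lambda>s. (4 * A_crit bc G - G * (1 - s)) * buckling_mode bc G s ^ 4) / 6"
    by simp
  moreover have "kappa_den bc G 0 (buckling_mode bc G) = integral {0..1} (\<lambda>s. (buckling_mode bc G s)\<^sup>2)"
    unfolding kappa_den_def sincos_part_def by (simp add: power2_eq_square)
  ultimately show ?thesis unfolding branch_A2_def kappa_def kn by simp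
qed

text \<open>The bound \<open>G / 4\<close> is what keeps the weight
  \<open>4 * A_crit bc G - G * (1 - s)\<close> nonnegative down to the supported end. The integral
  is strictly positive because at the free end gravity drops out and the mode equals 1. The pinned
  rod always satisfies the hypothesis, even with \<open>G / 2\<close>.\<close>

lemma branch_A2_positive:
  assumes G: "G > 0" and A: "A_crit bc G \<ge> G / 4"
  shows "branch_A2 bc G > 0"
proof -
  let ?f = "\<lambda>s. (4 * A_crit bc G - G * (1 - s)) * buckling_mode bc G s ^ 4"
  have c: "continuous_on {0..1} ?f" by (intro continuous_intros buckling_mode_continuous_s G)
  have nn: "?f s \<ge> 0" if "s \<in> {0..1}" for s
  proof (rule mult_nonneg_nonneg)
    have "G * (1 - s) \<le> G" using that G by (simp add: mult_left_le)
    then show "4 * A_crit bc G - G * (1 - s) \<ge> 0" using A by linarith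
  qed simp
  have "(LINT s:{0..1}|lborel. ?f s) > 0"
    by (rule integral_Icc_pos[OF c nn, of 1]) (use A G in auto)
  then have "integral {0..1} ?f > 0" using set_borel_integral_eq_integral(2)[OF set_integrable_continuous[OF c]] by simp
  then show ?thesis unfolding branch_A2_eq[OF G] using buckling_mass_pos[OF G, of bc] by (intro divide_pos_pos) auto
qed

lemma branch_A2_negative:
  assumes G: "G > 0" and A: "A_crit bc G = 0"
  shows "branch_A2 bc G < 0"
proof -
  let ?f = "\<lambda>s. G * (1 - s) * buckling_mode bc G s ^ 4"
  have c: "continuous_on {0..1} ?f" by (intro continuous_intros buckling_mode_continuous_s G)
  have nn: "?f s \<ge> 0" if "s \<in> {0..1}" for s using that G by simp
  have "(LINT s:{0..1}|lborel. ?f s) > 0"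
    by (rule integral_Icc_pos[OF c nn, of "1/2"]) (use buckling_mode_pos(1)[OF G, of "1/2" bc] G in auto)
  then have "integral {0..1} ?f > 0" using set_borel_integral_eq_integral(2)[OF set_integrable_continuous[OF c]] by simp
  moreover have "(\<lambda>s. (4 * A_crit bc G - G * (1 - s)) * buckling_mode bc G s ^ 4) = (\<lambda>s. - ?f s)" unfolding A by simp
  ultimately show ?thesis unfolding branch_A2_eq[OF G] using buckling_mass_pos[OF G, of bc] by (simp add: divide_neg_pos)
qed

section \<open>Planar equilibria\<close>

text \<open>First-order expansions are multiplied with an explicit remainder. The remainder will
  depend on \<open>s\<close> through the weak derivative of the variation, which may be unbounded,
  so a mere \<open>O\<close> bound at each \<open>s\<close> could not be integrated.\<close>

lemma second_order_mult:
  fixes X Y :: real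
  assumes "\<bar>X - x0 - t * x1\<bar> \<le> t\<^sup>2 * B" "\<bar>Y - y0 - t * y1\<bar> \<le> t\<^sup>2 * D" "\<bar>t\<bar> \<le> 1" "D \<ge> 0" "B \<ge> 0"
  shows "\<bar>X * Y - x0 * y0 - t * (x0 * y1 + x1 * y0)\<bar> \<le> t\<^sup>2 * (B * (\<bar>y0\<bar> + \<bar>y1\<bar> + D) + (\<bar>x0\<bar> + \<bar>x1\<bar>) * D + \<bar>x1\<bar> * \<bar>y1\<bar>)"
proof -
  have t2: "t\<^sup>2 \<le> 1" using assms(3) by (simp add: abs_square_le_1)
  have ty: "\<bar>t * z\<bar> \<le> \<bar>z\<bar>" for z using assms(3) by (simp add: abs_mult mult_left_le_one_le)
  have "t\<^sup>2 * D \<le> D" using t2 assms(4) by (simp add: mult_left_le_one_le)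
  then have Y: "\<bar>Y\<bar> \<le> \<bar>y0\<bar> + \<bar>y1\<bar> + D" using assms(2) ty[of y1] by linarith
  have x: "\<bar>x0 + t * x1\<bar> \<le> \<bar>x0\<bar> + \<bar>x1\<bar>" using ty[of x1] by linarith
  have "X * Y - x0 * y0 - t * (x0 * y1 + x1 * y0) =
      (X - x0 - t * x1) * Y + (x0 + t * x1) * (Y - y0 - t * y1) + t\<^sup>2 * (x1 * y1)"
    by (simp add: algebra_simps power2_eq_square)
  also have "\<bar>\<dots>\<bar> \<le> \<bar>X - x0 - t * x1\<bar> * \<bar>Y\<bar> + \<bar>x0 + t * x1\<bar> * \<bar>Y - y0 - t * y1\<bar> + t\<^sup>2 * (\<bar>x1\<bar> * \<bar>y1\<bar>)"
    by (intro order_trans[OF abs_triangle_ineq] add_mono) (simp_all add: abs_mult)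
  also have "\<dots> \<le> (t\<^sup>2 * B) * (\<bar>y0\<bar> + \<bar>y1\<bar> + D) + (\<bar>x0\<bar> + \<bar>x1\<bar>) * (t\<^sup>2 * D) + t\<^sup>2 * (\<bar>x1\<bar> * \<bar>y1\<bar>)"
    using assms Y x by (intro add_mono mult_mono) auto
  finally show ?thesis by (simp add: algebra_simps)
qed

text \<open>\<open>V\<close> is the squared length of \<open>d + t * \<eta>\<close> for a unit
  vector \<open>d\<close>, with \<open>a\<close> the inner product of \<open>d\<close> and
  \<open>\<eta>\<close> and \<open>b\<close> the squared length of \<open>\<eta>\<close>. The
  restriction on \<open>t\<close> keeps it away from zero.\<close>

lemma inverse_expansion:
  fixes t a b :: real
  defines "V \<equiv> 1 + 2 * t * a + t\<^sup>2 * b"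
  assumes M: "\<bar>a\<bar> \<le> M" "0 \<le> b" "b \<le> M\<^sup>2" "M \<ge> 1" and t: "\<bar>t\<bar> * M \<le> 1 / 8"
  shows "V \<ge> 1 / 2" "\<bar>1 / V - 1 - t * (- 2 * a)\<bar> \<le> t\<^sup>2 * (12 * M\<^sup>2)"
    "\<bar>1 / sqrt V - 1 - t * (- a)\<bar> \<le> t\<^sup>2 * (12 * M\<^sup>2)"
proof -
  have ta: "\<bar>t * a\<bar> \<le> 1 / 8"
  proof -
    have "\<bar>t\<bar> * \<bar>a\<bar> \<le> \<bar>t\<bar> * M" using M by (intro mult_left_mono) auto
    then show ?thesis using t by (simp add: abs_mult)
  qed
  have tb: "0 \<le> t\<^sup>2 * b" using M by simp
  then show V: "V \<ge> 1 / 2" using ta unfolding V_def by linarith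
  have a2: "a\<^sup>2 \<le> M\<^sup>2" using M power_mono[of "\<bar>a\<bar>" M 2] by simp
  have tab: "\<bar>2 * (t * a) * b\<bar> \<le> M\<^sup>2"
  proof -
    have "\<bar>2 * (t * a) * b\<bar> = 2 * \<bar>t * a\<bar> * b" using M by (simp add: abs_mult)
    also have "\<dots> \<le> 2 * (1/8) * b" using ta M by (intro mult_right_mono) auto
    finally show ?thesis using M by linarith
  qed
  have "1 / V - 1 - t * (- 2 * a) = t\<^sup>2 * ((- b + 4 * a\<^sup>2 + 2 * (t * a) * b) / V)"
    using V unfolding V_def by (simp add: divide_simps) (simp add: algebra_simps power2_eq_square)
  also have "\<bar>\<dots>\<bar> = t\<^sup>2 * (\<bar>- b + 4 * a\<^sup>2 + 2 * (t * a) * b\<bar> / V)" using V by (simp add: abs_mult abs_divide)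
  also have "\<dots> \<le> t\<^sup>2 * ((6 * M\<^sup>2) / (1 / 2))"
  proof (intro mult_left_mono frac_le)
    have "\<bar>- b + 4 * a\<^sup>2 + 2 * (t * a) * b\<bar> \<le> b + 4 * a\<^sup>2 + M\<^sup>2" using tab M zero_le_power2[of a] by linarith
    then show "\<bar>- b + 4 * a\<^sup>2 + 2 * (t * a) * b\<bar> \<le> 6 * M\<^sup>2" using M a2 by linarith
  qed (use V in auto)
  finally show "\<bar>1 / V - 1 - t * (- 2 * a)\<bar> \<le> t\<^sup>2 * (12 * M\<^sup>2)" by simp
  define w where "w = sqrt V"
  have w2: "w * w = V" "w > 0" using V by (auto simp: w_def)
  have w7: "w \<ge> 7 / 10"
  proof -
    have "(7/10)\<^sup>2 \<le> V" using V by (simp add: power2_eq_square)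
    then show ?thesis unfolding w_def by (rule real_le_rsqrt)
  qed
  have y: "\<bar>1 / w - 1 + (V - 1) / 2\<bar> \<le> (V - 1)\<^sup>2"
  proof -
    \<comment> \<open>With \<open>V = w * w\<close> the remainder has the factor
      \<open>(w - 1)^2\<close>, and so has \<open>(V - 1)^2\<close>. Comparing the cofactors takes
      only a rational lower bound for the root of one half, namely 7/10.\<close>
    have e: "1 / w - 1 + (V - 1) / 2 = (w - 1)\<^sup>2 * ((w + 2) / (2 * w))"
      unfolding w2(1)[symmetric] using w2(2) by (simp add: divide_simps) (simp add: algebra_simps power2_eq_square)
    have "(w + 2) / (2 * w) \<le> (w + 1)\<^sup>2"
    proof -
      have "w + 2 \<le> 2 * (7/10) * ((w + 1) * (7/10 + 1))" using w7 by (simp add: algebra_simps)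
      also have "\<dots> \<le> 2 * w * ((w + 1) * (w + 1))" using w7 by (intro mult_mono) auto
      finally show ?thesis using w2(2) by (simp add: divide_simps power2_eq_square mult_ac)
    qed
    then have "(w - 1)\<^sup>2 * ((w + 2) / (2 * w)) \<le> (w - 1)\<^sup>2 * (w + 1)\<^sup>2" by (intro mult_left_mono) auto
    also have "\<dots> = (V - 1)\<^sup>2" unfolding w2(1)[symmetric] by (simp add: algebra_simps power2_eq_square)
    finally show ?thesis unfolding e using w2(2) by simp
  qed
  have V1: "\<bar>V - 1\<bar> \<le> \<bar>t\<bar> * (3 * M)"
  proof -
    have "t\<^sup>2 * b \<le> t\<^sup>2 * M\<^sup>2" using M by (intro mult_left_mono) auto
    also have "\<dots> = (\<bar>t\<bar> * M) * (\<bar>t\<bar> * M)" by (simp add: power2_eq_square)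
    also have "\<dots> \<le> (\<bar>t\<bar> * M) * 1" using t M by (intro mult_left_mono) auto
    finally have "t\<^sup>2 * b \<le> \<bar>t\<bar> * M" by simp
    moreover have "\<bar>t * a\<bar> \<le> \<bar>t\<bar> * M" using M by (simp add: abs_mult mult_left_mono)
    ultimately show ?thesis unfolding V_def using tb by linarith
  qed
  have "(V - 1)\<^sup>2 \<le> (\<bar>t\<bar> * (3 * M))\<^sup>2" using V1 power_mono[of "\<bar>V - 1\<bar>" "\<bar>t\<bar> * (3 * M)" 2] by simp
  then have "(V - 1)\<^sup>2 \<le> t\<^sup>2 * (9 * M\<^sup>2)" by (simp add: power_mult_distrib)
  moreover have "1 / sqrt V - 1 - t * (- a) = (1 / w - 1 + (V - 1) / 2) - t\<^sup>2 * b / 2" unfolding w_def V_def by (simp add: add_divide_distrib)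
  moreover have "t\<^sup>2 * b \<le> t\<^sup>2 * M\<^sup>2" using M by (intro mult_left_mono) auto
  ultimately have "\<bar>1 / sqrt V - 1 - t * (- a)\<bar> \<le> t\<^sup>2 * (9 * M\<^sup>2) + t\<^sup>2 * M\<^sup>2" using y tb by linarith
  also have "\<dots> \<le> t\<^sup>2 * (12 * M\<^sup>2)" by (simp add: algebra_simps)
  finally show "\<bar>1 / sqrt V - 1 - t * (- a)\<bar> \<le> t\<^sup>2 * (12 * M\<^sup>2)" .
qed

text \<open>Integrating the pointwise quadratic remainder gives an error of at most a constant times
  the square of \<open>t\<close>, so the difference quotients converge.\<close>

lemma has_derivative_integral_second_order:
  fixes F :: "real \<Rightarrow> real \<Rightarrow> real"
  assumes t0: "t0 > 0" and F: "\<And>t. \<bar>t\<bar> \<le> t0 \<Longrightarrow> set_integrable lborel {0..1} (F t)"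
    and D: "set_integrable lborel {0..1} D" and B: "set_integrable lborel {0..1} B"
    and e: "\<And>t s. \<bar>t\<bar> \<le> t0 \<Longrightarrow> s \<in> {0..1} \<Longrightarrow> \<bar>F t s - F 0 s - t * D s\<bar> \<le> t\<^sup>2 * B s"
  shows "((\<lambda>t. LINT s:{0..1}|lborel. F t s) has_real_derivative (LINT s:{0..1}|lborel. D s)) (at 0)"
proof -
  let ?I = "\<lambda>f. LINT s:{0..1}|lborel. f s"
  have main: "\<bar>?I (F t) - ?I (F 0) - t * ?I D\<bar> \<le> t\<^sup>2 * ?I B" if t: "\<bar>t\<bar> \<le> t0" for t
  proof -
    have F0: "set_integrable lborel {0..1} (F 0)" using F[of 0] t0 by simp
    have tD: "set_integrable lborel {0..1} (\<lambda>s. t * D s)" using D by simp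
    have d1: "set_integrable lborel {0..1} (\<lambda>s. F t s - F 0 s)" by (rule set_integral_diff(1)[OF F[OF t] F0])
    have d2: "set_integrable lborel {0..1} (\<lambda>s. F t s - F 0 s - t * D s)" by (rule set_integral_diff(1)[OF d1 tD])
    have "?I (F t) - ?I (F 0) - t * ?I D = ?I (\<lambda>s. F t s - F 0 s - t * D s)"
      unfolding set_integral_diff(2)[OF d1 tD] set_integral_diff(2)[OF F[OF t] F0] by simp
    also have "\<bar>\<dots>\<bar> \<le> ?I (\<lambda>s. \<bar>F t s - F 0 s - t * D s\<bar>)"
      using set_integral_norm_bound[OF d2] by simp
    also have "\<dots> \<le> ?I (\<lambda>s. t\<^sup>2 * B s)"
      by (rule set_integral_mono) (use d2 B e t in \<open>auto intro: set_integrable_abs\<close>)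
    finally show ?thesis by simp
  qed
  have "((\<lambda>t. (?I (F t) - ?I (F 0)) / t) \<longlongrightarrow> ?I D) (at 0)"
  proof (rule LIM_I)
    fix r :: real assume r: "r > 0"
    have "\<bar>?I B\<bar> + 1 > 0" by simp
    then have "min t0 (r / (\<bar>?I B\<bar> + 1)) > 0" using r t0 by simp
    moreover have "norm ((?I (F t) - ?I (F 0)) / t - ?I D) < r" if "t \<noteq> 0 \<and> norm (t - 0) < min t0 (r / (\<bar>?I B\<bar> + 1))" for t
    proof -
      have t: "\<bar>t\<bar> \<le> t0" "t \<noteq> 0" "\<bar>t\<bar> < r / (\<bar>?I B\<bar> + 1)" using that by auto
      have "(?I (F t) - ?I (F 0)) / t - ?I D = (?I (F t) - ?I (F 0) - t * ?I D) / t" using t by (simp add: field_simps)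
      also have "\<bar>\<dots>\<bar> \<le> (t\<^sup>2 * ?I B) / \<bar>t\<bar>" unfolding abs_divide by (intro divide_right_mono main t) auto
      also have "\<dots> = \<bar>t\<bar> * ?I B" using t by (simp add: power2_eq_square abs_if)
      also have "\<dots> \<le> \<bar>t\<bar> * (\<bar>?I B\<bar> + 1)" by (intro mult_left_mono) auto
      also have "\<dots> < r" using t by (simp add: field_simps)
      finally show ?thesis by simp
    qed
    ultimately show "\<exists>s>0. \<forall>x. x \<noteq> 0 \<and> norm (x - 0) < s \<longrightarrow> norm ((?I (F x) - ?I (F 0)) / x - ?I D) < r" by blast
  qed
  then show ?thesis unfolding DERIV_def by simp
qed

definition e1 :: "real ^ 3" where "e1 = axis 1 1"

lemma e_inner [simp]: "e1 \<bullet> e1 = 1" "e3 \<bullet> e3 = 1" "e1 \<bullet> e3 = 0" "e3 \<bullet> e1 = 0"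
  by (simp_all add: e1_def e3_def inner_axis_axis)

definition planar :: "real \<Rightarrow> real ^ 3" where
  "planar x = sin x *\<^sub>R e1 + cos x *\<^sub>R e3"

definition planar_tangent :: "real \<Rightarrow> real ^ 3" where
  "planar_tangent x = cos x *\<^sub>R e1 - sin x *\<^sub>R e3"

lemma planar_inner:
  "planar x \<bullet> planar x = 1" "planar_tangent x \<bullet> planar_tangent x = 1" "planar x \<bullet> planar_tangent x = 0" "planar_tangent x \<bullet> planar x = 0"
  "planar x \<bullet> e3 = cos x" "e3 \<bullet> planar x = cos x" "planar_tangent x \<bullet> e3 = - sin x"
  by (simp_all add: planar_def planar_tangent_def inner_add_left inner_add_right inner_diff_left inner_diff_right
      power2_eq_square[symmetric] algebra_simps)

lemma planar_0: "planar 0 = e3"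
  by (simp add: planar_def)

lemma norm_planar: "norm (planar x) = 1" "norm (planar_tangent x) = 1"
  by (simp_all add: norm_eq_sqrt_inner planar_inner)

text \<open>The Euler-Lagrange equation of the energy for the angle from the vertical in a plane.
  \<open>top\<close> and \<open>pinned\<close> are its natural boundary conditions,
  \<open>clamped\<close> the imposed one.\<close>

locale planar_rod =
  fixes bc :: support and A G :: real and \<theta> \<theta>1 :: "real \<Rightarrow> real"
  assumes th: "\<And>s. s \<in> {0..1} \<Longrightarrow> (\<theta> has_real_derivative \<theta>1 s) (at s within {0..1})"
    and th1: "\<And>s. s \<in> {0..1} \<Longrightarrow> (\<theta>1 has_real_derivative A * (sin (\<theta> s) * cos (\<theta> s)) - G * (1 - s) * sin (\<theta> s)) (at s within {0..1})"
    and top: "\<theta>1 1 = 0" and clamped: "bc = Clamped \<Longrightarrow> \<theta> 0 = 0" and pinned: "bc = Pinned \<Longrightarrow> \<theta>1 0 = 0"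
begin

definition d :: "real \<Rightarrow> real ^ 3" where "d s = planar (\<theta> s)"
definition d' :: "real \<Rightarrow> real ^ 3" where "d' s = \<theta>1 s *\<^sub>R planar_tangent (\<theta> s)"

lemma cont: "continuous_on {0..1} \<theta>" "continuous_on {0..1} \<theta>1"
  by (rule DERIV_continuous_on[OF th], assumption) (rule DERIV_continuous_on[OF th1], assumption)

lemma cont_d: "continuous_on {0..1} d" "continuous_on {0..1} d'"
  unfolding d_def d'_def planar_def planar_tangent_def by (intro continuous_intros cont)+

lemma weak_d: "has_weak_deriv d d'"
proof (rule has_weak_deriv_C1[OF _ cont_d(2)])
  fix s :: real assume s: "s \<in> {0..1}"
  have sc: "((\<lambda>s. sin (\<theta> s)) has_real_derivative cos (\<theta> s) * \<theta>1 s) (at s within {0..1})"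
    "((\<lambda>s. cos (\<theta> s)) has_real_derivative - sin (\<theta> s) * \<theta>1 s) (at s within {0..1})"
    using th[OF s] by (auto intro!: derivative_eq_intros)
  have "((\<lambda>s. sin (\<theta> s) *\<^sub>R e1 + cos (\<theta> s) *\<^sub>R e3) has_vector_derivative
     (cos (\<theta> s) * \<theta>1 s) *\<^sub>R e1 + (- sin (\<theta> s) * \<theta>1 s) *\<^sub>R e3) (at s within {0..1})"
    using has_vector_derivative_scaleR[OF sc(1) has_vector_derivative_const[of e1]]
      has_vector_derivative_scaleR[OF sc(2) has_vector_derivative_const[of e3]]
    by (intro has_vector_derivative_add) simp_all
  then show "(d has_vector_derivative d' s) (at s within {0..1})"
    unfolding d_def[abs_def] d'_def planar_def planar_tangent_def by (simp add: scaleR_diff_right mult.commute)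
qed

lemma admissible: "admissible bc d"
  using has_weak_deriv_H1[OF weak_d] clamped unfolding admissible_def by (auto simp: d_def norm_planar planar_0)

end

text \<open>The variation is neither planar nor tangential: \<open>equilibrium\<close> tests a
  planar field against all of them.\<close>

locale planar_variation = planar_rod +
  fixes \<eta> :: "real \<Rightarrow> real ^ 3" and M :: real
  assumes eta: "H1 \<eta>" "bc = Clamped \<longrightarrow> \<eta> 0 = 0"
    and M1: "M \<ge> 1" and eta_M: "\<And>s. s \<in> {0..1} \<Longrightarrow> norm (\<eta> s) \<le> M" and th1_M: "\<And>s. s \<in> {0..1} \<Longrightarrow> \<bar>\<theta>1 s\<bar> \<le> M"
begin

abbreviation "g \<equiv> weak_deriv \<eta>"

definition v :: "real \<Rightarrow> real \<Rightarrow> real ^ 3" where "v t s = d s + t *\<^sub>R \<eta> s"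
definition v' :: "real \<Rightarrow> real \<Rightarrow> real ^ 3" where "v' t s = d' s + t *\<^sub>R g s"
definition V :: "real \<Rightarrow> real \<Rightarrow> real" where "V t s = v t s \<bullet> v t s"
definition n' :: "real \<Rightarrow> real \<Rightarrow> real ^ 3" where
  "n' t s = (1 / sqrt (V t s)) *\<^sub>R v' t s - ((v t s \<bullet> v' t s) / (V t s * sqrt (V t s))) *\<^sub>R v t s"

lemma weak_g: "has_weak_deriv \<eta> g" by (rule H1_weak_deriv[OF eta(1)])

lemma cont_eta: "continuous_on {0..1} \<eta>"
  by (rule indef_continuous[OF has_weak_deriv_indef[OF weak_g]])

lemma V_eq: "V t s = 1 + 2 * t * (d s \<bullet> \<eta> s) + t\<^sup>2 * (\<eta> s \<bullet> \<eta> s)"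
  unfolding V_def v_def by (simp add: d_def planar_inner inner_add_left inner_add_right inner_commute power2_eq_square algebra_simps)

lemma bounds:
  assumes "s \<in> {0..1}"
  shows "\<bar>d s \<bullet> \<eta> s\<bar> \<le> M" "0 \<le> \<eta> s \<bullet> \<eta> s" "\<eta> s \<bullet> \<eta> s \<le> M\<^sup>2"
proof -
  have "\<bar>d s \<bullet> \<eta> s\<bar> \<le> norm (d s) * norm (\<eta> s)" by (rule Cauchy_Schwarz_ineq2)
  then show "\<bar>d s \<bullet> \<eta> s\<bar> \<le> M" using eta_M[OF assms] by (simp add: d_def norm_planar)
  show "0 \<le> \<eta> s \<bullet> \<eta> s" by simp
  have "(norm (\<eta> s))\<^sup>2 \<le> M\<^sup>2" using eta_M[OF assms] by (intro power_mono) auto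
  then show "\<eta> s \<bullet> \<eta> s \<le> M\<^sup>2" by (simp add: power2_norm_eq_inner)
qed

lemma V_expansions:
  assumes "s \<in> {0..1}" "\<bar>t\<bar> \<le> 1 / (8 * M)"
  shows "V t s \<ge> 1 / 2" "\<bar>1 / V t s - 1 - t * (- 2 * (d s \<bullet> \<eta> s))\<bar> \<le> t\<^sup>2 * (12 * M\<^sup>2)"
    "\<bar>1 / sqrt (V t s) - 1 - t * (- (d s \<bullet> \<eta> s))\<bar> \<le> t\<^sup>2 * (12 * M\<^sup>2)"
proof -
  have "\<bar>t\<bar> * M \<le> 1 / 8" using assms(2) M1 by (simp add: field_simps)
  note ie = inverse_expansion[OF bounds[OF assms(1)] M1 this]
  show "V t s \<ge> 1 / 2" "\<bar>1 / V t s - 1 - t * (- 2 * (d s \<bullet> \<eta> s))\<bar> \<le> t\<^sup>2 * (12 * M\<^sup>2)"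
    "\<bar>1 / sqrt (V t s) - 1 - t * (- (d s \<bullet> \<eta> s))\<bar> \<le> t\<^sup>2 * (12 * M\<^sup>2)"
    unfolding V_eq by (rule ie)+
qed

lemma t_small: "\<bar>t\<bar> \<le> 1 / (8 * M) \<Longrightarrow> \<bar>t\<bar> \<le> 1"
proof -
  have "1 / (8 * M) \<le> 1" using M1 by (simp add: divide_simps)
  then show "\<bar>t\<bar> \<le> 1 / (8 * M) \<Longrightarrow> \<bar>t\<bar> \<le> 1" by simp
qed

lemma sgn_v: "sgn (v t s) = (1 / sqrt (V t s)) *\<^sub>R v t s"
  by (simp add: sgn_div_norm norm_eq_sqrt_inner V_def divide_inverse)

lemma indef_v: "indef (v t) (v' t)"
  unfolding v_def[abs_def] v'_def[abs_def]
  by (intro indef_add indef_scaleR has_weak_deriv_indef weak_d weak_g)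

lemma indef_inner_self:
  fixes u u' :: "real \<Rightarrow> real ^ 3"
  assumes "indef u u'"
  shows "indef (\<lambda>s. u s \<bullet> u s) (\<lambda>s. 2 * (u s \<bullet> u' s))"
proof -
  have sum: "indef (\<lambda>s. \<Sum>b\<in>S. f b s) (\<lambda>s. \<Sum>b\<in>S. f' b s)" if "finite S" "\<And>b. b \<in> S \<Longrightarrow> indef (f b) (f' b)"
    for S :: "(real ^ 3) set" and f f' :: "real ^ 3 \<Rightarrow> real \<Rightarrow> real"
    using that
  proof (induction S)
    case empty then show ?case using indef_const[of 0] by simp
  next
    case (insert x S)
    then have "indef (\<lambda>s. f x s + (\<Sum>b\<in>S. f b s)) (\<lambda>s. f' x s + (\<Sum>b\<in>S. f' b s))" by (intro indef_add) auto
    then show ?case using insert by simp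
  qed
  have "indef (\<lambda>s. \<Sum>b\<in>Basis. (u s \<bullet> b) * (u s \<bullet> b)) (\<lambda>s. \<Sum>b\<in>Basis. (u' s \<bullet> b) * (u s \<bullet> b) + (u s \<bullet> b) * (u' s \<bullet> b))"
    by (rule sum, simp, rule indef_mult[OF indef_inner[OF assms] indef_inner[OF assms]])
  moreover have "(\<Sum>b\<in>Basis. (u s \<bullet> b) * (u s \<bullet> b)) = u s \<bullet> u s" for s by (rule euclidean_inner[symmetric])
  moreover have "(\<Sum>b\<in>Basis. (u' s \<bullet> b) * (u s \<bullet> b) + (u s \<bullet> b) * (u' s \<bullet> b)) = 2 * (u s \<bullet> u' s)" for s
    unfolding euclidean_inner[of "u s" "u' s"] by (simp add: sum_distrib_left mult_ac)
  ultimately show ?thesis by simp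
qed

lemma indef_sgn_v:
  assumes t: "\<bar>t\<bar> \<le> 1 / (8 * M)"
  shows "indef (\<lambda>s. sgn (v t s)) (n' t)"
proof (rule indef_euclideanI)
  fix b :: "real ^ 3" assume "b \<in> Basis"
  have V: "indef (V t) (\<lambda>s. 2 * (v t s \<bullet> v' t s))" unfolding V_def[abs_def] by (rule indef_inner_self[OF indef_v])
  have z: "indef (\<lambda>s. 1 / sqrt (V t s)) (\<lambda>s. (- 1 / (2 * (V t s * sqrt (V t s)))) * (2 * (v t s \<bullet> v' t s)))"
  proof (rule indef_comp[OF V, where I="{0<..}" and F="\<lambda>y. 1 / sqrt y" and f="\<lambda>y. - 1 / (2 * (y * sqrt y))"])
    show "V t s \<in> {0<..}" if "s \<in> {0..1}" for s using V_expansions(1)[OF that t] by simp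
    show "((\<lambda>y. 1 / sqrt y) has_real_derivative - 1 / (2 * (y * sqrt y))) (at y)" if "y \<in> {0<..}" for y
      using that by (auto intro!: derivative_eq_intros simp: divide_simps)
    show "continuous_on {0<..} (\<lambda>y::real. - 1 / (2 * (y * sqrt y)))" by (intro continuous_intros) auto
  qed simp
  have "indef (\<lambda>s. (1 / sqrt (V t s)) * (v t s \<bullet> b))
     (\<lambda>s. ((- 1 / (2 * (V t s * sqrt (V t s)))) * (2 * (v t s \<bullet> v' t s))) * (v t s \<bullet> b) + (1 / sqrt (V t s)) * (v' t s \<bullet> b))"
    by (rule indef_mult[OF z indef_inner[OF indef_v]])
  then show "indef (\<lambda>s. sgn (v t s) \<bullet> b) (\<lambda>s. n' t s \<bullet> b)"
    unfolding sgn_v n'_def by (simp add: inner_diff_left algebra_simps)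
qed

lemma norm_n':
  assumes "V t s > 0"
  shows "(norm (n' t s))\<^sup>2 = (v' t s \<bullet> v' t s) * (1 / V t s) - (v t s \<bullet> v' t s)\<^sup>2 / (V t s)\<^sup>2"
proof -
  define W w m where "W = V t s" and "w = sqrt W" and "m = v t s \<bullet> v' t s"
  have w: "w * w = W" "w > 0" "W > 0" using assms by (auto simp: w_def W_def)
  have vv: "v t s \<bullet> v t s = W" by (simp add: W_def V_def)
  have "(norm (n' t s))\<^sup>2 = (1 / w) * (1 / w) * (v' t s \<bullet> v' t s) - 2 * (1 / w) * (m / (W * w)) * m + (m / (W * w)) * (m / (W * w)) * W"
    unfolding n'_def power2_norm_eq_inner
    by (simp add: inner_diff_left inner_diff_right vv m_def[symmetric] W_def[symmetric] w_def[symmetric] inner_commute[of "v' t s" "v t s"])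
      (simp add: diff_divide_distrib)
  also have "\<dots> = ((1 / w) * (1 / w)) * (v' t s \<bullet> v' t s - m * m / W)"
    using w(2,3) by (simp add: divide_simps)
  also have "(1 / w) * (1 / w) = 1 / W" using w(1) by simp
  also have "(1 / W) * (v' t s \<bullet> v' t s - m * m / W) = (v' t s \<bullet> v' t s) * (1 / W) - m\<^sup>2 / W\<^sup>2"
    using w(3) by (simp add: diff_divide_distrib power2_eq_square)
  finally show ?thesis by (simp add: W_def m_def)
qed

lemma int_g: "set_integrable lborel {0..1} (\<lambda>s. (norm (g s))\<^sup>2)"
  using integral_norm_weak_deriv(2)[OF weak_g] .

lemma int_bound: "set_integrable lborel {0..1} (\<lambda>s. K * (1 + (norm (g s))\<^sup>2))"
proof -
  have "set_integrable lborel {0..1} (\<lambda>s. 1 + (norm (g s))\<^sup>2)"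
    by (rule set_integral_add(1)[OF set_integrable_continuous[OF continuous_on_const] int_g])
  then show ?thesis by simp
qed

lemma norm_v'_le:
  assumes "s \<in> {0..1}" "\<bar>t\<bar> \<le> 1"
  shows "v' t s \<bullet> v' t s \<le> 2 * M\<^sup>2 * (1 + (norm (g s))\<^sup>2)"
proof -
  have "norm (v' t s) \<le> norm (d' s) + \<bar>t\<bar> * norm (g s)" unfolding v'_def by (rule order_trans[OF norm_triangle_ineq]) simp
  also have "\<dots> \<le> M + M * norm (g s)" using th1_M[OF assms(1)] assms(2) M1
    by (intro add_mono mult_right_mono) (auto simp: d'_def norm_planar)
  finally have "(norm (v' t s))\<^sup>2 \<le> (M + M * norm (g s))\<^sup>2" by (intro power_mono) auto
  also have "\<dots> = M\<^sup>2 * (1 + norm (g s))\<^sup>2" by (simp add: power2_eq_square algebra_simps)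
  also have "\<dots> \<le> M\<^sup>2 * (2 * (1 + (norm (g s))\<^sup>2))"
  proof (intro mult_left_mono)
    have "0 \<le> (1 - norm (g s))\<^sup>2" by simp
    then show "(1 + norm (g s))\<^sup>2 \<le> 2 * (1 + (norm (g s))\<^sup>2)" by (simp add: power2_eq_square algebra_simps)
  qed simp
  finally show ?thesis by (simp add: power2_norm_eq_inner algebra_simps)
qed

lemma weak_sgn_v:
  assumes t: "\<bar>t\<bar> \<le> 1 / (8 * M)"
  shows "has_weak_deriv (\<lambda>s. sgn (v t s)) (n' t)"
proof (rule has_weak_derivI[OF indef_sgn_v[OF t]])
  have m: "(\<lambda>s. indicator {0..1} s *\<^sub>R n' t s) \<in> borel_measurable lborel"
    using indef_integrable[OF indef_sgn_v[OF t]] unfolding set_integrable_def by (blast dest: borel_measurable_integrable)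
  show "set_integrable lborel {0..1} (\<lambda>s. (norm (n' t s))\<^sup>2)" unfolding set_integrable_def
  proof (rule Bochner_Integration.integrable_bound)
    show "integrable lborel (\<lambda>s. indicator {0..1} s *\<^sub>R (4 * M\<^sup>2 * (1 + (norm (g s))\<^sup>2)))"
      using int_bound[of "4 * M\<^sup>2"] unfolding set_integrable_def .
    have eq: "(\<lambda>s. indicator {0..1} s *\<^sub>R (norm (n' t s))\<^sup>2) = (\<lambda>s. (norm (indicator {0..1} s *\<^sub>R n' t s))\<^sup>2)"
      by (auto simp: indicator_def)
    show "(\<lambda>s. indicator {0..1} s *\<^sub>R (norm (n' t s))\<^sup>2) \<in> borel_measurable lborel"
      unfolding eq by (rule borel_measurable_power, rule measurable_compose[OF m borel_measurable_norm])
    show "AE s in lborel. norm (indicator {0..1} s *\<^sub>R (norm (n' t s))\<^sup>2) \<le> norm (indicator {0..1} s *\<^sub>R (4 * M\<^sup>2 * (1 + (norm (g s))\<^sup>2)))"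
    proof (rule AE_I2)
      fix s :: real
      show "norm (indicator {0..1} s *\<^sub>R (norm (n' t s))\<^sup>2) \<le> norm (indicator {0..1} s *\<^sub>R (4 * M\<^sup>2 * (1 + (norm (g s))\<^sup>2)))"
      proof (cases "s \<in> {0..1}")
        case True
        have V: "V t s \<ge> 1 / 2" by (rule V_expansions(1)[OF True t])
        then have "V t s > 0" by linarith
        then have "(norm (n' t s))\<^sup>2 \<le> (v' t s \<bullet> v' t s) * (1 / V t s)" unfolding norm_n'[OF \<open>V t s > 0\<close>] by simp
        also have "\<dots> \<le> (2 * M\<^sup>2 * (1 + (norm (g s))\<^sup>2)) * 2"
          using V by (intro mult_mono norm_v'_le[OF True t_small[OF t]]) (auto simp: divide_simps)
        finally show ?thesis using True by simp
      qed simp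
    qed
  qed
qed

lemma energy_v:
  assumes t: "\<bar>t\<bar> \<le> 1 / (8 * M)"
  shows "energy A G (\<lambda>s. sgn (d s + t *\<^sub>R \<eta> s)) =
     1 / 2 * (LINT s:{0..1}|lborel. (norm (n' t s))\<^sup>2)
     + A / 2 * (LINT s:{0..1}|lborel. 1 - (e3 \<bullet> sgn (v t s))\<^sup>2)
     + G * (LINT s:{0..1}|lborel. (1 - s) * (sgn (v t s) \<bullet> e3))"
  unfolding energy_def v_def[symmetric] integral_norm_weak_deriv(1)[OF weak_sgn_v[OF t]] ..

text \<open>The first-order change of the height component of the normalized field.\<close>

definition ht :: "real \<Rightarrow> real" where "ht s = \<eta> s \<bullet> e3 - cos (\<theta> s) * (d s \<bullet> \<eta> s)"

lemma height_expansion: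
  assumes s: "s \<in> {0..1}" and t: "\<bar>t\<bar> \<le> 1 / (8 * M)"
  shows "\<bar>sgn (v t s) \<bullet> e3 - cos (\<theta> s) - t * ht s\<bar> \<le> t\<^sup>2 * (25 * M ^ 3)"
proof -
  have c: "\<bar>cos (\<theta> s)\<bar> \<le> 1" by simp
  have e: "\<bar>\<eta> s \<bullet> e3\<bar> \<le> M"
    using Cauchy_Schwarz_ineq2[of "\<eta> s" e3] eta_M[OF s] by (simp add: norm_eq_sqrt_inner[of e3])
  have "\<bar>(v t s \<bullet> e3) * (1 / sqrt (V t s)) - cos (\<theta> s) * 1 - t * (cos (\<theta> s) * (- (d s \<bullet> \<eta> s)) + (\<eta> s \<bullet> e3) * 1)\<bar>
    \<le> t\<^sup>2 * (0 * (\<bar>1\<bar> + \<bar>- (d s \<bullet> \<eta> s)\<bar> + 12 * M\<^sup>2) + (\<bar>cos (\<theta> s)\<bar> + \<bar>\<eta> s \<bullet> e3\<bar>) * (12 * M\<^sup>2) + \<bar>\<eta> s \<bullet> e3\<bar> * \<bar>- (d s \<bullet> \<eta> s)\<bar>)"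
    by (rule second_order_mult[OF _ V_expansions(3)[OF s t] t_small[OF t]])
       (simp_all add: v_def d_def planar_inner inner_add_left)
  also have "\<dots> \<le> t\<^sup>2 * (0 + (1 + M) * (12 * M\<^sup>2) + M * M)"
    using c e bounds(1)[OF s] M1 by (intro mult_left_mono add_mono mult_mono mult_right_mono) auto
  also have "\<dots> \<le> t\<^sup>2 * (25 * M ^ 3)"
  proof (intro mult_left_mono)
    have "M\<^sup>2 \<le> M ^ 3" using M1 by (intro power_increasing) auto
    then show "0 + (1 + M) * (12 * M\<^sup>2) + M * M \<le> 25 * M ^ 3" by (simp add: algebra_simps power2_eq_square power3_eq_cube)
  qed simp
  finally show ?thesis unfolding sgn_v ht_def by (simp add: algebra_simps)
qed

lemma ht_le: "s \<in> {0..1} \<Longrightarrow> \<bar>ht s\<bar> \<le> 2 * M"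
proof -
  assume s: "s \<in> {0..1}"
  have e: "\<bar>\<eta> s \<bullet> e3\<bar> \<le> M"
    using Cauchy_Schwarz_ineq2[of "\<eta> s" e3] eta_M[OF s] by (simp add: norm_eq_sqrt_inner[of e3])
  have "\<bar>cos (\<theta> s) * (d s \<bullet> \<eta> s)\<bar> \<le> 1 * M" unfolding abs_mult using bounds(1)[OF s] by (intro mult_mono) auto
  then show ?thesis using e unfolding ht_def by linarith
qed

lemma square_expansion:
  assumes s: "s \<in> {0..1}" and t: "\<bar>t\<bar> \<le> 1 / (8 * M)"
  shows "\<bar>(e3 \<bullet> sgn (v t s))\<^sup>2 - (cos (\<theta> s))\<^sup>2 - t * (2 * cos (\<theta> s) * ht s)\<bar> \<le> t\<^sup>2 * (50 * M ^ 3 * (1 + 2 * M + 25 * M ^ 3) + 4 * M\<^sup>2)"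
proof -
  have c: "\<bar>cos (\<theta> s)\<bar> \<le> 1" by simp
  have B: "25 * M ^ 3 \<ge> 0" using M1 by simp
  have "\<bar>(sgn (v t s) \<bullet> e3) * (sgn (v t s) \<bullet> e3) - cos (\<theta> s) * cos (\<theta> s) - t * (cos (\<theta> s) * ht s + ht s * cos (\<theta> s))\<bar>
    \<le> t\<^sup>2 * (25 * M ^ 3 * (\<bar>cos (\<theta> s)\<bar> + \<bar>ht s\<bar> + 25 * M ^ 3) + (\<bar>cos (\<theta> s)\<bar> + \<bar>ht s\<bar>) * (25 * M ^ 3) + \<bar>ht s\<bar> * \<bar>ht s\<bar>)"
    by (rule second_order_mult[OF height_expansion[OF s t] height_expansion[OF s t] t_small[OF t] B B])
  also have "\<dots> \<le> t\<^sup>2 * (25 * M ^ 3 * (1 + 2 * M + 25 * M ^ 3) + (1 + 2 * M) * (25 * M ^ 3) + (2 * M) * (2 * M))"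
    using c ht_le[OF s] M1 by (intro mult_left_mono add_mono mult_mono) auto
  also have "\<dots> \<le> t\<^sup>2 * (50 * M ^ 3 * (1 + 2 * M + 25 * M ^ 3) + 4 * M\<^sup>2)"
    using M1 by (intro mult_left_mono) (auto simp: algebra_simps power2_eq_square)
  finally show ?thesis by (simp add: power2_eq_square inner_commute[of e3] algebra_simps)
qed

text \<open>Normalizing removes the part of \<open>v'\<close> along \<open>v\<close>. Since
  \<open>d\<close> is orthogonal to \<open>d'\<close>, the inner product of \<open>v\<close> and
  \<open>v'\<close> is of order \<open>t\<close>, so its square enters the remainder only. The
  majorant contains the squared norm of \<open>g\<close>, which is integrable though possibly
  unbounded.\<close>

lemma elastic_expansion:
  assumes s: "s \<in> {0..1}" and t: "\<bar>t\<bar> \<le> 1 / (8 * M)"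
  shows "\<bar>(norm (n' t s))\<^sup>2 - (norm (d' s))\<^sup>2 - t * (2 * (d' s \<bullet> g s) - 2 * (d s \<bullet> \<eta> s) * (norm (d' s))\<^sup>2)\<bar>
    \<le> t\<^sup>2 * (200 * M ^ 4 * (1 + (norm (g s))\<^sup>2))"
proof -
  have V: "V t s \<ge> 1 / 2" by (rule V_expansions(1)[OF s t])
  then have Vp: "V t s > 0" by linarith
  let ?g = "norm (g s)"
  let ?c = "(norm (d' s))\<^sup>2"
  have t1: "\<bar>t\<bar> \<le> 1" by (rule t_small[OF t])
  have nd: "norm (d' s) \<le> M" using th1_M[OF s] by (simp add: d'_def norm_planar)
  then have c: "?c \<le> M\<^sup>2" by (intro power_mono) auto
  have e: "\<bar>d' s \<bullet> g s\<bar> \<le> M * ?g" using Cauchy_Schwarz_ineq2[of "d' s" "g s"] nd by (meson mult_right_mono norm_ge_zero order_trans)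
  have g1: "?g \<le> 1 + ?g\<^sup>2"
  proof -
    have "0 \<le> (?g - 1/2)\<^sup>2" by simp
    then show ?thesis by (simp add: power2_eq_square algebra_simps)
  qed
  have m: "(v t s \<bullet> v' t s) = t * (d s \<bullet> g s + \<eta> s \<bullet> d' s + t * (\<eta> s \<bullet> g s))"
    unfolding v_def v'_def by (simp add: inner_add_left inner_add_right algebra_simps d_def d'_def planar_inner)
  have "\<bar>d s \<bullet> g s + \<eta> s \<bullet> d' s + t * (\<eta> s \<bullet> g s)\<bar> \<le> ?g + M * M + 1 * (M * ?g)"
  proof -
    have "\<bar>d s \<bullet> g s\<bar> \<le> ?g" using Cauchy_Schwarz_ineq2[of "d s" "g s"] by (simp add: d_def norm_planar)
    moreover have "\<bar>\<eta> s \<bullet> d' s\<bar> \<le> M * M"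
      using Cauchy_Schwarz_ineq2[of "\<eta> s" "d' s"] eta_M[OF s] nd M1 by (meson mult_mono norm_ge_zero order_trans zero_le_one)
    moreover have "\<bar>\<eta> s \<bullet> g s\<bar> \<le> M * ?g"
      by (rule order_trans[OF Cauchy_Schwarz_ineq2 mult_right_mono[OF eta_M[OF s]]]) simp
    then have "\<bar>t * (\<eta> s \<bullet> g s)\<bar> \<le> 1 * (M * ?g)"
      unfolding abs_mult using t1 by (intro mult_mono) auto
    ultimately show ?thesis by linarith
  qed
  also have "\<dots> \<le> 2 * M\<^sup>2 * (1 + ?g)"
  proof -
    have MM: "1 \<le> M\<^sup>2" "M \<le> M\<^sup>2" using M1 by (auto simp: power2_eq_square mult_le_cancel_left1 intro: order_trans[of 1 M])
    then have "?g \<le> M\<^sup>2 * ?g" "M * ?g \<le> M\<^sup>2 * ?g" by (auto simp: mult_le_cancel_right1 intro: mult_right_mono)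
    then show ?thesis using MM by (simp add: power2_eq_square algebra_simps)
  qed
  finally have m1: "\<bar>d s \<bullet> g s + \<eta> s \<bullet> d' s + t * (\<eta> s \<bullet> g s)\<bar> \<le> 2 * M\<^sup>2 * (1 + ?g)" .
  have m2: "(v t s \<bullet> v' t s)\<^sup>2 / (V t s)\<^sup>2 \<le> t\<^sup>2 * (32 * M ^ 4 * (1 + ?g\<^sup>2))"
  proof -
    have "(d s \<bullet> g s + \<eta> s \<bullet> d' s + t * (\<eta> s \<bullet> g s))\<^sup>2 \<le> (2 * M\<^sup>2 * (1 + ?g))\<^sup>2"
      using m1 power_mono[OF m1, of 2] by simp
    also have "\<dots> = 4 * M ^ 4 * (1 + ?g)\<^sup>2" by (simp add: power_mult_distrib)
    also have "\<dots> \<le> 4 * M ^ 4 * (2 * (1 + ?g\<^sup>2))"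
    proof (intro mult_left_mono)
      have "0 \<le> (1 - ?g)\<^sup>2" by simp
      then show "(1 + ?g)\<^sup>2 \<le> 2 * (1 + ?g\<^sup>2)" by (simp add: power2_eq_square algebra_simps)
    qed simp
    finally have q: "(d s \<bullet> g s + \<eta> s \<bullet> d' s + t * (\<eta> s \<bullet> g s))\<^sup>2 \<le> 8 * M ^ 4 * (1 + ?g\<^sup>2)"
      by (simp add: algebra_simps)
    have "(1/2)\<^sup>2 \<le> (V t s)\<^sup>2" using V by (intro power_mono) auto
    then have V2: "1 / 4 \<le> (V t s)\<^sup>2" by (simp add: power_divide)
    have "(v t s \<bullet> v' t s)\<^sup>2 / (V t s)\<^sup>2 = t\<^sup>2 * ((d s \<bullet> g s + \<eta> s \<bullet> d' s + t * (\<eta> s \<bullet> g s))\<^sup>2 / (V t s)\<^sup>2)"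
      unfolding m by (simp add: power_mult_distrib)
    also have "\<dots> \<le> t\<^sup>2 * ((8 * M ^ 4 * (1 + ?g\<^sup>2)) / (1 / 4))"
      using q V2 by (intro mult_left_mono frac_le) auto
    finally show ?thesis by simp
  qed
  have vv: "v' t s \<bullet> v' t s - ?c - t * (2 * (d' s \<bullet> g s)) = t\<^sup>2 * ?g\<^sup>2"
    unfolding v'_def power2_norm_eq_inner by (simp add: inner_add_left inner_add_right inner_commute algebra_simps power2_eq_square)
  have "\<bar>(v' t s \<bullet> v' t s) * (1 / V t s) - ?c * 1 - t * (?c * (- 2 * (d s \<bullet> \<eta> s)) + (2 * (d' s \<bullet> g s)) * 1)\<bar>
    \<le> t\<^sup>2 * (?g\<^sup>2 * (\<bar>1\<bar> + \<bar>- 2 * (d s \<bullet> \<eta> s)\<bar> + 12 * M\<^sup>2) + (\<bar>?c\<bar> + \<bar>2 * (d' s \<bullet> g s)\<bar>) * (12 * M\<^sup>2) + \<bar>2 * (d' s \<bullet> g s)\<bar> * \<bar>- 2 * (d s \<bullet> \<eta> s)\<bar>)"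
    by (rule second_order_mult[OF _ V_expansions(2)[OF s t] t1]) (simp_all add: vv)
  also have "\<dots> \<le> t\<^sup>2 * (?g\<^sup>2 * (1 + 2 * M + 12 * M\<^sup>2) + (M\<^sup>2 + 2 * (M * ?g)) * (12 * M\<^sup>2) + 2 * (M * ?g) * (2 * M))"
    using bounds(1)[OF s] c e M1 by (intro mult_left_mono add_mono mult_mono) (auto simp: abs_mult)
  also have "\<dots> \<le> t\<^sup>2 * (100 * M ^ 4 * (1 + ?g\<^sup>2))"
  proof (intro mult_left_mono)
    define h where "h = ?g\<^sup>2"
    have h: "h \<ge> 0" "?g \<le> 1 + h" using g1 by (auto simp: h_def)
    have P: "1 \<le> M ^ 4" "M \<le> M ^ 4" "M\<^sup>2 \<le> M ^ 4" "M ^ 3 \<le> M ^ 4"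
      using power_increasing[of 0 4 M] power_increasing[of 1 4 M] power_increasing[of 2 4 M] power_increasing[of 3 4 M] M1 by auto
    have "h * (1 + 2 * M + 12 * M\<^sup>2) \<le> h * (15 * M ^ 4)" using P h by (intro mult_left_mono) auto
    moreover have "(M\<^sup>2 + 2 * (M * ?g)) * (12 * M\<^sup>2) = 12 * M ^ 4 + 24 * (M ^ 3 * ?g)" by (simp add: eval_nat_numeral algebra_simps)
    moreover have "M ^ 3 * ?g \<le> M ^ 4 * (1 + h)" using P h M1 by (intro mult_mono) auto
    moreover have "2 * (M * ?g) * (2 * M) = 4 * (M\<^sup>2 * ?g)" by (simp add: power2_eq_square)
    moreover have "M\<^sup>2 * ?g \<le> M ^ 4 * (1 + h)" using P h M1 by (intro mult_mono) auto
    moreover have "h * (15 * M ^ 4) \<le> 15 * (M ^ 4 * (1 + h))" using P by (simp add: algebra_simps)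
    moreover have "12 * M ^ 4 \<le> 12 * (M ^ 4 * (1 + h))" using P h by (simp add: algebra_simps)
    moreover have "0 \<le> M ^ 4 * (1 + h)" using P h by simp
    ultimately have "h * (1 + 2 * M + 12 * M\<^sup>2) + (M\<^sup>2 + 2 * (M * ?g)) * (12 * M\<^sup>2) + 2 * (M * ?g) * (2 * M) \<le> 100 * (M ^ 4 * (1 + h))"
      by linarith
    then show "?g\<^sup>2 * (1 + 2 * M + 12 * M\<^sup>2) + (M\<^sup>2 + 2 * (M * ?g)) * (12 * M\<^sup>2) + 2 * (M * ?g) * (2 * M) \<le> 100 * M ^ 4 * (1 + ?g\<^sup>2)"
      unfolding h_def by simp
  qed simp
  finally have 1: "\<bar>(v' t s \<bullet> v' t s) * (1 / V t s) - ?c - t * (2 * (d' s \<bullet> g s) - 2 * (d s \<bullet> \<eta> s) * ?c)\<bar> \<le> t\<^sup>2 * (100 * M ^ 4 * (1 + ?g\<^sup>2))"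
    by (simp add: algebra_simps)
  have 2: "0 \<le> (v t s \<bullet> v' t s)\<^sup>2 / (V t s)\<^sup>2" by simp
  have "t\<^sup>2 * (100 * M ^ 4 * (1 + ?g\<^sup>2)) + t\<^sup>2 * (32 * M ^ 4 * (1 + ?g\<^sup>2)) \<le> t\<^sup>2 * (200 * M ^ 4 * (1 + ?g\<^sup>2))"
  proof -
    have "0 \<le> t\<^sup>2 * (M ^ 4 * (1 + ?g\<^sup>2))" by simp
    then show ?thesis by (simp add: algebra_simps)
  qed
  then show ?thesis unfolding norm_n'[OF Vp] using 1 2 m2 by linarith
qed


text \<open>The component of the variation along \<open>planar_tangent\<close>, the only one that
  influences the energy to first order.\<close>

definition ty :: "real \<Rightarrow> real" where "ty s = cos (\<theta> s) * (\<eta> s \<bullet> e1) - sin (\<theta> s) * (\<eta> s \<bullet> e3)"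

lemma d_eta: "d s \<bullet> \<eta> s = sin (\<theta> s) * (\<eta> s \<bullet> e1) + cos (\<theta> s) * (\<eta> s \<bullet> e3)"
  unfolding d_def planar_def by (simp add: inner_add_left inner_commute[of e1 "\<eta> s"] inner_commute[of e3 "\<eta> s"])

lemma ht_eq: "ht s = - sin (\<theta> s) * ty s"
proof -
  have "ht s = (1 - (cos (\<theta> s))\<^sup>2) * (\<eta> s \<bullet> e3) - cos (\<theta> s) * sin (\<theta> s) * (\<eta> s \<bullet> e1)"
    unfolding ht_def d_eta by (simp add: algebra_simps power2_eq_square)
  also have "1 - (cos (\<theta> s))\<^sup>2 = (sin (\<theta> s))\<^sup>2" by (simp add: sin_squared_eq)
  finally show ?thesis unfolding ty_def by (simp add: algebra_simps power2_eq_square)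
qed

text \<open>The integrand is the derivative of \<open>\<theta>1 * ty\<close>, so the integral is a
  difference of boundary values. At the free end and at a pinned end \<open>\<theta>1\<close>
  vanishes, at a clamped end \<open>ty\<close> does.\<close>

lemma first_variation_zero:
  "(LINT s:{0..1}|lborel. (A * (sin (\<theta> s) * cos (\<theta> s)) - G * (1 - s) * sin (\<theta> s)) * ty s
      + \<theta>1 s * ((planar_tangent (\<theta> s) \<bullet> g s) - \<theta>1 s * (d s \<bullet> \<eta> s))) = 0"
  "set_integrable lborel {0..1} (\<lambda>s. (A * (sin (\<theta> s) * cos (\<theta> s)) - G * (1 - s) * sin (\<theta> s)) * ty s
      + \<theta>1 s * ((planar_tangent (\<theta> s) \<bullet> g s) - \<theta>1 s * (d s \<bullet> \<eta> s)))"
proof -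
  have sc: "((\<lambda>s. sin (\<theta> s)) has_real_derivative cos (\<theta> s) * \<theta>1 s) (at s within {0..1})"
    "((\<lambda>s. cos (\<theta> s)) has_real_derivative - sin (\<theta> s) * \<theta>1 s) (at s within {0..1})" if "s \<in> {0..1}" for s
    using th[OF that] by (auto intro!: derivative_eq_intros)
  have isn: "indef (\<lambda>s. sin (\<theta> s)) (\<lambda>s. cos (\<theta> s) * \<theta>1 s)"
    by (rule has_weak_deriv_indef, rule has_weak_deriv_C1)
       (use sc in \<open>auto simp: has_real_derivative_iff_has_vector_derivative[symmetric] intro!: continuous_intros cont\<close>)
  have ic: "indef (\<lambda>s. cos (\<theta> s)) (\<lambda>s. - sin (\<theta> s) * \<theta>1 s)"
    by (rule has_weak_deriv_indef, rule has_weak_deriv_C1)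
       (use sc in \<open>auto simp: has_real_derivative_iff_has_vector_derivative[symmetric] intro!: continuous_intros cont\<close>)
  have i1: "indef \<theta>1 (\<lambda>s. A * (sin (\<theta> s) * cos (\<theta> s)) - G * (1 - s) * sin (\<theta> s))"
    by (rule has_weak_deriv_indef, rule has_weak_deriv_C1)
       (use th1 in \<open>auto simp: has_real_derivative_iff_has_vector_derivative[symmetric] intro!: continuous_intros cont\<close>)
  note ie = indef_inner[OF has_weak_deriv_indef[OF weak_g]]
  have "indef (\<lambda>s. cos (\<theta> s) * (\<eta> s \<bullet> e1) + (-1) * (sin (\<theta> s) * (\<eta> s \<bullet> e3)))
     (\<lambda>s. ((- sin (\<theta> s) * \<theta>1 s) * (\<eta> s \<bullet> e1) + cos (\<theta> s) * (g s \<bullet> e1)) + (-1) * ((cos (\<theta> s) * \<theta>1 s) * (\<eta> s \<bullet> e3) + sin (\<theta> s) * (g s \<bullet> e3)))"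
    by (rule indef_add[OF indef_mult[OF ic ie] indef_cmult[OF indef_mult[OF isn ie]]])
  moreover have "(\<lambda>s. cos (\<theta> s) * (\<eta> s \<bullet> e1) + (-1) * (sin (\<theta> s) * (\<eta> s \<bullet> e3))) = ty"
    by (auto simp: ty_def)
  moreover have "(\<lambda>s. ((- sin (\<theta> s) * \<theta>1 s) * (\<eta> s \<bullet> e1) + cos (\<theta> s) * (g s \<bullet> e1)) + (-1) * ((cos (\<theta> s) * \<theta>1 s) * (\<eta> s \<bullet> e3) + sin (\<theta> s) * (g s \<bullet> e3)))
     = (\<lambda>s. (planar_tangent (\<theta> s) \<bullet> g s) - \<theta>1 s * (d s \<bullet> \<eta> s))"
    unfolding d_eta planar_tangent_def by (auto simp: inner_diff_left inner_commute[of _ "g _"] algebra_simps)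
  ultimately have it: "indef ty (\<lambda>s. (planar_tangent (\<theta> s) \<bullet> g s) - \<theta>1 s * (d s \<bullet> \<eta> s))" by simp
  note I = indef_mult[OF i1 it]
  have z: "\<theta>1 0 * ty 0 = 0"
  proof (cases bc)
    case Clamped then show ?thesis using eta(2) by (simp add: ty_def)
  next
    case Pinned then show ?thesis using pinned by simp
  qed
  show "(LINT s:{0..1}|lborel. (A * (sin (\<theta> s) * cos (\<theta> s)) - G * (1 - s) * sin (\<theta> s)) * ty s
      + \<theta>1 s * ((planar_tangent (\<theta> s) \<bullet> g s) - \<theta>1 s * (d s \<bullet> \<eta> s))) = 0"
    using indef_diff[OF I, of 0 1] unfolding z top by simp
  show "set_integrable lborel {0..1} (\<lambda>s. (A * (sin (\<theta> s) * cos (\<theta> s)) - G * (1 - s) * sin (\<theta> s)) * ty s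
      + \<theta>1 s * ((planar_tangent (\<theta> s) \<bullet> g s) - \<theta>1 s * (d s \<bullet> \<eta> s)))"
    by (rule indef_integrable[OF I])
qed

lemma cont_sgn_v:
  assumes t: "\<bar>t\<bar> \<le> 1 / (8 * M)"
  shows "continuous_on {0..1} (\<lambda>s. sgn (v t s))"
  by (rule indef_continuous[OF indef_sgn_v[OF t]])

lemma sgn_v_0: "sgn (v 0 s) = d s"
  by (simp add: v_def d_def sgn_div_norm norm_planar)

lemma n'_0: "n' 0 s = d' s"
  unfolding n'_def V_def v_def v'_def by (simp add: d_def d'_def planar_inner)

lemma energy_stationary:
  "((\<lambda>t. energy A G (\<lambda>s. sgn (d s + t *\<^sub>R \<eta> s))) has_real_derivative 0) (at 0)"
proof -
  let ?t0 = "1 / (8 * M)"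
  have t0: "?t0 > 0" using M1 by simp
  let ?Da = "\<lambda>s. 2 * (d' s \<bullet> g s) - 2 * (d s \<bullet> \<eta> s) * (norm (d' s))\<^sup>2"
  let ?Db = "\<lambda>s. - (2 * cos (\<theta> s) * ht s)"
  let ?Dc = "\<lambda>s. (1 - s) * ht s"
  have c_ht: "continuous_on {0..1} ht" unfolding ht_def by (intro continuous_intros cont cont_eta cont_d)
  have c_ty: "continuous_on {0..1} ty" unfolding ty_def by (intro continuous_intros cont cont_eta)
  have iDb: "set_integrable lborel {0..1} ?Db" and iDc: "set_integrable lborel {0..1} ?Dc"
    by (intro set_integrable_continuous continuous_intros c_ht cont)+
  let ?R = "\<lambda>s. (A * (sin (\<theta> s) * cos (\<theta> s)) - G * (1 - s) * sin (\<theta> s)) * ty s"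
  let ?J = "\<lambda>s. ?R s + \<theta>1 s * ((planar_tangent (\<theta> s) \<bullet> g s) - \<theta>1 s * (d s \<bullet> \<eta> s))"
  have iR: "set_integrable lborel {0..1} ?R" by (intro set_integrable_continuous continuous_intros c_ty cont)
  \<comment> \<open>The elastic term is twice an exact derivative \<open>?J\<close> minus twice
    \<open>?R\<close>. After the factor one half, \<open>- ?R\<close> cancels against the magnetic
    and gravitational terms, whose sum is \<open>?R\<close>.\<close>
  have Da: "?Da s = 2 * (?J s - ?R s)" for s
  proof -
    have "(norm (d' s))\<^sup>2 = \<theta>1 s * \<theta>1 s" unfolding d'_def by (simp add: norm_planar power2_eq_square)
    moreover have "d' s \<bullet> g s = \<theta>1 s * (planar_tangent (\<theta> s) \<bullet> g s)" by (simp add: d'_def)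
    ultimately show ?thesis by (simp add: algebra_simps)
  qed
  have iJR: "set_integrable lborel {0..1} (\<lambda>s. ?J s - ?R s)" by (rule set_integral_diff(1)[OF first_variation_zero(2) iR])
  have iDa: "set_integrable lborel {0..1} ?Da" unfolding Da using iJR by simp
  have IDa: "(LINT s:{0..1}|lborel. ?Da s) = - 2 * (LINT s:{0..1}|lborel. ?R s)"
    unfolding Da set_integral_mult_right set_integral_diff(2)[OF first_variation_zero(2) iR] first_variation_zero(1) by simp
  have da: "((\<lambda>t. LINT s:{0..1}|lborel. (norm (n' t s))\<^sup>2) has_real_derivative (LINT s:{0..1}|lborel. ?Da s)) (at 0)"
  proof (rule has_derivative_integral_second_order[OF t0 _ iDa int_bound[of "200 * M ^ 4"]])
    show "set_integrable lborel {0..1} (\<lambda>s. (norm (n' t s))\<^sup>2)" if "\<bar>t\<bar> \<le> ?t0" for t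
      using weak_sgn_v[OF that] unfolding has_weak_deriv_def by blast
    show "\<bar>(norm (n' t s))\<^sup>2 - (norm (n' 0 s))\<^sup>2 - t * ?Da s\<bar> \<le> t\<^sup>2 * (200 * M ^ 4 * (1 + (norm (g s))\<^sup>2))"
      if "\<bar>t\<bar> \<le> ?t0" "s \<in> {0..1}" for t s
      unfolding n'_0 by (rule elastic_expansion[OF that(2,1)])
  qed
  let ?K = "50 * M ^ 3 * (1 + 2 * M + 25 * M ^ 3) + 4 * M\<^sup>2"
  have db: "((\<lambda>t. LINT s:{0..1}|lborel. 1 - (e3 \<bullet> sgn (v t s))\<^sup>2) has_real_derivative (LINT s:{0..1}|lborel. ?Db s)) (at 0)"
  proof (rule has_derivative_integral_second_order[OF t0 _ iDb set_integrable_continuous[OF continuous_on_const]])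
    show "set_integrable lborel {0..1} (\<lambda>s. 1 - (e3 \<bullet> sgn (v t s))\<^sup>2)" if "\<bar>t\<bar> \<le> ?t0" for t
      by (intro set_integrable_continuous continuous_intros cont_sgn_v that)
    show "\<bar>(1 - (e3 \<bullet> sgn (v t s))\<^sup>2) - (1 - (e3 \<bullet> sgn (v 0 s))\<^sup>2) - t * ?Db s\<bar> \<le> t\<^sup>2 * ?K"
      if "\<bar>t\<bar> \<le> ?t0" "s \<in> {0..1}" for t s
    proof -
      have "e3 \<bullet> sgn (v 0 s) = cos (\<theta> s)" unfolding sgn_v_0 d_def by (simp add: planar_inner)
      then have "(1 - (e3 \<bullet> sgn (v t s))\<^sup>2) - (1 - (e3 \<bullet> sgn (v 0 s))\<^sup>2) - t * ?Db s
        = - ((e3 \<bullet> sgn (v t s))\<^sup>2 - (cos (\<theta> s))\<^sup>2 - t * (2 * cos (\<theta> s) * ht s))" by simp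
      then show ?thesis using square_expansion[OF that(2,1)] by (simp only: abs_minus_cancel)
    qed
  qed
  have dc: "((\<lambda>t. LINT s:{0..1}|lborel. (1 - s) * (sgn (v t s) \<bullet> e3)) has_real_derivative (LINT s:{0..1}|lborel. ?Dc s)) (at 0)"
  proof (rule has_derivative_integral_second_order[OF t0 _ iDc set_integrable_continuous[OF continuous_on_const]])
    show "set_integrable lborel {0..1} (\<lambda>s. (1 - s) * (sgn (v t s) \<bullet> e3))" if "\<bar>t\<bar> \<le> ?t0" for t
      by (intro set_integrable_continuous continuous_intros cont_sgn_v that)
    show "\<bar>(1 - s) * (sgn (v t s) \<bullet> e3) - (1 - s) * (sgn (v 0 s) \<bullet> e3) - t * ?Dc s\<bar> \<le> t\<^sup>2 * (25 * M ^ 3)"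
      if "\<bar>t\<bar> \<le> ?t0" "s \<in> {0..1}" for t s
    proof -
      have "sgn (v 0 s) \<bullet> e3 = cos (\<theta> s)" unfolding sgn_v_0 d_def by (simp add: planar_inner)
      then have "(1 - s) * (sgn (v t s) \<bullet> e3) - (1 - s) * (sgn (v 0 s) \<bullet> e3) - t * ?Dc s
        = (1 - s) * (sgn (v t s) \<bullet> e3 - cos (\<theta> s) - t * ht s)" by (simp add: algebra_simps)
      also have "\<bar>\<dots>\<bar> \<le> 1 * (t\<^sup>2 * (25 * M ^ 3))"
        unfolding abs_mult using that(2) by (intro mult_mono height_expansion that) auto
      finally show ?thesis by simp
    qed
  qed
  let ?E = "\<lambda>t. 1 / 2 * (LINT s:{0..1}|lborel. (norm (n' t s))\<^sup>2)
     + A / 2 * (LINT s:{0..1}|lborel. 1 - (e3 \<bullet> sgn (v t s))\<^sup>2)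
     + G * (LINT s:{0..1}|lborel. (1 - s) * (sgn (v t s) \<bullet> e3))"
  have dE: "(?E has_real_derivative 1 / 2 * (LINT s:{0..1}|lborel. ?Da s) + A / 2 * (LINT s:{0..1}|lborel. ?Db s)
      + G * (LINT s:{0..1}|lborel. ?Dc s)) (at 0)"
    by (intro DERIV_add DERIV_cmult da db dc)
  have "A / 2 * (LINT s:{0..1}|lborel. ?Db s) + G * (LINT s:{0..1}|lborel. ?Dc s) = (LINT s:{0..1}|lborel. A / 2 * ?Db s + G * ?Dc s)"
    unfolding set_integral_mult_right[symmetric]
    by (rule set_integral_continuous_add[symmetric]) (intro continuous_intros c_ht cont)+
  also have "\<dots> = (LINT s:{0..1}|lborel. ?R s)" unfolding ht_eq by (simp add: algebra_simps)
  finally have z: "1 / 2 * (LINT s:{0..1}|lborel. ?Da s) + A / 2 * (LINT s:{0..1}|lborel. ?Db s)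
      + G * (LINT s:{0..1}|lborel. ?Dc s) = 0" unfolding IDa by linarith
  show ?thesis
  proof (subst DERIV_cong_ev[OF refl _ refl])
    have "eventually (\<lambda>t. t \<in> {- ?t0<..<?t0}) (nhds 0)" using t0 by (intro eventually_nhds_in_open) auto
    then show "\<forall>\<^sub>F t in nhds 0. energy A G (\<lambda>s. sgn (d s + t *\<^sub>R \<eta> s)) = ?E t"
      by eventually_elim (rule energy_v, auto)
    show "(?E has_real_derivative 0) (at 0)" using dE unfolding z .
  qed
qed

end

lemma (in planar_rod) equilibrium: "equilibrium bc A G d"
  unfolding equilibrium_def
proof (intro conjI admissible allI impI)
  fix \<eta> :: "real \<Rightarrow> real ^ 3" assume h: "H1 \<eta> \<and> (bc = Clamped \<longrightarrow> \<eta> 0 = 0)"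
  have ce: "continuous_on {0..1} \<eta>"
    using h by (intro indef_continuous[OF has_weak_deriv_indef[OF H1_weak_deriv]]) auto
  have "bounded (\<eta> ` {0..1})" by (intro compact_imp_bounded compact_continuous_image ce) auto
  then obtain M1 where "\<forall>y\<in>\<eta> ` {0..1}. norm y \<le> M1" using bounded_iff by blast
  then have M1: "norm (\<eta> s) \<le> M1" if "s \<in> {0..1}" for s using that by auto
  have "bounded (\<theta>1 ` {0..1})" by (intro compact_imp_bounded compact_continuous_image cont) auto
  then obtain M2 where "\<forall>y\<in>\<theta>1 ` {0..1}. norm y \<le> M2" using bounded_iff by blast
  then have M2: "\<bar>\<theta>1 s\<bar> \<le> M2" if "s \<in> {0..1}" for s using that by auto
  interpret planar_variation bc A G \<theta> \<theta>1 \<eta> "max 1 (max M1 M2)"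
    by unfold_locales (use h M1 M2 in \<open>auto simp: le_max_iff_disj\<close>)
  show "((\<lambda>t. energy A G (\<lambda>s. sgn (d s + t *\<^sub>R \<eta> s))) has_real_derivative 0) (at 0)" by (rule energy_stationary)
qed

text \<open>A constant field makes sine and cosine of the angle constant, so
  \<open>\<theta>1\<close> is zero inside the rod and the right-hand side of the equation vanishes
  at every interior point. Its gravity part depends on \<open>s\<close> unless the sine is
  zero.\<close>

lemma (in planar_rod) straight_imp:
  assumes G: "G > 0" and str: "straight d"
  shows "sin (\<theta> 1) = 0"
proof -
  obtain c where c: "\<And>s. s \<in> {0..1} \<Longrightarrow> d s = c" using str by (auto simp: straight_def)
  have de: "d s \<bullet> e1 = sin (\<theta> s)" "d s \<bullet> e3 = cos (\<theta> s)" for s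
    by (simp_all add: d_def planar_def inner_add_left)
  have sc: "sin (\<theta> s) = sin (\<theta> 1)" "cos (\<theta> s) = cos (\<theta> 1)" if "s \<in> {0..1}" for s
    using c[OF that] c[of 1] de[of s] de[of 1] by auto
  have int: "at s within {0..1} = at s" if "0 < s" "s < 1" for s :: real using at_within_Icc_at[OF that] .
  have ev: "eventually (\<lambda>y. y \<in> {0<..<1}) (nhds s)" if "0 < s" "s < 1" for s :: real
    using that by (intro eventually_nhds_in_open) auto
  have const: "D = 0" if "0 < s" "s < 1" "(f has_real_derivative D) (at s)" "\<And>y. 0 < y \<Longrightarrow> y < 1 \<Longrightarrow> f y = k" for f D k s
  proof -
    have "((\<lambda>_. k) has_real_derivative 0) (at s)" by simp
    then have "(f has_real_derivative 0) (at s)"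
      by (subst DERIV_cong_ev[OF refl _ refl, of _ "\<lambda>_. k"]) (use ev[OF that(1,2)] that(4) in \<open>auto elim!: eventually_mono\<close>)
    then show ?thesis using that(3) DERIV_unique by blast
  qed
  have t1: "\<theta>1 s = 0" if s: "0 < s" "s < 1" for s
  proof -
    have d: "(\<theta> has_real_derivative \<theta>1 s) (at s)" using th[of s] s int[OF s] by simp
    have D: "((\<lambda>s. sin (\<theta> s)) has_real_derivative cos (\<theta> s) * \<theta>1 s) (at s)"
      "((\<lambda>s. cos (\<theta> s)) has_real_derivative - sin (\<theta> s) * \<theta>1 s) (at s)"
      using d by (auto intro!: derivative_eq_intros)
    have 1: "cos (\<theta> s) * \<theta>1 s = 0" by (rule const[OF s D(1)], rule sc(1), simp)
    have 2: "- sin (\<theta> s) * \<theta>1 s = 0" by (rule const[OF s D(2)], rule sc(2), simp)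
    have "\<theta>1 s = ((sin (\<theta> s))\<^sup>2 + (cos (\<theta> s))\<^sup>2) * \<theta>1 s" by simp
    also have "\<dots> = - sin (\<theta> s) * (- sin (\<theta> s) * \<theta>1 s) + cos (\<theta> s) * (cos (\<theta> s) * \<theta>1 s)"
      by (simp only: power2_eq_square distrib_right mult.assoc mult_minus_left mult_minus_right minus_minus)
    finally show ?thesis unfolding 1 2 by simp
  qed
  have q: "A * (sin (\<theta> 1) * cos (\<theta> 1)) - G * (1 - s) * sin (\<theta> 1) = 0" if s: "0 < s" "s < 1" for s
  proof -
    have "(\<theta>1 has_real_derivative A * (sin (\<theta> s) * cos (\<theta> s)) - G * (1 - s) * sin (\<theta> s)) (at s)"
      using th1[of s] s int[OF s] by simp
    from const[OF s this t1] show ?thesis using sc[of s] s by simp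
  qed
  \<comment> \<open>Two arbitrary interior points; their difference eliminates the magnetic
    term.\<close>
  have "A * (sin (\<theta> 1) * cos (\<theta> 1)) - G * (1 - 1/2) * sin (\<theta> 1) = 0"
    "A * (sin (\<theta> 1) * cos (\<theta> 1)) - G * (1 - 1/4) * sin (\<theta> 1) = 0"
    by (rule q; simp)+
  then have "G * (1 - 1/2) * sin (\<theta> 1) = G * (1 - 1/4) * sin (\<theta> 1)" by linarith
  then show ?thesis using G by simp
qed

context branch_point
begin

lemma profile_close:
  assumes s: "s \<in> {0..1}"
  shows "\<bar>branch_profile bc G r s - buckling_mode bc G s\<bar> \<le> r\<^sup>2 * (C * (340 * C ^ 7))"
proof -
  have "\<bar>integral {s..1} (\<lambda>t. airy_kernel bc G s t * branch_rhs bc G r (branch_profile bc G r) t)\<bar> \<le> C * (340 * C ^ 7)"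
    using s by (intro integral_abs_le tail_integrable_cont profile_near mult_ker_le rhs_le) auto
  then show ?thesis unfolding profile_fixed_point[OF s]
    by (auto simp: branch_step_def abs_mult intro!: mult_left_mono)
qed

lemma planar_close:
  assumes s: "s \<in> {0..1}" and r0: "r \<noteq> 0"
  shows "norm ((planar (r * branch_profile bc G r s) - e3) /\<^sub>R r - buckling_mode bc G s *\<^sub>R e1)
     \<le> \<bar>r\<bar> * (C * (340 * C ^ 7) + 4 * C ^ 3 + 2 * C\<^sup>2)"
proof -
  define y where "y = branch_profile bc G r s"
  have y: "\<bar>y\<bar> \<le> 2 * C" unfolding y_def by (rule near_le[OF profile_near s])
  have "\<bar>r\<bar> * 1 \<le> \<bar>r\<bar> * C ^ 5" using C1 by (intro mult_left_mono) auto
  moreover have "\<bar>r\<bar> * C ^ 5 \<le> 1 / 100" using r C1 by (simp add: field_simps)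
  ultimately have r1: "\<bar>r\<bar> \<le> 1" by linarith
  have rr: "r\<^sup>2 \<le> \<bar>r\<bar>"
  proof -
    have "\<bar>r\<bar> * \<bar>r\<bar> \<le> \<bar>r\<bar> * 1" using r1 by (intro mult_left_mono) auto
    then show ?thesis by (simp add: power2_eq_square)
  qed
  have "r * (sin (r * y) / r) = r * (y - r\<^sup>2 * cub r y)"
    using cub_eq[of r y] r0 by (simp add: algebra_simps power2_eq_square power3_eq_cube)
  then have sn: "sin (r * y) / r = y - r\<^sup>2 * cub r y" using r0 by simp
  have "(planar (r * y) - e3) /\<^sub>R r - buckling_mode bc G s *\<^sub>R e1
     = (sin (r * y) / r - buckling_mode bc G s) *\<^sub>R e1 - ((1 - cos (r * y)) / r) *\<^sub>R e3"
    unfolding planar_def using r0 by (simp add: algebra_simps divide_inverse)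
  also have "norm \<dots> \<le> \<bar>sin (r * y) / r - buckling_mode bc G s\<bar> + \<bar>(1 - cos (r * y)) / r\<bar>"
    by (rule order_trans[OF norm_triangle_ineq4]) (simp add: norm_eq_sqrt_inner[of e1] norm_eq_sqrt_inner[of e3])
  also have "\<dots> \<le> (r\<^sup>2 * (C * (340 * C ^ 7)) + r\<^sup>2 * (4 * C ^ 3)) + \<bar>r\<bar> * (2 * C\<^sup>2)"
  proof (rule add_mono)
    have "\<bar>y - buckling_mode bc G s\<bar> \<le> r\<^sup>2 * (C * (340 * C ^ 7))" unfolding y_def by (rule profile_close[OF s])
    moreover have "\<bar>r\<^sup>2 * cub r y\<bar> \<le> r\<^sup>2 * (4 * C ^ 3)" unfolding abs_mult using cub_le[OF y] by (intro mult_mono) auto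
    ultimately show "\<bar>sin (r * y) / r - buckling_mode bc G s\<bar> \<le> r\<^sup>2 * (C * (340 * C ^ 7)) + r\<^sup>2 * (4 * C ^ 3)"
      unfolding sn by linarith
    have "\<bar>(1 - cos (r * y)) / r\<bar> = (1 - cos (r * y)) / \<bar>r\<bar>" by (simp add: abs_divide)
    also have "\<dots> \<le> ((r * y)\<^sup>2 / 2) / \<bar>r\<bar>" by (intro divide_right_mono one_minus_cos_le) auto
    also have "\<dots> = \<bar>r\<bar> * (y\<^sup>2 / 2)" using r0 by (simp add: power_mult_distrib power2_eq_square[of r] abs_if)
    also have "\<dots> \<le> \<bar>r\<bar> * ((2 * C)\<^sup>2 / 2)"
    proof (intro mult_left_mono divide_right_mono)
      have "\<bar>y\<bar>\<^sup>2 \<le> (2 * C)\<^sup>2" by (rule power_mono[OF y]) simp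
      then show "y\<^sup>2 \<le> (2 * C)\<^sup>2" by simp
    qed auto
    finally show "\<bar>(1 - cos (r * y)) / r\<bar> \<le> \<bar>r\<bar> * (2 * C\<^sup>2)" by (simp add: power_mult_distrib)
  qed
  also have "\<dots> \<le> (\<bar>r\<bar> * (C * (340 * C ^ 7)) + \<bar>r\<bar> * (4 * C ^ 3)) + \<bar>r\<bar> * (2 * C\<^sup>2)"
    using rr C1 by (intro add_mono mult_right_mono) auto
  finally show ?thesis unfolding y_def by (simp add: algebra_simps)
qed

lemma branch_planar_rod:
  obtains v1 where "planar_rod bc (branch_parameter bc G r) G (\<lambda>s. r * branch_profile bc G r s) (\<lambda>s. r * v1 s)"
    "branch_profile bc G r 1 = 1"
proof (rule profile_solution, goal_cases)
  case (1 v1)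
  let ?y = "branch_profile bc G r" and ?a = "branch_parameter bc G r"
  have "planar_rod bc ?a G (\<lambda>s. r * ?y s) (\<lambda>s. r * v1 s)"
  proof
    fix s :: real assume s: "s \<in> {0..1}"
    show "((\<lambda>s. r * ?y s) has_real_derivative r * v1 s) (at s within {0..1})" by (rule DERIV_cmult[OF 1(2)[OF s]])
    have "r * (?a * sincos_part r (?y s) - G * (1 - s) * (?y s - r\<^sup>2 * cub r (?y s)))
      = ?a * (r * sincos_part r (?y s)) - G * (1 - s) * (r * ?y s - r ^ 3 * cub r (?y s))"
      by (simp add: algebra_simps power2_eq_square power3_eq_cube)
    also have "\<dots> = ?a * (sin (r * ?y s) * cos (r * ?y s)) - G * (1 - s) * sin (r * ?y s)"
      unfolding sincos_part_eq cub_eq by simp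
    finally show "((\<lambda>s. r * v1 s) has_real_derivative ?a * (sin (r * ?y s) * cos (r * ?y s)) - G * (1 - s) * sin (r * ?y s)) (at s within {0..1})"
      using DERIV_cmult[OF 1(3)[OF s], of r] by simp
  qed (use 1(5-) in auto)
  then show ?case using 1(4) by (rule 1(1))
qed

end

section \<open>The pitchfork branches and the stated consequences\<close>

definition branch_field :: "support \<Rightarrow> real \<Rightarrow> real \<Rightarrow> real \<Rightarrow> real ^ 3" where
  "branch_field bc G r s = planar (r * branch_profile bc G r s)"

lemma branch_field_continuous:
  "continuous_on (branch_domain bc \<times> {0..1}) (\<lambda>x. branch_field bc (fst (fst x)) (snd (fst x)) (snd x))"
  unfolding branch_field_def planar_def
  by (intro continuous_intros continuous_on_mult branch_profile_continuous)

lemma half_turn_planar: "half_turn (planar x) = planar (- x)"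
  unfolding half_turn_def planar_inner by (simp add: planar_def algebra_simps scaleR_2[symmetric] scaleR_left_distrib[symmetric])

lemma branch_is_pitchfork:
  assumes G: "G > 0"
  shows "pitchfork_branch bc G (branch_A2 bc G) (branch_radius bc G) (branch_parameter bc G) (branch_field bc G)"
  unfolding pitchfork_branch_def
proof (intro conjI)
  let ?e = "branch_radius bc G" and ?C = "mode_const bc G"
  have pt: "branch_point bc G r ?C" if "\<bar>r\<bar> < ?e" for r
    using branch_domain_point[of "(G, r)" bc] that G by (simp add: branch_domain_def)
  show "?e > 0" by (rule branch_radius_pos[OF G])
  have "continuous_on {r. \<bar>r\<bar> < ?e} (\<lambda>r. branch_parameter bc (fst (G, r)) (snd (G, r)))"
    by (rule continuous_on_compose2[OF branch_parameter_continuous, where f="\<lambda>r. (G, r)"])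
       (use G in \<open>auto intro!: continuous_intros simp: branch_domain_def\<close>)
  then show "continuous_on {r. \<bar>r\<bar> < ?e} (branch_parameter bc G)" by simp
  have "continuous_on {(r, s). \<bar>r\<bar> < ?e \<and> s \<in> {0..1}}
     (\<lambda>x. branch_field bc (fst (fst ((G, fst x), snd x))) (snd (fst ((G, fst x), snd x))) (snd ((G, fst x), snd x)))"
    by (rule continuous_on_compose2[OF branch_field_continuous, where f="\<lambda>x. ((G, fst x), snd x)"])
       (use G in \<open>auto intro!: continuous_intros simp: branch_domain_def\<close>)
  then show "continuous_on {(r, s). \<bar>r\<bar> < ?e \<and> s \<in> {0..1}} (\<lambda>(r, s). branch_field bc G r s)"
    by (simp add: case_prod_unfold)
  show "branch_parameter bc G 0 = A_crit bc G" by (simp add: branch_parameter_def)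
  show "\<forall>s\<in>{0..1}. branch_field bc G 0 s = e3" by (simp add: branch_field_def planar_0)
  show "\<forall>r. \<bar>r\<bar> < ?e \<longrightarrow> equilibrium bc (branch_parameter bc G r) G (branch_field bc G r)"
  proof (intro allI impI)
    fix r assume "\<bar>r\<bar> < ?e"
    then interpret branch_point bc G r ?C by (rule pt)
    obtain v1 where "planar_rod bc (branch_parameter bc G r) G (\<lambda>s. r * branch_profile bc G r s) (\<lambda>s. r * v1 s)"
      using branch_planar_rod by metis
    then interpret P: planar_rod bc "branch_parameter bc G r" G "\<lambda>s. r * branch_profile bc G r s" "\<lambda>s. r * v1 s" .
    have "branch_field bc G r = P.d" by (rule ext) (simp add: branch_field_def P.d_def)
    then show "equilibrium bc (branch_parameter bc G r) G (branch_field bc G r)" using P.equilibrium by simp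
  qed
  show "\<forall>r. \<bar>r\<bar> < ?e \<and> r \<noteq> 0 \<longrightarrow> \<not> straight (branch_field bc G r)"
  proof (intro allI impI notI)
    fix r assume hr: "\<bar>r\<bar> < ?e \<and> r \<noteq> 0" and str: "straight (branch_field bc G r)"
    then interpret branch_point bc G r ?C by (intro pt) simp
    obtain v1 where v1: "planar_rod bc (branch_parameter bc G r) G (\<lambda>s. r * branch_profile bc G r s) (\<lambda>s. r * v1 s)"
      "branch_profile bc G r 1 = 1"
      using branch_planar_rod by metis
    interpret P: planar_rod bc "branch_parameter bc G r" G "\<lambda>s. r * branch_profile bc G r s" "\<lambda>s. r * v1 s" by (rule v1)
    have "branch_field bc G r = P.d" by (rule ext) (simp add: branch_field_def P.d_def)
    \<comment> \<open>The profile equals 1 at the free end, so the angle there is \<open>r\<close>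
      itself, and the radius keeps it below \<open>pi\<close>.\<close>
    then have "sin r = 0" using P.straight_imp[OF G] str v1(2) by simp
    moreover have "\<bar>r\<bar> < pi" using hr branch_radius_le[OF G, of bc] pi_gt3 by linarith
    ultimately show False using hr sin_eq_0_pi[of r] by (auto simp: abs_less_iff)
  qed
  show "\<forall>r. \<bar>r\<bar> < ?e \<longrightarrow> branch_parameter bc G (- r) = branch_parameter bc G r \<and>
     (\<forall>s\<in>{0..1}. branch_field bc G (- r) s = half_turn (branch_field bc G r s))"
    by (auto simp: branch_parameter_even branch_field_def branch_profile_even half_turn_planar)
  show "(\<lambda>r. branch_parameter bc G r - (A_crit bc G + branch_A2 bc G * r\<^sup>2)) \<in> o[at 0](\<lambda>r. r\<^sup>2)"
    by (rule branch_parameter_expansion[OF G])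
  show "\<exists>\<phi>. nonzero01 \<phi> \<and> uniform_limit {0..1} (\<lambda>r s. (branch_field bc G r s - e3) /\<^sub>R r) \<phi> (at 0)"
  proof (intro exI conjI)
    have "e1 \<noteq> 0" by (metis e_inner(1) inner_zero_left zero_neq_one)
    then show "nonzero01 (\<lambda>s. buckling_mode bc G s *\<^sub>R e1)"
      unfolding nonzero01_def by (intro bexI[of _ 1]) auto
    let ?K = "?C * (340 * ?C ^ 7) + 4 * ?C ^ 3 + 2 * ?C\<^sup>2"
    have K: "?K > 0" using mode_const_ge_1[OF G, of bc] by (intro add_pos_pos mult_pos_pos zero_less_power) auto
    show "uniform_limit {0..1} (\<lambda>r s. (branch_field bc G r s - e3) /\<^sub>R r) (\<lambda>s. buckling_mode bc G s *\<^sub>R e1) (at 0)"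
    proof (rule uniform_limitI)
      fix e :: real assume e: "e > 0"
      have "eventually (\<lambda>r. r \<in> ball 0 (min ?e (e / ?K)) - {0}) (at (0::real))"
        by (rule eventually_at_in_open) (use e K branch_radius_pos[OF G, of bc] in auto)
      then show "\<forall>\<^sub>F r in at 0. \<forall>s\<in>{0..1}. dist ((branch_field bc G r s - e3) /\<^sub>R r) (buckling_mode bc G s *\<^sub>R e1) < e"
      proof eventually_elim
        case (elim r)
        then have hr: "\<bar>r\<bar> < ?e" "\<bar>r\<bar> < e / ?K" "r \<noteq> 0" by (auto simp: dist_real_def)
        interpret branch_point bc G r ?C by (rule pt[OF hr(1)])
        show ?case
        proof
          fix s :: real assume s: "s \<in> {0..1}"
          have "dist ((branch_field bc G r s - e3) /\<^sub>R r) (buckling_mode bc G s *\<^sub>R e1) \<le> \<bar>r\<bar> * ?K"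
            using planar_close[OF s hr(3)] by (simp add: dist_norm branch_field_def)
          also have "\<dots> < e" using hr(2) K by (simp add: field_simps)
          finally show "dist ((branch_field bc G r s - e3) /\<^sub>R r) (buckling_mode bc G s *\<^sub>R e1) < e" .
        qed
      qed
    qed
  qed
qed

lemma branch_is_continuous_family:
  "continuous_pitchfork_family bc (branch_A2 bc) (branch_radius bc) (branch_parameter bc) (branch_field bc)"
  unfolding continuous_pitchfork_family_def
proof (intro conjI allI impI branch_is_pitchfork branch_A2_continuous branch_radius_continuous)
  have "{(G, r). G > 0 \<and> \<bar>r\<bar> < branch_radius bc G} = branch_domain bc" by (simp add: branch_domain_def)
  then show "continuous_on {(G, r). G > 0 \<and> \<bar>r\<bar> < branch_radius bc G} (\<lambda>(G, r). branch_parameter bc G r)"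
    using branch_parameter_continuous[of bc] by (simp add: case_prod_unfold)
  let ?S = "{(G, r, s). G > 0 \<and> \<bar>r\<bar> < branch_radius bc G \<and> s \<in> {0..1::real}}"
  let ?f = "\<lambda>x::real \<times> real \<times> real. ((fst x, fst (snd x)), snd (snd x))"
  have "continuous_on ?S (\<lambda>x. branch_field bc (fst (fst (?f x))) (snd (fst (?f x))) (snd (?f x)))"
    by (rule continuous_on_compose2[OF branch_field_continuous, where f="?f"])
       (auto intro!: continuous_intros simp: branch_domain_def)
  then show "continuous_on ?S (\<lambda>(G, r, s). branch_field bc G r s)" by (simp add: case_prod_unfold)
qed

text \<open>At \<open>G_crit\<close> the eigenvalue is zero and the coefficient is the integral of a
  negative weight, so by continuity it stays negative for nearby \<open>G\<close>. Monotonicity of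
  \<open>beta0\<close> translates closeness of \<open>beta0\<close> to zero into closeness of
  \<open>G\<close> to \<open>G_crit\<close>.\<close>

lemma supercritical_near_Greenhill:
  "\<exists>\<delta>>0. \<forall>G>0. \<bar>beta0 Clamped G\<bar> < \<delta> \<longrightarrow> branch_A2 Clamped G < 0"
proof -
  have Gc: "G_crit > 0" using G_crit(1) by simp
  have neg: "branch_A2 Clamped G_crit < 0"
    by (rule branch_A2_negative[OF Gc]) (simp add: A_crit_def beta0_Clamped_G_crit)
  obtain h where h: "h > 0" "\<And>G. G \<in> {0<..} \<Longrightarrow> dist G G_crit < h \<Longrightarrow> dist (branch_A2 Clamped G) (branch_A2 Clamped G_crit) < - branch_A2 Clamped G_crit"
    using branch_A2_continuous[of Clamped, unfolded continuous_on_iff, rule_format, of G_crit "- branch_A2 Clamped G_crit"] neg Gc by auto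
  define k where "k = min (h / 2) (G_crit / 2)"
  have k: "k > 0" "k < h" "k < G_crit" using h(1) Gc by (auto simp: k_def)
  \<comment> \<open>The smaller distance of \<open>beta0\<close> from zero at the two ends of the
    interval around \<open>G_crit\<close>; a value closer to zero is taken only inside.\<close>
  define \<delta> where "\<delta> = min (beta0 Clamped (G_crit - k)) (- beta0 Clamped (G_crit + k))"
  have "beta0 Clamped (G_crit - k) > 0" using beta0_Clamped_pos_iff[of "G_crit - k"] k by simp
  moreover have "beta0 Clamped (G_crit + k) < 0" by (rule beta0_Clamped_negative) (use k in simp)
  ultimately have d: "\<delta> > 0" by (simp add: \<delta>_def)
  have dle: "\<delta> \<le> beta0 Clamped (G_crit - k)" "\<delta> \<le> - beta0 Clamped (G_crit + k)" by (simp_all add: \<delta>_def)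
  have "branch_A2 Clamped G < 0" if G: "G > 0" "\<bar>beta0 Clamped G\<bar> < \<delta>" for G
  proof -
    have "\<not> G \<le> G_crit - k"
    proof
      assume "G \<le> G_crit - k"
      then have "beta0 Clamped (G_crit - k) \<le> beta0 Clamped G" using beta0_Lipschitz(1)[of G "G_crit - k" Clamped] G by simp
      then show False using G(2) dle by linarith
    qed
    moreover have "\<not> G \<ge> G_crit + k"
    proof
      assume "G \<ge> G_crit + k"
      then have "beta0 Clamped G \<le> beta0 Clamped (G_crit + k)" using beta0_Lipschitz(1)[of "G_crit + k" G Clamped] Gc k by simp
      then show False using G(2) dle by linarith
    qed
    ultimately have "dist G G_crit < h" using k by (simp add: dist_real_def abs_if)
    then have "\<bar>branch_A2 Clamped G - branch_A2 Clamped G_crit\<bar> < - branch_A2 Clamped G_crit"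
      using h(2)[of G] G by (simp add: dist_real_def)
    then show ?thesis by linarith
  qed
  then show ?thesis using d by blast
qed

lemma gravity_par_pos: "\<rho> > 0 \<Longrightarrow> A0 > 0 \<Longrightarrow> g > 0 \<Longrightarrow> L > 0 \<Longrightarrow> B > 0 \<Longrightarrow> gravity_par \<rho> A0 g L B > 0"
  unfolding gravity_par_def by simp

lemma straight_stable_if_gravity_less:
  assumes "G > 0" "G < A"
  shows "straight_stable bc A G"
  by (rule straight_stable_above) (use assms beta0_ge_minus_G[of G bc] in auto)

text \<open>Both parameters contain the factor \<open>A0 * L^2 / B\<close>. Cancelling it, the bound
  on the length says precisely that the magnetic parameter exceeds the gravity parameter, which
  suffices because \<open>beta0\<close> is at least \<open>- G\<close> for either support.\<close>

lemma short_rod_stable: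
  assumes "\<rho> > 0" "g > 0" "Kd > 0" "L > 0" "L < Kd / (\<rho> * g)" "diam > 0" "B > 0"
  shows "straight_stable bc (magnetic_par Kd (disc_area diam) L B) (gravity_par \<rho> (disc_area diam) g L B)"
proof (rule straight_stable_if_gravity_less)
  have A0: "disc_area diam > 0" using assms unfolding disc_area_def by simp
  show "gravity_par \<rho> (disc_area diam) g L B > 0" using assms A0 by (intro gravity_par_pos)
  have "L * (\<rho> * g) < Kd" using assms by (simp add: pos_less_divide_eq)
  then have "(L * (\<rho> * g)) * (disc_area diam * L\<^sup>2 / B) < Kd * (disc_area diam * L\<^sup>2 / B)"
    using A0 assms by (intro mult_strict_right_mono) auto
  then show "gravity_par \<rho> (disc_area diam) g L B < magnetic_par Kd (disc_area diam) L B"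
    unfolding gravity_par_def magnetic_par_def by (simp add: power2_eq_square power3_eq_cube mult_ac)
qed

theorem theorem1p1:
  shows
    "\<comment> \<open>(1) clamped: stability, onset of instability, control of the threshold by G and Ai\<close>
     ((\<forall>G>0. (\<forall>A. A > - beta0 Clamped G \<longrightarrow> straight_stable Clamped A G) \<and>
             (\<forall>A. A < - beta0 Clamped G \<longrightarrow> straight_unstable Clamped A G)) \<and>
      (\<forall>G\<ge>G_crit. beta0 Clamped G \<le> - G - Ai_zero * G powr (2 / 3)) \<and>
      ((\<lambda>G. (beta0 Clamped G + G) / G powr (2 / 3)) \<longlongrightarrow> - Ai_zero) at_top \<and>
      \<comment> \<open>the Greenhill threshold\<close>
      G_crit > 0 \<and>
      Ai (- (G_crit powr (1 / 3))) + 1 / sqrt 3 * Bi (- (G_crit powr (1 / 3))) = 0 \<and>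
      \<bar>G_crit - 7.8373\<bar> < 0.00005 \<and>
      (\<forall>G>0. beta0 Clamped G > 0 \<longleftrightarrow> G < G_crit) \<and>
      (\<forall>G>0. G < G_crit \<longrightarrow> straight_stable Clamped 0 G) \<and>
      \<comment> \<open>the bifurcation and its continuous deformation from supercritical to subcritical\<close>
      (\<exists>A2 \<epsilon> a D. continuous_pitchfork_family Clamped A2 \<epsilon> a D \<and>
         (\<exists>\<delta>>0. \<forall>G>0. \<bar>beta0 Clamped G\<bar> < \<delta> \<longrightarrow> supercritical (A2 G)) \<and>
         (\<forall>G>0. beta0 Clamped G \<le> - G / 4 \<longrightarrow> subcritical (A2 G))) \<and>
      (\<forall>\<^sub>F G in at_top. beta0 Clamped G \<le> - G / 4))
     \<and>
     \<comment> \<open>(2) pinned\<close>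
     ((\<forall>G>0. beta0 Pinned G \<le> - G / 2 \<and> - G / 2 < 0) \<and>
      (\<forall>\<rho>>0. \<forall>A0>0. \<forall>g>0. \<forall>B>0. \<forall>L>0. straight_unstable Pinned 0 (gravity_par \<rho> A0 g L B)) \<and>
      (\<forall>G>0. (\<forall>A. A > - beta0 Pinned G \<longrightarrow> straight_stable Pinned A G) \<and>
             (\<forall>A. A < - beta0 Pinned G \<longrightarrow> straight_unstable Pinned A G)) \<and>
      (\<forall>G>0. beta0 Pinned G \<le> - G - Ai'_zero * G powr (2 / 3)) \<and>
      ((\<lambda>G. (beta0 Pinned G + G) / G powr (2 / 3)) \<longlongrightarrow> - Ai'_zero) at_top \<and>
      (\<forall>G>0. \<exists>A2 \<epsilon> a D. pitchfork_branch Pinned G A2 \<epsilon> a D \<and> subcritical A2))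
     \<and>
     \<comment> \<open>(3) a sufficient length, the same for all diameters\<close>
     (\<forall>\<rho>>0. \<forall>g>0. \<forall>Kd>0. \<forall>L>0. L < Kd / (\<rho> * g) \<longrightarrow>
        (\<forall>bc. \<forall>diam>0. \<forall>B>0.
           straight_stable bc (magnetic_par Kd (disc_area diam) L B)
                     (gravity_par \<rho> (disc_area diam) g L B)))"
proof (intro conjI)
  have Gc: "G_crit > 0" using G_crit(1) by simp
  show "\<forall>G>0. (\<forall>A. A > - beta0 Clamped G \<longrightarrow> straight_stable Clamped A G) \<and>
             (\<forall>A. A < - beta0 Clamped G \<longrightarrow> straight_unstable Clamped A G)"
    using straight_stable_above straight_unstable_below by (meson order_less_imp_le)
  show "\<forall>G\<ge>G_crit. beta0 Clamped G \<le> - G - Ai_zero * G powr (2 / 3)" using beta0_Clamped_upper by blast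
  show "((\<lambda>G. (beta0 Clamped G + G) / G powr (2 / 3)) \<longlongrightarrow> - Ai_zero) at_top" by (rule beta0_Clamped_limit)
  show "G_crit > 0" by (rule Gc)
  show "Ai (- (G_crit powr (1 / 3))) + 1 / sqrt 3 * Bi (- (G_crit powr (1 / 3))) = 0" by (rule G_crit(5))
  show "\<bar>G_crit - 7.8373\<bar> < 0.00005" using G_crit(1,2) unfolding abs_less_iff by simp
  show "\<forall>G>0. beta0 Clamped G > 0 \<longleftrightarrow> G < G_crit" using beta0_Clamped_pos_iff by blast
  show "\<forall>G>0. G < G_crit \<longrightarrow> straight_stable Clamped 0 G"
    using beta0_Clamped_pos_iff by (auto intro!: straight_stable_above)
  show "\<exists>A2 \<epsilon> a D. continuous_pitchfork_family Clamped A2 \<epsilon> a D \<and>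
         (\<exists>\<delta>>0. \<forall>G>0. \<bar>beta0 Clamped G\<bar> < \<delta> \<longrightarrow> supercritical (A2 G)) \<and>
         (\<forall>G>0. beta0 Clamped G \<le> - G / 4 \<longrightarrow> subcritical (A2 G))"
  proof (rule exI[where x="branch_A2 Clamped"], rule exI[where x="branch_radius Clamped"],
      rule exI[where x="branch_parameter Clamped"], rule exI[where x="branch_field Clamped"], intro conjI)
    show "continuous_pitchfork_family Clamped (branch_A2 Clamped) (branch_radius Clamped) (branch_parameter Clamped) (branch_field Clamped)"
      by (rule branch_is_continuous_family)
    show "\<exists>\<delta>>0. \<forall>G>0. \<bar>beta0 Clamped G\<bar> < \<delta> \<longrightarrow> supercritical (branch_A2 Clamped G)"
      unfolding supercritical_def by (rule supercritical_near_Greenhill)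
    show "\<forall>G>0. beta0 Clamped G \<le> - G / 4 \<longrightarrow> subcritical (branch_A2 Clamped G)"
      unfolding subcritical_def by (auto intro!: branch_A2_positive simp: A_crit_def)
  qed
  show "\<forall>\<^sub>F G in at_top. beta0 Clamped G \<le> - G / 4" by (rule eventually_beta0_Clamped_le)
  show "\<forall>G>0. beta0 Pinned G \<le> - G / 2 \<and> - G / 2 < 0" using beta0_Pinned_le by auto
  show "\<forall>\<rho>>0. \<forall>A0>0. \<forall>g>0. \<forall>B>0. \<forall>L>0. straight_unstable Pinned 0 (gravity_par \<rho> A0 g L B)"
  proof (intro allI impI)
    fix \<rho> A0 g B L :: real assume "\<rho> > 0" "A0 > 0" "g > 0" "B > 0" "L > 0"
    then have "gravity_par \<rho> A0 g L B > 0" by (intro gravity_par_pos)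
    then show "straight_unstable Pinned 0 (gravity_par \<rho> A0 g L B)"
      using beta0_Pinned_le[of "gravity_par \<rho> A0 g L B"] by (intro straight_unstable_below) linarith
  qed
  show "\<forall>G>0. (\<forall>A. A > - beta0 Pinned G \<longrightarrow> straight_stable Pinned A G) \<and>
             (\<forall>A. A < - beta0 Pinned G \<longrightarrow> straight_unstable Pinned A G)"
    using straight_stable_above straight_unstable_below by (meson order_less_imp_le)
  show "\<forall>G>0. beta0 Pinned G \<le> - G - Ai'_zero * G powr (2 / 3)" using beta0_Pinned_upper by blast
  show "((\<lambda>G. (beta0 Pinned G + G) / G powr (2 / 3)) \<longlongrightarrow> - Ai'_zero) at_top" by (rule beta0_Pinned_limit)
  show "\<forall>G>0. \<exists>A2 \<epsilon> a D. pitchfork_branch Pinned G A2 \<epsilon> a D \<and> subcritical A2"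
  proof (intro allI impI exI conjI)
    fix G :: real assume G: "G > 0"
    show "pitchfork_branch Pinned G (branch_A2 Pinned G) (branch_radius Pinned G) (branch_parameter Pinned G) (branch_field Pinned G)"
      by (rule branch_is_pitchfork[OF G])
    show "subcritical (branch_A2 Pinned G)" unfolding subcritical_def
      by (rule branch_A2_positive[OF G]) (use beta0_Pinned_le[OF G] G in \<open>simp add: A_crit_def\<close>)
  qed
  show "\<forall>\<rho>>0. \<forall>g>0. \<forall>Kd>0. \<forall>L>0. L < Kd / (\<rho> * g) \<longrightarrow>
        (\<forall>bc. \<forall>diam>0. \<forall>B>0.
           straight_stable bc (magnetic_par Kd (disc_area diam) L B)
                     (gravity_par \<rho> (disc_area diam) g L B))"
    using short_rod_stable by blast
qed

end
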